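(* Let $Y_1,\dots,Y_n$ be i.i.d. observations from $f_{0Y}:=f_\varepsilon\ast f_{0X}$ on $\mathbb R$, where $f_\varepsilon(u)=e^{-|u|}/2$ is the standard Laplace density and $f_{0X}$ is a probability density with $f_{0X}(x)\lesssim e^{-(1+C_0)|x|}$, $x\in\mathbb R$, for some constant $C_0>0$. Let $\Pi$ be the prior distribution induced by $\mathscr D_{H_0}\otimes\Pi_\sigma$ through $f_Y=f_\varepsilon\ast(\phi_\sigma\ast\mu_H)$, $(\mu_H,\sigma)\sim\mathscr D_{H_0}\otimes\Pi_\sigma$, where: (A) the base measure $H_0$ has a continuous and positive density $h_0$ on $\mathbb R$ such that, for constants $b_0,b_0',c_0,c_0'>0$ and $\iota>0$, $c_0\exp(-b_0|u|^\iota)\le h_0(u)\le c_0'\exp(-b_0'|u|^\iota)$ for all $u\in\mathbb R$; (B) $\Pi_\sigma$ has a continuous density $\pi_\sigma$ on $(0,\infty)$ such that, for constants $D_1,D_2>0$ and $s_1,s_2,t_1,t_2\ge0$, $\sigma^{-s_1}\exp(-D_1\sigma^{-1}|\log\sigma|^{t_1})\lesssim\pi_\sigma(\sigma)\lesssim\sigma^{-s_2}\exp(-D_2\sigma^{-1}|\log\sigma|^{t_2})$ for all $\sigma$ in a neighbourhood of $0$, and, for constants $D_3,\varpi>0$, $\Pi_\sigma((\bar\sigma,\infty))\lesssim\exp(-D_3\bar\sigma^\varpi)$ as $\bar\sigma\to\infty$. Then there is $\varphi>0$ such that, for $\tilde\epsilon_n=n^{-2/5}(\log n)^\varphi$, there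 exist constants $c_1,c_2,c_3,c_4>0$ and sets $\mathscr P_n\subseteq\mathscr P(\mathbb R)$ satisfying $$\log D(\tilde\epsilon_n,\mathscr F(\mathscr P_n),\mathrm d)\le c_1n\tilde\epsilon_n^2,\qquad\Pi(\mathscr P_n^c)\le c_3\exp(-(c_2+4)n\tilde\epsilon_n^2),\qquad\Pi(B_{\mathrm{KL}}(P_{0Y};\tilde\epsilon_n^2))\ge c_4\exp(-c_2n\tilde\epsilon_n^2),$$ and there exists $D$ large enough so that $$\Pi(\mu_Y:\|f_Y-f_{0Y}\|_1>D\tilde\epsilon_n\mid Y^{(n)})\to0\quad\text{in }P_{0Y}^n\text{-probability}.$$
   Context: $\mathscr P(\mathbb R)$ is the set of probability measures on $\mathbb R$. $\phi_\sigma(x)=\sigma^{-1}\phi(x/\sigma)$ with $\phi$ the standard normal density. $\mathscr D_{H_0}$ is the Dirichlet process law on $\mathscr P(\mathbb R)$ with finite positive base measure $H_0$. The mixing distribution is $\mu_X=\phi_\sigma\ast\mu_H$ (with density $f_X=\phi_\sigma\ast\mu_H$) and $\mu_Y$ has density $f_Y=f_\varepsilon\ast f_X$; $\Pi$ denotes equivalently the induced law of $\mu_X$ or of $\mu_Y$. $\Pi(\cdot\mid Y^{(n)})$ is the posterior given $Y^{(n)}=(Y_1,\dots,Y_n)$, proportional to $\prod_if_Y(Y_i)\,\mathrm d\Pi$. $P_{0Y}$ has density $f_{0Y}$ and $P_{0Y}^n$ is its $n$-fold product. $\mathscr F(\mathscr P_n)$ is the set of measures with densities $f_\varepsilon\ast\mu_X$,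 $\mu_X\in\mathscr P_n$. $D(\epsilon,B,\mathrm d)$ is the $\epsilon$-packing number of $B$ (maximal number of points with pairwise distance at least $\epsilon$) with $\mathrm d$ the Hellinger distance $\|\sqrt f-\sqrt g\|_2$ or the $L^1$-distance between densities. $B_{\mathrm{KL}}(P;\epsilon^2)$ is the set of absolutely continuous $Q$ with $\int f_P\log(f_P/f_Q)\le\epsilon^2$ and $\int f_P(\log(f_P/f_Q))^2\le\epsilon^2$. $a\lesssim b$ means $a\le Cb$ for some constant $C>0$. *)

theory Defs
  imports "HOL-Probability.Probability"
begin

text \<open>
  The space of probability measures on the real line is \<^term>\<open>prob_algebra (borel :: real measure)\<close>.
\<close>

section \<open>Dirichlet process\<close>

text \<open>
  Gamma law with shape \<open>a\<close> and unit scale; shape \<open>0\<close> is the point mass at \<open>0\<close>, so that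
  cells of base measure zero are allowed in the definition of the Dirichlet law below (Ferguson's
  convention).
\<close>

definition gamma_law :: "real \<Rightarrow> real measure" where
  "gamma_law a =
    (if a = 0 then return borel 0
     else density lborel (\<lambda>x. ennreal (indicator {0<..} x * x powr (a - 1) * exp (- x) / Gamma a)))"

definition dirichlet_law :: "nat \<Rightarrow> (nat \<Rightarrow> real) \<Rightarrow> (nat \<Rightarrow> real) measure" where
  "dirichlet_law k a =
    distr (\<Pi>\<^sub>M i\<in>{..<k}. gamma_law (a i)) (\<Pi>\<^sub>M i\<in>{..<k}. borel)
      (\<lambda>z. \<lambda>i\<in>{..<k}. z i / (\<Sum>j<k. z j))"

text \<open>
  \<open>D\<close> is the law of a Dirichlet process with base measure \<open>H\<close>: the joint law of the random masses
  of the cells of any finite Borel partition is the Dirichlet law whose parameters are the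
  \<open>H\<close>-masses of the cells.
\<close>

definition dirichlet_process :: "real measure \<Rightarrow> real measure measure \<Rightarrow> bool" where
  "dirichlet_process H D \<longleftrightarrow>
    prob_space D \<and> sets D = sets (prob_algebra borel) \<and>
    (\<forall>k A. 0 < k \<and> (\<forall>i<k. A i \<in> sets borel) \<and> disjoint_family_on A {..<k} \<and> (\<Union>i<k. A i) = UNIV \<longrightarrow>
       distr D (\<Pi>\<^sub>M i\<in>{..<k}. borel) (\<lambda>\<mu>. \<lambda>i\<in>{..<k}. measure \<mu> (A i))
         = dirichlet_law k (\<lambda>i. measure H (A i)))"

section \<open>The convolution model\<close>

definition laplace_density :: "real \<Rightarrow> real" where
  "laplace_density u = exp (- \<bar>u\<bar>) / 2"

definition conv_density :: "(real \<Rightarrow> real) \<Rightarrow> real measure \<Rightarrow> real \<Rightarrow> real" where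
  "conv_density f \<mu> y = (\<integral>x. f (y - x) \<partial>\<mu>)"

definition normal_mixture :: "real measure \<Rightarrow> real \<Rightarrow> real measure" where
  "normal_mixture \<mu>H \<sigma> = density lborel (\<lambda>x. ennreal (conv_density (normal_density 0 \<sigma>) \<mu>H x))"

text \<open>Density and law of an observation when the latent variable has law \<open>\<mu>X\<close>.\<close>

abbreviation obs_density :: "real measure \<Rightarrow> real \<Rightarrow> real" where
  "obs_density \<mu>X \<equiv> conv_density laplace_density \<mu>X"

definition obs_law :: "real measure \<Rightarrow> real measure" where
  "obs_law \<mu>X = density lborel (\<lambda>y. ennreal (obs_density \<mu>X y))"

text \<open>
  The prior is the induced law of the mixing distribution \<open>\<mu>X\<close>; events about the law of an
  observation are pulled back along \<^const>\<open>obs_law\<close>. The bandwidth law \<open>\<Pi>\<sigma>\<close> lives on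
  the subspace \<^term>\<open>{0<..} :: real set\<close>, where \<^const>\<open>normal_mixture\<close> takes values in the
  probability measures (it would be the null measure for \<open>\<sigma> = 0\<close>).
\<close>

definition mixture_prior :: "real measure measure \<Rightarrow> real measure \<Rightarrow> real measure measure" where
  "mixture_prior DH \<Pi>\<sigma> =
    distr (DH \<Otimes>\<^sub>M \<Pi>\<sigma>) (prob_algebra borel) (\<lambda>(\<mu>H, \<sigma>). normal_mixture \<mu>H \<sigma>)"

definition likelihood :: "nat \<Rightarrow> (nat \<Rightarrow> real) \<Rightarrow> real measure \<Rightarrow> real" where
  "likelihood n y \<mu>X = (\<Prod>i<n. obs_density \<mu>X (y i))"

definition posterior :: "real measure measure \<Rightarrow> nat \<Rightarrow> (nat \<Rightarrow> real) \<Rightarrow> real measure measure" where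
  "posterior prior n y =
    density prior (\<lambda>\<mu>X. ennreal (likelihood n y \<mu>X / (\<integral>\<nu>. likelihood n y \<nu> \<partial>prior)))"

section \<open>Distances, packing numbers and Kullback--Leibler neighbourhoods\<close>

definition lebesgue_density :: "real measure \<Rightarrow> real \<Rightarrow> real" where
  "lebesgue_density P x = enn2real (RN_deriv lborel P x)"

definition hellinger_dist :: "real measure \<Rightarrow> real measure \<Rightarrow> real" where
  "hellinger_dist P Q =
    sqrt (\<integral>x. (sqrt (lebesgue_density P x) - sqrt (lebesgue_density Q x))\<^sup>2 \<partial>lborel)"

definition L1_dist :: "real measure \<Rightarrow> real measure \<Rightarrow> real" where
  "L1_dist P Q = (\<integral>x. \<bar>lebesgue_density P x - lebesgue_density Q x\<bar> \<partial>lborel)"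

definition packing_number :: "real \<Rightarrow> 'a set \<Rightarrow> ('a \<Rightarrow> 'a \<Rightarrow> real) \<Rightarrow> enat" where
  "packing_number \<epsilon> B d =
    (SUP S\<in>{S. S \<subseteq> B \<and> finite S \<and> pairwise (\<lambda>x y. \<epsilon> \<le> d x y) S}. enat (card S))"

definition ln_enat :: "enat \<Rightarrow> ereal" where
  "ln_enat N = (case N of enat k \<Rightarrow> if k = 0 then - \<infinity> else ereal (ln (real k)) | \<infinity> \<Rightarrow> \<infinity>)"

text \<open>
  The two integrals are required to exist, because a non-integrable function has Bochner integral
  \<open>0\<close>. Likewise \<open>P\<close> must be absolutely continuous with respect to \<open>Q\<close>: otherwise the logarithm is
  infinite on a set of positive \<open>P\<close>-mass, whereas the formal expression \<open>ln (p / 0)\<close> is \<open>0\<close>.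
\<close>

definition KL_nbhd :: "real measure \<Rightarrow> real \<Rightarrow> real measure set" where
  "KL_nbhd P r =
    {Q \<in> space (prob_algebra borel).
       absolutely_continuous lborel Q \<and> absolutely_continuous Q P \<and>
       (let p = lebesgue_density P; q = lebesgue_density Q in
          integrable lborel (\<lambda>x. p x * ln (p x / q x)) \<and>
          (\<integral>x. p x * ln (p x / q x) \<partial>lborel) \<le> r \<and>
          integrable lborel (\<lambda>x. p x * (ln (p x / q x))\<^sup>2) \<and>
          (\<integral>x. p x * (ln (p x / q x))\<^sup>2 \<partial>lborel) \<le> r)}"

end

theory Submission
  imports Defs "HOL-Real_Asymp.Real_Asymp"
begin

text \<open>
  Everything is measured through the chi-square divergence of the true density from the model
  density, which bounds both Kullback--Leibler integrals, and makes the evidence bound a direct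
  consequence of Markov's inequality.

  Prior mass. The true density satisfies \<open>f0Y \<asymp> exp (- |y|)\<close>, and all errors are measured in the
  supremum norm weighted by \<open>exp |y|\<close>. Since \<open>f0X\<close> is bounded, smoothing with bandwidth \<open>\<sigma>\<close> costs
  \<open>\<sigma>\<^sup>2\<close>. Replacing the mass of a cell of length \<open>\<delta>\<close> by an atom at its barycentre costs \<open>\<delta>\<^sup>2\<close>:
  the first order term vanishes except next to the kink of the Laplace kernel, where only mass of
  order \<open>\<delta>\<close> is involved. With \<open>\<sigma>\<close> and \<open>\<delta>\<close> of order \<open>n powr (- 1 / 5)\<close> the error is \<open>n powr (- 2 / 5)\<close>,
  and the Dirichlet process charges the corresponding masses of \<open>n powr (1 / 5) ln n\<close> tiny intervals
  with probability at least \<open>exp (- n powr (1 / 5))\<close> up to powers of \<open>ln n\<close> in the exponent.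

  Sieve. Divide a polynomially long interval into cells of length \<open>1 / n\<close>. A Dirichlet process puts
  all but \<open>1 / n\<close> of its mass on \<open>N\<close> of them, except with probability \<open>exp (- c N ln n)\<close>; to see this,
  write the cell masses as normalised independent gamma variables and use a Chernoff bound. Such
  mixtures have an \<open>L\<^sup>1\<close>-net of log-cardinality \<open>N ln n\<close> whatever the bandwidth, because the
  Laplace kernel is Lipschitz in \<open>L\<^sup>1\<close>.

  Contraction follows by testing the truth against each ball of the net.
\<close>

section \<open>Gamma and Dirichlet laws\<close>

text \<open>The errors are measured relative to \<open>exp (- |y|)\<close> because the chi-square
  integrand divides by the model density. The decay rate \<open>1 + C0\<close> makes this possible:
  shifting the kernel by a latent point \<open>x\<close> costs \<open>exp |x|\<close>, and
  \<open>exp (- C0 * |x|)\<close> remains integrable. Mass that the prior puts outside the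
  prescribed cells cannot be controlled in this norm; it enters the chi-square divergence linearly,
  as plain mass. Exponents are multiples of \<open>E = n * \<epsilon>\<^sup>2\<close>. Prior mass
  \<open>exp (- E)\<close> makes the evidence at least \<open>exp (- 3 * E)\<close> with high
  probability; the complement of the sieve and the errors of the second kind are at most
  \<open>exp (- 5 * E)\<close>, which leaves \<open>exp (- 2 * E)\<close> for the posterior. The
  balls of the net have L1 radius \<open>\<epsilon>\<^sup>2 / 4\<close>, so that two members of a
  ball are closer than \<open>\<epsilon>\<close> in the Hellinger and in the L1 distance alike, and
  one sieve serves both. The power of the logarithm, \<open>3 + \<iota> + t1\<close>, is set by the
  prior mass; the sieve asks only for a power above 1.\<close>

lemma PiM_density:
  assumes "finite I" "\<And>i. sigma_finite_measure (M i)" "\<And>i. sigma_finite_measure (density (M i) (f i))"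
    and f[measurable]: "\<And>i. f i \<in> borel_measurable (M i)"
  shows "PiM I (\<lambda>i. density (M i) (f i)) = density (PiM I M) (\<lambda>x. \<Prod>i\<in>I. f i (x i))"
proof -
  interpret M: product_sigma_finite M using assms(2) by unfold_locales (auto simp: sigma_finite_measure_def)
  interpret D: product_sigma_finite "\<lambda>i. density (M i) (f i)"
    using assms(3) by (simp add: product_sigma_finite_def)
  show ?thesis
  proof (rule D.PiM_eqI[symmetric])
    show "sets (density (PiM I M) (\<lambda>x. \<Prod>i\<in>I. f i (x i))) = sets (PiM I (\<lambda>i. density (M i) (f i)))"
      by (simp cong: sets_PiM_cong)
    fix A assume A: "\<And>i. i \<in> I \<Longrightarrow> A i \<in> sets (density (M i) (f i))"
    have A'[measurable]: "i \<in> I \<Longrightarrow> A i \<in> sets (M i)" for i using A by simp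
    have m: "i \<in> I \<Longrightarrow> (\<lambda>x. f i (x i)) \<in> borel_measurable (PiM I M)" for i
      using measurable_compose[OF measurable_component_singleton[of i I M] f] .
    have sA: "Pi\<^sub>E I A \<in> sets (PiM I M)" using assms(1) A' by (intro sets_PiM_I_finite)
    have "emeasure (density (PiM I M) (\<lambda>x. \<Prod>i\<in>I. f i (x i))) (Pi\<^sub>E I A)
      = (\<integral>\<^sup>+x. (\<Prod>i\<in>I. f i (x i)) * indicator (Pi\<^sub>E I A) x \<partial>PiM I M)"
      using sA m by (intro emeasure_density) (auto intro!: borel_measurable_prod_ennreal)
    also have "\<dots> = (\<integral>\<^sup>+x. (\<Prod>i\<in>I. f i (x i) * indicator (A i) (x i)) \<partial>PiM I M)"
    proof (intro nn_integral_cong)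
      fix x assume x: "x \<in> space (PiM I M)"
      have "indicator (Pi\<^sub>E I A) x = (\<Prod>i\<in>I. indicator (A i) (x i) :: ennreal)"
        using x \<open>finite I\<close> by (auto simp: indicator_def space_PiM PiE_iff prod_zero_iff)
      then show "(\<Prod>i\<in>I. f i (x i)) * indicator (Pi\<^sub>E I A) x = (\<Prod>i\<in>I. f i (x i) * indicator (A i) (x i))"
        by (simp add: prod.distrib)
    qed
    also have "\<dots> = (\<Prod>i\<in>I. \<integral>\<^sup>+x. f i x * indicator (A i) x \<partial>M i)"
      using assms(1) by (intro M.product_nn_integral_prod) auto
    also have "\<dots> = (\<Prod>i\<in>I. emeasure (density (M i) (f i)) (A i))"
      by (intro prod.cong refl emeasure_density[symmetric]) auto
    finally show "emeasure (density (PiM I M) (\<lambda>x. \<Prod>i\<in>I. f i (x i))) (Pi\<^sub>E I A) = \<dots>" .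
  qed fact
qed

section \<open>Gamma laws and their exponential tilting\<close>

definition gamma_density :: "real \<Rightarrow> real \<Rightarrow> real" where
  "gamma_density a x = indicator {0<..} x * x powr (a - 1) * exp (- x) / Gamma a"

lemma gamma_density_measurable[measurable]: "gamma_density a \<in> borel_measurable borel"
  unfolding gamma_density_def by measurable

lemma gamma_law_pos: "0 < a \<Longrightarrow> gamma_law a = density lborel (\<lambda>x. ennreal (gamma_density a x))"
  by (simp add: gamma_law_def gamma_density_def)

lemma gamma_law_0: "gamma_law 0 = return borel 0"
  by (simp add: gamma_law_def)

lemma sets_gamma_law[simp, measurable_cong]: "sets (gamma_law a) = sets borel"
  by (simp add: gamma_law_def)

lemma space_gamma_law[simp]: "space (gamma_law a) = UNIV"
  by (simp add: gamma_law_def)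

lemma gamma_density_nonneg: "0 < a \<Longrightarrow> 0 \<le> gamma_density a x"
  by (auto simp: gamma_density_def indicator_def intro!: divide_nonneg_pos mult_nonneg_nonneg)

lemma nn_integral_gamma_density:
  assumes "0 < a" shows "(\<integral>\<^sup>+x. ennreal (gamma_density a x) \<partial>lborel) = 1"
proof -
  have "(\<integral>\<^sup>+x. ennreal (gamma_density a x) \<partial>lborel)
    = (\<integral>\<^sup>+x. ennreal (indicator {0..} x * x powr (a - 1) / exp x) * ennreal (1 / Gamma a) \<partial>lborel)"
    using assms
    by (intro nn_integral_cong)
       (auto simp: gamma_density_def indicator_def exp_minus field_simps less_le
             simp flip: ennreal_mult' intro!: ennreal_cong)
  also have "\<dots> = ennreal (Gamma a) * ennreal (1 / Gamma a)"
    using assms by (subst nn_integral_multc) (auto simp: Gamma_conv_nn_integral_real)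
  also have "\<dots> = 1"
    using Gamma_real_pos[OF assms] by (simp add: less_imp_neq[THEN not_sym] flip: ennreal_mult')
  finally show ?thesis .
qed

lemma prob_space_gamma_law:
  assumes "0 \<le> a" shows "prob_space (gamma_law a)"
proof (cases "a = 0")
  case True then show ?thesis by (simp add: gamma_law_0 prob_space_return)
next
  case False
  with assms have "0 < a" by simp
  then show ?thesis
    by (auto simp: gamma_law_pos emeasure_density nn_integral_gamma_density intro!: prob_spaceI)
qed

text \<open>Tilting by \<open>exp (- \<theta> * x)\<close> turns rate 1 into rate
  \<open>1 + \<theta>\<close>, times the Laplace transform \<open>(1 + \<theta>) powr (- a)\<close>.
  The tilted law appears as a rescaled copy of the original one because invariance under rescaling
  is what is exploited later. For \<open>a = 0\<close> everything is the point mass at 0.\<close>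

lemma gamma_law_scale:
  assumes "0 \<le> a" "0 \<le> \<theta>"
  shows "density (gamma_law a) (\<lambda>x. ennreal (exp (- \<theta> * x)))
    = density (distr (gamma_law a) borel (\<lambda>x. x / (1 + \<theta>))) (\<lambda>_. ennreal ((1 + \<theta>) powr (- a)))"
proof (cases "a = 0")
  case True
  show ?thesis
  proof (rule measure_eqI)
    fix A assume "A \<in> sets (density (gamma_law a) (\<lambda>x. ennreal (exp (- \<theta> * x))))"
    then have [measurable]: "A \<in> sets borel" by simp
    show "emeasure (density (gamma_law a) (\<lambda>x. ennreal (exp (- \<theta> * x)))) A
      = emeasure (density (distr (gamma_law a) borel (\<lambda>x. x / (1 + \<theta>))) (\<lambda>_. ennreal ((1 + \<theta>) powr (- a)))) A"
      using assms unfolding True gamma_law_0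
      by (simp add: emeasure_density nn_integral_return distr_return)
  qed simp
next
  case False
  with assms have a: "0 < a" by simp
  define c where "c = 1 + \<theta>"
  have c: "0 < c" using assms by (simp add: c_def)
  show ?thesis unfolding c_def[symmetric]
  proof (rule measure_eqI)
    fix A assume "A \<in> sets (density (gamma_law a) (\<lambda>x. ennreal (exp (- \<theta> * x))))"
    then have [measurable]: "A \<in> sets borel" by simp
    have "emeasure (density (distr (gamma_law a) borel (\<lambda>x. x / c)) (\<lambda>_. ennreal (c powr (- a)))) A
      = ennreal (c powr (- a)) * emeasure (distr (gamma_law a) borel (\<lambda>x. x / c)) A"
      by (subst emeasure_density) (auto simp: nn_integral_cmult)
    also have "emeasure (distr (gamma_law a) borel (\<lambda>x. x / c)) A
      = (\<integral>\<^sup>+x. indicator A (x / c) \<partial>gamma_law a)"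
      by (subst nn_integral_indicator[symmetric], simp) (subst nn_integral_distr, auto)
    also have "\<dots> = (\<integral>\<^sup>+x. ennreal (gamma_density a x) * indicator A (x / c) \<partial>lborel)"
      using a by (simp add: gamma_law_pos nn_integral_density)
    also have "\<dots> = ennreal c * (\<integral>\<^sup>+x. ennreal (gamma_density a (c * x)) * indicator A x \<partial>lborel)"
      using c by (subst nn_integral_real_affine[where c=c and t=0]) (auto)
    also have "ennreal (c powr (- a)) * \<dots> = 
       (\<integral>\<^sup>+x. ennreal (c powr (- a)) * (ennreal c * (ennreal (gamma_density a (c * x)) * indicator A x)) \<partial>lborel)"
      by (simp add: nn_integral_cmult)
    also have "\<dots> = (\<integral>\<^sup>+x. ennreal (gamma_density a x) * (ennreal (exp (- \<theta> * x)) * indicator A x) \<partial>lborel)"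
    proof (intro nn_integral_cong)
      fix x :: real
      have "c powr (- a) * (c * gamma_density a (c * x)) = gamma_density a x * exp (- \<theta> * x)"
      proof (cases "x > 0")
        case True
        have "c powr (- a) * c * c powr (a - 1) = 1"
          using c by (simp add: powr_diff powr_minus field_simps)
        moreover have "exp (- (c * x)) = exp (- x) * exp (- \<theta> * x)"
          by (simp add: c_def algebra_simps flip: exp_add)
        moreover have "(c * x) powr (a - 1) = c powr (a - 1) * x powr (a - 1)"
          using True c by (simp add: powr_mult)
        moreover have "indicator {0<..} (c * x) = (1::real)" "indicator {0<..} x = (1::real)"
          using True c by auto
        ultimately have "c powr (- a) * (c * gamma_density a (c * x))
          = (c powr (- a) * c * c powr (a - 1)) * (x powr (a - 1) * exp (- x) / Gamma a * exp (- \<theta> * x))"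
          by (simp only: gamma_density_def) (simp add: mult_ac)
        also have "\<dots> = gamma_density a x * exp (- \<theta> * x)"
          using \<open>c powr (- a) * c * c powr (a - 1) = 1\<close> True by (simp add: gamma_density_def)
        finally show ?thesis .
      next
        case False
        then show ?thesis using c by (auto simp: gamma_density_def indicator_def zero_less_mult_iff)
      qed
      then show "ennreal (c powr (- a)) * (ennreal c * (ennreal (gamma_density a (c * x)) * indicator A x))
        = ennreal (gamma_density a x) * (ennreal (exp (- \<theta> * x)) * indicator A x)"
        using c a gamma_density_nonneg[OF a]
        by (simp add: indicator_def flip: ennreal_mult')
    qed
    also have "\<dots> = emeasure (density (gamma_law a) (\<lambda>x. ennreal (exp (- \<theta> * x)))) A"
      using a by (simp add: gamma_law_pos emeasure_density nn_integral_density)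
    finally show "emeasure (density (gamma_law a) (\<lambda>x. ennreal (exp (- \<theta> * x)))) A
      = emeasure (density (distr (gamma_law a) borel (\<lambda>x. x / c)) (\<lambda>_. ennreal (c powr (- a)))) A" by simp
  qed simp
qed


lemma sets_PiM_gamma: "sets (PiM I (\<lambda>i. gamma_law (a i))) = sets (PiM I (\<lambda>i. borel))"
  by (intro sets_PiM_cong) auto

lemma space_PiM_gamma: "space (PiM I (\<lambda>i. gamma_law (a i))) = PiE I (\<lambda>_. UNIV)"
  by (simp add: space_PiM)

lemma prob_space_PiM_gamma:
  "(\<And>i. 0 \<le> a i) \<Longrightarrow> prob_space (PiM I (\<lambda>i. gamma_law (a i)))"
  by (intro prob_space_PiM prob_space_gamma_law)

text \<open>The weight is a product over the coordinates, so the one-dimensional tilt applies to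
  each factor. All coordinates are divided by the same number, a change that the normalised vector
  does not see.\<close>

lemma PiM_gamma_scale:
  fixes a :: "'i \<Rightarrow> real"
  assumes I: "finite I" and a: "\<And>i. 0 \<le> a i" and th: "0 \<le> \<theta>"
  shows "density (PiM I (\<lambda>i. gamma_law (a i))) (\<lambda>z. ennreal (exp (- \<theta> * (\<Sum>i\<in>I. z i))))
    = density (distr (PiM I (\<lambda>i. gamma_law (a i))) (PiM I (\<lambda>i. borel)) (\<lambda>z. \<lambda>i\<in>I. z i / (1 + \<theta>)))
        (\<lambda>_. ennreal ((1 + \<theta>) powr (- (\<Sum>i\<in>I. a i))))"
proof -
  note [measurable_cong] = sets_PiM_gamma
  have ps: "prob_space (gamma_law (a i))" for i by (intro prob_space_gamma_law a)
  have psd: "prob_space (distr (gamma_law (a i)) borel (\<lambda>x. x / (1 + \<theta>)))" for i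
    by (intro prob_space.prob_space_distr ps) simp
  have sf: "sigma_finite_measure M" if "prob_space M" for M :: "real measure"
    using that prob_space_imp_sigma_finite by blast
  have fin2: "sigma_finite_measure (density (distr (gamma_law (a i)) borel (\<lambda>x. x / (1 + \<theta>)))
        (\<lambda>_. ennreal ((1 + \<theta>) powr (- a i))))" for i
    using prob_space.emeasure_space_1[OF psd[of i]]
    by (intro finite_measure.sigma_finite_measure finite_measureI)
       (auto simp: emeasure_density nn_integral_cmult ennreal_mult_eq_top_iff)
  have fin1: "sigma_finite_measure (density (gamma_law (a i)) (\<lambda>x. ennreal (exp (- \<theta> * x))))" for i
    using fin2[of i] by (simp only: gamma_law_scale[OF a th])
  have "density (PiM I (\<lambda>i. gamma_law (a i))) (\<lambda>z. ennreal (exp (- \<theta> * (\<Sum>i\<in>I. z i))))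
    = density (PiM I (\<lambda>i. gamma_law (a i))) (\<lambda>z. \<Prod>i\<in>I. ennreal (exp (- \<theta> * z i)))"
    using I by (simp add: prod_ennreal exp_sum sum_distrib_left flip: sum_negf)
  also have "\<dots> = PiM I (\<lambda>i. density (gamma_law (a i)) (\<lambda>x. ennreal (exp (- \<theta> * x))))"
    by (rule PiM_density[OF I sf[OF ps] fin1, symmetric]) simp
  also have "\<dots> = PiM I (\<lambda>i. density (distr (gamma_law (a i)) borel (\<lambda>x. x / (1 + \<theta>)))
        (\<lambda>_. ennreal ((1 + \<theta>) powr (- a i))))"
    by (simp only: gamma_law_scale[OF a th])
  also have "\<dots> = density (PiM I (\<lambda>i. distr (gamma_law (a i)) borel (\<lambda>x. x / (1 + \<theta>))))
        (\<lambda>x. \<Prod>i\<in>I. ennreal ((1 + \<theta>) powr (- a i)))"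
    by (rule PiM_density[OF I sf[OF psd] fin2]) simp
  also have "PiM I (\<lambda>i. distr (gamma_law (a i)) borel (\<lambda>x. x / (1 + \<theta>)))
    = distr (PiM I (\<lambda>i. gamma_law (a i))) (PiM I (\<lambda>i. borel)) (compose I (\<lambda>x. x / (1 + \<theta>)))"
  proof -
    have "distr (PiM I (\<lambda>i. gamma_law (a i))) (PiM I (\<lambda>i. distr (gamma_law (a i)) borel (\<lambda>x. x / (1 + \<theta>))))
        (compose I (\<lambda>x. x / (1 + \<theta>)))
      = PiM I (\<lambda>i. distr (gamma_law (a i)) (distr (gamma_law (a i)) borel (\<lambda>x. x / (1 + \<theta>))) (\<lambda>x. x / (1 + \<theta>)))"
      by (rule distr_PiM_finite_prob_space'[OF I ps psd]) simp
    also have "\<dots> = PiM I (\<lambda>i. distr (gamma_law (a i)) borel (\<lambda>x. x / (1 + \<theta>)))"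
      by (intro PiM_cong refl distr_cong) auto
    finally have "distr (PiM I (\<lambda>i. gamma_law (a i))) (PiM I (\<lambda>i. distr (gamma_law (a i)) borel (\<lambda>x. x / (1 + \<theta>))))
        (compose I (\<lambda>x. x / (1 + \<theta>))) = \<dots>" .
    moreover have "distr (PiM I (\<lambda>i. gamma_law (a i))) (PiM I (\<lambda>i. distr (gamma_law (a i)) borel (\<lambda>x. x / (1 + \<theta>))))
        (compose I (\<lambda>x. x / (1 + \<theta>)))
      = distr (PiM I (\<lambda>i. gamma_law (a i))) (PiM I (\<lambda>i. borel)) (compose I (\<lambda>x. x / (1 + \<theta>)))"
      by (intro distr_cong refl sets_PiM_cong) simp
    ultimately show ?thesis by simp
  qed
  also have "compose I (\<lambda>x. x / (1 + \<theta>)) = (\<lambda>z. \<lambda>i\<in>I. z i / (1 + \<theta>))"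
    by (auto simp: compose_def)
  also have "(\<Prod>i\<in>I. ennreal ((1 + \<theta>) powr (- a i))) = ennreal ((1 + \<theta>) powr (- (\<Sum>i\<in>I. a i)))"
    using I th by (simp add: prod_ennreal powr_sum flip: sum_negf)
  finally show ?thesis .
qed

section \<open>The Dirichlet law as a normalised vector of independent gamma variables\<close>

definition dirichlet_map :: "nat \<Rightarrow> (nat \<Rightarrow> real) \<Rightarrow> nat \<Rightarrow> real" where
  "dirichlet_map k z = (\<lambda>i\<in>{..<k}. z i / (\<Sum>j<k. z j))"

lemma dirichlet_map_measurable[measurable]:
  "dirichlet_map k \<in> PiM {..<k} (\<lambda>i. borel) \<rightarrow>\<^sub>M PiM {..<k} (\<lambda>i. borel)"
  unfolding dirichlet_map_def by measurable

lemma measure_dirichlet_law: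
  assumes "E \<in> sets (PiM {..<k} (\<lambda>i. borel))"
  shows "measure (dirichlet_law k a) E
    = measure (PiM {..<k} (\<lambda>i. gamma_law (a i))) {z\<in>PiE {..<k} (\<lambda>_. UNIV). dirichlet_map k z \<in> E}"
proof -
  note [measurable_cong] = sets_PiM_gamma
  have "(\<lambda>z. \<lambda>i\<in>{..<k}. z i / (\<Sum>j<k. z j)) = dirichlet_map k"
    by (auto simp: dirichlet_map_def)
  then show ?thesis
    unfolding dirichlet_law_def using assms
    by (simp add: measure_distr space_PiM_gamma vimage_def Int_def conj_commute)
qed

text \<open>
  The normalised vector and the total mass of independent gamma variables are independent. All that
  is needed here is that an event on the normalised vector does not force the total mass to be
  small, and this follows from comparing the gamma laws of rates \<open>1\<close> and \<open>1 + \<theta>\<close>.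
\<close>

lemma dirichlet_law_le_gamma:
  assumes a: "\<And>i. 0 \<le> a i" and s0: "0 < s0"
    and A: "exp 1 * (1 + 1 / s0) powr (- (\<Sum>i<k. a i)) \<le> 1 / 2"
    and E: "E \<in> sets (PiM {..<k} (\<lambda>i. borel))"
  shows "measure (dirichlet_law k a) E
    \<le> 2 * measure (PiM {..<k} (\<lambda>i. gamma_law (a i)))
          {z\<in>PiE {..<k} (\<lambda>_. UNIV). dirichlet_map k z \<in> E \<and> s0 \<le> (\<Sum>i<k. z i)}"
proof -
  let ?P = "PiM {..<k} (\<lambda>i. gamma_law (a i))" and ?B = "PiM {..<k} (\<lambda>i. borel :: real measure)"
  note [measurable_cong] = sets_PiM_gamma[of "{..<k}" a]
  note E[measurable]
  interpret P: prob_space ?P by (intro prob_space_PiM_gamma a)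
  define \<theta> where "\<theta> = 1 / s0"
  have th: "0 \<le> \<theta>" using s0 by (simp add: \<theta>_def)
  define F where "F = {z\<in>space ?B. dirichlet_map k z \<in> E}"
  define r where "r = (1 + \<theta>) powr (- (\<Sum>i<k. a i))"
  have r0: "0 \<le> r" by (simp add: r_def)
  have sp: "space ?B = PiE {..<k} (\<lambda>_. UNIV)" by (simp add: space_PiM)
  have F[measurable]: "F \<in> sets ?B" unfolding F_def by measurable
  \<comment> \<open>Events on the normalised vector are cones: the common factor cancels in
    \<open>dirichlet_map\<close>.\<close>
  have inv: "(\<lambda>i\<in>{..<k}. z i / (1 + \<theta>)) \<in> F \<longleftrightarrow> z \<in> F" if z: "z \<in> space ?B" for z
  proof -
    have "dirichlet_map k (\<lambda>i\<in>{..<k}. z i / (1 + \<theta>)) = dirichlet_map k z"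
      using th by (auto simp: dirichlet_map_def fun_eq_iff simp flip: sum_divide_distrib)
    then show ?thesis using z by (auto simp: F_def sp)
  qed
  have "(\<integral>\<^sup>+z. ennreal (exp (- \<theta> * (\<Sum>i<k. z i))) * indicator F z \<partial>?P)
      = emeasure (density ?P (\<lambda>z. ennreal (exp (- \<theta> * (\<Sum>i<k. z i))))) F"
    by (subst emeasure_density) auto
  also have "\<dots> = ennreal r * emeasure (distr ?P ?B (\<lambda>z. \<lambda>i\<in>{..<k}. z i / (1 + \<theta>))) F"
    unfolding PiM_gamma_scale[OF finite_lessThan a th] r_def
    by (subst emeasure_density) (auto simp: nn_integral_cmult)
  also have "emeasure (distr ?P ?B (\<lambda>z. \<lambda>i\<in>{..<k}. z i / (1 + \<theta>))) F = emeasure ?P F"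
  proof -
    have "(\<lambda>z. \<lambda>i\<in>{..<k}. z i / (1 + \<theta>)) -` F \<inter> space ?P = F"
      using inv F[THEN sets.sets_into_space] by (auto simp: space_PiM_gamma sp)
    moreover have "(\<lambda>z. \<lambda>i\<in>{..<k}. z i / (1 + \<theta>)) \<in> ?P \<rightarrow>\<^sub>M ?B" by measurable
    ultimately show ?thesis using F by (simp add: emeasure_distr)
  qed
  finally have eq: "(\<integral>\<^sup>+z. ennreal (exp (- \<theta> * (\<Sum>i<k. z i))) * indicator F z \<partial>?P) = ennreal (r * P.prob F)"
    using r0 by (simp add: P.emeasure_eq_measure ennreal_mult)
  define G where "G = {z\<in>F. (\<Sum>i<k. z i) < s0}"
  define H where "H = {z\<in>F. s0 \<le> (\<Sum>i<k. z i)}"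
  have [measurable]: "G \<in> sets ?B" "H \<in> sets ?B"
    using F[THEN sets.sets_into_space] unfolding G_def H_def by measurable
  \<comment> \<open>With \<open>\<theta> = 1 / s0\<close> the tilt is at least
    \<open>exp (- 1)\<close> on \<open>G\<close>. The condition on \<open>s0\<close> then gives
    \<open>G\<close> at most half of the mass of \<open>F\<close>, whatever the event.\<close>
  have "ennreal (exp (- 1) * P.prob G) = (\<integral>\<^sup>+z. ennreal (exp (- 1)) * indicator G z \<partial>?P)"
    by (simp add: nn_integral_cmult P.emeasure_eq_measure ennreal_mult)
  also have "\<dots> \<le> (\<integral>\<^sup>+z. ennreal (exp (- \<theta> * (\<Sum>i<k. z i))) * indicator F z \<partial>?P)"
    using s0 by (intro nn_integral_mono) (auto simp: G_def indicator_def \<theta>_def field_simps intro!: ennreal_leI)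
  finally have "exp (- 1) * P.prob G \<le> r * P.prob F"
    using r0 unfolding eq by (simp add: ennreal_le_iff)
  then have "exp 1 * (exp (- 1) * P.prob G) \<le> exp 1 * (r * P.prob F)"
    by (intro mult_left_mono) auto
  then have "P.prob G \<le> (exp 1 * r) * P.prob F"
    by (simp add: exp_minus mult.assoc[symmetric])
  also have "\<dots> \<le> 1 / 2 * P.prob F"
    using A by (intro mult_right_mono) (auto simp: r_def \<theta>_def)
  finally have "P.prob G \<le> 1 / 2 * P.prob F" .
  moreover have "P.prob F = P.prob G + P.prob H"
    by (subst P.finite_measure_Union[symmetric]) (auto simp: G_def H_def intro!: arg_cong[where f="P.prob"])
  ultimately have "P.prob F \<le> 2 * P.prob H" by simp
  moreover have "measure (dirichlet_law k a) E = P.prob F"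
    using E by (simp add: measure_dirichlet_law F_def sp)
  moreover have "H = {z\<in>PiE {..<k} (\<lambda>_. UNIV). dirichlet_map k z \<in> E \<and> s0 \<le> (\<Sum>i<k. z i)}"
    by (auto simp: H_def F_def sp)
  ultimately show ?thesis by simp
qed

section \<open>Bounds for gamma laws that are uniform over small shapes\<close>

lemma Gamma_bounds:
  assumes "0 \<le> (A::real)"
  obtains c C where "0 < c" "0 < C" "\<And>a. 0 \<le> a \<Longrightarrow> a \<le> A \<Longrightarrow> c \<le> Gamma (1 + a) \<and> Gamma (1 + a) \<le> C"
proof -
  have cont: "continuous_on {1..1 + A} (Gamma :: real \<Rightarrow> real)"
    by (intro continuous_on_Gamma) (auto simp: nonpos_Ints_def)
  obtain x where x: "x \<in> {1..1 + A}" "\<forall>y\<in>{1..1 + A}. Gamma x \<le> Gamma y"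
    using continuous_attains_inf[OF _ _ cont] assms by auto
  obtain x' where x': "x' \<in> {1..1 + A}" "\<forall>y\<in>{1..1 + A}. Gamma y \<le> Gamma x'"
    using continuous_attains_sup[OF _ _ cont] assms by auto
  show thesis
    by (rule that[of "Gamma x" "Gamma x'"]) (use x x' in auto)
qed

text \<open>For a small shape the law is almost a point mass at 0:
  \<open>1 / Gamma a = a / Gamma (1 + a)\<close> with \<open>Gamma (1 + a)\<close> bounded below, so
  a factor \<open>a\<close> comes out. Summed over cells these factors give the total base mass,
  however many cells there are. The power \<open>u powr (- \<beta>)\<close> is the price for a
  majorant \<open>x powr (\<beta> - 1)\<close> that is integrable at 0 uniformly in
  \<open>a\<close>.\<close>

lemma gamma_law_tail:
  assumes "0 < \<beta>"
  obtains C where "0 < C"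
    "\<And>a u. 0 \<le> a \<Longrightarrow> a \<le> 1 \<Longrightarrow> 0 < u \<Longrightarrow> measure (gamma_law a) {u<..} \<le> a * (C * u powr (- \<beta>))"
proof -
  obtain c where c: "0 < c" "\<And>a. 0 \<le> a \<Longrightarrow> a \<le> 1 \<Longrightarrow> c \<le> Gamma (1 + a :: real)"
    using Gamma_bounds[of 1] by (metis zero_le_one)
  define C where "C = (Gamma \<beta> + Gamma (\<beta> + 1)) / c"
  have "0 < C" using assms c by (simp add: C_def add_pos_pos)
  moreover have "measure (gamma_law a) {u<..} \<le> a * (C * u powr (- \<beta>))" if a: "0 \<le> a" "a \<le> 1" and u: "0 < u" for a u
  proof (cases "a = 0")
    case True
    then show ?thesis using u by (simp add: gamma_law_0 measure_return)
  next
    case False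
    with a have a0: "0 < a" by simp
    interpret prob_space "gamma_law a" using a by (intro prob_space_gamma_law)
    have Ga: "a * c \<le> a * (Gamma (1 + a))" using c(2)[of a] a by (intro mult_left_mono) auto
    have Geq: "Gamma (1 + a) = a * Gamma a" using a0 Gamma_plus1[of a] by (auto simp: add.commute nonpos_Ints_def)
    have inv: "1 / Gamma a \<le> a / c"
      using c(1) c(2)[of a] a a0 Geq Gamma_real_pos[OF a0] by (simp add: field_simps)
    have "emeasure (gamma_law a) {u<..} = (\<integral>\<^sup>+x. ennreal (gamma_density a x) * indicator {u<..} x \<partial>lborel)"
      using a0 by (simp add: gamma_law_pos emeasure_density)
    also have "\<dots> \<le> (\<integral>\<^sup>+x. ennreal (a / c * u powr (- \<beta>)) *
        (ennreal (indicator {0..} x * x powr (\<beta> - 1) / exp x) + ennreal (indicator {0..} x * x powr (\<beta> + 1 - 1) / exp x)) \<partial>lborel)"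
    proof (intro nn_integral_mono)
      fix x :: real
      show "ennreal (gamma_density a x) * indicator {u<..} x \<le> ennreal (a / c * u powr (- \<beta>)) *
        (ennreal (indicator {0..} x * x powr (\<beta> - 1) / exp x) + ennreal (indicator {0..} x * x powr (\<beta> + 1 - 1) / exp x))"
      proof (cases "u < x")
        case True
        have x: "0 < x" using True u by simp
        \<comment> \<open>A bound free of \<open>a\<close>; its two summands lead to
          \<open>Gamma \<beta>\<close> and \<open>Gamma (\<beta> + 1)\<close>.\<close>
        have "x powr a \<le> 1 + x"
        proof (cases "x \<le> 1")
          case True
          have "x powr a \<le> 1 powr a" using True x a by (intro powr_mono2) auto
          then show ?thesis using x by simp
        next
          case False
          have "x powr a \<le> x powr 1" using False a by (intro powr_mono) auto
          then show ?thesis using x by simp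
        qed
        moreover have "x powr (a - 1) = x powr a * x powr (- \<beta>) * x powr (\<beta> - 1)"
          by (simp flip: powr_add)
        moreover have "x powr (- \<beta>) \<le> u powr (- \<beta>)"
          using True u assms by (intro powr_mono2') auto
        ultimately have "x powr (a - 1) \<le> (1 + x) * u powr (- \<beta>) * x powr (\<beta> - 1)"
          using x by (auto intro!: mult_mono)
        also have "\<dots> = u powr (- \<beta>) * (x powr (\<beta> - 1) + x powr \<beta>)"
          using x by (simp add: powr_diff field_simps)
        finally have "x powr (a - 1) \<le> u powr (- \<beta>) * (x powr (\<beta> - 1) + x powr \<beta>)" .
        then have "x powr (a - 1) * exp (- x) * (1 / Gamma a)
          \<le> u powr (- \<beta>) * (x powr (\<beta> - 1) + x powr \<beta>) * exp (- x) * (a / c)"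
          using inv Gamma_real_pos[OF a0] by (intro mult_mono mult_right_mono) (auto)
        then have "gamma_density a x \<le> (a / c * u powr (- \<beta>)) * (x powr (\<beta> - 1) / exp x + x powr \<beta> / exp x)"
          using x by (simp add: gamma_density_def exp_minus field_simps)
        then have "ennreal (gamma_density a x) \<le> ennreal (a / c * u powr (- \<beta>)) * ennreal (x powr (\<beta> - 1) / exp x + x powr \<beta> / exp x)"
          using a c by (subst ennreal_mult[symmetric]) (auto intro!: ennreal_leI)
        then show ?thesis using True x by (simp add: ennreal_plus)
      qed simp
    qed
    also have "\<dots> = ennreal (a / c * u powr (- \<beta>)) * (ennreal (Gamma \<beta>) + ennreal (Gamma (\<beta> + 1)))"
      using assms by (simp add: nn_integral_cmult nn_integral_add Gamma_conv_nn_integral_real)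
    also have "\<dots> = ennreal (a * (C * u powr (- \<beta>)))"
      using assms a c by (simp add: C_def field_simps flip: ennreal_plus ennreal_mult')
    finally show ?thesis
      using a \<open>0 < C\<close> by (simp add: emeasure_eq_measure)
  qed
  ultimately show thesis using that by blast
qed

text \<open>Only the upper half of the interval is used: there \<open>x\<close> lies between
  \<open>\<tau> / 2\<close> and 2, so the density is at least of order
  \<open>a * \<tau> powr A\<close>, and the length supplies the last power of \<open>\<tau>\<close>.
  The bound is linear in \<open>a\<close>, so that a cell of small base mass costs only a logarithm
  in the exponent.\<close>

lemma gamma_law_interval:
  assumes "0 < A"
  obtains c where "0 < c" "c \<le> 1"
    "\<And>a p \<tau>. 0 < a \<Longrightarrow> a \<le> A \<Longrightarrow> 0 \<le> p \<Longrightarrow> p \<le> 1 \<Longrightarrow> 0 < \<tau> \<Longrightarrow> \<tau> \<le> 1 \<Longrightarrow>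
       c * a * \<tau> powr (A + 1) \<le> measure (gamma_law a) {p..p + \<tau>}"
proof -
  obtain C where C: "0 < C" "\<And>a. 0 \<le> a \<Longrightarrow> a \<le> A \<Longrightarrow> Gamma (1 + a :: real) \<le> C"
    using Gamma_bounds[of A] assms by (metis less_imp_le)
  define d where "d = exp (- 2) / (2 * C) * (1 / 2) powr (A + 1)"
  define c where "c = min 1 d"
  have c: "0 < c" "c \<le> 1" "c \<le> d" using C by (auto simp: c_def d_def)
  moreover have "c * a * \<tau> powr (A + 1) \<le> measure (gamma_law a) {p..p + \<tau>}"
    if a: "0 < a" "a \<le> A" and p: "0 \<le> p" "p \<le> 1" and \<tau>: "0 < \<tau>" "\<tau> \<le> 1" for a p \<tau>
  proof -
    interpret prob_space "gamma_law a" using a by (intro prob_space_gamma_law) auto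
    have Geq: "Gamma (1 + a) = a * Gamma a" using a Gamma_plus1[of a] by (auto simp: add.commute nonpos_Ints_def)
    have inv: "a / C \<le> 1 / Gamma a"
      using C(1) C(2)[of a] a Geq Gamma_real_pos[OF a(1)] by (simp add: field_simps)
    define l where "l = (\<tau> / 2) powr A / 2 * exp (- 2) * (a / C)"
    have l0: "0 \<le> l" using C a by (simp add: l_def)
    have lb: "l \<le> gamma_density a x" if x: "p + \<tau> / 2 \<le> x" "x \<le> p + \<tau>" for x
    proof -
      have x': "\<tau> / 2 \<le> x" "x \<le> 2" "0 < x" using x p \<tau> by auto
      have "(\<tau> / 2) powr A / 2 \<le> x powr a / x"
      proof (rule frac_le)
        have "(\<tau> / 2) powr A \<le> (\<tau> / 2) powr a" using \<tau> a by (intro powr_mono') auto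
        also have "\<dots> \<le> x powr a" using x' \<tau> a by (intro powr_mono2) auto
        finally show "(\<tau> / 2) powr A \<le> x powr a" .
      qed (use x' in auto)
      also have "x powr a / x = x powr (a - 1)" using x' by (simp add: powr_diff)
      finally have "(\<tau> / 2) powr A / 2 * exp (- 2) * (a / C) \<le> x powr (a - 1) * exp (- x) * (1 / Gamma a)"
        using inv x' a C by (intro mult_mono) auto
      then show ?thesis using x' by (simp add: gamma_density_def l_def)
    qed
    have "l * (\<tau> / 2) = d * a * \<tau> powr (A + 1)"
      using \<tau> by (simp add: l_def d_def powr_divide powr_add field_simps)
    then have "ennreal (d * a * \<tau> powr (A + 1)) = (\<integral>\<^sup>+x. ennreal l * indicator {p + \<tau> / 2..p + \<tau>} x \<partial>lborel)"
      using \<tau> l0 by (simp add: nn_integral_cmult flip: ennreal_mult')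
    also have "\<dots> \<le> (\<integral>\<^sup>+x. ennreal (gamma_density a x) * indicator {p..p + \<tau>} x \<partial>lborel)"
      using lb \<tau> by (intro nn_integral_mono) (auto simp: indicator_def intro!: ennreal_leI)
    also have "\<dots> = emeasure (gamma_law a) {p..p + \<tau>}"
      using a by (simp add: gamma_law_pos emeasure_density)
    finally have "d * a * \<tau> powr (A + 1) \<le> measure (gamma_law a) {p..p + \<tau>}"
      by (simp add: emeasure_eq_measure)
    moreover have "c * a * \<tau> powr (A + 1) \<le> d * a * \<tau> powr (A + 1)"
      using c a by (intro mult_right_mono) auto
    ultimately show ?thesis by simp
  qed
  ultimately show thesis using that by blast
qed

section \<open>Dirichlet laws: concentration on few cells, and small-ball probabilities\<close>

lemma card_exceeding_iff:
  fixes x :: "nat \<Rightarrow> real"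
  shows "N < card {j\<in>{..<K}. t < x j} \<longleftrightarrow> real N < (\<Sum>j<K. indicator {t<..} (x j))"
proof -
  have "(\<Sum>j<K. indicator {t<..} (x j)) = (\<Sum>j<K. if t < x j then 1 else (0::real))"
    by (intro sum.cong) (auto simp: indicator_def)
  also have "\<dots> = real (card {j\<in>{..<K}. t < x j})" by (simp add: sum.If_cases Int_def)
  finally show ?thesis by simp
qed

lemma sum_exceeding_measurable:
  "(\<lambda>x. \<Sum>j<K. indicator {t<..} (x j) :: real) \<in> borel_measurable (PiM {..<Suc K} (\<lambda>_. borel :: real measure))"
proof -
  have "(\<lambda>x. indicator {t<..} (x j) :: real) \<in> borel_measurable (PiM {..<Suc K} (\<lambda>_. borel :: real measure))" if "j < K" for j
  proof -
    have "(\<lambda>x. x j) \<in> borel_measurable (PiM {..<Suc K} (\<lambda>_. borel :: real measure))"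
      using that by (intro measurable_component_singleton) auto
    then show ?thesis by measurable
  qed
  then show ?thesis by (intro borel_measurable_sum) auto
qed

lemma many_cells_measurable:
  "{x\<in>space (PiM {..<Suc K} (\<lambda>_. borel :: real measure)). t < x K \<or> N < card {j\<in>{..<K}. t < x j}}
    \<in> sets (PiM {..<Suc K} (\<lambda>_. borel))"
proof -
  have "(\<lambda>x. x K) \<in> borel_measurable (PiM {..<Suc K} (\<lambda>_. borel :: real measure))"
    by (intro measurable_component_singleton) auto
  then show ?thesis unfolding card_exceeding_iff using sum_exceeding_measurable[of t K] by measurable
qed

text \<open>Index \<open>K\<close> is the exterior cell; the others are counted. If the gamma total
  is at least \<open>s0\<close>, a share above \<open>t\<close> forces a gamma variable above
  \<open>t * s0\<close>, and these events are independent. The exterior cell uses the tail bound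
  directly, the count a Chernoff bound with base \<open>l\<close>. The base stays free because it
  will grow with the sample size: a power of \<open>n\<close> in place of \<open>l\<close> makes
  \<open>l powr (- real N)\<close> an exponential of order \<open>N ln n\<close>.\<close>

lemma dirichlet_law_many_cells:
  assumes \<beta>: "0 < \<beta>"
  obtains C where "0 < C"
    "\<And>K N a A t s0 l. (\<And>i. 0 \<le> a i) \<Longrightarrow> (\<And>i. i \<le> K \<Longrightarrow> a i \<le> 1) \<Longrightarrow> (\<Sum>i\<le>K. a i) = A \<Longrightarrow>
       0 < s0 \<Longrightarrow> exp 1 * (1 + 1 / s0) powr (- A) \<le> 1 / 2 \<Longrightarrow> 0 < t \<Longrightarrow> 1 \<le> l \<Longrightarrow>
       measure (dirichlet_law (Suc K) a) {x\<in>space (PiM {..<Suc K} (\<lambda>_. borel)). t < x K \<or> N < card {j\<in>{..<K}. t < x j}}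
         \<le> 2 * (a K * C * (t * s0) powr (- \<beta>) + l powr (- real N) * exp (l * A * C * (t * s0) powr (- \<beta>)))"
proof -
  obtain C where C: "0 < C"
    "\<And>a u. 0 \<le> a \<Longrightarrow> a \<le> 1 \<Longrightarrow> 0 < u \<Longrightarrow> measure (gamma_law a) {u<..} \<le> a * (C * u powr (- \<beta>))"
    using gamma_law_tail[OF \<beta>] by blast
  show thesis
  proof (rule that[OF C(1)])
    fix K N :: nat and a :: "nat \<Rightarrow> real" and A t s0 l :: real
    assume a: "\<And>i. 0 \<le> a i" and a1: "\<And>i. i \<le> K \<Longrightarrow> a i \<le> 1" and A: "(\<Sum>i\<le>K. a i) = A"
      and s0: "0 < s0" "exp 1 * (1 + 1 / s0) powr (- A) \<le> 1 / 2" and t: "0 < t" and l: "1 \<le> l"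
    let ?P = "PiM {..<Suc K} (\<lambda>i. gamma_law (a i))" and ?B = "PiM {..<Suc K} (\<lambda>i. borel :: real measure)"
    note [measurable_cong] = sets_PiM_gamma[of "{..<Suc K}" a]
    interpret P: prob_space ?P by (intro prob_space_PiM_gamma a)
    interpret ps: product_sigma_finite "\<lambda>i. gamma_law (a i)"
      by (simp add: product_sigma_finite_def prob_space_gamma_law[OF a] prob_space_imp_sigma_finite)
    define u where "u = t * s0"
    have u: "0 < u" using t s0 by (simp add: u_def)
    define E where "E = {x\<in>space ?B. t < x K \<or> N < card {j\<in>{..<K}. t < x j}}"
    have cardlt: "N < card {j\<in>{..<K}. v < x j} \<longleftrightarrow> real N < (\<Sum>j<K. indicator {v<..} (x j))" for v and x :: "nat \<Rightarrow> real"
      by (rule card_exceeding_iff)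
    have comp: "(\<lambda>x. x j) \<in> borel_measurable ?B" if "j < Suc K" for j
      using that by (intro measurable_component_singleton) auto
    have sumi: "(\<lambda>x. \<Sum>j<K. indicator {v<..} (x j) :: real) \<in> borel_measurable ?B" for v
      by (rule sum_exceeding_measurable)
    have E: "E \<in> sets ?B" unfolding E_def by (rule many_cells_measurable)
    have E1: "{z\<in>space ?B. u < z K} \<in> sets ?B" (is "?E1 \<in> _") using comp[of K] by measurable
    have E2: "{z\<in>space ?B. real N < (\<Sum>j<K. indicator {u<..} (z j))} \<in> sets ?B" (is "?E2 \<in> _")
      using sumi[of u] by measurable
    have "measure (dirichlet_law (Suc K) a) E
      \<le> 2 * P.prob {z\<in>PiE {..<Suc K} (\<lambda>_. UNIV). dirichlet_map (Suc K) z \<in> E \<and> s0 \<le> (\<Sum>i<Suc K. z i)}"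
      using A s0 by (intro dirichlet_law_le_gamma a E) (auto simp: lessThan_Suc_atMost)
    also have "P.prob {z\<in>PiE {..<Suc K} (\<lambda>_. UNIV). dirichlet_map (Suc K) z \<in> E \<and> s0 \<le> (\<Sum>i<Suc K. z i)}
      \<le> P.prob (?E1 \<union> ?E2)"
    proof (intro P.finite_measure_mono subsetI)
      fix z assume z: "z \<in> {z\<in>PiE {..<Suc K} (\<lambda>_. UNIV). dirichlet_map (Suc K) z \<in> E \<and> s0 \<le> (\<Sum>i<Suc K. z i)}"
      have imp: "u < z j" if "t < dirichlet_map (Suc K) z j" "j < Suc K" for j
      proof -
        let ?S = "\<Sum>i<Suc K. z i"
        have S: "s0 \<le> ?S" using z by simp
        have "t < z j / ?S" using that by (simp add: dirichlet_map_def del: sum.lessThan_Suc)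
        then have "t * ?S < z j" using S s0 by (simp add: field_simps del: sum.lessThan_Suc)
        moreover have "t * s0 \<le> t * ?S" using S t by (intro mult_left_mono) auto
        ultimately show ?thesis by (simp add: u_def)
      qed
      have zs: "z \<in> space ?B" using z by (simp add: space_PiM)
      from z have "t < dirichlet_map (Suc K) z K \<or> N < card {j\<in>{..<K}. t < dirichlet_map (Suc K) z j}"
        by (simp add: E_def)
      then show "z \<in> ?E1 \<union> ?E2"
      proof
        assume "t < dirichlet_map (Suc K) z K"
        then show ?thesis using imp[of K] zs by auto
      next
        assume "N < card {j\<in>{..<K}. t < dirichlet_map (Suc K) z j}"
        also have "\<dots> \<le> card {j\<in>{..<K}. u < z j}" using imp by (intro card_mono) auto
        finally have "N < card {j\<in>{..<K}. u < z j}" .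
        then have "real N < (\<Sum>j<K. indicator {u<..} (z j))" by (simp only: cardlt)
        then show ?thesis using zs by simp
      qed
    qed (use E1 E2 in simp)
    also have "\<dots> \<le> P.prob ?E1 + P.prob ?E2"
      using E1 E2 by (intro measure_Un_le) simp_all
    also have "P.prob ?E1 \<le> a K * C * u powr (- \<beta>)"
    proof -
      have "P.prob ?E1 = measure (gamma_law (a K)) {u<..}"
      proof -
        have "distr ?P (gamma_law (a K)) (\<lambda>z. z K) = gamma_law (a K)"
          by (rule distr_PiM_component) (auto intro!: prob_space_gamma_law a)
        then have "measure (gamma_law (a K)) {u<..} = measure (distr ?P (gamma_law (a K)) (\<lambda>z. z K)) {u<..}" by simp
        also have "\<dots> = P.prob ((\<lambda>z. z K) -` {u<..} \<inter> space ?P)"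
          using comp[of K] by (intro measure_distr) auto
        also have "(\<lambda>z. z K) -` {u<..} \<inter> space ?P = ?E1" by (auto simp: space_PiM)
        finally show ?thesis by simp
      qed
      then show ?thesis using C(2)[OF a[of K] a1[of K] u] by (simp add: mult.assoc)
    qed
    also have "P.prob ?E2 \<le> l powr (- real N) * exp (l * A * C * u powr (- \<beta>))"
    proof -
      \<comment> \<open>Index \<open>K\<close> gets the factor 1, so the product is \<open>l\<close>
        to the number of counted cells above \<open>u\<close>.\<close>
      let ?f = "\<lambda>i x. if i = K then 1 else ennreal (1 + (l - 1) * indicator {u<..} x)"
      have "ennreal (l powr real N) * emeasure ?P ?E2 = (\<integral>\<^sup>+z. ennreal (l powr real N) * indicator ?E2 z \<partial>?P)"
        using E2 by (simp add: nn_integral_cmult)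
      also have "\<dots> \<le> (\<integral>\<^sup>+z. (\<Prod>i<Suc K. ?f i (z i)) \<partial>?P)"
      proof (intro nn_integral_mono)
        fix z assume "z \<in> space ?P"
        show "ennreal (l powr real N) * indicator ?E2 z \<le> (\<Prod>i<Suc K. ?f i (z i))"
        proof (cases "z \<in> ?E2")
          case True
          have "(\<Prod>i<Suc K. ?f i (z i)) = ennreal (\<Prod>i<K. 1 + (l - 1) * indicator {u<..} (z i))"
            using l by (subst prod_ennreal[symmetric]) auto
          also have "(\<Prod>i<K. 1 + (l - 1) * indicator {u<..} (z i)) = (\<Prod>i<K. l powr indicator {u<..} (z i))"
            using l by (intro prod.cong) (auto simp: indicator_def)
          also have "\<dots> = l powr (\<Sum>i<K. indicator {u<..} (z i))"
            using l by (simp add: powr_sum)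
          finally show ?thesis using True l by (auto intro!: ennreal_leI powr_mono)
        qed simp
      qed
      also have "\<dots> = (\<Prod>i<Suc K. \<integral>\<^sup>+x. ?f i x \<partial>gamma_law (a i))"
        by (intro ps.product_nn_integral_prod) auto
      also have "\<dots> \<le> (\<Prod>i<Suc K. ennreal (exp (if i = K then 0 else (l - 1) * (a i * (C * u powr (- \<beta>))))))"
      proof (intro prod_mono_ennreal)
        fix i assume "i \<in> {..<Suc K}"
        then have i: "i \<le> K" by auto
        interpret g: prob_space "gamma_law (a i)" by (intro prob_space_gamma_law a)
        show "(\<integral>\<^sup>+x. ?f i x \<partial>gamma_law (a i)) \<le> ennreal (exp (if i = K then 0 else (l - 1) * (a i * (C * u powr (- \<beta>)))))"
        proof (cases "i = K")
          case True
          then show ?thesis using g.emeasure_space_1 by simp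
        next
          case False
          have "(\<integral>\<^sup>+x. ennreal (1 + (l - 1) * indicator {u<..} x) \<partial>gamma_law (a i))
            = (\<integral>\<^sup>+x. 1 + ennreal (l - 1) * indicator {u<..} x \<partial>gamma_law (a i))"
            using l by (intro nn_integral_cong) (simp add: ennreal_mult ennreal_indicator)
          also have "\<dots> = 1 + ennreal (l - 1) * ennreal (g.prob {u<..})"
            using g.emeasure_space_1 by (simp add: nn_integral_add nn_integral_cmult g.emeasure_eq_measure)
          also have "\<dots> = ennreal (1 + (l - 1) * g.prob {u<..})"
            using l by (simp flip: ennreal_mult' ennreal_plus ennreal_1)
          also have "\<dots> \<le> ennreal (exp ((l - 1) * g.prob {u<..}))"
            by (intro ennreal_leI exp_ge_add_one_self)
          also have "\<dots> \<le> ennreal (exp ((l - 1) * (a i * (C * u powr (- \<beta>)))))"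
            using C(2)[OF a[of i] a1[OF i] u] l by (auto intro!: ennreal_leI mult_left_mono)
          finally show ?thesis using False by simp
        qed
      qed
      also have "\<dots> = ennreal (exp (\<Sum>i<K. (l - 1) * (a i * (C * u powr (- \<beta>)))))"
        by (simp add: prod_ennreal exp_sum)
      also have "\<dots> \<le> ennreal (exp (l * A * C * u powr (- \<beta>)))"
      proof -
        have "(\<Sum>i<K. (l - 1) * (a i * (C * u powr (- \<beta>)))) = (l - 1) * (\<Sum>i<K. a i) * (C * u powr (- \<beta>))"
          by (simp add: sum_distrib_left sum_distrib_right mult_ac)
        also have "\<dots> \<le> l * A * (C * u powr (- \<beta>))"
        proof (intro mult_mono mult_right_mono)
          show "(\<Sum>i<K. a i) \<le> A" using a unfolding A[symmetric] by (intro sum_mono2) auto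
        qed (use l a C u in \<open>auto intro!: sum_nonneg mult_nonneg_nonneg simp flip: A\<close>)
        finally show ?thesis by (auto intro!: ennreal_leI simp: mult.assoc)
      qed
      finally have "ennreal (l powr real N * P.prob ?E2) \<le> ennreal (exp (l * A * C * u powr (- \<beta>)))"
        using l by (simp add: P.emeasure_eq_measure ennreal_mult')
      then have "l powr real N * P.prob ?E2 \<le> exp (l * A * C * u powr (- \<beta>))"
        by (simp add: ennreal_le_iff)
      then show ?thesis using l by (simp add: powr_minus field_simps)
    qed
    finally show "measure (dirichlet_law (Suc K) a) {x\<in>space ?B. t < x K \<or> N < card {j\<in>{..<K}. t < x j}}
         \<le> 2 * (a K * C * (t * s0) powr (- \<beta>) + l powr (- real N) * exp (l * A * C * (t * s0) powr (- \<beta>)))"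
      by (simp add: E_def u_def)
  qed
qed

text \<open>If every gamma variable lies in \<open>[p i, p i + \<tau>]\<close>, the total lies in
  \<open>[1, 1 + k * \<tau>]\<close>, and normalising lowers a coordinate by at most
  \<open>k * \<tau>\<close>. Independence turns the probability of this box into a product.\<close>

lemma dirichlet_law_small_ball:
  assumes A: "0 < A"
  obtains c where "0 < c" "c \<le> 1"
    "\<And>k a p \<tau>. 0 < k \<Longrightarrow> (\<And>i. 0 \<le> a i) \<Longrightarrow> (\<And>i. i < k \<Longrightarrow> 0 < a i \<and> a i \<le> A) \<Longrightarrow> (\<And>i. i < k \<Longrightarrow> 0 \<le> p i) \<Longrightarrow>
       (\<Sum>i<k. p i) = 1 \<Longrightarrow> 0 < \<tau> \<Longrightarrow> \<tau> \<le> 1 \<Longrightarrow>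
       (\<Prod>i<k. c * a i * \<tau> powr (A + 1))
         \<le> measure (dirichlet_law k a) {x\<in>space (PiM {..<k} (\<lambda>_. borel)). \<forall>i<k. \<bar>x i - p i\<bar> \<le> (real k + 1) * \<tau>}"
proof -
  obtain c where c: "0 < c" "c \<le> 1"
    "\<And>a p \<tau>. 0 < a \<Longrightarrow> a \<le> A \<Longrightarrow> 0 \<le> p \<Longrightarrow> p \<le> 1 \<Longrightarrow> 0 < \<tau> \<Longrightarrow> \<tau> \<le> 1 \<Longrightarrow>
       c * a * \<tau> powr (A + 1) \<le> measure (gamma_law a) {p..p + \<tau>}"
    using gamma_law_interval[OF A] by blast
  show thesis
  proof (rule that[OF c(1,2)])
    fix k :: nat and a p :: "nat \<Rightarrow> real" and \<tau> :: real
    assume k: "0 < k" and a: "\<And>i. 0 \<le> a i" "\<And>i. i < k \<Longrightarrow> 0 < a i \<and> a i \<le> A"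
      and p: "\<And>i. i < k \<Longrightarrow> 0 \<le> p i" "(\<Sum>i<k. p i) = 1" and \<tau>: "0 < \<tau>" "\<tau> \<le> 1"
    let ?P = "PiM {..<k} (\<lambda>i. gamma_law (a i))" and ?B = "PiM {..<k} (\<lambda>i. borel :: real measure)"
    note [measurable_cong] = sets_PiM_gamma[of "{..<k}" a]
    interpret P: prob_space ?P by (intro prob_space_PiM_gamma a)
    interpret ps: product_sigma_finite "\<lambda>i. gamma_law (a i)"
      by (simp add: product_sigma_finite_def prob_space_gamma_law[OF a(1)] prob_space_imp_sigma_finite)
    have p1: "p i \<le> 1" if "i < k" for i
      using p(2) member_le_sum[of i "{..<k}" p] p(1) that by auto
    define E where "E = {x\<in>space ?B. \<forall>i<k. \<bar>x i - p i\<bar> \<le> (real k + 1) * \<tau>}"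
    have "E = {x\<in>space ?B. \<forall>i\<in>{..<k}. \<bar>x i - p i\<bar> \<le> (real k + 1) * \<tau>}" by (auto simp: E_def)
    also have "\<dots> \<in> sets ?B" by measurable
    finally have E: "E \<in> sets ?B" .
    have "(\<Prod>i<k. c * a i * \<tau> powr (A + 1)) \<le> (\<Prod>i<k. measure (gamma_law (a i)) {p i..p i + \<tau>})"
      using a c p p1 \<tau> by (intro prod_mono) (auto intro!: mult_nonneg_nonneg)
    also have "\<dots> = P.prob (PiE {..<k} (\<lambda>i. {p i..p i + \<tau>}))"
    proof -
      have "emeasure ?P (PiE {..<k} (\<lambda>i. {p i..p i + \<tau>})) = (\<Prod>i<k. emeasure (gamma_law (a i)) {p i..p i + \<tau>})"
        by (intro ps.emeasure_PiM) auto
      also have "\<dots> = ennreal (\<Prod>i<k. measure (gamma_law (a i)) {p i..p i + \<tau>})"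
        using prob_space_gamma_law[OF a(1)]
        by (subst prod_ennreal[symmetric]) (auto intro!: prod.cong simp: finite_measure.emeasure_eq_measure prob_space_def)
      finally show ?thesis by (simp add: measure_def prod_nonneg)
    qed
    also have "\<dots> \<le> P.prob {z\<in>PiE {..<k} (\<lambda>_. UNIV). dirichlet_map k z \<in> E}"
    proof (intro P.finite_measure_mono subsetI)
      fix z assume z: "z \<in> PiE {..<k} (\<lambda>i. {p i..p i + \<tau>})"
      let ?S = "\<Sum>i<k. z i"
      have zi: "p i \<le> z i" "z i \<le> p i + \<tau>" if "i < k" for i using z that by (auto simp: PiE_iff)
      have S1: "1 \<le> ?S" unfolding p(2)[symmetric] using zi by (intro sum_mono) auto
      have "?S \<le> (\<Sum>i<k. p i + \<tau>)" using zi by (intro sum_mono) auto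
      then have S2: "?S \<le> 1 + real k * \<tau>" by (simp add: sum.distrib p)
      have "\<bar>z i / ?S - p i\<bar> \<le> (real k + 1) * \<tau>" if i: "i < k" for i
      proof -
        have z0: "0 \<le> z i" using zi[OF i] p(1)[OF i] by simp
        have zS: "z i \<le> ?S" using zi p by (intro member_le_sum) (auto intro: order_trans[of 0 "p _"] i)
        have "z i / ?S \<le> z i / 1" using S1 z0 by (intro divide_left_mono) auto
        moreover have "z i - z i / ?S \<le> real k * \<tau>"
        proof -
          have "z i - z i / ?S = (z i / ?S) * (?S - 1)" using S1 by (simp add: field_simps)
          also have "\<dots> \<le> 1 * (?S - 1)" using S1 zS z0 by (intro mult_right_mono) auto
          finally show ?thesis using S2 by simp
        qed
        moreover have "0 \<le> real k * \<tau>" using \<tau> by simp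
        ultimately show ?thesis using zi[OF i] \<tau> unfolding distrib_right abs_le_iff by (intro conjI) linarith+
      qed
      then show "z \<in> {z\<in>PiE {..<k} (\<lambda>_. UNIV). dirichlet_map k z \<in> E}"
        using z by (auto simp: E_def dirichlet_map_def space_PiM PiE_iff)
    next
      have "{z\<in>space ?B. dirichlet_map k z \<in> E} \<in> sets ?B" using E by measurable
      then show "{z\<in>PiE {..<k} (\<lambda>_. UNIV). dirichlet_map k z \<in> E} \<in> P.events" 
        by (simp add: space_PiM cong: sets_PiM_cong)
    qed
    also have "\<dots> = measure (dirichlet_law k a) E" using E by (simp add: measure_dirichlet_law)
    finally show "(\<Prod>i<k. c * a i * \<tau> powr (A + 1))
         \<le> measure (dirichlet_law k a) {x\<in>space ?B. \<forall>i<k. \<bar>x i - p i\<bar> \<le> (real k + 1) * \<tau>}"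
      by (simp add: E_def)
  qed
qed

section \<open>Measurability of integrals against a random probability measure\<close>

lemma prob_algebra_borelD:
  assumes "\<mu> \<in> space (prob_algebra borel)"
  shows "prob_space \<mu>" "sets \<mu> = sets borel" "space \<mu> = UNIV"
  using assms sets_eq_imp_space_eq[of \<mu> borel] by (auto simp: space_prob_algebra)

text \<open>For a nonnegative integrand the Bochner integral is \<open>enn2real\<close> of the
  nonnegative integral even when the latter is infinite, both being 0; measurability therefore
  transfers without any integrability.\<close>

lemma borel_measurable_integral_prob_kernel:
  fixes f :: "'a \<Rightarrow> 'b \<Rightarrow> real"
  assumes f: "(\<lambda>(x, y). f x y) \<in> borel_measurable (M \<Otimes>\<^sub>M N)" and nn: "\<And>x y. 0 \<le> f x y"
    and L: "L \<in> M \<rightarrow>\<^sub>M prob_algebra N"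
  shows "(\<lambda>x. \<integral>y. f x y \<partial>L x) \<in> borel_measurable M"
proof -
  have "(\<lambda>x. enn2real (\<integral>\<^sup>+y. ennreal (f x y) \<partial>L x)) \<in> borel_measurable M"
    using f L by (intro measurable_compose[OF _ borel_measurable_enn2real]
        nn_integral_measurable_subprob_algebra2 measurable_prob_algebraD) auto
  moreover have "(\<integral>y. f x y \<partial>L x) = enn2real (\<integral>\<^sup>+y. ennreal (f x y) \<partial>L x)" if x: "x \<in> space M" for x
  proof -
    have "L x \<in> space (prob_algebra N)" using measurable_space[OF L x] .
    then have s: "sets (L x) = sets N" by (simp add: space_prob_algebra)
    have "f x \<in> borel_measurable N" using measurable_compose[OF measurable_Pair1'[OF x] f] by simp
    then show ?thesis using nn s by (intro integral_eq_nn_integral) (auto cong: measurable_cong_sets)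
  qed
  ultimately show ?thesis by (subst measurable_cong) auto
qed

section \<open>The Laplace kernel\<close>

lemma laplace_density_measurable[measurable]: "laplace_density \<in> borel_measurable borel"
  unfolding laplace_density_def by measurable

lemma laplace_density_pos[simp]: "0 < laplace_density u"
  by (simp add: laplace_density_def)

lemma laplace_density_nonneg[simp]: "0 \<le> laplace_density u"
  by (simp add: laplace_density_def)

lemma laplace_density_le: "laplace_density u \<le> 1 / 2"
  by (simp add: laplace_density_def)

lemma laplace_density_twice_le[simp]: "laplace_density u * 2 \<le> 1"
  by (simp add: laplace_density_def)

lemma nn_integral_shift:
  fixes f :: "real \<Rightarrow> ennreal"
  assumes "f \<in> borel_measurable borel"
  shows "(\<integral>\<^sup>+y. f (y - a) \<partial>lborel) = (\<integral>\<^sup>+y. f y \<partial>lborel)"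
  using nn_integral_real_affine[OF assms, of 1 "-a"] by simp

lemma nn_integral_laplace_density: "(\<integral>\<^sup>+y. ennreal (laplace_density y) \<partial>lborel) = 1"
proof -
  let ?E = "exponential_density 1"
  have E: "(\<integral>\<^sup>+y. ennreal (?E y) \<partial>lborel) = 1"
    using prob_space.emeasure_space_1[OF prob_space_exponential_density[of 1]]
    by (simp add: emeasure_density)
  have E': "(\<integral>\<^sup>+y. ennreal (?E (- y)) \<partial>lborel) = 1"
    using nn_integral_real_affine[of "\<lambda>y. ennreal (?E y)" "-1" 0] E by simp
  have "(\<integral>\<^sup>+y. ennreal (laplace_density y) \<partial>lborel)
    = (\<integral>\<^sup>+y. ennreal (1 / 2) * (ennreal (?E y) + ennreal (?E (- y))) \<partial>lborel)"
  proof (intro nn_integral_cong_AE)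
    show "AE y in lborel. ennreal (laplace_density y) = ennreal (1 / 2) * (ennreal (?E y) + ennreal (?E (- y)))"
      \<comment> \<open>At 0 the two half-line densities overlap, so the identity holds only off
        this null set.\<close>
      using AE_lborel_singleton[of 0]
    proof eventually_elim
      case (elim y)
      then have "laplace_density y = 1 / 2 * (?E y + ?E (- y))"
        by (auto simp: laplace_density_def exponential_density_def)
      also have "ennreal \<dots> = ennreal (1 / 2) * (ennreal (?E y) + ennreal (?E (- y)))"
        by (subst ennreal_mult') (auto simp: exponential_density_def)
      finally show ?case .
    qed
  qed
  also have "\<dots> = ennreal (1 / 2) * (1 + 1)"
    using E E' by (simp add: nn_integral_cmult nn_integral_add)
  also have "\<dots> = ennreal (1 / 2 * 2)"
    by (subst ennreal_mult') auto
  finally show ?thesis by simp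
qed

text \<open>The triangle inequality in multiplicative form. All estimates relative to the kernel
  rest on it: moving the argument costs a factor, not an additive error.\<close>

lemma laplace_density_shift: "laplace_density u \<le> exp \<bar>u - v\<bar> * laplace_density v"
proof -
  have "exp (- \<bar>u\<bar>) \<le> exp (\<bar>u - v\<bar> - \<bar>v\<bar>)" by simp
  then show ?thesis by (simp add: laplace_density_def exp_diff exp_minus field_simps)
qed

text \<open>The lower side loses \<open>1 - exp (- t)\<close>, which is at most
  \<open>exp t - 1\<close>.\<close>

lemma abs_diff_le_of_ratio:
  fixes a b t :: real
  assumes "0 \<le> b" "a \<le> exp t * b" "b \<le> exp t * a" "0 \<le> t"
  shows "\<bar>a - b\<bar> \<le> (exp t - 1) * b"
proof -
  have "b * exp (- t) \<le> a" using assms by (simp add: exp_minus field_simps)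
  then have "b - a \<le> (1 - exp (- t)) * b" by (simp add: algebra_simps)
  also have "1 - exp (- t) \<le> exp t - 1"
    using exp_ge_add_one_self[of t] exp_ge_add_one_self[of "-t"] by linarith
  finally show ?thesis using assms by (simp add: abs_le_iff algebra_simps mult_right_mono)
qed

lemma laplace_density_diff: "\<bar>laplace_density u - laplace_density v\<bar> \<le> (exp \<bar>u - v\<bar> - 1) * laplace_density v"
  using laplace_density_shift[of u v] laplace_density_shift[of v u]
  by (intro abs_diff_le_of_ratio) (auto simp: abs_minus_commute)

section \<open>Densities of observations\<close>

lemma integrable_conv_density:
  fixes f :: "real \<Rightarrow> real"
  assumes \<mu>: "\<mu> \<in> space (prob_algebra borel)" and f[measurable]: "f \<in> borel_measurable borel"
    and "\<And>x. 0 \<le> f x" "\<And>x. f x \<le> B"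
  shows "integrable \<mu> (\<lambda>x. f (y - x))"
proof -
  interpret prob_space \<mu> using prob_algebra_borelD[OF \<mu>] by simp
  note [measurable_cong] = prob_algebra_borelD(2)[OF \<mu>]
  show ?thesis using assms(3,4) by (intro integrable_const_bound[where B=B]) auto
qed

lemma ennreal_conv_density:
  fixes f :: "real \<Rightarrow> real"
  assumes \<mu>: "\<mu> \<in> space (prob_algebra borel)" and f[measurable]: "f \<in> borel_measurable borel"
    and "\<And>x. 0 \<le> f x" "\<And>x. f x \<le> B"
  shows "ennreal (conv_density f \<mu> y) = (\<integral>\<^sup>+x. ennreal (f (y - x)) \<partial>\<mu>)"
  unfolding conv_density_def using integrable_conv_density[OF assms] assms(3)
  by (intro nn_integral_eq_integral[symmetric]) auto

lemma conv_density_nonneg: "(\<And>x. 0 \<le> f x) \<Longrightarrow> 0 \<le> conv_density f \<mu> y"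
  unfolding conv_density_def by (intro Bochner_Integration.integral_nonneg) auto

lemma conv_density_measurable:
  fixes f :: "real \<Rightarrow> real"
  assumes \<mu>: "\<mu> \<in> space (prob_algebra borel)" and f[measurable]: "f \<in> borel_measurable borel"
    and "\<And>x. 0 \<le> f x"
  shows "conv_density f \<mu> \<in> borel_measurable borel"
  unfolding conv_density_def using assms(3) \<mu>
  by (intro borel_measurable_integral_prob_kernel[where N=borel]) auto

lemma nn_integral_conv_density:
  fixes f :: "real \<Rightarrow> real"
  assumes \<mu>: "\<mu> \<in> space (prob_algebra borel)" and f[measurable]: "f \<in> borel_measurable borel"
    and nn: "\<And>x. 0 \<le> f x" "\<And>x. f x \<le> B" and int: "(\<integral>\<^sup>+y. ennreal (f y) \<partial>lborel) = 1"
  shows "(\<integral>\<^sup>+y. ennreal (conv_density f \<mu> y) \<partial>lborel) = 1"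
proof -
  interpret prob_space \<mu> using prob_algebra_borelD[OF \<mu>] by simp
  interpret pair_sigma_finite lborel \<mu> by unfold_locales
  note [measurable_cong] = prob_algebra_borelD(2)[OF \<mu>]
  have "(\<integral>\<^sup>+y. ennreal (conv_density f \<mu> y) \<partial>lborel) = (\<integral>\<^sup>+y. \<integral>\<^sup>+x. ennreal (f (y - x)) \<partial>\<mu> \<partial>lborel)"
    using ennreal_conv_density[OF \<mu> f nn] by simp
  also have "\<dots> = (\<integral>\<^sup>+x. \<integral>\<^sup>+y. ennreal (f (y - x)) \<partial>lborel \<partial>\<mu>)"
    by (rule Fubini'[symmetric]) measurable
  also have "\<dots> = (\<integral>\<^sup>+x. 1 \<partial>\<mu>)"
    by (subst nn_integral_shift[where f="\<lambda>y. ennreal (f y)"]) (auto simp: int)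
  finally show ?thesis by (simp add: emeasure_space_1)
qed

lemma obs_density_measurable: "\<mu> \<in> space (prob_algebra borel) \<Longrightarrow> obs_density \<mu> \<in> borel_measurable borel"
  by (intro conv_density_measurable) auto

lemma obs_density_measurable_pair[measurable]:
  "(\<lambda>x. obs_density (fst x) (snd x)) \<in> borel_measurable (prob_algebra borel \<Otimes>\<^sub>M borel)"
proof -
  have "(\<lambda>x. \<integral>h. laplace_density (snd x - h) \<partial>fst x) \<in> borel_measurable (prob_algebra borel \<Otimes>\<^sub>M (borel :: real measure))"
    by (intro borel_measurable_integral_prob_kernel[where N=borel]) auto
  then show ?thesis by (simp add: conv_density_def)
qed

lemma ennreal_obs_density:
  "\<mu> \<in> space (prob_algebra borel) \<Longrightarrow> ennreal (obs_density \<mu> y) = (\<integral>\<^sup>+x. ennreal (laplace_density (y - x)) \<partial>\<mu>)"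
  by (intro ennreal_conv_density[where B="1/2"]) (auto intro: laplace_density_le)

lemma nn_integral_obs_density:
  "\<mu> \<in> space (prob_algebra borel) \<Longrightarrow> (\<integral>\<^sup>+y. ennreal (obs_density \<mu> y) \<partial>lborel) = 1"
  by (intro nn_integral_conv_density[where B="1/2"]) (auto intro: laplace_density_le simp: nn_integral_laplace_density)

lemma obs_density_nonneg[simp]: "0 \<le> obs_density \<mu> y"
  by (intro conv_density_nonneg) auto

lemma obs_density_le:
  assumes \<mu>: "\<mu> \<in> space (prob_algebra borel)" shows "obs_density \<mu> y \<le> 1 / 2"
proof -
  interpret prob_space \<mu> using prob_algebra_borelD[OF \<mu>] by simp
  have "(\<integral>x. laplace_density (y - x) \<partial>\<mu>) \<le> (\<integral>x. 1 / 2 \<partial>\<mu>)"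
    using integrable_conv_density[OF \<mu>, of laplace_density "1/2"]
    by (intro integral_mono) (auto intro: laplace_density_le)
  then show ?thesis by (simp add: conv_density_def prob_space)
qed

lemma obs_density_pos:
  assumes \<mu>: "\<mu> \<in> space (prob_algebra borel)" shows "0 < obs_density \<mu> y"
proof -
  interpret prob_space \<mu> using prob_algebra_borelD[OF \<mu>] by simp
  have i: "integrable \<mu> (\<lambda>x. laplace_density (y - x))"
    using integrable_conv_density[OF \<mu>, of laplace_density "1/2"] by (auto intro: laplace_density_le)
  have "obs_density \<mu> y \<noteq> 0"
  proof
    assume "obs_density \<mu> y = 0"
    then have "AE x in \<mu>. laplace_density (y - x) = 0"
      using integral_nonneg_eq_0_iff_AE[OF i] by (auto simp: conv_density_def)
    then have "AE x in \<mu>. False"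
      by eventually_elim (metis laplace_density_pos less_irrefl)
    then show False using AE_False by auto
  qed
  then show ?thesis using obs_density_nonneg[of \<mu> y] by (simp add: less_le)
qed

lemma obs_law_prob_algebra:
  assumes \<mu>: "\<mu> \<in> space (prob_algebra borel)" shows "obs_law \<mu> \<in> space (prob_algebra borel)"
  using nn_integral_obs_density[OF \<mu>] obs_density_measurable[OF \<mu>]
  by (auto simp: space_prob_algebra obs_law_def emeasure_density intro!: prob_spaceI)

lemma integral_obs_density:
  assumes \<mu>: "\<mu> \<in> space (prob_algebra borel)"
  shows "integrable lborel (obs_density \<mu>)" "(\<integral>y. obs_density \<mu> y \<partial>lborel) = 1"
  using nn_integral_obs_density[OF \<mu>] obs_density_measurable[OF \<mu>]
  by (auto simp: integrable_iff_bounded integral_eq_nn_integral)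

section \<open>Gaussian smoothing\<close>

definition std_normal :: "real measure" where
  "std_normal = density lborel (\<lambda>x. ennreal (std_normal_density x))"

lemma prob_space_std_normal: "prob_space std_normal"
  unfolding std_normal_def using prob_space_normal_density[of 1 0] by simp

lemma sets_std_normal[simp, measurable_cong]: "sets std_normal = sets borel"
  by (simp add: std_normal_def)

lemma space_std_normal[simp]: "space std_normal = UNIV"
  by (simp add: std_normal_def)

lemma std_normal_prob_algebra: "std_normal \<in> space (prob_algebra borel)"
  by (simp add: space_prob_algebra prob_space_std_normal)

text \<open>The factor by which averaging over Gaussian shifts of standard deviation at most 1 can
  inflate a function that obeys the shift inequality of the Laplace kernel.\<close>

definition exp_abs_moment :: real where
  "exp_abs_moment = (\<integral>z. exp \<bar>z\<bar> \<partial>std_normal)"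

text \<open>Completing the square turns the tilted density into the normal density with mean
  \<open>s\<close>; \<open>s\<^sup>2 = 1\<close> covers both signs at once.\<close>

lemma normal_exp_moment:
  assumes "s\<^sup>2 = 1"
  shows "(\<integral>\<^sup>+z. ennreal (exp (s * z)) \<partial>std_normal) = ennreal (exp (1 / 2))"
proof -
  have "(\<integral>\<^sup>+z. ennreal (exp (s * z)) \<partial>std_normal)
    = (\<integral>\<^sup>+z. ennreal (exp (1 / 2)) * ennreal (normal_density s 1 z) \<partial>lborel)"
    unfolding std_normal_def
  proof (subst nn_integral_density, simp, simp, intro nn_integral_cong)
    fix z :: real
    have "std_normal_density z * exp (s * z) = exp (1 / 2) * normal_density s 1 z"
    proof -
      have "exp (- z\<^sup>2 / 2) * exp (s * z) = exp (1 / 2) * exp (- (z - s)\<^sup>2 / 2)"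
        using assms by (simp add: power2_diff algebra_simps diff_divide_distrib add_divide_distrib flip: exp_add)
      then show ?thesis by (simp add: normal_density_def)
    qed
    then show "ennreal (std_normal_density z) * ennreal (exp (s * z)) = ennreal (exp (1 / 2)) * ennreal (normal_density s 1 z)"
      by (simp flip: ennreal_mult')
  qed
  also have "\<dots> = ennreal (exp (1 / 2))"
    using prob_space.emeasure_space_1[OF prob_space_normal_density[of 1 s]]
    by (simp add: nn_integral_cmult emeasure_density)
  finally show ?thesis .
qed

lemma exp_abs_moment:
  shows integrable_exp_abs: "integrable std_normal (\<lambda>z. exp \<bar>z\<bar>)"
    and exp_abs_moment_ge: "1 \<le> exp_abs_moment"
    and nn_integral_exp_abs: "(\<integral>\<^sup>+z. ennreal (exp \<bar>z\<bar>) \<partial>std_normal) = ennreal exp_abs_moment"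
proof -
  interpret prob_space std_normal by (rule prob_space_std_normal)
  have "(\<integral>\<^sup>+z. ennreal (exp \<bar>z\<bar>) \<partial>std_normal)
    \<le> (\<integral>\<^sup>+z. ennreal (exp (1 * z)) + ennreal (exp ((- 1) * z)) \<partial>std_normal)"
    by (intro nn_integral_mono) (auto simp: abs_real_def simp flip: ennreal_plus)
  also have "\<dots> < \<infinity>"
    by (subst nn_integral_add) (auto simp: normal_exp_moment[of 1, simplified] normal_exp_moment[of "-1", simplified])
  finally show i: "integrable std_normal (\<lambda>z. exp \<bar>z\<bar>)"
    by (intro integrableI_bounded) auto
  have "(\<integral>z. 1 \<partial>std_normal) \<le> exp_abs_moment"
    unfolding exp_abs_moment_def by (intro integral_mono i) auto
  then show "1 \<le> exp_abs_moment" using prob_space by simp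
  show "(\<integral>\<^sup>+z. ennreal (exp \<bar>z\<bar>) \<partial>std_normal) = ennreal exp_abs_moment"
    unfolding exp_abs_moment_def by (intro nn_integral_eq_integral i) auto
qed

text \<open>The convolution of the Laplace density with a centred normal one, hence the kernel of
  the observation density of a normal mixture. Written as an expectation over a standard normal
  variable it also makes sense for \<open>\<sigma> = 0\<close>, where it is the Laplace density; a
  bandwidth grid may thus contain 0.\<close>

definition smooth_laplace :: "real \<Rightarrow> real \<Rightarrow> real" where
  "smooth_laplace \<sigma> u = (\<integral>z. laplace_density (u - \<sigma> * z) \<partial>std_normal)"

lemma integrable_smooth_laplace: "integrable std_normal (\<lambda>z. laplace_density (u - \<sigma> * z))"
proof -
  interpret prob_space std_normal by (rule prob_space_std_normal)
  show ?thesis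
    by (intro integrable_const_bound[where B="1/2"]) (auto intro: laplace_density_le)
qed

lemma ennreal_smooth_laplace:
  "ennreal (smooth_laplace \<sigma> u) = (\<integral>\<^sup>+z. ennreal (laplace_density (u - \<sigma> * z)) \<partial>std_normal)"
  unfolding smooth_laplace_def
  by (intro nn_integral_eq_integral[symmetric] integrable_smooth_laplace) auto

lemma smooth_laplace_nonneg[simp]: "0 \<le> smooth_laplace \<sigma> u"
  unfolding smooth_laplace_def by (intro Bochner_Integration.integral_nonneg) auto

lemma smooth_laplace_le: "smooth_laplace \<sigma> u \<le> 1 / 2"
proof -
  interpret prob_space std_normal by (rule prob_space_std_normal)
  have "smooth_laplace \<sigma> u \<le> (\<integral>z. 1 / 2 \<partial>std_normal)"
    unfolding smooth_laplace_def by (intro integral_mono integrable_smooth_laplace) (auto intro: laplace_density_le)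
  then show ?thesis using prob_space by simp
qed

lemma smooth_laplace_measurable[measurable]: "smooth_laplace \<sigma> \<in> borel_measurable borel"
  unfolding smooth_laplace_def[abs_def] using std_normal_prob_algebra
  by (intro borel_measurable_integral_prob_kernel[where N=borel]) auto

lemma nn_integral_smooth_laplace: "(\<integral>\<^sup>+u. ennreal (smooth_laplace \<sigma> u) \<partial>lborel) = 1"
proof -
  interpret prob_space std_normal by (rule prob_space_std_normal)
  interpret pair_sigma_finite lborel std_normal by unfold_locales
  have "(\<integral>\<^sup>+u. ennreal (smooth_laplace \<sigma> u) \<partial>lborel)
    = (\<integral>\<^sup>+z. \<integral>\<^sup>+u. ennreal (laplace_density (u - \<sigma> * z)) \<partial>lborel \<partial>std_normal)"
    unfolding ennreal_smooth_laplace by (rule Fubini'[symmetric]) measurable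
  also have "\<dots> = (\<integral>\<^sup>+z. 1 \<partial>std_normal)"
    by (subst nn_integral_shift[where f="\<lambda>y. ennreal (laplace_density y)"]) (auto simp: nn_integral_laplace_density)
  finally show ?thesis using emeasure_space_1 by simp
qed

text \<open>An average of translates inherits the shift inequality, with the same constant for every
  bandwidth.\<close>

lemma smooth_laplace_shift: "smooth_laplace \<sigma> u \<le> exp \<bar>u - v\<bar> * smooth_laplace \<sigma> v"
proof -
  have "smooth_laplace \<sigma> u \<le> (\<integral>z. exp \<bar>u - v\<bar> * laplace_density (v - \<sigma> * z) \<partial>std_normal)"
    unfolding smooth_laplace_def
    by (intro integral_mono integrable_mult_right integrable_smooth_laplace)
       (metis (no_types, lifting) add_diff_cancel_left' diff_add_cancel diff_diff_eq2 laplace_density_shift diff_diff_add add.commute)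
  then show ?thesis by (simp add: smooth_laplace_def)
qed

lemma smooth_laplace_diff: "\<bar>smooth_laplace \<sigma> u - smooth_laplace \<sigma> v\<bar> \<le> (exp \<bar>u - v\<bar> - 1) * smooth_laplace \<sigma> v"
  using smooth_laplace_shift[of \<sigma> u v] smooth_laplace_shift[of \<sigma> v u]
  by (intro abs_diff_le_of_ratio) (auto simp: abs_minus_commute)

text \<open>Convexity of \<open>exp\<close> on the segment from 0 to \<open>x\<close>.\<close>

lemma exp_mult_le:
  fixes t x :: real
  assumes "0 \<le> t" "t \<le> 1" "0 \<le> x"
  shows "exp (t * x) - 1 \<le> t * exp x"
proof -
  have "convex_on UNIV (exp :: real \<Rightarrow> real)" by (rule exp_convex)
  then have "exp ((1 - t) *\<^sub>R 0 + t *\<^sub>R x) \<le> (1 - t) * exp 0 + t * exp x"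
    using assms by (intro convex_onD) auto
  then show ?thesis using assms by simp
qed

lemma smooth_laplace_le_laplace:
  assumes "0 \<le> \<sigma>" "\<sigma> \<le> 1"
  shows "smooth_laplace \<sigma> u \<le> exp_abs_moment * laplace_density u"
proof -
  have "smooth_laplace \<sigma> u \<le> (\<integral>z. exp \<bar>z\<bar> * laplace_density u \<partial>std_normal)"
    unfolding smooth_laplace_def
  proof (intro integral_mono integrable_mult_left integrable_exp_abs integrable_smooth_laplace)
    fix z :: real
    have "laplace_density (u - \<sigma> * z) \<le> exp \<bar>u - \<sigma> * z - u\<bar> * laplace_density u" by (rule laplace_density_shift)
    also have "\<dots> \<le> exp \<bar>z\<bar> * laplace_density u"
      using assms by (intro mult_right_mono) (auto simp: abs_mult mult_left_le_one_le)
    finally show "laplace_density (u - \<sigma> * z) \<le> exp \<bar>z\<bar> * laplace_density u" .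
  qed
  then show ?thesis by (simp add: exp_abs_moment_def)
qed

text \<open>For a fixed Gaussian value \<open>z\<close> the two kernels are Laplace densities
  shifted against each other by \<open>|\<sigma> - \<sigma>'| * |z|\<close>. The relative error is
  at most \<open>|\<sigma> - \<sigma>'| * exp |z|\<close>, and integrating over \<open>u\<close>
  first removes the kernel. The bound does not degenerate as the bandwidths tend to 0.\<close>

lemma smooth_laplace_bandwidth:
  assumes "\<bar>\<sigma> - \<sigma>'\<bar> \<le> 1"
  shows "(\<integral>\<^sup>+u. ennreal \<bar>smooth_laplace \<sigma> u - smooth_laplace \<sigma>' u\<bar> \<partial>lborel) \<le> ennreal (exp_abs_moment * \<bar>\<sigma> - \<sigma>'\<bar>)"
proof -
  interpret prob_space std_normal by (rule prob_space_std_normal)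
  interpret pair_sigma_finite lborel std_normal by unfold_locales
  have "(\<integral>\<^sup>+u. ennreal \<bar>smooth_laplace \<sigma> u - smooth_laplace \<sigma>' u\<bar> \<partial>lborel)
    \<le> (\<integral>\<^sup>+u. \<integral>\<^sup>+z. ennreal \<bar>\<sigma> - \<sigma>'\<bar> * ennreal (exp \<bar>z\<bar>) * ennreal (laplace_density (u - \<sigma>' * z)) \<partial>std_normal \<partial>lborel)"
  proof (intro nn_integral_mono)
    fix u :: real
    have "smooth_laplace \<sigma> u - smooth_laplace \<sigma>' u = (\<integral>z. laplace_density (u - \<sigma> * z) - laplace_density (u - \<sigma>' * z) \<partial>std_normal)"
      unfolding smooth_laplace_def by (intro Bochner_Integration.integral_diff[symmetric] integrable_smooth_laplace)
    then have "ennreal \<bar>smooth_laplace \<sigma> u - smooth_laplace \<sigma>' u\<bar>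
      = ennreal (norm (\<integral>z. laplace_density (u - \<sigma> * z) - laplace_density (u - \<sigma>' * z) \<partial>std_normal))" by simp
    also have "\<dots> \<le> (\<integral>\<^sup>+z. ennreal (norm (laplace_density (u - \<sigma> * z) - laplace_density (u - \<sigma>' * z))) \<partial>std_normal)"
      by (rule integral_norm_bound_ennreal) (intro Bochner_Integration.integrable_diff integrable_smooth_laplace)
    also have "\<dots> \<le> (\<integral>\<^sup>+z. ennreal \<bar>\<sigma> - \<sigma>'\<bar> * ennreal (exp \<bar>z\<bar>) * ennreal (laplace_density (u - \<sigma>' * z)) \<partial>std_normal)"
    proof (intro nn_integral_mono)
      fix z :: real
      have "\<bar>laplace_density (u - \<sigma> * z) - laplace_density (u - \<sigma>' * z)\<bar>
        \<le> (exp \<bar>(u - \<sigma> * z) - (u - \<sigma>' * z)\<bar> - 1) * laplace_density (u - \<sigma>' * z)" by (rule laplace_density_diff)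
      also have "\<bar>(u - \<sigma> * z) - (u - \<sigma>' * z)\<bar> = \<bar>\<sigma> - \<sigma>'\<bar> * \<bar>z\<bar>"
        by (simp add: abs_mult[symmetric] left_diff_distrib abs_minus_commute)
      also have "(exp (\<bar>\<sigma> - \<sigma>'\<bar> * \<bar>z\<bar>) - 1) * laplace_density (u - \<sigma>' * z) \<le> \<bar>\<sigma> - \<sigma>'\<bar> * exp \<bar>z\<bar> * laplace_density (u - \<sigma>' * z)"
        using assms by (intro mult_right_mono exp_mult_le) auto
      finally show "ennreal (norm (laplace_density (u - \<sigma> * z) - laplace_density (u - \<sigma>' * z)))
        \<le> ennreal \<bar>\<sigma> - \<sigma>'\<bar> * ennreal (exp \<bar>z\<bar>) * ennreal (laplace_density (u - \<sigma>' * z))"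
        by (simp flip: ennreal_mult')
    qed
    finally show "ennreal \<bar>smooth_laplace \<sigma> u - smooth_laplace \<sigma>' u\<bar> \<le> \<dots>" .
  qed
  also have "\<dots> = (\<integral>\<^sup>+z. \<integral>\<^sup>+u. ennreal \<bar>\<sigma> - \<sigma>'\<bar> * ennreal (exp \<bar>z\<bar>) * ennreal (laplace_density (u - \<sigma>' * z)) \<partial>lborel \<partial>std_normal)"
    by (rule Fubini'[symmetric]) measurable
  also have "\<dots> = (\<integral>\<^sup>+z. ennreal \<bar>\<sigma> - \<sigma>'\<bar> * ennreal (exp \<bar>z\<bar>) \<partial>std_normal)"
  proof (intro nn_integral_cong)
    fix z :: real
    show "(\<integral>\<^sup>+u. ennreal \<bar>\<sigma> - \<sigma>'\<bar> * ennreal (exp \<bar>z\<bar>) * ennreal (laplace_density (u - \<sigma>' * z)) \<partial>lborel)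
      = ennreal \<bar>\<sigma> - \<sigma>'\<bar> * ennreal (exp \<bar>z\<bar>)"
      using nn_integral_shift[of "\<lambda>y. ennreal (laplace_density y)" "\<sigma>' * z"]
      by (simp add: nn_integral_cmult nn_integral_laplace_density)
  qed
  also have "\<dots> = ennreal (exp_abs_moment * \<bar>\<sigma> - \<sigma>'\<bar>)"
    using exp_abs_moment_ge
    by (subst nn_integral_cmult) (simp_all add: nn_integral_exp_abs mult.commute[of exp_abs_moment] ennreal_mult')
  finally show ?thesis .
qed

section \<open>Normal mixtures\<close>

lemma normal_density_le: "0 < \<sigma> \<Longrightarrow> normal_density m \<sigma> x \<le> 1 / sqrt (2 * pi * \<sigma>\<^sup>2)"
  by (simp add: normal_density_def divide_right_mono mult_left_le)

lemma normal_mixture_prob_algebra: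
  assumes \<mu>: "\<mu> \<in> space (prob_algebra borel)" and \<sigma>: "0 < \<sigma>"
  shows "normal_mixture \<mu> \<sigma> \<in> space (prob_algebra borel)"
proof -
  have "(\<integral>\<^sup>+y. ennreal (conv_density (normal_density 0 \<sigma>) \<mu> y) \<partial>lborel) = 1"
    using prob_space.emeasure_space_1[OF prob_space_normal_density[OF \<sigma>, of 0]]
    by (intro nn_integral_conv_density[OF \<mu> _ _ normal_density_le[OF \<sigma>]]) (auto simp: emeasure_density)
  then show ?thesis
    using conv_density_measurable[OF \<mu>, of "normal_density 0 \<sigma>"]
    by (auto simp: space_prob_algebra normal_mixture_def emeasure_density intro!: prob_spaceI)
qed

text \<open>On the open half-line every value is a probability measure. Measurability into the space
  of measures then reduces to that of each \<open>emeasure\<close>, an integral of a jointly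
  measurable density.\<close>

lemma normal_mixture_measurable:
  assumes S: "sets S = sets (restrict_space borel {0<..})"
  shows "(\<lambda>(\<mu>, \<sigma>). normal_mixture \<mu> \<sigma>) \<in> prob_algebra borel \<Otimes>\<^sub>M S \<rightarrow>\<^sub>M prob_algebra borel"
proof (rule measurable_prob_algebraI)
  have sp: "space S = {0<..}" using sets_eq_imp_space_eq[OF S] by (simp add: space_restrict_space)
  let ?PS = "prob_algebra (borel :: real measure) \<Otimes>\<^sub>M S"
  have in_PA: "normal_mixture (fst x) (snd x) \<in> space (prob_algebra borel)" if "x \<in> space ?PS" for x
    using that by (auto simp: space_pair_measure sp intro!: normal_mixture_prob_algebra)
  then show "x \<in> space ?PS \<Longrightarrow> prob_space (case x of (\<mu>, \<sigma>) \<Rightarrow> normal_mixture \<mu> \<sigma>)" for x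
    by (auto simp: space_prob_algebra split: prod.split)
  have snd': "(\<lambda>x. x) \<in> S \<rightarrow>\<^sub>M borel"
    using S by (simp add: measurable_restrict_space1 cong: measurable_cong_sets)
  have m: "(\<lambda>p. conv_density (normal_density 0 (snd (fst p))) (fst (fst p)) (snd p)) \<in> borel_measurable (?PS \<Otimes>\<^sub>M lborel)"
    unfolding conv_density_def
  proof (intro borel_measurable_integral_prob_kernel[where N=borel])
    have [measurable]: "(\<lambda>p. snd (fst (fst p))) \<in> borel_measurable ((?PS \<Otimes>\<^sub>M lborel) \<Otimes>\<^sub>M (borel :: real measure))"
      by (rule measurable_compose[OF _ snd']) measurable
    have [measurable]: "(\<lambda>p. snd (fst p) - snd p) \<in> borel_measurable ((?PS \<Otimes>\<^sub>M lborel) \<Otimes>\<^sub>M (borel :: real measure))"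
      by measurable
    show "(\<lambda>(p, h). normal_density 0 (snd (fst p)) (snd p - h)) \<in> borel_measurable ((?PS \<Otimes>\<^sub>M lborel) \<Otimes>\<^sub>M borel)"
      unfolding normal_density_def split_beta' by measurable
  qed auto
  show "(\<lambda>(\<mu>, \<sigma>). normal_mixture \<mu> \<sigma>) \<in> ?PS \<rightarrow>\<^sub>M subprob_algebra borel"
  proof (rule measurable_subprob_algebra)
    fix x assume x: "x \<in> space ?PS"
    show "subprob_space (case x of (\<mu>, \<sigma>) \<Rightarrow> normal_mixture \<mu> \<sigma>)"
      using in_PA[OF x] by (auto simp: space_prob_algebra prob_space_imp_subprob_space split: prod.split)
    show "sets (case x of (\<mu>, \<sigma>) \<Rightarrow> normal_mixture \<mu> \<sigma>) = sets borel"
      by (auto simp: normal_mixture_def split: prod.split)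
  next
    fix A :: "real set" assume A[measurable]: "A \<in> sets borel"
    have "(\<lambda>x. \<integral>\<^sup>+y. ennreal (conv_density (normal_density 0 (snd x)) (fst x) y) * indicator A y \<partial>lborel) \<in> borel_measurable ?PS"
      using m by (intro lborel.borel_measurable_nn_integral) (auto simp: split_beta')
    moreover have "emeasure (case x of (\<mu>, \<sigma>) \<Rightarrow> normal_mixture \<mu> \<sigma>) A
      = (\<integral>\<^sup>+y. ennreal (conv_density (normal_density 0 (snd x)) (fst x) y) * indicator A y \<partial>lborel)" if "x \<in> space ?PS" for x
    proof -
      have "conv_density (normal_density 0 (snd x)) (fst x) \<in> borel_measurable borel"
        using that by (intro conv_density_measurable) (auto simp: space_pair_measure)
      then show ?thesis by (auto simp: normal_mixture_def emeasure_density split: prod.split)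
    qed
    ultimately show "(\<lambda>x. emeasure (case x of (\<mu>, \<sigma>) \<Rightarrow> normal_mixture \<mu> \<sigma>) A) \<in> borel_measurable ?PS"
      by (subst measurable_cong) auto
  qed
qed

text \<open>Associativity of convolution, by Fubini and the substitution
  \<open>x = h + \<sigma> * z\<close>.\<close>

lemma obs_density_normal_mixture:
  assumes \<mu>: "\<mu> \<in> space (prob_algebra borel)" and \<sigma>: "0 < \<sigma>"
  shows "obs_density (normal_mixture \<mu> \<sigma>) y = conv_density (smooth_laplace \<sigma>) \<mu> y"
proof -
  interpret prob_space \<mu> using prob_algebra_borelD[OF \<mu>] by simp
  interpret pair_sigma_finite lborel \<mu> by unfold_locales
  note [measurable_cong] = prob_algebra_borelD(2)[OF \<mu>]
  have m[measurable]: "conv_density (normal_density 0 \<sigma>) \<mu> \<in> borel_measurable borel"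
    by (intro conv_density_measurable \<mu>) auto
  have "ennreal (obs_density (normal_mixture \<mu> \<sigma>) y) = (\<integral>\<^sup>+x. ennreal (laplace_density (y - x)) \<partial>normal_mixture \<mu> \<sigma>)"
    by (intro ennreal_obs_density normal_mixture_prob_algebra \<mu> \<sigma>)
  also have "\<dots> = (\<integral>\<^sup>+x. ennreal (conv_density (normal_density 0 \<sigma>) \<mu> x) * ennreal (laplace_density (y - x)) \<partial>lborel)"
    unfolding normal_mixture_def by (subst nn_integral_density) auto
  also have "\<dots> = (\<integral>\<^sup>+x. \<integral>\<^sup>+h. ennreal (normal_density 0 \<sigma> (x - h)) * ennreal (laplace_density (y - x)) \<partial>\<mu> \<partial>lborel)"
    by (intro nn_integral_cong)
       (simp add: ennreal_conv_density[OF \<mu> _ _ normal_density_le[OF \<sigma>]] nn_integral_multc)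
  also have "\<dots> = (\<integral>\<^sup>+h. \<integral>\<^sup>+x. ennreal (normal_density 0 \<sigma> (x - h)) * ennreal (laplace_density (y - x)) \<partial>lborel \<partial>\<mu>)"
    by (rule Fubini'[symmetric]) measurable
  also have "\<dots> = (\<integral>\<^sup>+h. ennreal (smooth_laplace \<sigma> (y - h)) \<partial>\<mu>)"
  proof (intro nn_integral_cong)
    fix h :: real
    have "(\<integral>\<^sup>+x. ennreal (normal_density 0 \<sigma> (x - h)) * ennreal (laplace_density (y - x)) \<partial>lborel)
      = ennreal \<sigma> * (\<integral>\<^sup>+z. ennreal (normal_density 0 \<sigma> (\<sigma> * z)) * ennreal (laplace_density (y - (h + \<sigma> * z))) \<partial>lborel)"
      using \<sigma> by (subst nn_integral_real_affine[where c=\<sigma> and t=h]) auto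
    also have "\<dots> = (\<integral>\<^sup>+z. ennreal \<sigma> * (ennreal (normal_density 0 \<sigma> (\<sigma> * z)) * ennreal (laplace_density (y - (h + \<sigma> * z)))) \<partial>lborel)"
      by (simp add: nn_integral_cmult)
    also have "\<dots> = (\<integral>\<^sup>+z. ennreal (std_normal_density z) * ennreal (laplace_density (y - h - \<sigma> * z)) \<partial>lborel)"
    proof (intro nn_integral_cong)
      fix z :: real
      have "\<sigma> * normal_density 0 \<sigma> (\<sigma> * z) = std_normal_density z"
        using \<sigma> by (simp add: normal_density_def power_mult_distrib real_sqrt_mult)
      then have "ennreal \<sigma> * ennreal (normal_density 0 \<sigma> (\<sigma> * z)) = ennreal (std_normal_density z)"
        using \<sigma> by (simp flip: ennreal_mult')
      then show "ennreal \<sigma> * (ennreal (normal_density 0 \<sigma> (\<sigma> * z)) * ennreal (laplace_density (y - (h + \<sigma> * z))))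
        = ennreal (std_normal_density z) * ennreal (laplace_density (y - h - \<sigma> * z))"
        by (simp add: mult.assoc[symmetric] diff_diff_add)
    qed
    also have "\<dots> = ennreal (smooth_laplace \<sigma> (y - h))"
      unfolding ennreal_smooth_laplace std_normal_def by (subst nn_integral_density) auto
    finally show "(\<integral>\<^sup>+x. ennreal (normal_density 0 \<sigma> (x - h)) * ennreal (laplace_density (y - x)) \<partial>lborel)
      = ennreal (smooth_laplace \<sigma> (y - h))" .
  qed
  also have "\<dots> = ennreal (conv_density (smooth_laplace \<sigma>) \<mu> y)"
    by (intro ennreal_conv_density[OF \<mu> _ _ smooth_laplace_le, symmetric]) auto
  finally show ?thesis by (simp add: conv_density_nonneg)
qed

section \<open>Kullback--Leibler neighbourhoods contain chi-square neighbourhoods\<close>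

text \<open>With \<open>p\<close> the true and \<open>q\<close> the model density this is the
  integral of \<open>p\<^sup>2 / q\<close> minus 1: the excess over 1 of the expected inverse
  likelihood ratio of one observation under the truth.\<close>

definition chi_square :: "real measure \<Rightarrow> real measure \<Rightarrow> ennreal" where
  "chi_square \<mu>0 \<mu> = (\<integral>\<^sup>+y. ennreal ((obs_density \<mu>0 y - obs_density \<mu> y)\<^sup>2 / obs_density \<mu> y) \<partial>lborel)"

text \<open>The centre \<open>g\<close> is an arbitrary function because mixtures with rounded
  weights need not integrate to 1. The value is an extended real, so no integrability has to be
  carried along.\<close>

definition L1_diff :: "real measure \<Rightarrow> (real \<Rightarrow> real) \<Rightarrow> ennreal" where
  "L1_diff \<mu> g = (\<integral>\<^sup>+y. ennreal \<bar>obs_density \<mu> y - g y\<bar> \<partial>lborel)"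

lemma obs_density_measurable_pair'[measurable]:
  assumes "f \<in> M \<rightarrow>\<^sub>M prob_algebra borel" "g \<in> M \<rightarrow>\<^sub>M borel"
  shows "(\<lambda>x. obs_density (f x) (g x)) \<in> borel_measurable M"
  using measurable_compose[OF measurable_Pair[OF assms] obs_density_measurable_pair] by simp

lemma chi_square_measurable:
  assumes \<mu>0: "\<mu>0 \<in> space (prob_algebra borel)"
  shows "chi_square \<mu>0 \<in> borel_measurable (prob_algebra borel)"
proof -
  note [measurable] = obs_density_measurable[OF \<mu>0]
  show ?thesis unfolding chi_square_def by measurable
qed

lemma L1_diff_measurable:
  assumes [measurable]: "g \<in> borel_measurable borel"
  shows "(\<lambda>\<mu>. L1_diff \<mu> g) \<in> borel_measurable (prob_algebra borel)"
  unfolding L1_diff_def by measurable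

lemma lebesgue_density_obs_law:
  assumes \<mu>: "\<mu> \<in> space (prob_algebra borel)"
  shows "AE y in lborel. lebesgue_density (obs_law \<mu>) y = obs_density \<mu> y"
proof -
  have m: "(\<lambda>y. ennreal (obs_density \<mu> y)) \<in> borel_measurable lborel"
    using obs_density_measurable[OF \<mu>] by simp
  have "AE y in lborel. RN_deriv lborel (obs_law \<mu>) y = ennreal (obs_density \<mu> y)"
    using density_RN_deriv_density[OF m] unfolding obs_law_def
    by (intro sigma_finite_measure.density_unique[OF sigma_finite_lborel] m) auto
  then show ?thesis by eventually_elim (simp add: lebesgue_density_def)
qed

lemma lebesgue_density_measurable: "lebesgue_density P \<in> borel_measurable borel"
  unfolding lebesgue_density_def by measurable

lemma sets_obs_law[simp]: "sets (obs_law \<mu>) = sets borel"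
  by (simp add: obs_law_def)

text \<open>The Laplace kernel is positive everywhere, so every model law has the null sets of
  Lebesgue measure. This settles both absolute continuity clauses of \<open>KL_nbhd\<close>.\<close>

lemma null_sets_obs_law:
  assumes \<mu>: "\<mu> \<in> space (prob_algebra borel)"
  shows "null_sets (obs_law \<mu>) = null_sets lborel"
proof -
  have m: "(\<lambda>y. ennreal (obs_density \<mu> y)) \<in> borel_measurable lborel"
    using obs_density_measurable[OF \<mu>] by simp
  have "A \<in> null_sets (obs_law \<mu>) \<longleftrightarrow> A \<in> sets lborel \<and> (AE y in lborel. y \<notin> A)" for A
    using obs_density_pos[OF \<mu>, THEN less_imp_neq, THEN not_sym] unfolding obs_law_def
    by (subst null_sets_density_iff[OF m]) auto
  moreover have "A \<in> null_sets lborel \<longleftrightarrow> A \<in> sets lborel \<and> (AE y in lborel. y \<notin> A)" for A :: "real set"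
    by (metis AE_iff_null_sets null_setsD2)
  ultimately show ?thesis by blast
qed

text \<open>Radon-Nikodym derivatives are known only almost everywhere; \<open>obs_density\<close>
  is an everywhere defined version, jointly measurable in the mixing law and the point, which makes
  the neighbourhood a measurable event.\<close>

lemma KL_nbhd_obs_law_iff:
  assumes \<mu>0: "\<mu>0 \<in> space (prob_algebra borel)" and \<mu>: "\<mu> \<in> space (prob_algebra borel)"
  defines "p \<equiv> obs_density \<mu>0" and "q \<equiv> obs_density \<mu>"
  shows "obs_law \<mu> \<in> KL_nbhd (obs_law \<mu>0) r \<longleftrightarrow>
    integrable lborel (\<lambda>x. p x * ln (p x / q x)) \<and> (\<integral>x. p x * ln (p x / q x) \<partial>lborel) \<le> r \<and>
    integrable lborel (\<lambda>x. p x * (ln (p x / q x))\<^sup>2) \<and> (\<integral>x. p x * (ln (p x / q x))\<^sup>2 \<partial>lborel) \<le> r"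
proof -
  let ?p = "lebesgue_density (obs_law \<mu>0)" and ?q = "lebesgue_density (obs_law \<mu>)"
  note [measurable] = lebesgue_density_measurable
  have [measurable]: "p \<in> borel_measurable borel" "q \<in> borel_measurable borel"
    unfolding p_def q_def by (intro obs_density_measurable \<mu>0 \<mu>)+
  have ae: "AE y in lborel. ?p y = p y \<and> ?q y = q y"
    using lebesgue_density_obs_law[OF \<mu>0] lebesgue_density_obs_law[OF \<mu>]
    by eventually_elim (simp add: p_def q_def)
  have ac: "absolutely_continuous lborel (obs_law \<mu>)" "absolutely_continuous (obs_law \<mu>) (obs_law \<mu>0)"
    using null_sets_obs_law \<mu> \<mu>0 by (auto simp: absolutely_continuous_def)
  have 1: "AE x in lborel. ?p x * ln (?p x / ?q x) = p x * ln (p x / q x)"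
    and 2: "AE x in lborel. ?p x * (ln (?p x / ?q x))\<^sup>2 = p x * (ln (p x / q x))\<^sup>2"
    using ae by (eventually_elim, simp)+
  have "integrable lborel (\<lambda>x. ?p x * ln (?p x / ?q x)) \<longleftrightarrow> integrable lborel (\<lambda>x. p x * ln (p x / q x))"
    "(\<integral>x. ?p x * ln (?p x / ?q x) \<partial>lborel) = (\<integral>x. p x * ln (p x / q x) \<partial>lborel)"
    "integrable lborel (\<lambda>x. ?p x * (ln (?p x / ?q x))\<^sup>2) \<longleftrightarrow> integrable lborel (\<lambda>x. p x * (ln (p x / q x))\<^sup>2)"
    "(\<integral>x. ?p x * (ln (?p x / ?q x))\<^sup>2 \<partial>lborel) = (\<integral>x. p x * (ln (p x / q x))\<^sup>2 \<partial>lborel)"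
    by (intro integrable_cong_AE integral_cong_AE 1 2; measurable)+
  then show ?thesis
    using ac obs_law_prob_algebra[OF \<mu>] unfolding KL_nbhd_def Let_def by simp
qed

lemma KL_nbhd_obs_law_measurable:
  assumes \<mu>0: "\<mu>0 \<in> space (prob_algebra borel)"
  shows "{\<mu> \<in> space (prob_algebra borel). obs_law \<mu> \<in> KL_nbhd (obs_law \<mu>0) r} \<in> sets (prob_algebra borel)"
proof -
  note [measurable] = obs_density_measurable[OF \<mu>0]
  let ?p = "obs_density \<mu>0"
  have "{\<mu> \<in> space (prob_algebra borel).
      integrable lborel (\<lambda>x. ?p x * ln (?p x / obs_density \<mu> x)) \<and> (\<integral>x. ?p x * ln (?p x / obs_density \<mu> x) \<partial>lborel) \<le> r \<and>
      integrable lborel (\<lambda>x. ?p x * (ln (?p x / obs_density \<mu> x))\<^sup>2) \<and> (\<integral>x. ?p x * (ln (?p x / obs_density \<mu> x))\<^sup>2 \<partial>lborel) \<le> r}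
    \<in> sets (prob_algebra borel)"
    by measurable
  also have "?this \<longleftrightarrow> ?thesis"
    using KL_nbhd_obs_law_iff[OF \<mu>0] by (intro arg_cong2[where f="(\<in>)"] Collect_cong refl conj_cong) auto
  finally show ?thesis .
qed

text \<open>The derivative of the difference is the square of
  \<open>exp (x / 2) - exp (- (x / 2))\<close>.\<close>

lemma sinh_ge_self:
  fixes v :: real assumes "0 \<le> v" shows "2 * v \<le> exp v - exp (- v)"
proof -
  let ?f = "\<lambda>x :: real. exp x - exp (- x) - 2 * x"
  have "?f 0 \<le> ?f v"
  proof (rule DERIV_nonneg_imp_nondecreasing[OF assms])
    fix x :: real
    have "(?f has_real_derivative exp x + exp (- x) - 2) (at x)"
      by (auto intro!: derivative_eq_intros)
    moreover have "exp x + exp (- x) - 2 = (exp (x / 2) - exp (- (x / 2)))\<^sup>2"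
      by (simp add: power2_diff mult.assoc exp_minus_inverse flip: exp_double)
    ultimately show "\<exists>y. (?f has_real_derivative y) (at x) \<and> 0 \<le> y" by auto
  qed
  then show ?thesis by simp
qed

text \<open>With \<open>t = exp (2 * v)\<close> the two sides are the squares of
  \<open>2 * v\<close> and of \<open>exp v - exp (- v)\<close>.\<close>

lemma ln_square_le:
  fixes t :: real assumes "0 < t" shows "(ln t)\<^sup>2 \<le> (t - 1)\<^sup>2 / t"
proof -
  define v where "v = ln t / 2"
  have t: "t = (exp v)\<^sup>2" using assms by (simp add: v_def flip: exp_double)
  have "\<bar>2 * v\<bar> \<le> \<bar>exp v - exp (- v)\<bar>"
    using sinh_ge_self[of v] sinh_ge_self[of "-v"] by (cases "0 \<le> v") auto
  then have "(2 * v)\<^sup>2 \<le> (exp v - exp (- v))\<^sup>2" by (simp add: abs_le_square_iff)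
  also have "exp v - exp (- v) = (t - 1) / exp v"
    by (simp add: t exp_minus power2_eq_square field_simps)
  also have "((t - 1) / exp v)\<^sup>2 = (t - 1)\<^sup>2 / t" by (simp only: power_divide t[symmetric])
  finally show ?thesis by (simp add: v_def)
qed

text \<open>The first two bounds are \<open>ln x \<le> x - 1\<close> at \<open>q / p\<close> and at
  \<open>p / q\<close>, the third is \<open>ln_square_le\<close> at \<open>p / q\<close>. The
  chi-square integrand thus dominates both divergence integrands without any bound on the ratio of
  the densities.\<close>

lemma KL_pointwise:
  fixes p q :: real assumes "0 < p" "0 < q"
  shows "0 \<le> p * ln (p / q) - p + q" "p * ln (p / q) - p + q \<le> (p - q)\<^sup>2 / q"
    "p * (ln (p / q))\<^sup>2 \<le> (p - q)\<^sup>2 / q"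
proof -
  have "p * ln (q / p) \<le> p * (q / p - 1)" using assms by (intro mult_left_mono ln_le_minus_one) auto
  also have "p * (q / p - 1) = q - p" using assms by (simp add: field_simps)
  finally have "p * ln (q / p) \<le> q - p" .
  then show "0 \<le> p * ln (p / q) - p + q"
    using assms by (simp add: ln_div field_simps)
  have "p * ln (p / q) \<le> p * (p / q - 1)" using assms by (intro mult_left_mono ln_le_minus_one) auto
  then show "p * ln (p / q) - p + q \<le> (p - q)\<^sup>2 / q"
    using assms by (simp add: power2_eq_square field_simps)
  have "p * (ln (p / q))\<^sup>2 \<le> p * ((p / q - 1)\<^sup>2 / (p / q))"
    using assms by (intro mult_left_mono ln_square_le) auto
  also have "\<dots> = (p - q)\<^sup>2 / q"
    using assms by (simp add: power2_eq_square field_simps)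
  finally show "p * (ln (p / q))\<^sup>2 \<le> (p - q)\<^sup>2 / q" .
qed

text \<open>Adding \<open>q - p\<close> makes the Kullback-Leibler integrand nonnegative and
  dominated by the chi-square integrand, hence integrable. The added term integrates to 0 because
  both are probability densities.\<close>

lemma chi_square_KL_nbhd:
  assumes \<mu>0: "\<mu>0 \<in> space (prob_algebra borel)" and \<mu>: "\<mu> \<in> space (prob_algebra borel)"
    and r: "0 \<le> r" and chi: "chi_square \<mu>0 \<mu> \<le> ennreal r"
  shows "obs_law \<mu> \<in> KL_nbhd (obs_law \<mu>0) r"
proof -
  let ?p = "obs_density \<mu>0" and ?q = "obs_density \<mu>"
  let ?c = "\<lambda>y. (?p y - ?q y)\<^sup>2 / ?q y" and ?h = "\<lambda>y. ?p y * ln (?p y / ?q y) - ?p y + ?q y"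
  note [measurable] = obs_density_measurable[OF \<mu>0] obs_density_measurable[OF \<mu>]
  note pos = obs_density_pos[OF \<mu>0] obs_density_pos[OF \<mu>]
  note kl = KL_pointwise[OF pos]
  have c: "integrable lborel ?c"
    using chi unfolding chi_square_def
    by (auto simp: integrable_iff_bounded le_less_trans[OF _ ennreal_less_top])
  have cr: "(\<integral>y. ?c y \<partial>lborel) \<le> r"
    using chi r unfolding chi_square_def
    by (subst (asm) nn_integral_eq_integral[OF c]) (auto simp: ennreal_le_iff)
  have ih: "integrable lborel ?h"
    using kl by (intro Bochner_Integration.integrable_bound[OF c]) auto
  have i: "integrable lborel (\<lambda>y. ?h y + (?p y - ?q y))"
    by (intro Bochner_Integration.integrable_add Bochner_Integration.integrable_diff ih integral_obs_density \<mu>0 \<mu>)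
  have "(\<integral>y. ?h y + (?p y - ?q y) \<partial>lborel) = (\<integral>y. ?h y \<partial>lborel) + (\<integral>y. ?p y - ?q y \<partial>lborel)"
    by (intro Bochner_Integration.integral_add Bochner_Integration.integrable_diff ih integral_obs_density \<mu>0 \<mu>)
  also have "(\<integral>y. ?p y - ?q y \<partial>lborel) = 0"
    using integral_obs_density[OF \<mu>0] integral_obs_density[OF \<mu>] by simp
  also have "(\<integral>y. ?h y \<partial>lborel) + 0 = (\<integral>y. ?h y \<partial>lborel)" by simp
  also have "\<dots> \<le> r"
    using integral_mono[OF ih c] kl cr by fastforce
  finally have 1: "(\<integral>y. ?p y * ln (?p y / ?q y) \<partial>lborel) \<le> r" by simp
  have i2: "integrable lborel (\<lambda>y. ?p y * (ln (?p y / ?q y))\<^sup>2)"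
    using kl by (intro Bochner_Integration.integrable_bound[OF c]) auto
  have "(\<integral>y. ?p y * (ln (?p y / ?q y))\<^sup>2 \<partial>lborel) \<le> r"
    using integral_mono[OF i2 c] kl cr by fastforce
  with 1 i i2 show ?thesis unfolding KL_nbhd_obs_law_iff[OF \<mu>0 \<mu>] by simp
qed

section \<open>Distances between laws of observations\<close>

lemma L1_dist_obs_law:
  assumes \<mu>: "\<mu> \<in> space (prob_algebra borel)" "\<nu> \<in> space (prob_algebra borel)"
  shows "ennreal (L1_dist (obs_law \<mu>) (obs_law \<nu>)) = L1_diff \<mu> (obs_density \<nu>)"
proof -
  note [measurable] = lebesgue_density_measurable obs_density_measurable[OF \<mu>(1)] obs_density_measurable[OF \<mu>(2)]
  have "L1_dist (obs_law \<mu>) (obs_law \<nu>) = (\<integral>y. \<bar>obs_density \<mu> y - obs_density \<nu> y\<bar> \<partial>lborel)"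
    unfolding L1_dist_def using lebesgue_density_obs_law[OF \<mu>(1)] lebesgue_density_obs_law[OF \<mu>(2)]
    by (intro integral_cong_AE) auto
  moreover have "integrable lborel (\<lambda>y. \<bar>obs_density \<mu> y - obs_density \<nu> y\<bar>)"
    by (intro integrable_abs Bochner_Integration.integrable_diff integral_obs_density \<mu>)
  ultimately show ?thesis unfolding L1_diff_def by (simp add: nn_integral_eq_integral)
qed

text \<open>\<open>(sqrt a - sqrt b)\<^sup>2 \<le> |a - b|\<close>, since
  \<open>|sqrt a - sqrt b| \<le> sqrt a + sqrt b\<close>.\<close>

lemma hellinger_dist_obs_law:
  assumes \<mu>: "\<mu> \<in> space (prob_algebra borel)" "\<nu> \<in> space (prob_algebra borel)"
  shows "ennreal ((hellinger_dist (obs_law \<mu>) (obs_law \<nu>))\<^sup>2) \<le> L1_diff \<mu> (obs_density \<nu>)"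
proof -
  note [measurable] = lebesgue_density_measurable obs_density_measurable[OF \<mu>(1)] obs_density_measurable[OF \<mu>(2)]
  let ?h = "\<lambda>y. (sqrt (obs_density \<mu> y) - sqrt (obs_density \<nu> y))\<^sup>2"
  have h: "?h y \<le> \<bar>obs_density \<mu> y - obs_density \<nu> y\<bar>" for y
  proof -
    let ?a = "sqrt (obs_density \<mu> y)" and ?b = "sqrt (obs_density \<nu> y)"
    have "?h y = \<bar>?a - ?b\<bar> * \<bar>?a - ?b\<bar>" by (simp add: power2_eq_square flip: abs_mult)
    also have "\<dots> \<le> \<bar>?a - ?b\<bar> * \<bar>?a + ?b\<bar>" by (intro mult_left_mono) (auto simp: abs_le_iff)
    also have "\<dots> = \<bar>?a\<^sup>2 - ?b\<^sup>2\<bar>"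
      by (simp only: abs_mult[symmetric]) (simp add: power2_eq_square algebra_simps)
    finally show ?thesis by simp
  qed
  have "(hellinger_dist (obs_law \<mu>) (obs_law \<nu>))\<^sup>2
    = (\<integral>x. (sqrt (lebesgue_density (obs_law \<mu>) x) - sqrt (lebesgue_density (obs_law \<nu>) x))\<^sup>2 \<partial>lborel)"
    unfolding hellinger_dist_def by (intro real_sqrt_pow2 Bochner_Integration.integral_nonneg) auto
  also have "\<dots> = (\<integral>y. ?h y \<partial>lborel)"
    using lebesgue_density_obs_law[OF \<mu>(1)] lebesgue_density_obs_law[OF \<mu>(2)]
    by (intro integral_cong_AE) auto
  also have "ennreal \<dots> = (\<integral>\<^sup>+y. ennreal (?h y) \<partial>lborel)"
    using h by (intro nn_integral_eq_integral[symmetric]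
        Bochner_Integration.integrable_bound[OF integrable_abs[OF Bochner_Integration.integrable_diff[OF
            integral_obs_density(1)[OF \<mu>(1)] integral_obs_density(1)[OF \<mu>(2)]]]]) auto
  also have "\<dots> \<le> L1_diff \<mu> (obs_density \<nu>)"
    unfolding L1_diff_def using h by (intro nn_integral_mono ennreal_leI)
  finally show ?thesis .
qed

section \<open>Posterior contraction\<close>

definition likelihood_ratio :: "nat \<Rightarrow> real measure \<Rightarrow> real measure \<Rightarrow> (nat \<Rightarrow> real) \<Rightarrow> real" where
  "likelihood_ratio n \<mu>0 \<mu> y = (\<Prod>i<n. obs_density \<mu> (y i) / obs_density \<mu>0 (y i))"

abbreviation sample_law :: "nat \<Rightarrow> real measure \<Rightarrow> (nat \<Rightarrow> real) measure" where
  "sample_law n \<mu> \<equiv> PiM {..<n} (\<lambda>_. obs_law \<mu>)"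

lemma prob_space_obs_law: "\<mu> \<in> space (prob_algebra borel) \<Longrightarrow> prob_space (obs_law \<mu>)"
  using obs_law_prob_algebra by (auto simp: space_prob_algebra)

lemma sets_sample_law: "sets (sample_law n \<mu>) = sets (PiM {..<n} (\<lambda>_. borel))"
  by (intro sets_PiM_cong) auto

lemma space_sample_law: "space (sample_law n \<mu>) = space (PiM {..<n} (\<lambda>_. borel :: real measure))"
  by (intro sets_eq_imp_space_eq sets_sample_law)

lemma prob_space_sample_law: "\<mu> \<in> space (prob_algebra borel) \<Longrightarrow> prob_space (sample_law n \<mu>)"
  by (intro prob_space_PiM prob_space_obs_law)

lemma likelihood_ratio_pos:
  "\<mu>0 \<in> space (prob_algebra borel) \<Longrightarrow> \<mu> \<in> space (prob_algebra borel) \<Longrightarrow> 0 < likelihood_ratio n \<mu>0 \<mu> y"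
  unfolding likelihood_ratio_def by (intro prod_pos divide_pos_pos obs_density_pos) auto

lemma likelihood_ratio_measurable_pair:
  assumes \<mu>0: "\<mu>0 \<in> space (prob_algebra borel)"
  shows "(\<lambda>(\<mu>, y). likelihood_ratio n \<mu>0 \<mu> y) \<in> borel_measurable (prob_algebra borel \<Otimes>\<^sub>M PiM {..<n} (\<lambda>_. borel))"
proof -
  note [measurable] = obs_density_measurable[OF \<mu>0]
  have "(\<lambda>x. \<Prod>i<n. obs_density (fst x) (snd x i) / obs_density \<mu>0 (snd x i))
    \<in> borel_measurable (prob_algebra borel \<Otimes>\<^sub>M PiM {..<n} (\<lambda>_. borel))"
  proof (rule borel_measurable_prod)
    fix i assume "i \<in> {..<n}"
    then have [measurable]: "(\<lambda>x. snd x i) \<in> borel_measurable (prob_algebra borel \<Otimes>\<^sub>M PiM {..<n} (\<lambda>_. borel :: real measure))"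
      by (intro measurable_compose[OF measurable_snd measurable_component_singleton])
    show "(\<lambda>x. obs_density (fst x) (snd x i) / obs_density \<mu>0 (snd x i))
      \<in> borel_measurable (prob_algebra borel \<Otimes>\<^sub>M PiM {..<n} (\<lambda>_. borel))"
      by measurable
  qed
  then show ?thesis by (simp add: likelihood_ratio_def split_beta')
qed

lemma sample_law_eq_density:
  assumes \<mu>0: "\<mu>0 \<in> space (prob_algebra borel)" and \<mu>: "\<mu> \<in> space (prob_algebra borel)"
  shows "sample_law n \<mu> = density (sample_law n \<mu>0) (\<lambda>y. ennreal (likelihood_ratio n \<mu>0 \<mu> y))"
proof -
  note [measurable] = obs_density_measurable[OF \<mu>0] obs_density_measurable[OF \<mu>]
  let ?r = "\<lambda>y. ennreal (obs_density \<mu> y / obs_density \<mu>0 y)"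
  have pos: "0 < obs_density \<mu>0 y" for y by (rule obs_density_pos[OF \<mu>0])
  have "density (obs_law \<mu>0) ?r = density lborel (\<lambda>y. ennreal (obs_density \<mu>0 y) * ?r y)"
    unfolding obs_law_def by (intro density_density_eq) auto
  also have "(\<lambda>y. ennreal (obs_density \<mu>0 y) * ?r y) = (\<lambda>y. ennreal (obs_density \<mu> y))"
    using pos[THEN less_imp_neq, THEN not_sym] by (auto simp: fun_eq_iff simp flip: ennreal_mult')
  also have "density lborel (\<lambda>y. ennreal (obs_density \<mu> y)) = obs_law \<mu>" by (simp add: obs_law_def)
  finally have eq: "density (obs_law \<mu>0) ?r = obs_law \<mu>" .
  have "sample_law n \<mu> = PiM {..<n} (\<lambda>_. density (obs_law \<mu>0) ?r)" by (simp add: eq)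
  also have "\<dots> = density (sample_law n \<mu>0) (\<lambda>y. \<Prod>i<n. ?r (y i))"
    using prob_space_obs_law[OF \<mu>0] prob_space_obs_law[OF \<mu>]
    by (intro PiM_density) (auto simp: eq prob_space_imp_sigma_finite cong: measurable_cong_sets)
  also have "\<dots> = density (sample_law n \<mu>0) (\<lambda>y. ennreal (likelihood_ratio n \<mu>0 \<mu> y))"
    by (simp add: likelihood_ratio_def prod_ennreal)
  finally show ?thesis .
qed

text \<open>Change of measure: weighting by the likelihood ratio under the truth amounts to sampling
  from the model. This is how errors of the second kind enter the posterior numerator.\<close>

lemma nn_integral_likelihood_ratio:
  assumes \<mu>0: "\<mu>0 \<in> space (prob_algebra borel)" and \<mu>: "\<mu> \<in> space (prob_algebra borel)"
    and f: "f \<in> borel_measurable (PiM {..<n} (\<lambda>_. borel))"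
  shows "(\<integral>\<^sup>+y. ennreal (likelihood_ratio n \<mu>0 \<mu> y) * f y \<partial>sample_law n \<mu>0) = (\<integral>\<^sup>+y. f y \<partial>sample_law n \<mu>)"
proof -
  have "(\<lambda>y. likelihood_ratio n \<mu>0 \<mu> y) \<in> borel_measurable (PiM {..<n} (\<lambda>_. borel))"
    using measurable_compose[OF measurable_Pair1'[OF \<mu>] likelihood_ratio_measurable_pair[OF \<mu>0]] by simp
  then show ?thesis
    using f by (subst sample_law_eq_density[OF \<mu>0 \<mu>], subst nn_integral_density)
      (auto simp: sets_sample_law cong: measurable_cong_sets)
qed

lemma nn_integral_sample_law_prod:
  assumes \<mu>: "\<mu> \<in> space (prob_algebra borel)" and f: "f \<in> borel_measurable borel"
  shows "(\<integral>\<^sup>+y. (\<Prod>i<n. f (y i)) \<partial>sample_law n \<mu>) = (\<integral>\<^sup>+x. f x \<partial>obs_law \<mu>) ^ n"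
proof -
  interpret product_sigma_finite "\<lambda>_. obs_law \<mu>"
    using prob_space_obs_law[OF \<mu>] by (simp add: product_sigma_finite_def prob_space_imp_sigma_finite)
  show ?thesis
    using f by (subst product_nn_integral_prod) (auto cong: measurable_cong_sets)
qed

text \<open>For densities \<open>p\<close> and \<open>q\<close>,
  \<open>p\<^sup>2 / q + q = (p - q)\<^sup>2 / q + 2 * p\<close>. The mass 1 of \<open>q\<close>
  stays on the left until the end, where it is cancelled, to avoid subtraction in the extended
  reals.\<close>

lemma nn_integral_density_ratio:
  assumes \<mu>0: "\<mu>0 \<in> space (prob_algebra borel)" and \<mu>: "\<mu> \<in> space (prob_algebra borel)"
  shows "(\<integral>\<^sup>+y. ennreal (obs_density \<mu>0 y / obs_density \<mu> y) \<partial>obs_law \<mu>0) \<le> 1 + chi_square \<mu>0 \<mu>"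
proof -
  note [measurable] = obs_density_measurable[OF \<mu>0] obs_density_measurable[OF \<mu>]
  let ?p = "obs_density \<mu>0" and ?q = "obs_density \<mu>"
  have "(\<integral>\<^sup>+y. ennreal (?p y / ?q y) \<partial>obs_law \<mu>0) + 1
    = (\<integral>\<^sup>+y. ennreal (?p y) * ennreal (?p y / ?q y) \<partial>lborel) + (\<integral>\<^sup>+y. ennreal (?q y) \<partial>lborel)"
    unfolding nn_integral_obs_density[OF \<mu>] by (subst obs_law_def, subst nn_integral_density) auto
  also have "\<dots> = (\<integral>\<^sup>+y. ennreal (?p y) * ennreal (?p y / ?q y) + ennreal (?q y) \<partial>lborel)"
    by (intro nn_integral_add[symmetric]) auto
  also have "\<dots> = (\<integral>\<^sup>+y. ennreal ((?p y - ?q y)\<^sup>2 / ?q y) + (ennreal (?p y) + ennreal (?p y)) \<partial>lborel)"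
  proof (intro nn_integral_cong)
    fix y
    have "?p y * (?p y / ?q y) + ?q y = (?p y - ?q y)\<^sup>2 / ?q y + (?p y + ?p y)"
      using obs_density_pos[OF \<mu>, of y] by (simp add: field_simps power2_eq_square)
    then show "ennreal (?p y) * ennreal (?p y / ?q y) + ennreal (?q y)
      = ennreal ((?p y - ?q y)\<^sup>2 / ?q y) + (ennreal (?p y) + ennreal (?p y))"
      by (simp flip: ennreal_mult' ennreal_plus)
  qed
  also have "\<dots> = chi_square \<mu>0 \<mu> + (1 + 1)"
    by (subst nn_integral_add, simp, simp, subst nn_integral_add, simp, simp)
       (simp add: nn_integral_obs_density[OF \<mu>0] chi_square_def)
  finally have "1 + (\<integral>\<^sup>+y. ennreal (?p y / ?q y) \<partial>obs_law \<mu>0) = 1 + (1 + chi_square \<mu>0 \<mu>)"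
    by (simp add: ac_simps)
  then show ?thesis by (subst (asm) ennreal_add_left_cancel) auto
qed

lemma one_plus_power_le_exp:
  fixes r :: real assumes "0 \<le> r" shows "(1 + r) ^ n \<le> exp (real n * r)"
  using power_mono[OF exp_ge_add_one_self[of r], of n] assms by (simp add: exp_of_nat_mult)

text \<open>
  Jensen's inequality for the convex function \<open>1 / x\<close> replaces the usual bound through the variance
  of the log-likelihood ratio; it is used in the linearised form \<open>2 \<le> l x + 1 / (l x)\<close>.
\<close>

lemma evidence_lower_bound:
  assumes \<mu>0: "\<mu>0 \<in> space (prob_algebra borel)"
    and P: "prob_space P" "sets P = sets (prob_algebra borel)"
    and G: "G \<in> sets P" "0 < measure P G"
    and r: "0 \<le> r" and chi: "\<And>\<mu>. \<mu> \<in> G \<Longrightarrow> chi_square \<mu>0 \<mu> \<le> ennreal r"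
  shows "emeasure (sample_law n \<mu>0) {y\<in>space (sample_law n \<mu>0).
      (\<integral>\<^sup>+\<mu>. ennreal (likelihood_ratio n \<mu>0 \<mu> y) * indicator G \<mu> \<partial>P) \<le> ennreal (exp (- 2 * real n * r) * measure P G)}
    \<le> ennreal (exp (- (real n * r)))"
proof -
  interpret P: prob_space P by (rule P)
  interpret S: prob_space "sample_law n \<mu>0" by (rule prob_space_sample_law[OF \<mu>0])
  interpret pair_sigma_finite "sample_law n \<mu>0" P by unfold_locales
  note [measurable_cong] = P(2) sets_sample_law[of n \<mu>0]
  note [measurable] = G(1)
  have lr[measurable]: "(\<lambda>x. likelihood_ratio n \<mu>0 (fst x) (snd x)) \<in> borel_measurable (P \<Otimes>\<^sub>M sample_law n \<mu>0)"
    using likelihood_ratio_measurable_pair[OF \<mu>0] P(2)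
    by (simp add: split_beta' cong: measurable_cong_sets sets_pair_measure_cong)
  have lr'[measurable]: "(\<lambda>x. likelihood_ratio n \<mu>0 (snd x) (fst x)) \<in> borel_measurable (sample_law n \<mu>0 \<Otimes>\<^sub>M P)"
    using measurable_compose[OF measurable_pair_swap' lr] by (simp add: split_beta')
  have spP: "space P = space (prob_algebra borel)" using P(2) by (rule sets_eq_imp_space_eq)
  have G_PA: "\<mu> \<in> space (prob_algebra borel)" if "\<mu> \<in> G" for \<mu>
    using that G(1)[THEN sets.sets_into_space] spP by auto
  define a where "a = measure P G"
  define l where "l = exp (2 * real n * r)"
  have a: "0 < a" using G by (simp add: a_def)
  have l: "0 < l" by (simp add: l_def)
  \<comment> \<open>The prior average of the inverse likelihood ratio. For each parameter in
    \<open>G\<close> its expectation under the truth is an \<open>n\<close>-fold product of factors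
    at most \<open>1 + r\<close>.\<close>
  define J where "J y = (\<integral>\<^sup>+\<mu>. ennreal (1 / likelihood_ratio n \<mu>0 \<mu> y) * indicator G \<mu> \<partial>P)" for y
  have J[measurable]: "J \<in> borel_measurable (sample_law n \<mu>0)" unfolding J_def[abs_def] by measurable
  have "(\<integral>\<^sup>+y. J y \<partial>sample_law n \<mu>0)
    = (\<integral>\<^sup>+\<mu>. \<integral>\<^sup>+y. ennreal (1 / likelihood_ratio n \<mu>0 \<mu> y) * indicator G \<mu> \<partial>sample_law n \<mu>0 \<partial>P)"
    unfolding J_def by (rule Fubini'[symmetric]) measurable
  also have "\<dots> \<le> (\<integral>\<^sup>+\<mu>. ennreal (exp (real n * r)) * indicator G \<mu> \<partial>P)"
  proof (intro nn_integral_mono)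
    fix \<mu> assume "\<mu> \<in> space P"
    show "(\<integral>\<^sup>+y. ennreal (1 / likelihood_ratio n \<mu>0 \<mu> y) * indicator G \<mu> \<partial>sample_law n \<mu>0)
      \<le> ennreal (exp (real n * r)) * indicator G \<mu>"
    proof (cases "\<mu> \<in> G")
      case True
      note \<mu> = G_PA[OF True]
      note [measurable] = obs_density_measurable[OF \<mu>0] obs_density_measurable[OF \<mu>]
      have "(\<integral>\<^sup>+y. ennreal (1 / likelihood_ratio n \<mu>0 \<mu> y) \<partial>sample_law n \<mu>0)
        = (\<integral>\<^sup>+y. (\<Prod>i<n. ennreal (obs_density \<mu>0 (y i) / obs_density \<mu> (y i))) \<partial>sample_law n \<mu>0)"
        by (intro nn_integral_cong) (simp add: likelihood_ratio_def prod_ennreal prod_dividef)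
      also have "\<dots> = (\<integral>\<^sup>+y. ennreal (obs_density \<mu>0 y / obs_density \<mu> y) \<partial>obs_law \<mu>0) ^ n"
        by (rule nn_integral_sample_law_prod[OF \<mu>0]) simp
      also have "\<dots> \<le> (1 + ennreal r) ^ n"
        using nn_integral_density_ratio[OF \<mu>0 \<mu>] chi[OF True]
        by (intro power_mono order_trans[OF nn_integral_density_ratio[OF \<mu>0 \<mu>]] add_left_mono) auto
      also have "\<dots> = ennreal ((1 + r) ^ n)" using r by (simp add: ennreal_power flip: ennreal_plus ennreal_1)
      also have "\<dots> \<le> ennreal (exp (real n * r))" using r by (intro ennreal_leI one_plus_power_le_exp)
      finally show ?thesis using True by simp
    qed simp
  qed
  also have "\<dots> = ennreal (exp (real n * r) * a)"
    by (simp add: nn_integral_cmult P.emeasure_eq_measure a_def ennreal_mult')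
  finally have EJ: "(\<integral>\<^sup>+y. J y \<partial>sample_law n \<mu>0) \<le> ennreal (exp (real n * r) * a)" .
  \<comment> \<open>If the evidence is at most \<open>a / l\<close>, averaging
    \<open>2 \<le> l * x + 1 / (l * x)\<close> over \<open>G\<close> leaves
    \<open>a \<le> J y / l\<close>. Then \<open>J y\<close> exceeds the bound on its mean by the
    factor \<open>exp (n * r)\<close>, and Markov's inequality applies.\<close>
  have key: "1 \<le> ennreal (1 / (l * a)) * J y"
    if y: "y \<in> space (sample_law n \<mu>0)"
      and le: "(\<integral>\<^sup>+\<mu>. ennreal (likelihood_ratio n \<mu>0 \<mu> y) * indicator G \<mu> \<partial>P) \<le> ennreal (exp (- 2 * real n * r) * a)" for y
  proof -
    have [measurable]: "(\<lambda>\<mu>. likelihood_ratio n \<mu>0 \<mu> y) \<in> borel_measurable P"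
      using measurable_compose[OF measurable_Pair2'[OF y] lr] by simp
    have "ennreal a + ennreal a = (\<integral>\<^sup>+\<mu>. 2 * indicator G \<mu> \<partial>P)"
      by (simp add: mult_2 nn_integral_add P.emeasure_eq_measure a_def)
    also have "\<dots> \<le> (\<integral>\<^sup>+\<mu>. ennreal l * (ennreal (likelihood_ratio n \<mu>0 \<mu> y) * indicator G \<mu>)
         + ennreal (1 / l) * (ennreal (1 / likelihood_ratio n \<mu>0 \<mu> y) * indicator G \<mu>) \<partial>P)"
    proof (intro nn_integral_mono)
      fix \<mu>
      show "2 * indicator G \<mu> \<le> ennreal l * (ennreal (likelihood_ratio n \<mu>0 \<mu> y) * indicator G \<mu>)
         + ennreal (1 / l) * (ennreal (1 / likelihood_ratio n \<mu>0 \<mu> y) * indicator G \<mu>)"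
      proof (cases "\<mu> \<in> G")
        case True
        define x where "x = l * likelihood_ratio n \<mu>0 \<mu> y"
        have x: "0 < x" using l likelihood_ratio_pos[OF \<mu>0 G_PA[OF True]] by (simp add: x_def)
        have "0 \<le> (x - 1)\<^sup>2 / x" using x by simp
        also have "(x - 1)\<^sup>2 / x = x + 1 / x - 2" using x by (simp add: power2_eq_square field_simps)
        finally have "ennreal 2 \<le> ennreal (x + 1 / x)" by (intro ennreal_leI) simp
        also have "\<dots> = ennreal l * ennreal (likelihood_ratio n \<mu>0 \<mu> y) + ennreal (1 / l) * ennreal (1 / likelihood_ratio n \<mu>0 \<mu> y)"
          using x l by (simp add: x_def ennreal_plus flip: ennreal_mult')
        finally show ?thesis using True by simp
      qed simp
    qed
    also have "\<dots> = ennreal l * (\<integral>\<^sup>+\<mu>. ennreal (likelihood_ratio n \<mu>0 \<mu> y) * indicator G \<mu> \<partial>P) + ennreal (1 / l) * J y"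
      unfolding J_def by (subst nn_integral_add) (auto simp: nn_integral_cmult)
    also have "\<dots> \<le> ennreal l * ennreal (exp (- 2 * real n * r) * a) + ennreal (1 / l) * J y"
      by (intro add_right_mono mult_left_mono le) auto
    also have "ennreal l * ennreal (exp (- 2 * real n * r) * a) = ennreal a"
    proof -
      have "l * (exp (- 2 * real n * r) * a) = a" by (simp add: l_def mult.assoc[symmetric] flip: exp_add)
      then show ?thesis using l by (metis ennreal_mult' less_imp_le)
    qed
    finally have "ennreal a \<le> ennreal (1 / l) * J y"
      by (simp add: ennreal_add_left_cancel_le)
    then have "ennreal (1 / a) * ennreal a \<le> ennreal (1 / a) * (ennreal (1 / l) * J y)"
      by (intro mult_left_mono) auto
    also have "ennreal (1 / a) * (ennreal (1 / l) * J y) = ennreal (1 / (l * a)) * J y"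
    proof -
      have "ennreal (1 / a) * ennreal (1 / l) = ennreal (1 / (l * a))"
        using a l by (subst ennreal_mult'[symmetric]) (auto simp: mult.commute)
      then show ?thesis by (simp only: mult.assoc[symmetric])
    qed
    also have "ennreal (1 / a) * ennreal a = 1"
      using a by (simp flip: ennreal_mult')
    finally show ?thesis .
  qed
  have "emeasure (sample_law n \<mu>0) {y\<in>space (sample_law n \<mu>0).
      (\<integral>\<^sup>+\<mu>. ennreal (likelihood_ratio n \<mu>0 \<mu> y) * indicator G \<mu> \<partial>P) \<le> ennreal (exp (- 2 * real n * r) * measure P G)}
    \<le> emeasure (sample_law n \<mu>0) {y\<in>space (sample_law n \<mu>0). 1 \<le> ennreal (1 / (l * a)) * J y}"
    using key by (intro emeasure_mono subsetI) (auto simp: a_def)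
  also have "\<dots> \<le> ennreal (1 / (l * a)) * (\<integral>\<^sup>+y. J y * indicator (space (sample_law n \<mu>0)) y \<partial>sample_law n \<mu>0)"
    by (rule nn_integral_Markov_inequality) auto
  also have "(\<integral>\<^sup>+y. J y * indicator (space (sample_law n \<mu>0)) y \<partial>sample_law n \<mu>0) = (\<integral>\<^sup>+y. J y \<partial>sample_law n \<mu>0)"
    by (intro nn_integral_cong) auto
  also have "ennreal (1 / (l * a)) * \<dots> \<le> ennreal (1 / (l * a)) * ennreal (exp (real n * r) * a)"
    by (intro mult_left_mono EJ) auto
  also have "\<dots> = ennreal (exp (- (real n * r)))"
  proof -
    have "l = exp (real n * r) * exp (real n * r)" by (simp add: l_def flip: exp_add)
    then have "1 / (l * a) * (exp (real n * r) * a) = exp (- (real n * r))"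
      using a by (simp add: exp_minus field_simps)
    moreover have "ennreal (1 / (l * a)) * ennreal (exp (real n * r) * a) = ennreal (1 / (l * a) * (exp (real n * r) * a))"
      using l a by (intro ennreal_mult'[symmetric]) simp
    ultimately show ?thesis by (simp only:)
  qed
  finally show ?thesis .
qed

section \<open>Tests of the truth against balls in L1\<close>

lemma exp_le_quadratic:
  fixes l :: real assumes "\<bar>l\<bar> \<le> 1" shows "exp l \<le> 1 + l + l\<^sup>2"
proof (cases "0 \<le> l")
  case True then show ?thesis using exp_bound[of l] assms by simp
next
  case False
  define x where "x = - l"
  have x: "0 \<le> x" "x \<le> 1" using False assms by (auto simp: x_def)
  \<comment> \<open>For \<open>l = - x\<close> the claim is
    \<open>(1 - x + x\<^sup>2) * exp x \<ge> 1\<close>; replacing \<open>exp x\<close> by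
    \<open>1 + x\<close> turns the left side into \<open>1 + x ^ 3\<close>.\<close>
  have "1 \<le> 1 + x ^ 3" using x by simp
  also have "1 + x ^ 3 = (1 - x + x\<^sup>2) * (1 + x)" by (simp add: power2_eq_square power3_eq_cube algebra_simps)
  also have "\<dots> \<le> (1 - x + x\<^sup>2) * exp x"
    using x by (intro mult_left_mono exp_ge_add_one_self) (auto intro: add_nonneg_nonneg)
  finally have "exp (- x) \<le> 1 - x + x\<^sup>2" by (simp add: exp_minus field_simps)
  then show ?thesis by (simp add: x_def)
qed

text \<open>The indicator takes two values, so its exponential is affine in it. Then
  \<open>exp l - 1 \<le> l + l\<^sup>2\<close> and \<open>1 + u \<le> exp u\<close> give a bound of
  sub-Gaussian type for \<open>|l| \<le> 1\<close>.\<close>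

lemma indicator_mgf:
  assumes Q: "prob_space Q" and A: "A \<in> sets Q" and l: "\<bar>l\<bar> \<le> 1"
  shows "(\<integral>\<^sup>+x. ennreal (exp (l * (indicator A x - c))) \<partial>Q) \<le> ennreal (exp (l * (measure Q A - c) + l\<^sup>2))"
proof -
  interpret prob_space Q by (rule Q)
  note [measurable] = A
  have "(\<integral>\<^sup>+x. ennreal (exp (l * (indicator A x - c))) \<partial>Q)
    = ennreal (\<integral>x. exp (- l * c) * (1 + (exp l - 1) * indicator A x) \<partial>Q)"
  proof (subst nn_integral_eq_integral[symmetric])
    show "integrable Q (\<lambda>x. exp (- l * c) * (1 + (exp l - 1) * indicator A x))"
      by (intro integrable_mult_right Bochner_Integration.integrable_add) (auto simp: emeasure_eq_measure)
    show "AE x in Q. 0 \<le> exp (- l * c) * (1 + (exp l - 1) * indicator A x)"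
      by (auto simp: indicator_def)
    show "(\<integral>\<^sup>+x. ennreal (exp (l * (indicator A x - c))) \<partial>Q)
      = (\<integral>\<^sup>+x. ennreal (exp (- l * c) * (1 + (exp l - 1) * indicator A x)) \<partial>Q)"
      by (intro nn_integral_cong) (auto simp: indicator_def algebra_simps exp_diff exp_minus divide_inverse)
  qed
  also have "(\<integral>x. exp (- l * c) * (1 + (exp l - 1) * indicator A x) \<partial>Q) = exp (- l * c) * (1 + (exp l - 1) * prob A)"
    by (simp add: prob_space emeasure_eq_measure)
  also have "\<dots> \<le> exp (- l * c) * exp (l * prob A + l\<^sup>2)"
  proof (intro mult_left_mono)
    have "1 + (exp l - 1) * prob A \<le> 1 + (l + l\<^sup>2) * prob A"
      using exp_le_quadratic[OF l] by (intro add_left_mono mult_right_mono) auto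
    also have "\<dots> \<le> 1 + (l * prob A + l\<^sup>2)"
      using mult_left_mono[of "prob A" 1 "l\<^sup>2"] by (simp add: distrib_right)
    also have "\<dots> \<le> exp (l * prob A + l\<^sup>2)" by (rule exp_ge_add_one_self)
    finally show "1 + (exp l - 1) * prob A \<le> exp (l * prob A + l\<^sup>2)" .
  qed simp
  also have "\<dots> = exp (l * (prob A - c) + l\<^sup>2)" by (simp add: algebra_simps flip: exp_add)
  finally show ?thesis by (simp add: ennreal_leI)
qed

lemma measure_obs_law:
  assumes \<mu>: "\<mu> \<in> space (prob_algebra borel)" and A: "A \<in> sets borel"
  shows "measure (obs_law \<mu>) A = (\<integral>y. obs_density \<mu> y * indicator A y \<partial>lborel)"
    "integrable lborel (\<lambda>y. obs_density \<mu> y * indicator A y)"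
proof -
  note [measurable] = obs_density_measurable[OF \<mu>] A
  show i: "integrable lborel (\<lambda>y. obs_density \<mu> y * indicator A y)"
    by (rule Bochner_Integration.integrable_bound[OF integral_obs_density(1)[OF \<mu>]]) (auto simp: indicator_def)
  have "emeasure (obs_law \<mu>) A = (\<integral>\<^sup>+y. ennreal (obs_density \<mu> y * indicator A y) \<partial>lborel)"
    unfolding obs_law_def by (subst emeasure_density) (auto intro!: nn_integral_cong simp: indicator_def)
  also have "\<dots> = ennreal (\<integral>y. obs_density \<mu> y * indicator A y \<partial>lborel)"
    by (intro nn_integral_eq_integral i) auto
  finally show "measure (obs_law \<mu>) A = (\<integral>y. obs_density \<mu> y * indicator A y \<partial>lborel)"
    by (simp add: measure_def integral_nonneg_AE)
qed

text \<open>
  The Scheffe set of \<open>g\<close> and the true density also separates every density close to \<open>g\<close>; the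
  centre \<open>g\<close> of a ball need not be a probability density.
\<close>

lemma scheffe_separation:
  assumes \<mu>0: "\<mu>0 \<in> space (prob_algebra borel)" and \<mu>: "\<mu> \<in> space (prob_algebra borel)"
    and g[measurable]: "g \<in> borel_measurable borel"
    and \<rho>: "0 \<le> \<rho>" "L1_diff \<mu> g \<le> ennreal \<rho>" and d: "d < (\<integral>y. \<bar>obs_density \<mu> y - obs_density \<mu>0 y\<bar> \<partial>lborel)"
  shows "d / 2 - \<rho> \<le> measure (obs_law \<mu>) {y. obs_density \<mu>0 y < g y} - measure (obs_law \<mu>0) {y. obs_density \<mu>0 y < g y}"
proof -
  let ?p = "obs_density \<mu>0" and ?q = "obs_density \<mu>" and ?A = "{y. obs_density \<mu>0 y < g y}"
  note [measurable] = obs_density_measurable[OF \<mu>0] obs_density_measurable[OF \<mu>]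
  have A: "?A \<in> sets borel" by measurable
  have ig: "integrable lborel (\<lambda>y. \<bar>?q y - g y\<bar>)"
    using \<rho>(2) unfolding L1_diff_def by (auto simp: integrable_iff_bounded le_less_trans[OF _ ennreal_less_top])
  have g\<rho>: "(\<integral>y. \<bar>?q y - g y\<bar> \<partial>lborel) \<le> \<rho>"
    using \<rho> unfolding L1_diff_def by (subst (asm) nn_integral_eq_integral[OF ig]) (auto simp: ennreal_le_iff)
  note ip = integral_obs_density[OF \<mu>0] and iq = integral_obs_density[OF \<mu>]
  have id: "integrable lborel (\<lambda>y. ?q y - ?p y)" using ip iq by simp
  \<comment> \<open>Half of the sum is the positive part of the difference of the densities. Passing
    from it to that difference on the set where \<open>g\<close> exceeds the truth loses at most the
    pointwise distance to \<open>g\<close>.\<close>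
  have pw: "(\<bar>?q y - ?p y\<bar> + (?q y - ?p y)) / 2 - \<bar>?q y - g y\<bar> \<le> ?q y * indicator ?A y - ?p y * indicator ?A y" for y
    by (auto simp: indicator_def abs_real_def field_simps)
  have "d / 2 - \<rho> \<le> ((\<integral>y. \<bar>?q y - ?p y\<bar> \<partial>lborel) + (\<integral>y. ?q y - ?p y \<partial>lborel)) / 2 - (\<integral>y. \<bar>?q y - g y\<bar> \<partial>lborel)"
    using d g\<rho> ip iq by simp
  also have "\<dots> = (\<integral>y. (\<bar>?q y - ?p y\<bar> + (?q y - ?p y)) / 2 - \<bar>?q y - g y\<bar> \<partial>lborel)"
    using id ig integrable_abs[OF id] ip(1) iq(1)
    by (subst Bochner_Integration.integral_diff; (subst integral_divide_zero, subst Bochner_Integration.integral_add)?)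
       (auto intro!: integrable_divide_zero Bochner_Integration.integrable_add)
  also have "\<dots> \<le> (\<integral>y. ?q y * indicator ?A y - ?p y * indicator ?A y \<partial>lborel)"
    using id ig integrable_abs[OF id] ip(1) iq(1)
    by (intro integral_mono pw Bochner_Integration.integrable_diff measure_obs_law(2) A \<mu> \<mu>0
        integrable_divide_zero Bochner_Integration.integrable_add) auto
  also have "\<dots> = measure (obs_law \<mu>) ?A - measure (obs_law \<mu>0) ?A"
    by (simp add: measure_obs_law[OF \<mu>0 A] measure_obs_law[OF \<mu> A])
  finally show ?thesis .
qed

text \<open>The exponential Markov inequality for the centred number of observations in
  \<open>A\<close>. With \<open>l\<close> positive the event means too many of them, with
  \<open>l\<close> negative too few.\<close>

lemma sample_law_indicator_mgf:
  assumes \<mu>: "\<mu> \<in> space (prob_algebra borel)" and A[measurable]: "A \<in> sets borel" and l: "\<bar>l\<bar> \<le> 1"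
  shows "emeasure (sample_law n \<mu>) {y\<in>space (PiM {..<n} (\<lambda>_. borel)). 1 \<le> (\<Prod>i<n. ennreal (exp (l * (indicator A (y i) - c))))}
    \<le> ennreal (exp (real n * (l * (measure (obs_law \<mu>) A - c) + l\<^sup>2)))"
proof -
  have m: "(\<lambda>y. \<Prod>i<n. ennreal (exp (l * (indicator A (y i) - c)))) \<in> borel_measurable (sample_law n \<mu>)"
    unfolding measurable_cong_sets[OF sets_sample_law refl]
    by (intro borel_measurable_prod_ennreal measurable_compose[OF measurable_component_singleton, where g="\<lambda>x. ennreal (exp (l * (indicator A x - c)))"]) auto
  have "emeasure (sample_law n \<mu>) {y\<in>space (PiM {..<n} (\<lambda>_. borel)). 1 \<le> 1 * (\<Prod>i<n. ennreal (exp (l * (indicator A (y i) - c))))}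
    \<le> 1 * (\<integral>\<^sup>+y. (\<Prod>i<n. ennreal (exp (l * (indicator A (y i) - c)))) * indicator (space (PiM {..<n} (\<lambda>_. borel))) y \<partial>sample_law n \<mu>)"
    using m by (intro nn_integral_Markov_inequality borel_measurable_times_ennreal borel_measurable_indicator) (simp_all add: sets_sample_law)
  also have "\<dots> = (\<integral>\<^sup>+y. (\<Prod>i<n. ennreal (exp (l * (indicator A (y i) - c)))) \<partial>sample_law n \<mu>)"
    by (simp, intro nn_integral_cong) (simp add: space_sample_law)
  also have "\<dots> = (\<integral>\<^sup>+x. ennreal (exp (l * (indicator A x - c))) \<partial>obs_law \<mu>) ^ n"
    by (rule nn_integral_sample_law_prod[OF \<mu>]) measurable
  also have "\<dots> \<le> ennreal (exp (l * (measure (obs_law \<mu>) A - c) + l\<^sup>2)) ^ n"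
    by (intro power_mono indicator_mgf prob_space_obs_law \<mu> l) auto
  also have "\<dots> = ennreal (exp (real n * (l * (measure (obs_law \<mu>) A - c) + l\<^sup>2)))"
    by (simp add: ennreal_power exp_of_nat_mult)
  finally show ?thesis by simp
qed

text \<open>The test rejects when the frequency of the Scheffe set \<open>A\<close> reaches its true
  probability plus \<open>d / 8\<close>. Since \<open>\<rho> \<le> d / 4\<close>, the alternatives
  give \<open>A\<close> at least \<open>d / 4\<close> more than the truth does, so the margin is
  \<open>d / 8\<close> on either side. The choice \<open>l = d / 16\<close> maximises
  \<open>l * d / 8 - l\<^sup>2\<close>, with value \<open>d\<^sup>2 / 256\<close>.\<close>

lemma ball_test:
  assumes \<mu>0: "\<mu>0 \<in> space (prob_algebra borel)" and g: "g \<in> borel_measurable borel"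
    and d: "0 < d" "d \<le> 16" and \<rho>: "0 \<le> \<rho>" "\<rho> \<le> d / 4"
  obtains T where "T \<in> sets (PiM {..<n} (\<lambda>_. borel))"
    "emeasure (sample_law n \<mu>0) T \<le> ennreal (exp (- (real n * d\<^sup>2 / 256)))"
    "\<And>\<mu>. \<mu> \<in> space (prob_algebra borel) \<Longrightarrow> L1_diff \<mu> g \<le> ennreal \<rho> \<Longrightarrow>
       d < (\<integral>y. \<bar>obs_density \<mu> y - obs_density \<mu>0 y\<bar> \<partial>lborel) \<Longrightarrow>
       emeasure (sample_law n \<mu>) (space (PiM {..<n} (\<lambda>_. borel)) - T) \<le> ennreal (exp (- (real n * d\<^sup>2 / 256)))"
proof -
  note [measurable] = obs_density_measurable[OF \<mu>0] g
  define A where "A = {y. obs_density \<mu>0 y < g y}"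
  have A[measurable]: "A \<in> sets borel" unfolding A_def by measurable
  define c where "c = measure (obs_law \<mu>0) A + d / 8"
  define l where "l = d / 16"
  have l: "\<bar>l\<bar> \<le> 1" "\<bar>- l\<bar> \<le> 1" "0 < l" using d by (auto simp: l_def)
  define w where "w m y = (\<Prod>i<n. ennreal (exp (m * (indicator A (y i) - c))))" for m y
  have wm[measurable]: "w m \<in> borel_measurable (PiM {..<n} (\<lambda>_. borel))" for m
    unfolding w_def[abs_def]
    by (intro borel_measurable_prod_ennreal measurable_compose[OF measurable_component_singleton, where g="\<lambda>x. ennreal (exp (m * (indicator A x - c)))"]) auto
  \<comment> \<open>The weights for \<open>l\<close> and \<open>- l\<close> are reciprocal, so
    acceptance implies that the weight for \<open>- l\<close> is at least 1 and the same exponential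
    bound covers both errors.\<close>
  have winv: "w l y * w (- l) y = 1" for y
    unfolding w_def by (simp flip: prod.distrib ennreal_mult' exp_add)
  define T where "T = {y\<in>space (PiM {..<n} (\<lambda>_. borel :: real measure)). 1 \<le> w l y}"
  show thesis
  proof
    show "T \<in> sets (PiM {..<n} (\<lambda>_. borel))" unfolding T_def by measurable
    have "emeasure (sample_law n \<mu>0) T \<le> ennreal (exp (real n * (l * (measure (obs_law \<mu>0) A - c) + l\<^sup>2)))"
      unfolding T_def w_def by (rule sample_law_indicator_mgf[OF \<mu>0 A l(1)])
    also have "real n * (l * (measure (obs_law \<mu>0) A - c) + l\<^sup>2) = - (real n * d\<^sup>2 / 256)"
      by (simp add: c_def l_def power2_eq_square field_simps)
    finally show "emeasure (sample_law n \<mu>0) T \<le> ennreal (exp (- (real n * d\<^sup>2 / 256)))" .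
  next
    fix \<mu> assume \<mu>: "\<mu> \<in> space (prob_algebra borel)" "L1_diff \<mu> g \<le> ennreal \<rho>"
      "d < (\<integral>y. \<bar>obs_density \<mu> y - obs_density \<mu>0 y\<bar> \<partial>lborel)"
    have sep: "d / 4 \<le> measure (obs_law \<mu>) A - measure (obs_law \<mu>0) A"
      using scheffe_separation[OF \<mu>0 \<mu>(1) g \<rho>(1) \<mu>(2,3)] \<rho>(2) by (simp add: A_def)
    have "space (PiM {..<n} (\<lambda>_. borel)) - T \<subseteq> {y\<in>space (PiM {..<n} (\<lambda>_. borel)). 1 \<le> w (- l) y}"
    proof
      fix y assume "y \<in> space (PiM {..<n} (\<lambda>_. borel)) - T"
      then have y: "y \<in> space (PiM {..<n} (\<lambda>_. borel))" "w l y \<le> 1" by (auto simp: T_def)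
      have "w l y * w (- l) y \<le> 1 * w (- l) y" by (intro mult_right_mono y) auto
      then show "y \<in> {y\<in>space (PiM {..<n} (\<lambda>_. borel)). 1 \<le> w (- l) y}" using y by (simp add: winv)
    qed
    then have "emeasure (sample_law n \<mu>) (space (PiM {..<n} (\<lambda>_. borel)) - T)
      \<le> emeasure (sample_law n \<mu>) {y\<in>space (PiM {..<n} (\<lambda>_. borel)). 1 \<le> w (- l) y}"
      by (intro emeasure_mono) (simp_all add: sets_sample_law)
    also have "\<dots> \<le> ennreal (exp (real n * (- l * (measure (obs_law \<mu>) A - c) + (- l)\<^sup>2)))"
      unfolding w_def by (rule sample_law_indicator_mgf[OF \<mu>(1) A l(2)])
    also have "\<dots> \<le> ennreal (exp (- (real n * d\<^sup>2 / 256)))"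
    proof (intro ennreal_leI, subst exp_le_cancel_iff)
      have "l * (d / 8) \<le> l * (measure (obs_law \<mu>) A - c)" using sep l by (intro mult_left_mono) (auto simp: c_def)
      then have "- l * (measure (obs_law \<mu>) A - c) + (- l)\<^sup>2 \<le> - (d\<^sup>2 / 256)"
        by (simp add: l_def power2_eq_square field_simps)
      then have "real n * (- l * (measure (obs_law \<mu>) A - c) + (- l)\<^sup>2) \<le> real n * (- (d\<^sup>2 / 256))"
        by (intro mult_left_mono) auto
      then show "real n * (- l * (measure (obs_law \<mu>) A - c) + (- l)\<^sup>2) \<le> - (real n * d\<^sup>2 / 256)" by simp
    qed
    finally show "emeasure (sample_law n \<mu>) (space (PiM {..<n} (\<lambda>_. borel)) - T) \<le> ennreal (exp (- (real n * d\<^sup>2 / 256)))" .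
  qed
qed

section \<open>From evidence, tests and sieve to the posterior mass of the far set\<close>

lemma emeasure_posterior_le:
  assumes \<mu>0: "\<mu>0 \<in> space (prob_algebra borel)"
    and P: "prob_space P" "sets P = sets (prob_algebra borel)" and U: "U \<in> sets P"
    and y: "y \<in> space (PiM {..<n} (\<lambda>_. borel))"
    and z: "0 < z" "ennreal z \<le> (\<integral>\<^sup>+\<mu>. ennreal (likelihood_ratio n \<mu>0 \<mu> y) \<partial>P)"
  shows "emeasure (posterior P n y) U \<le> ennreal (1 / z) * (\<integral>\<^sup>+\<mu>. ennreal (likelihood_ratio n \<mu>0 \<mu> y) * indicator U \<mu> \<partial>P)"
proof -
  interpret P: prob_space P by (rule P)
  have spP: "space P = space (prob_algebra borel)" using P(2) by (rule sets_eq_imp_space_eq)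
  define L where "L = (\<Prod>i<n. obs_density \<mu>0 (y i))"
  have L: "0 < L" unfolding L_def by (intro prod_pos obs_density_pos \<mu>0)
  have lr[measurable]: "(\<lambda>\<mu>. likelihood_ratio n \<mu>0 \<mu> y) \<in> borel_measurable P"
    using measurable_compose[OF measurable_Pair2'[OF y] likelihood_ratio_measurable_pair[OF \<mu>0]] P(2)
    by (simp cong: measurable_cong_sets)
  have lik: "likelihood n y \<mu> = L * likelihood_ratio n \<mu>0 \<mu> y" for \<mu>
    using obs_density_pos[OF \<mu>0, THEN less_imp_neq, THEN not_sym]
    by (simp add: likelihood_def likelihood_ratio_def L_def flip: prod.distrib)
  \<comment> \<open>Boundedness makes the likelihood integrable, so the normalising Bochner integral
    is the true evidence and not the default value 0.\<close>
  have "likelihood n y \<mu> \<le> 1" if "\<mu> \<in> space P" for \<mu>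
  proof -
    have "obs_density \<mu> v \<le> 1" for v using that obs_density_le[of \<mu> v] by (simp add: spP)
    then show ?thesis unfolding likelihood_def by (intro prod_le_1) auto
  qed
  then have bd: "likelihood_ratio n \<mu>0 \<mu> y \<le> 1 / L" if "\<mu> \<in> space P" for \<mu>
    using that L by (simp add: lik field_simps)
  have lr0: "0 \<le> likelihood_ratio n \<mu>0 \<mu> y" for \<mu>
    unfolding likelihood_ratio_def by (intro prod_nonneg) simp
  have i: "integrable P (\<lambda>\<mu>. likelihood_ratio n \<mu>0 \<mu> y)"
    using bd lr0 by (intro P.integrable_const_bound[where B="1 / L"]) auto
  define Z where "Z = (\<integral>\<mu>. likelihood_ratio n \<mu>0 \<mu> y \<partial>P)"
  have Z: "z \<le> Z"
    using z lr0 by (subst (asm) nn_integral_eq_integral[OF i]) (auto simp: Z_def ennreal_le_iff integral_nonneg_AE)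
  have eq: "likelihood n y \<mu> / (\<integral>\<nu>. likelihood n y \<nu> \<partial>P) = likelihood_ratio n \<mu>0 \<mu> y / Z" for \<mu>
    using L by (simp add: lik Z_def)
  have "emeasure (posterior P n y) U = (\<integral>\<^sup>+\<mu>. ennreal (likelihood_ratio n \<mu>0 \<mu> y / Z) * indicator U \<mu> \<partial>P)"
    unfolding posterior_def eq using U by (intro emeasure_density) auto
  also have "\<dots> \<le> (\<integral>\<^sup>+\<mu>. ennreal (1 / z) * (ennreal (likelihood_ratio n \<mu>0 \<mu> y) * indicator U \<mu>) \<partial>P)"
  proof (intro nn_integral_mono)
    fix \<mu>
    have "likelihood_ratio n \<mu>0 \<mu> y / Z \<le> 1 / z * likelihood_ratio n \<mu>0 \<mu> y"
      using z Z lr0[of \<mu>] by (simp add: field_simps mult_right_mono)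
    then have "ennreal (likelihood_ratio n \<mu>0 \<mu> y / Z) \<le> ennreal (1 / z) * ennreal (likelihood_ratio n \<mu>0 \<mu> y)"
      using z lr0[of \<mu>] by (simp add: ennreal_leI flip: ennreal_mult')
    then show "ennreal (likelihood_ratio n \<mu>0 \<mu> y / Z) * indicator U \<mu> \<le> ennreal (1 / z) * (ennreal (likelihood_ratio n \<mu>0 \<mu> y) * indicator U \<mu>)"
      by (simp add: indicator_def)
  qed
  also have "\<dots> = ennreal (1 / z) * (\<integral>\<^sup>+\<mu>. ennreal (likelihood_ratio n \<mu>0 \<mu> y) * indicator U \<mu> \<partial>P)"
    using U by (intro nn_integral_cmult) auto
  finally show ?thesis .
qed

text \<open>As a neighbourhood of a finite net, the sieve has bounded entropy by construction and is
  measurable as a finite union; what remains to be shown is that the prior puts little mass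
  outside.\<close>

definition L1_net_sieve :: "(real \<Rightarrow> real) set \<Rightarrow> real \<Rightarrow> real measure set" where
  "L1_net_sieve C \<rho> = {\<mu> \<in> space (prob_algebra borel). \<exists>g\<in>C. L1_diff \<mu> g \<le> ennreal \<rho>}"

lemma L1_net_sieve_measurable:
  assumes "finite C" "C \<subseteq> borel_measurable borel"
  shows "L1_net_sieve C \<rho> \<in> sets (prob_algebra borel)"
proof -
  have "{\<mu> \<in> space (prob_algebra borel). L1_diff \<mu> g \<le> ennreal \<rho>} \<in> sets (prob_algebra borel)" if "g \<in> C" for g
  proof -
    have "g \<in> borel_measurable borel" using that assms(2) by auto
    note [measurable] = L1_diff_measurable[OF this]
    show ?thesis by measurable
  qed
  then have "(\<Union>g\<in>C. {\<mu> \<in> space (prob_algebra borel). L1_diff \<mu> g \<le> ennreal \<rho>}) \<in> sets (prob_algebra borel)"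
    using assms(1) by (intro sets.finite_UN) auto
  also have "(\<Union>g\<in>C. {\<mu> \<in> space (prob_algebra borel). L1_diff \<mu> g \<le> ennreal \<rho>}) = L1_net_sieve C \<rho>"
    by (auto simp: L1_net_sieve_def)
  finally show ?thesis .
qed

lemma obs_L1_measurable:
  assumes \<mu>0: "\<mu>0 \<in> space (prob_algebra borel)"
  shows "(\<lambda>\<mu>. \<integral>x. \<bar>obs_density \<mu> x - obs_density \<mu>0 x\<bar> \<partial>lborel) \<in> borel_measurable (prob_algebra borel)"
proof -
  note [measurable] = obs_density_measurable[OF \<mu>0]
  show ?thesis by measurable
qed

text \<open>Three rare events are excluded: some ball test rejects the truth, the evidence is small,
  or the posterior numerator is large although all tests accept. The condition on \<open>D\<close>
  makes each test error at most \<open>exp (- (c1 + 5) * E)\<close>, which beats the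
  \<open>exp (c1 * E)\<close> centres; the numerator is bounded in mean and handled by Markov's
  inequality.\<close>

lemma posterior_mass_bound:
  fixes P :: "real measure measure" and n :: nat
  assumes \<mu>0: "\<mu>0 \<in> space (prob_algebra borel)"
    and P: "prob_space P" "sets P = sets (prob_algebra borel)"
    and \<epsilon>: "0 < \<epsilon>" "\<epsilon> \<le> 1" and D: "1 \<le> D" "D * \<epsilon> \<le> 16" "256 * (c1 + 5) \<le> D\<^sup>2" and c1: "0 \<le> c1"
    and E: "E = real n * \<epsilon>\<^sup>2"
    and G: "G \<in> sets P" "exp (- E) \<le> measure P G" "\<And>\<mu>. \<mu> \<in> G \<Longrightarrow> chi_square \<mu>0 \<mu> \<le> ennreal (\<epsilon>\<^sup>2)"
    and C: "finite C" "C \<subseteq> borel_measurable borel" "real (card C) \<le> exp (c1 * E)"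
    and sieve: "measure P (space P - L1_net_sieve C (\<epsilon>\<^sup>2 / 4)) \<le> exp (- 5 * E)"
    and \<eta>: "0 < \<eta>"
  shows "measure (sample_law n \<mu>0) {y \<in> space (sample_law n \<mu>0).
      \<eta> < measure (posterior P n y) {\<mu> \<in> space P. D * \<epsilon> < (\<integral>x. \<bar>obs_density \<mu> x - obs_density \<mu>0 x\<bar> \<partial>lborel)}}
    \<le> 2 * exp (- E) + 2 / \<eta> * exp (- 2 * E)"
proof -
  interpret P: prob_space P by (rule P)
  interpret S: prob_space "sample_law n \<mu>0" by (rule prob_space_sample_law[OF \<mu>0])
  interpret pair_sigma_finite "sample_law n \<mu>0" P by unfold_locales
  note [measurable_cong] = P(2) sets_sample_law[of n \<mu>0]
  note ss = sets_sample_law[of n] space_sample_law[of n]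
  have spP: "space P = space (prob_algebra borel)" using P(2) by (rule sets_eq_imp_space_eq)
  have E0: "0 \<le> E" by (simp add: E)
  let ?B = "PiM {..<n} (\<lambda>_. borel :: real measure)"
  define d where "d = D * \<epsilon>"
  have d: "0 < d" "d \<le> 16" using D \<epsilon> by (auto simp: d_def)
  define \<rho> where "\<rho> = \<epsilon>\<^sup>2 / 4"
  have \<rho>: "0 \<le> \<rho>" "\<rho> \<le> d / 4"
  proof -
    have "\<epsilon> * \<epsilon> \<le> D * \<epsilon>" using D \<epsilon> by (intro mult_right_mono) auto
    then show "\<rho> \<le> d / 4" by (simp add: \<rho>_def d_def power2_eq_square)
  qed (simp add: \<rho>_def)
  have dE: "(c1 + 5) * E \<le> real n * d\<^sup>2 / 256"
  proof -
    have "(256 * (c1 + 5)) * E \<le> D\<^sup>2 * E" using D E0 by (intro mult_right_mono) auto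
    then show ?thesis by (simp add: d_def E power_mult_distrib algebra_simps)
  qed
  define U where "U = {\<mu> \<in> space P. d < (\<integral>x. \<bar>obs_density \<mu> x - obs_density \<mu>0 x\<bar> \<partial>lborel)}"
  have U[measurable]: "U \<in> sets P"
    using obs_L1_measurable[OF \<mu>0] P(2) unfolding U_def by measurable
  define N where "N = L1_net_sieve C \<rho>"
  have N[measurable]: "N \<in> sets P" unfolding N_def using L1_net_sieve_measurable[OF C(1,2)] P(2) by simp
  define good where "good g T \<longleftrightarrow> T \<in> sets ?B \<and> emeasure (sample_law n \<mu>0) T \<le> ennreal (exp (- (real n * d\<^sup>2 / 256))) \<and>
    (\<forall>\<mu>\<in>space (prob_algebra borel). L1_diff \<mu> g \<le> ennreal \<rho> \<longrightarrow> d < (\<integral>y. \<bar>obs_density \<mu> y - obs_density \<mu>0 y\<bar> \<partial>lborel) \<longrightarrow>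
       emeasure (sample_law n \<mu>) (space ?B - T) \<le> ennreal (exp (- (real n * d\<^sup>2 / 256))))" for g T
  have "\<forall>g\<in>C. \<exists>T. good g T"
  proof
    fix g assume "g \<in> C"
    then have "g \<in> borel_measurable borel" using C by auto
    then show "\<exists>T. good g T"
      by (rule ball_test[OF \<mu>0 _ d \<rho>, of g n]) (auto simp: good_def)
  qed
  from bchoice[OF this] obtain T where T0: "\<forall>g\<in>C. good g (T g)" ..
  have T: "\<And>g. g \<in> C \<Longrightarrow> T g \<in> sets ?B"
      "\<And>g. g \<in> C \<Longrightarrow> emeasure (sample_law n \<mu>0) (T g) \<le> ennreal (exp (- (real n * d\<^sup>2 / 256)))"
      "\<And>g \<mu>. g \<in> C \<Longrightarrow> \<mu> \<in> space (prob_algebra borel) \<Longrightarrow> L1_diff \<mu> g \<le> ennreal \<rho> \<Longrightarrow>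
         d < (\<integral>y. \<bar>obs_density \<mu> y - obs_density \<mu>0 y\<bar> \<partial>lborel) \<Longrightarrow>
         emeasure (sample_law n \<mu>) (space ?B - T g) \<le> ennreal (exp (- (real n * d\<^sup>2 / 256)))"
    using T0 unfolding good_def by blast+
  define TT where "TT = (\<Union>g\<in>C. T g)"
  have TT[measurable]: "TT \<in> sets ?B" unfolding TT_def using T(1) C(1) by (intro sets.finite_UN) auto
  have cTT[measurable]: "space ?B - TT \<in> sets ?B" using TT by (rule sets.compl_sets)
  have iTT[measurable]: "(indicator (space ?B - TT) :: _ \<Rightarrow> ennreal) \<in> borel_measurable (sample_law n \<mu>0)"
    using cTT by (intro borel_measurable_indicator) (simp add: ss)
  have T1: "emeasure (sample_law n \<mu>0) TT \<le> ennreal (exp (- E))"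
  proof -
    have "emeasure (sample_law n \<mu>0) TT \<le> (\<Sum>g\<in>C. emeasure (sample_law n \<mu>0) (T g))"
      unfolding TT_def using T(1) C(1) by (intro emeasure_subadditive_finite) (auto simp: ss)
    also have "\<dots> \<le> (\<Sum>g\<in>C. ennreal (exp (- (real n * d\<^sup>2 / 256))))" by (intro sum_mono T(2))
    also have "\<dots> = ennreal (real (card C) * exp (- (real n * d\<^sup>2 / 256)))"
      by (simp add: ennreal_mult' ennreal_of_nat_eq_real_of_nat)
    also have "\<dots> \<le> ennreal (exp (c1 * E) * exp (- ((c1 + 5) * E)))"
      using C(3) dE by (intro ennreal_leI mult_mono) auto
    also have "\<dots> \<le> ennreal (exp (- E))"
      using E0 by (intro ennreal_leI) (simp add: algebra_simps flip: exp_add)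
    finally show ?thesis .
  qed
  define R where "R \<mu> y = ennreal (likelihood_ratio n \<mu>0 \<mu> y)" for \<mu> y
  have R[measurable]: "(\<lambda>x. R (fst x) (snd x)) \<in> borel_measurable (P \<Otimes>\<^sub>M sample_law n \<mu>0)"
    using likelihood_ratio_measurable_pair[OF \<mu>0] P(2) unfolding R_def
    by (simp add: split_beta' cong: measurable_cong_sets sets_pair_measure_cong)
  have R'[measurable]: "(\<lambda>x. R (snd x) (fst x)) \<in> borel_measurable (sample_law n \<mu>0 \<Otimes>\<^sub>M P)"
    using measurable_compose[OF measurable_pair_swap' R] by (simp add: split_beta')
  have Ry: "(\<lambda>\<mu>. R \<mu> y) \<in> borel_measurable P" if "y \<in> space (sample_law n \<mu>0)" for y
    using measurable_compose[OF measurable_Pair2'[OF that] R] by simp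
  have Rm: "(\<lambda>y. R \<mu> y) \<in> borel_measurable (sample_law n \<mu>0)" if "\<mu> \<in> space P" for \<mu>
    using measurable_compose[OF measurable_Pair1'[OF that] R] by simp
  define a where "a = measure P G"
  have a: "0 < a" using G(2) by (simp add: a_def less_le_trans[OF exp_gt_zero])
  \<comment> \<open>The threshold for the evidence: \<open>a\<close> is the mass of
    \<open>G\<close>, itself at least \<open>exp (- E)\<close>, and \<open>exp (- 2 * E)\<close> is
    the loss in \<open>evidence_lower_bound\<close> with
    \<open>r = \<epsilon>\<^sup>2\<close>.\<close>
  define z where "z = exp (- 2 * E) * a"
  have z: "0 < z" using a by (simp add: z_def)
  have z3: "exp (- 3 * E) \<le> z"
  proof -
    have "exp (- 3 * E) = exp (- 2 * E) * exp (- E)" by (simp flip: exp_add)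
    also have "\<dots> \<le> z" unfolding z_def a_def by (intro mult_left_mono G(2)) auto
    finally show ?thesis .
  qed
  define V where "V = {y\<in>space (sample_law n \<mu>0). (\<integral>\<^sup>+\<mu>. R \<mu> y * indicator G \<mu> \<partial>P) \<le> ennreal z}"
  have V[measurable]: "V \<in> sets (sample_law n \<mu>0)" unfolding V_def using G(1) by measurable
  have V1: "emeasure (sample_law n \<mu>0) V \<le> ennreal (exp (- E))"
    using evidence_lower_bound[OF \<mu>0 P G(1) _ _ G(3), of n] a
    by (simp add: V_def R_def a_def z_def E mult.assoc)
  \<comment> \<open>Everything outside the sieve is counted as bad, far from the truth or not; the
    tests are then needed only for members of the sieve.\<close>
  define W where "W = (U \<inter> N) \<union> (space P - N)"
  have W[measurable]: "W \<in> sets P" unfolding W_def by measurable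
  define X where "X y = (\<integral>\<^sup>+\<mu>. R \<mu> y * indicator W \<mu> \<partial>P) * indicator (space ?B - TT) y" for y
  have X[measurable]: "X \<in> borel_measurable (sample_law n \<mu>0)"
    unfolding X_def[abs_def] by measurable
  have EX: "(\<integral>\<^sup>+y. X y \<partial>sample_law n \<mu>0) \<le> ennreal (2 * exp (- 5 * E))"
  proof -
    have "(\<integral>\<^sup>+y. X y \<partial>sample_law n \<mu>0)
      = (\<integral>\<^sup>+y. \<integral>\<^sup>+\<mu>. R \<mu> y * indicator W \<mu> * indicator (space ?B - TT) y \<partial>P \<partial>sample_law n \<mu>0)"
      unfolding X_def by (intro nn_integral_cong nn_integral_multc[symmetric] borel_measurable_times_ennreal Ry borel_measurable_indicator W) simp_all
    also have "\<dots> = (\<integral>\<^sup>+\<mu>. \<integral>\<^sup>+y. R \<mu> y * indicator W \<mu> * indicator (space ?B - TT) y \<partial>sample_law n \<mu>0 \<partial>P)"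
      by (intro Fubini'[symmetric]) measurable
    also have "\<dots> \<le> (\<integral>\<^sup>+\<mu>. ennreal (exp (- 5 * E)) + indicator (space P - N) \<mu> \<partial>P)"
    proof (intro nn_integral_mono)
      fix \<mu> assume \<mu>: "\<mu> \<in> space P"
      then have \<mu>': "\<mu> \<in> space (prob_algebra borel)" by (simp add: spP)
      interpret Q: prob_space "sample_law n \<mu>" by (rule prob_space_sample_law[OF \<mu>'])
      have eq: "(\<integral>\<^sup>+y. R \<mu> y * indicator W \<mu> * indicator (space ?B - TT) y \<partial>sample_law n \<mu>0)
        = indicator W \<mu> * emeasure (sample_law n \<mu>) (space ?B - TT)"
      proof -
        have "(\<integral>\<^sup>+y. R \<mu> y * indicator W \<mu> * indicator (space ?B - TT) y \<partial>sample_law n \<mu>0)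
          = (\<integral>\<^sup>+y. indicator W \<mu> * (R \<mu> y * indicator (space ?B - TT) y) \<partial>sample_law n \<mu>0)"
          by (simp add: mult_ac)
        also have "\<dots> = indicator W \<mu> * (\<integral>\<^sup>+y. R \<mu> y * indicator (space ?B - TT) y \<partial>sample_law n \<mu>0)"
          by (intro nn_integral_cmult borel_measurable_times_ennreal Rm \<mu> iTT)
        also have "(\<integral>\<^sup>+y. R \<mu> y * indicator (space ?B - TT) y \<partial>sample_law n \<mu>0)
          = (\<integral>\<^sup>+y. indicator (space ?B - TT) y \<partial>sample_law n \<mu>)"
          unfolding R_def using cTT by (intro nn_integral_likelihood_ratio \<mu>0 \<mu>' borel_measurable_indicator)
        also have "\<dots> = emeasure (sample_law n \<mu>) (space ?B - TT)"
          using cTT by (intro nn_integral_indicator) (simp add: ss)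
        finally show ?thesis .
      qed
      show "(\<integral>\<^sup>+y. R \<mu> y * indicator W \<mu> * indicator (space ?B - TT) y \<partial>sample_law n \<mu>0)
        \<le> ennreal (exp (- 5 * E)) + indicator (space P - N) \<mu>"
      proof (cases "\<mu> \<in> N")
        case True
        show ?thesis
        proof (cases "\<mu> \<in> U")
          case U: True
          from True obtain g where g: "g \<in> C" "L1_diff \<mu> g \<le> ennreal \<rho>" by (auto simp: N_def L1_net_sieve_def)
          have "emeasure (sample_law n \<mu>) (space ?B - TT) \<le> emeasure (sample_law n \<mu>) (space ?B - T g)"
            using T(1)[OF g(1)] g by (intro emeasure_mono) (auto simp: TT_def ss)
          also have "\<dots> \<le> ennreal (exp (- (real n * d\<^sup>2 / 256)))"
            using U by (intro T(3) g \<mu>') (auto simp: U_def)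
          also have "\<dots> \<le> ennreal (exp (- 5 * E))"
          proof -
            have "0 \<le> c1 * E" using c1 E0 by simp
            then have "5 * E \<le> (c1 + 5) * E" by (simp add: distrib_right)
            then show ?thesis using dE by (intro ennreal_leI) simp
          qed
          finally show ?thesis unfolding eq using True by (auto simp: indicator_def)
        next
          case False
          then show ?thesis unfolding eq using True by (simp add: W_def)
        qed
      next
        case False
        then show ?thesis unfolding eq using \<mu> Q.measure_le_1[of "space ?B - TT"]
          by (auto simp: indicator_def Q.emeasure_le_1 intro: add_increasing)
      qed
    qed
    also have "\<dots> = ennreal (exp (- 5 * E)) + ennreal (measure P (space P - N))"
      by (subst nn_integral_add) (auto simp: P.emeasure_space_1 P.emeasure_eq_measure[symmetric])
    also have "\<dots> \<le> ennreal (exp (- 5 * E)) + ennreal (exp (- 5 * E))"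
      using sieve by (intro add_left_mono ennreal_leI) (simp add: N_def \<rho>_def)
    also have "\<dots> = ennreal (2 * exp (- 5 * E))" by (simp flip: ennreal_plus)
    finally show ?thesis .
  qed
  define Y where "Y = {y\<in>space (sample_law n \<mu>0). 1 \<le> ennreal (1 / (\<eta> * z)) * X y}"
  have Y[measurable]: "Y \<in> sets (sample_law n \<mu>0)" unfolding Y_def by measurable
  have "emeasure (sample_law n \<mu>0) Y \<le> ennreal (1 / (\<eta> * z)) * (\<integral>\<^sup>+y. X y * indicator (space (sample_law n \<mu>0)) y \<partial>sample_law n \<mu>0)"
    unfolding Y_def by (rule nn_integral_Markov_inequality) auto
  also have "(\<integral>\<^sup>+y. X y * indicator (space (sample_law n \<mu>0)) y \<partial>sample_law n \<mu>0) = (\<integral>\<^sup>+y. X y \<partial>sample_law n \<mu>0)"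
    by (intro nn_integral_cong) auto
  also have "ennreal (1 / (\<eta> * z)) * \<dots> \<le> ennreal (1 / (\<eta> * exp (- 3 * E))) * ennreal (2 * exp (- 5 * E))"
    using z3 z \<eta> by (intro mult_mono EX ennreal_leI divide_left_mono mult_left_mono) auto
  also have "\<dots> = ennreal (1 / (\<eta> * exp (- 3 * E)) * (2 * exp (- 5 * E)))"
    using \<eta> by (intro ennreal_mult'[symmetric]) auto
  also have "1 / (\<eta> * exp (- 3 * E)) * (2 * exp (- 5 * E)) = 2 / \<eta> * exp (- 2 * E)"
  proof -
    have "exp (- 5 * E) = exp (- 3 * E) * exp (- 2 * E)" by (simp flip: exp_add)
    then show ?thesis using \<eta> by (simp add: field_simps)
  qed
  finally have Y1: "emeasure (sample_law n \<mu>0) Y \<le> ennreal (2 / \<eta> * exp (- 2 * E))" .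
  have sub: "{y \<in> space (sample_law n \<mu>0). \<eta> < measure (posterior P n y) U} \<subseteq> TT \<union> V \<union> Y"
  proof
    fix y assume "y \<in> {y \<in> space (sample_law n \<mu>0). \<eta> < measure (posterior P n y) U}"
    then have y: "y \<in> space (sample_law n \<mu>0)" "\<eta> < measure (posterior P n y) U" by auto
    show "y \<in> TT \<union> V \<union> Y"
    proof (rule ccontr)
      assume "y \<notin> TT \<union> V \<union> Y"
      then have ny: "y \<notin> TT" "y \<notin> V" "y \<notin> Y" by auto
      note [measurable] = Ry[OF y(1)]
      have "ennreal z \<le> (\<integral>\<^sup>+\<mu>. R \<mu> y * indicator G \<mu> \<partial>P)" using ny y by (auto simp: V_def not_le)
      also have "\<dots> \<le> (\<integral>\<^sup>+\<mu>. R \<mu> y \<partial>P)" by (intro nn_integral_mono) (auto simp: indicator_def)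
      finally have zz: "ennreal z \<le> (\<integral>\<^sup>+\<mu>. ennreal (likelihood_ratio n \<mu>0 \<mu> y) \<partial>P)" by (simp add: R_def)
      have "ennreal \<eta> < ennreal (measure (posterior P n y) U)" using y \<eta> by (simp add: ennreal_less_iff)
      \<comment> \<open>Where \<open>emeasure\<close> is infinite \<open>measure\<close> is 0, so
        the inequality holds in that case as well.\<close>
      also have "\<dots> \<le> emeasure (posterior P n y) U"
        by (cases "emeasure (posterior P n y) U = \<top>") (auto simp: measure_def less_top)
      also have "\<dots> \<le> ennreal (1 / z) * (\<integral>\<^sup>+\<mu>. ennreal (likelihood_ratio n \<mu>0 \<mu> y) * indicator U \<mu> \<partial>P)"
        using y(1) by (intro emeasure_posterior_le \<mu>0 P U z zz) (simp add: ss)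
      also have "\<dots> \<le> ennreal (1 / z) * X y"
      proof (intro mult_left_mono)
        have "(\<integral>\<^sup>+\<mu>. ennreal (likelihood_ratio n \<mu>0 \<mu> y) * indicator U \<mu> \<partial>P) \<le> (\<integral>\<^sup>+\<mu>. R \<mu> y * indicator W \<mu> \<partial>P)"
          unfolding R_def by (intro nn_integral_mono mult_left_mono) (auto simp: W_def indicator_def)
        then show "(\<integral>\<^sup>+\<mu>. ennreal (likelihood_ratio n \<mu>0 \<mu> y) * indicator U \<mu> \<partial>P) \<le> X y"
          using ny y by (simp add: X_def ss)
      qed simp
      finally have "ennreal \<eta> \<le> ennreal (1 / z) * X y" by simp
      then have "ennreal (1 / \<eta>) * ennreal \<eta> \<le> ennreal (1 / \<eta>) * (ennreal (1 / z) * X y)"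
        by (intro mult_left_mono) auto
      also have "ennreal (1 / \<eta>) * ennreal \<eta> = 1" using \<eta> by (subst ennreal_mult'[symmetric]) auto
      also have "ennreal (1 / \<eta>) * (ennreal (1 / z) * X y) = ennreal (1 / (\<eta> * z)) * X y"
      proof -
        have "ennreal (1 / \<eta>) * ennreal (1 / z) = ennreal (1 / (\<eta> * z))"
          using \<eta> z by (subst ennreal_mult'[symmetric]) auto
        then show ?thesis by (simp only: mult.assoc[symmetric])
      qed
      finally show False using ny y by (simp add: Y_def)
    qed
  qed
  have TT': "TT \<in> sets (sample_law n \<mu>0)" using TT by (simp add: ss)
  have "emeasure (sample_law n \<mu>0) (TT \<union> V \<union> Y) \<le> emeasure (sample_law n \<mu>0) TT + emeasure (sample_law n \<mu>0) V + emeasure (sample_law n \<mu>0) Y"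
    using TT' V Y by (intro order_trans[OF emeasure_subadditive] add_right_mono emeasure_subadditive) auto
  also have "\<dots> \<le> ennreal (exp (- E)) + ennreal (exp (- E)) + ennreal (2 / \<eta> * exp (- 2 * E))"
    by (intro add_mono T1 V1 Y1)
  also have "\<dots> = ennreal (2 * exp (- E) + 2 / \<eta> * exp (- 2 * E))"
    using \<eta> by (simp flip: ennreal_plus)
  finally have "ennreal (S.prob (TT \<union> V \<union> Y)) \<le> ennreal (2 * exp (- E) + 2 / \<eta> * exp (- 2 * E))"
    by (simp only: S.emeasure_eq_measure)
  moreover have "0 \<le> 2 * exp (- E) + 2 / \<eta> * exp (- 2 * E)" using \<eta> by (intro add_nonneg_nonneg) auto
  ultimately have fin: "S.prob (TT \<union> V \<union> Y) \<le> 2 * exp (- E) + 2 / \<eta> * exp (- 2 * E)"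
    using ennreal_le_iff by blast
  have "S.prob {y \<in> space (sample_law n \<mu>0). \<eta> < measure (posterior P n y) U} \<le> S.prob (TT \<union> V \<union> Y)"
    using TT' V Y by (intro S.finite_measure_mono sub) auto
  with fin show ?thesis by (simp add: U_def d_def)
qed

section \<open>Approximating the true density\<close>

lemma exp_abs_scaled:
  fixes c :: real
  assumes "0 < c"
  shows "integrable lborel (\<lambda>x. exp (- c * \<bar>x\<bar>))" "(\<integral>x. exp (- c * \<bar>x\<bar>) \<partial>lborel) = 2 / c"
proof -
  have "(\<integral>\<^sup>+x. ennreal (exp (- c * \<bar>x\<bar>)) \<partial>lborel) = ennreal (1 / c) * (\<integral>\<^sup>+x. ennreal (exp (- \<bar>x\<bar>)) \<partial>lborel)"
    using assms by (subst nn_integral_real_affine[where c="1 / c" and t=0]) (auto simp: abs_mult)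
  also have "(\<integral>\<^sup>+x. ennreal (exp (- \<bar>x\<bar>)) \<partial>lborel) = (\<integral>\<^sup>+x. ennreal 2 * ennreal (laplace_density x) \<partial>lborel)"
    by (intro nn_integral_cong) (simp add: laplace_density_def flip: ennreal_mult' ennreal_numeral)
  also have "\<dots> = ennreal 2" by (subst nn_integral_cmult) (auto simp: nn_integral_laplace_density)
  also have "ennreal (1 / c) * ennreal 2 = ennreal (2 / c)" using assms by (simp flip: ennreal_mult' ennreal_numeral)
  finally have eq: "(\<integral>\<^sup>+x. ennreal (exp (- c * \<bar>x\<bar>)) \<partial>lborel) = ennreal (2 / c)" .
  show "integrable lborel (\<lambda>x. exp (- c * \<bar>x\<bar>))"
    using eq by (intro integrableI_bounded) auto
  show "(\<integral>x. exp (- c * \<bar>x\<bar>) \<partial>lborel) = 2 / c"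
    using eq assms by (subst integral_eq_nn_integral) auto
qed

lemma std_normal_symmetric:
  fixes f :: "real \<Rightarrow> real"
  assumes "f \<in> borel_measurable borel" "\<And>x. 0 \<le> f x"
  shows "(\<integral>z. f (- z) \<partial>std_normal) = (\<integral>z. f z \<partial>std_normal)"
proof -
  have "(\<integral>\<^sup>+z. ennreal (f (- z)) \<partial>std_normal) = (\<integral>\<^sup>+z. ennreal (f z) \<partial>std_normal)"
  proof -
    have "(\<integral>\<^sup>+z. ennreal (f z) \<partial>std_normal) = (\<integral>\<^sup>+z. ennreal (std_normal_density z) * ennreal (f z) \<partial>lborel)"
      unfolding std_normal_def using assms by (subst nn_integral_density) auto
    also have "\<dots> = (\<integral>\<^sup>+z. ennreal (std_normal_density (- z)) * ennreal (f (- z)) \<partial>lborel)"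
      using assms by (subst nn_integral_real_affine[where c="-1" and t=0]) auto
    also have "\<dots> = (\<integral>\<^sup>+z. ennreal (f (- z)) \<partial>std_normal)"
      unfolding std_normal_def using assms by (subst nn_integral_density) (auto simp: std_normal_density_def)
    finally show ?thesis by simp
  qed
  then show ?thesis
    using assms by (subst (1 2) integral_eq_nn_integral) (auto cong: measurable_cong_sets)
qed

text \<open>For \<open>|u| > |s|\<close> the kernel is a pure exponential between
  \<open>u - s\<close> and \<open>u + s\<close>, and the second difference is the kernel times
  \<open>exp |s| + exp (- |s|) - 2\<close>, of second order. When the kink lies within reach only
  two first order differences can be bounded, which gives the extra term.\<close>

lemma laplace_second_difference:
  "\<bar>laplace_density (u - s) + laplace_density (u + s) - 2 * laplace_density u\<bar>
    \<le> (s\<^sup>2 * exp \<bar>s\<bar> + (if \<bar>u\<bar> \<le> \<bar>s\<bar> then 2 * \<bar>s\<bar> * exp \<bar>s\<bar> else 0)) * laplace_density u"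
proof (cases "\<bar>u\<bar> \<le> \<bar>s\<bar>")
  case True
  have e: "exp \<bar>s\<bar> - 1 \<le> \<bar>s\<bar> * exp \<bar>s\<bar>"
    using exp_ge_add_one_self[of "- \<bar>s\<bar>"] mult_left_mono[of "1 - \<bar>s\<bar>" "exp (- \<bar>s\<bar>)" "exp \<bar>s\<bar>"]
    by (simp add: exp_minus algebra_simps)
  have "\<bar>laplace_density (u - s) - laplace_density u\<bar> \<le> (exp \<bar>s\<bar> - 1) * laplace_density u"
    using laplace_density_diff[of "u - s" u] by simp
  moreover have "\<bar>laplace_density (u + s) - laplace_density u\<bar> \<le> (exp \<bar>s\<bar> - 1) * laplace_density u"
    using laplace_density_diff[of "u + s" u] by simp
  ultimately have "\<bar>laplace_density (u - s) + laplace_density (u + s) - 2 * laplace_density u\<bar> \<le> 2 * ((exp \<bar>s\<bar> - 1) * laplace_density u)"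
    by linarith
  also have "\<dots> \<le> 2 * ((\<bar>s\<bar> * exp \<bar>s\<bar>) * laplace_density u)"
    using e by (intro mult_left_mono mult_right_mono) auto
  also have "\<dots> \<le> (s\<^sup>2 * exp \<bar>s\<bar> + 2 * \<bar>s\<bar> * exp \<bar>s\<bar>) * laplace_density u"
    by (simp add: distrib_right)
  finally show ?thesis using True by simp
next
  case False
  have e: "laplace_density (u - s) + laplace_density (u + s) = (exp \<bar>s\<bar> + exp (- \<bar>s\<bar>)) * laplace_density u"
  proof -
    have "exp (- \<bar>u - s\<bar>) + exp (- \<bar>u + s\<bar>) = (exp \<bar>s\<bar> + exp (- \<bar>s\<bar>)) * exp (- \<bar>u\<bar>)"
      unfolding distrib_right mult_exp_exp using False by (auto simp: abs_real_def algebra_simps split: if_splits)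
    then show ?thesis by (simp add: laplace_density_def)
  qed
  have c: "exp \<bar>s\<bar> + exp (- \<bar>s\<bar>) - 2 = (exp \<bar>s\<bar> - 1)\<^sup>2 * exp (- \<bar>s\<bar>)"
    by (simp add: power2_eq_square exp_minus field_simps)
  have e1: "exp \<bar>s\<bar> - 1 \<le> \<bar>s\<bar> * exp \<bar>s\<bar>"
    using exp_ge_add_one_self[of "- \<bar>s\<bar>"] mult_left_mono[of "1 - \<bar>s\<bar>" "exp (- \<bar>s\<bar>)" "exp \<bar>s\<bar>"]
    by (simp add: exp_minus algebra_simps)
  have "(exp \<bar>s\<bar> - 1)\<^sup>2 * exp (- \<bar>s\<bar>) \<le> (\<bar>s\<bar> * exp \<bar>s\<bar>)\<^sup>2 * exp (- \<bar>s\<bar>)"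
    using e1 by (intro mult_right_mono power_mono) auto
  also have "\<dots> = s\<^sup>2 * exp \<bar>s\<bar>" by (simp add: power_mult_distrib exp_minus power2_eq_square field_simps)
  finally have c2: "exp \<bar>s\<bar> + exp (- \<bar>s\<bar>) - 2 \<le> s\<^sup>2 * exp \<bar>s\<bar>" using c by simp
  have c0: "0 \<le> exp \<bar>s\<bar> + exp (- \<bar>s\<bar>) - 2" unfolding c by simp
  have "laplace_density (u - s) + laplace_density (u + s) - 2 * laplace_density u = (exp \<bar>s\<bar> + exp (- \<bar>s\<bar>) - 2) * laplace_density u"
    using e by (simp add: algebra_simps)
  then show ?thesis using False c0 c2 by (simp add: abs_mult mult_right_mono)
qed

section \<open>The true density compared with the Laplace kernel, and the bias of smoothing\<close>

locale laplace_truth =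
  fixes f0X :: "real \<Rightarrow> real" and M C0 :: real
  assumes f0X_measurable[measurable]: "f0X \<in> borel_measurable borel"
    and f0X_nonneg: "\<And>x. 0 \<le> f0X x"
    and f0X_prob: "prob_space (density lborel (\<lambda>x. ennreal (f0X x)))"
    and C0: "0 < C0" and M: "0 < M"
    and f0X_le: "\<And>x. f0X x \<le> M * exp (- (1 + C0) * \<bar>x\<bar>)"
begin

definition \<mu>0 :: "real measure" where
  "\<mu>0 = density lborel (\<lambda>x. ennreal (f0X x))"

lemma \<mu>0: "\<mu>0 \<in> space (prob_algebra borel)"
  using f0X_prob by (simp add: space_prob_algebra \<mu>0_def)

sublocale \<mu>0: prob_space \<mu>0
  using f0X_prob by (simp add: \<mu>0_def)

lemma sets_\<mu>0[simp, measurable_cong]: "sets \<mu>0 = sets borel"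
  by (simp add: \<mu>0_def)

lemma integral_\<mu>0:
  fixes g :: "real \<Rightarrow> real"
  assumes "g \<in> borel_measurable borel"
  shows "(\<integral>x. g x \<partial>\<mu>0) = (\<integral>x. f0X x * g x \<partial>lborel)"
  unfolding \<mu>0_def using assms f0X_nonneg by (subst integral_density) auto

lemma integrable_\<mu>0_bounded:
  fixes g :: "real \<Rightarrow> real"
  assumes "g \<in> borel_measurable borel" "\<And>x. \<bar>g x\<bar> \<le> B"
  shows "integrable \<mu>0 g"
  using assms by (intro \<mu>0.integrable_const_bound[where B=B]) auto

text \<open>Moving the kernel from \<open>y - x\<close> to \<open>y\<close> costs
  \<open>exp |x|\<close>; the decay of \<open>f0X\<close> absorbs it and leaves
  \<open>exp (- C0 * |x|)\<close>, so integrals over \<open>x\<close> stay finite relative to the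
  kernel at \<open>y\<close>.\<close>

lemma weight_le: "f0X x * laplace_density (y - x) \<le> laplace_density y * (M * exp (- C0 * \<bar>x\<bar>))"
proof -
  have "f0X x * laplace_density (y - x) \<le> (M * exp (- (1 + C0) * \<bar>x\<bar>)) * (exp \<bar>x\<bar> * laplace_density y)"
    using f0X_le[of x] laplace_density_shift[of "y - x" y] f0X_nonneg M by (intro mult_mono) auto
  also have "\<dots> = laplace_density y * (M * (exp (- (1 + C0) * \<bar>x\<bar>) * exp \<bar>x\<bar>))" by simp
  also have "exp (- (1 + C0) * \<bar>x\<bar>) * exp \<bar>x\<bar> = exp (- C0 * \<bar>x\<bar>)" by (simp add: algebra_simps flip: exp_add)
  finally show ?thesis .
qed

lemma weighted_integral_le:
  assumes A[measurable]: "A \<in> sets borel"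
  shows "(\<integral>x. laplace_density (y - x) * indicator A x \<partial>\<mu>0) \<le> laplace_density y * (M * (\<integral>x. exp (- C0 * \<bar>x\<bar>) * indicator A x \<partial>lborel))"
proof -
  have i: "integrable lborel (\<lambda>x. exp (- C0 * \<bar>x\<bar>) * indicator A x)"
    by (rule Bochner_Integration.integrable_bound[OF exp_abs_scaled(1)[OF C0]]) (auto simp: indicator_def)
  have "(\<integral>x. laplace_density (y - x) * indicator A x \<partial>\<mu>0) = (\<integral>x. f0X x * (laplace_density (y - x) * indicator A x) \<partial>lborel)"
    by (subst integral_\<mu>0) auto
  also have "\<dots> \<le> (\<integral>x. laplace_density y * (M * (exp (- C0 * \<bar>x\<bar>) * indicator A x)) \<partial>lborel)"
  proof (rule integral_mono')
    show "integrable lborel (\<lambda>x. laplace_density y * (M * (exp (- C0 * \<bar>x\<bar>) * indicator A x)))"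
      using i by (intro integrable_mult_right)
    show "f0X x * (laplace_density (y - x) * indicator A x) \<le> laplace_density y * (M * (exp (- C0 * \<bar>x\<bar>) * indicator A x))" for x
      using weight_le[of x y] by (auto simp: indicator_def)
    show "0 \<le> laplace_density y * (M * (exp (- C0 * \<bar>x\<bar>) * indicator A x))" for x using M by auto
  qed
  also have "\<dots> = laplace_density y * (M * (\<integral>x. exp (- C0 * \<bar>x\<bar>) * indicator A x \<partial>lborel))"
    by simp
  finally show ?thesis .
qed

lemma obs_density_\<mu>0_le: "obs_density \<mu>0 y \<le> 2 * M / C0 * laplace_density y"
  using weighted_integral_le[of UNIV y] exp_abs_scaled[OF C0]
  by (simp add: conv_density_def mult_ac)

text \<open>Boundedness of \<open>f0X\<close> makes the mass within \<open>s\<close> of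
  \<open>y\<close> proportional to \<open>s\<close>; this pays for the kink of the kernel.\<close>

lemma local_mass_le:
  assumes "0 \<le> s"
  shows "(\<integral>x. laplace_density (y - x) * indicator {y - s..y + s} x \<partial>\<mu>0) \<le> laplace_density y * (M * (2 * s))"
proof -
  have "(\<integral>x. exp (- C0 * \<bar>x\<bar>) * indicator {y - s..y + s} x \<partial>lborel) \<le> (\<integral>x. indicator {y - s..y + s} x \<partial>lborel)"
  proof (rule integral_mono')
    show "integrable lborel (\<lambda>x. indicator {y - s..y + s} x :: real)"
      by (intro integrable_real_indicator) (auto simp: emeasure_lborel_Icc_eq)
  qed (use C0 in \<open>auto simp: indicator_def\<close>)
  also have "\<dots> = 2 * s" using assms by simp
  finally show ?thesis
    using M by (intro order_trans[OF weighted_integral_le] mult_left_mono) auto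
qed

lemma tail_integral_le:
  "(\<integral>x. exp (- C0 * \<bar>x\<bar>) * indicator {x. L \<le> \<bar>x\<bar>} x \<partial>lborel) \<le> 4 / C0 * exp (- C0 * L / 2)"
proof -
  have "(\<integral>x. exp (- C0 * \<bar>x\<bar>) * indicator {x. L \<le> \<bar>x\<bar>} x \<partial>lborel) \<le> (\<integral>x. exp (- C0 * L / 2) * exp (- (C0 / 2) * \<bar>x\<bar>) \<partial>lborel)"
  proof (rule integral_mono')
    show "integrable lborel (\<lambda>x. exp (- C0 * L / 2) * exp (- (C0 / 2) * \<bar>x\<bar>))"
      using exp_abs_scaled(1)[of "C0 / 2"] C0 by (intro integrable_mult_right) auto
    fix x :: real
    have "exp (- C0 * \<bar>x\<bar>) \<le> exp (- C0 * L / 2) * exp (- (C0 / 2) * \<bar>x\<bar>)" if "L \<le> \<bar>x\<bar>"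
    proof -
      have "C0 * L \<le> C0 * \<bar>x\<bar>" using C0 that by (intro mult_left_mono) auto
      then show ?thesis by (simp flip: exp_add)
    qed
    then show "exp (- C0 * \<bar>x\<bar>) * indicator {x. L \<le> \<bar>x\<bar>} x \<le> exp (- C0 * L / 2) * exp (- (C0 / 2) * \<bar>x\<bar>)"
      by (auto simp: indicator_def)
  qed (auto simp: indicator_def)
  also have "\<dots> = exp (- C0 * L / 2) * (2 / (C0 / 2))"
    using exp_abs_scaled(2)[of "C0 / 2"] C0 by simp
  finally show ?thesis by (simp add: mult.commute)
qed

lemma tail_mass_le:
  "(\<integral>x. laplace_density (y - x) * indicator {x. L \<le> \<bar>x\<bar>} x \<partial>\<mu>0) \<le> laplace_density y * (4 * M / C0 * exp (- C0 * L / 2))"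
  using mult_left_mono[OF tail_integral_le[of L], of M] M
  by (intro order_trans[OF weighted_integral_le] mult_left_mono) (auto simp: mult.left_commute[of M 4])

lemma tail_prob_le: "measure \<mu>0 {x. L \<le> \<bar>x\<bar>} \<le> 4 * M / C0 * exp (- C0 * L / 2)"
proof -
  have i: "integrable lborel (\<lambda>x. exp (- C0 * \<bar>x\<bar>) * indicator {x. L \<le> \<bar>x\<bar>} x)"
    by (rule Bochner_Integration.integrable_bound[OF exp_abs_scaled(1)[OF C0]]) (auto simp: indicator_def)
  have "measure \<mu>0 {x. L \<le> \<bar>x\<bar>} = (\<integral>x. indicator {x. L \<le> \<bar>x\<bar>} x \<partial>\<mu>0)" by simp
  also have "\<dots> = (\<integral>x. f0X x * indicator {x. L \<le> \<bar>x\<bar>} x \<partial>lborel)"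
    by (rule integral_\<mu>0) measurable
  also have "\<dots> \<le> (\<integral>x. M * (exp (- C0 * \<bar>x\<bar>) * indicator {x. L \<le> \<bar>x\<bar>} x) \<partial>lborel)"
  proof (rule integral_mono')
    fix x :: real
    have "f0X x \<le> M * exp (- (1 + C0) * \<bar>x\<bar>)" by (rule f0X_le)
    also have "\<dots> \<le> M * exp (- C0 * \<bar>x\<bar>)" using M by (intro mult_left_mono) (auto simp: algebra_simps)
    finally show "f0X x * indicator {x. L \<le> \<bar>x\<bar>} x \<le> M * (exp (- C0 * \<bar>x\<bar>) * indicator {x. L \<le> \<bar>x\<bar>} x)"
      by (auto simp: indicator_def)
  qed (use i M in auto)
  also have "\<dots> = M * (\<integral>x. exp (- C0 * \<bar>x\<bar>) * indicator {x. L \<le> \<bar>x\<bar>} x \<partial>lborel)" by simp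
  also have "\<dots> \<le> M * (4 / C0 * exp (- C0 * L / 2))" using M by (intro mult_left_mono tail_integral_le) auto
  finally show ?thesis by (simp add: mult.left_commute[of M 4])
qed

text \<open>A lower bound for the ratio of the true density to the Laplace density, from
  \<open>laplace_density (y - x) \<ge> exp (- |x|) * laplace_density y\<close>.\<close>

definition lower_const :: real where "lower_const = (\<integral>x. exp (- \<bar>x\<bar>) \<partial>\<mu>0)"

lemma lower_const_pos: "0 < lower_const"
proof -
  have i: "integrable \<mu>0 (\<lambda>x. exp (- \<bar>x\<bar>))" by (rule integrable_\<mu>0_bounded[where B=1]) auto
  have "lower_const \<noteq> 0"
  proof
    assume "lower_const = 0"
    then have "AE x in \<mu>0. exp (- \<bar>x\<bar>) = 0" using integral_nonneg_eq_0_iff_AE[OF i] by (auto simp: lower_const_def)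
    then have "AE x in \<mu>0. False" by simp
    then show False using \<mu>0.AE_False by auto
  qed
  moreover have "0 \<le> lower_const" unfolding lower_const_def by (intro Bochner_Integration.integral_nonneg) auto
  ultimately show ?thesis by simp
qed

lemma obs_density_\<mu>0_ge: "lower_const * laplace_density y \<le> obs_density \<mu>0 y"
proof -
  have "lower_const * laplace_density y = (\<integral>x. exp (- \<bar>x\<bar>) * laplace_density y \<partial>\<mu>0)" by (simp add: lower_const_def)
  also have "\<dots> \<le> (\<integral>x. laplace_density (y - x) \<partial>\<mu>0)"
  proof (rule integral_mono)
    show "integrable \<mu>0 (\<lambda>x. exp (- \<bar>x\<bar>) * laplace_density y)"
      by (intro integrable_mult_left integrable_\<mu>0_bounded[where B=1]) auto
    show "integrable \<mu>0 (\<lambda>x. laplace_density (y - x))" by (intro integrable_\<mu>0_bounded[where B=1]) (auto intro: order_trans[OF laplace_density_le])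
    show "exp (- \<bar>x\<bar>) * laplace_density y \<le> laplace_density (y - x)" for x
      using laplace_density_shift[of y "y - x"] by (simp add: exp_minus field_simps)
  qed
  finally show ?thesis by (simp add: conv_density_def)
qed

text \<open>By symmetry of the normal law the bias is half the average of symmetric second
  differences of the true density. At step \<open>s\<close> such a difference is of order
  \<open>s\<^sup>2\<close>, apart from a term of order \<open>s\<close> carried by the latent points
  within \<open>|s|\<close> of \<open>y\<close>, whose mass is itself of order
  \<open>s\<close>.\<close>

lemma smoothing_bias:
  assumes \<sigma>: "0 \<le> \<sigma>" "\<sigma> \<le> 1 / 2"
  shows "\<bar>(\<integral>z. obs_density \<mu>0 (y - \<sigma> * z) \<partial>std_normal) - obs_density \<mu>0 y\<bar>
    \<le> (8 * M / C0 + 16 * M) * exp_abs_moment * \<sigma>\<^sup>2 * laplace_density y"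
proof -
  interpret N: prob_space std_normal by (rule prob_space_std_normal)
  let ?p = "obs_density \<mu>0"
  note [measurable] = obs_density_measurable[OF \<mu>0]
  have pb: "?p v \<le> 1 / 2" for v by (rule obs_density_le[OF \<mu>0])
  have ip: "integrable std_normal (\<lambda>z. ?p (y - \<sigma> * z))" "integrable std_normal (\<lambda>z. ?p (y + \<sigma> * z))"
    using pb by (auto intro!: N.integrable_const_bound[where B="1/2"])
  have sym: "(\<integral>z. ?p (y + \<sigma> * z) \<partial>std_normal) = (\<integral>z. ?p (y - \<sigma> * z) \<partial>std_normal)"
    using std_normal_symmetric[of "\<lambda>z. ?p (y - \<sigma> * z)"] by simp
  have second: "\<bar>?p (y - s) + ?p (y + s) - 2 * ?p y\<bar> \<le> (2 * M / C0 + 4 * M) * (s\<^sup>2 * exp \<bar>s\<bar>) * laplace_density y" for s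
  proof -
    let ?D = "\<lambda>u. laplace_density (u - s) + laplace_density (u + s) - 2 * laplace_density u"
    have il: "integrable \<mu>0 (\<lambda>x. laplace_density (v - x))" for v
      by (intro integrable_\<mu>0_bounded[where B=1]) (auto intro: order_trans[OF laplace_density_le])
    have il2: "integrable \<mu>0 (\<lambda>x. laplace_density (y - x) * indicator {y - \<bar>s\<bar>..y + \<bar>s\<bar>} x)"
      by (intro integrable_\<mu>0_bounded[where B=1]) (auto simp: indicator_def intro: order_trans[OF laplace_density_le])
    have e: "y - s - x = y - x - s" "y + s - x = y - x + s" for x by auto
    have eq: "?p (y - s) + ?p (y + s) - 2 * ?p y = (\<integral>x. ?D (y - x) \<partial>\<mu>0)"
      unfolding conv_density_def
      using il[of "y - s"] il[of "y + s"] il[of y] by (simp add: e)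
    have "\<bar>?p (y - s) + ?p (y + s) - 2 * ?p y\<bar> \<le> (\<integral>x. (s\<^sup>2 * exp \<bar>s\<bar>) * laplace_density (y - x)
        + (2 * \<bar>s\<bar> * exp \<bar>s\<bar>) * (laplace_density (y - x) * indicator {y - \<bar>s\<bar>..y + \<bar>s\<bar>} x) \<partial>\<mu>0)"
      unfolding eq
    proof (rule order_trans[OF integral_abs_bound], rule integral_mono')
      show "integrable \<mu>0 (\<lambda>x. (s\<^sup>2 * exp \<bar>s\<bar>) * laplace_density (y - x)
        + (2 * \<bar>s\<bar> * exp \<bar>s\<bar>) * (laplace_density (y - x) * indicator {y - \<bar>s\<bar>..y + \<bar>s\<bar>} x))"
        using il il2 by (intro Bochner_Integration.integrable_add integrable_mult_right)
      show "\<bar>?D (y - x)\<bar> \<le> (s\<^sup>2 * exp \<bar>s\<bar>) * laplace_density (y - x)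
        + (2 * \<bar>s\<bar> * exp \<bar>s\<bar>) * (laplace_density (y - x) * indicator {y - \<bar>s\<bar>..y + \<bar>s\<bar>} x)" for x
        by (rule order_trans[OF laplace_second_difference]) (auto simp: indicator_def distrib_right)
    qed (intro add_nonneg_nonneg mult_nonneg_nonneg; simp)
    also have "\<dots> = (\<integral>x. (s\<^sup>2 * exp \<bar>s\<bar>) * laplace_density (y - x) \<partial>\<mu>0)
        + (\<integral>x. (2 * \<bar>s\<bar> * exp \<bar>s\<bar>) * (laplace_density (y - x) * indicator {y - \<bar>s\<bar>..y + \<bar>s\<bar>} x) \<partial>\<mu>0)"
      by (intro Bochner_Integration.integral_add integrable_mult_right il il2)
    also have "\<dots> = (s\<^sup>2 * exp \<bar>s\<bar>) * ?p y
        + (2 * \<bar>s\<bar> * exp \<bar>s\<bar>) * (\<integral>x. laplace_density (y - x) * indicator {y - \<bar>s\<bar>..y + \<bar>s\<bar>} x \<partial>\<mu>0)"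
      unfolding conv_density_def by (simp only: integral_mult_right_zero)
    also have "\<dots> \<le> (s\<^sup>2 * exp \<bar>s\<bar>) * (2 * M / C0 * laplace_density y)
        + (2 * \<bar>s\<bar> * exp \<bar>s\<bar>) * (laplace_density y * (M * (2 * \<bar>s\<bar>)))"
    proof (rule add_mono[OF mult_left_mono mult_left_mono])
      show "?p y \<le> 2 * M / C0 * laplace_density y" by (rule obs_density_\<mu>0_le)
      show "(\<integral>x. laplace_density (y - x) * indicator {y - \<bar>s\<bar>..y + \<bar>s\<bar>} x \<partial>\<mu>0) \<le> laplace_density y * (M * (2 * \<bar>s\<bar>))"
        by (rule local_mass_le) simp
    qed auto
    also have "\<dots> = (2 * M / C0 + 4 * M) * (s\<^sup>2 * exp \<bar>s\<bar>) * laplace_density y"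
    proof -
      have "s\<^sup>2 = \<bar>s\<bar> * \<bar>s\<bar>" by (simp add: power2_eq_square)
      then show ?thesis by (simp only:) (simp add: algebra_simps)
    qed
    finally show ?thesis .
  qed
  \<comment> \<open>The exponent is split: one half of \<open>|z|\<close> dominates
    \<open>z\<^sup>2 / 8\<close>, the other half the shift factor, by
    \<open>\<sigma> \<le> 1 / 2\<close>.\<close>
  have s2: "(\<sigma> * z)\<^sup>2 * exp \<bar>\<sigma> * z\<bar> \<le> 8 * \<sigma>\<^sup>2 * exp \<bar>z\<bar>" for z
  proof -
    have "z\<^sup>2 / 8 \<le> exp (\<bar>z\<bar> / 2)"
      using exp_lower_Taylor_quadratic[of "\<bar>z\<bar> / 2"] by (simp add: power_divide)
    moreover have "exp \<bar>\<sigma> * z\<bar> \<le> exp (\<bar>z\<bar> / 2)"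
      using \<sigma> mult_right_mono[of \<sigma> "1/2" "\<bar>z\<bar>"] by (simp add: abs_mult)
    ultimately have "z\<^sup>2 / 8 * exp \<bar>\<sigma> * z\<bar> \<le> exp (\<bar>z\<bar> / 2) * exp (\<bar>z\<bar> / 2)"
      by (intro mult_mono) auto
    also have "\<dots> = exp \<bar>z\<bar>" by (simp flip: exp_add)
    finally have "\<sigma>\<^sup>2 * (z\<^sup>2 / 8 * exp \<bar>\<sigma> * z\<bar>) \<le> \<sigma>\<^sup>2 * exp \<bar>z\<bar>" by (intro mult_left_mono) auto
    then show ?thesis by (simp add: power_mult_distrib)
  qed
  have eq: "2 * ((\<integral>z. ?p (y - \<sigma> * z) \<partial>std_normal) - ?p y) = (\<integral>z. ?p (y - \<sigma> * z) + ?p (y + \<sigma> * z) - 2 * ?p y \<partial>std_normal)"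
    using ip sym N.prob_space by simp
  have "\<bar>2 * ((\<integral>z. ?p (y - \<sigma> * z) \<partial>std_normal) - ?p y)\<bar> \<le> (\<integral>z. (2 * M / C0 + 4 * M) * (8 * \<sigma>\<^sup>2 * exp \<bar>z\<bar>) * laplace_density y \<partial>std_normal)"
    unfolding eq
  proof (rule order_trans[OF integral_abs_bound], rule integral_mono')
    show "integrable std_normal (\<lambda>z. (2 * M / C0 + 4 * M) * (8 * \<sigma>\<^sup>2 * exp \<bar>z\<bar>) * laplace_density y)"
      by (intro integrable_mult_left integrable_mult_right integrable_exp_abs)
    show "\<bar>?p (y - \<sigma> * z) + ?p (y + \<sigma> * z) - 2 * ?p y\<bar> \<le> (2 * M / C0 + 4 * M) * (8 * \<sigma>\<^sup>2 * exp \<bar>z\<bar>) * laplace_density y" for z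
      using M C0 by (intro order_trans[OF second] mult_right_mono mult_left_mono s2) auto
  qed (use M C0 in \<open>intro mult_nonneg_nonneg add_nonneg_nonneg; simp\<close>)
  also have "\<dots> = (2 * M / C0 + 4 * M) * (8 * \<sigma>\<^sup>2 * exp_abs_moment) * laplace_density y"
    by (simp add: exp_abs_moment_def)
  finally have "\<bar>2 * ((\<integral>z. ?p (y - \<sigma> * z) \<partial>std_normal) - ?p y)\<bar>
    \<le> (2 * M / C0 + 4 * M) * (8 * \<sigma>\<^sup>2 * exp_abs_moment) * laplace_density y" .
  moreover have "\<bar>2 * a\<bar> = 2 * \<bar>a\<bar>" for a :: real by simp
  moreover have "(2 * M / C0 + 4 * M) * (8 * \<sigma>\<^sup>2 * exp_abs_moment) * laplace_density y
    = 2 * ((8 * M / C0 + 16 * M) * exp_abs_moment * \<sigma>\<^sup>2 * laplace_density y)"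
    by (simp add: algebra_simps)
  ultimately show ?thesis by simp
qed

end

section \<open>Replacing the true mixing distribution by atoms at barycentres\<close>

lemma exp_minus_one_le_double: "0 \<le> t \<Longrightarrow> t \<le> 1 \<Longrightarrow> exp t - 1 \<le> 2 * t" for t :: real
  using exp_le_quadratic[of t] mult_left_mono[of t 1 t] by (simp add: power2_eq_square)

context laplace_truth
begin

lemma integrable_laplace_indicator:
  "A \<in> sets borel \<Longrightarrow> integrable \<mu>0 (\<lambda>x. laplace_density (y - x) * indicator A x)"
  by (intro integrable_\<mu>0_bounded[where B=1]) (auto simp: indicator_def intro: order_trans[OF laplace_density_le])

text \<open>
  Replacing the mass in a cell by an atom at its barycentre costs only a second order error away from
  the cell, because there the Laplace kernel is a smooth exponential. Next to the kink the error is
  of first order, but it is charged only to the mass near \<open>y\<close>.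
\<close>

lemma cell_error:
  assumes C[measurable]: "C \<in> sets borel" and Cl: "C \<subseteq> {l..l + \<delta>}" and b: "l \<le> b" "b \<le> l + \<delta>"
    and bary: "(\<integral>x. (x - b) * indicator C x \<partial>\<mu>0) = 0" and \<delta>: "0 < \<delta>" "\<delta> \<le> 1"
  shows "\<bar>(\<integral>x. laplace_density (y - x) * indicator C x \<partial>\<mu>0) - measure \<mu>0 C * laplace_density (y - b)\<bar>
    \<le> 3 * \<delta>\<^sup>2 * (\<integral>x. laplace_density (y - x) * indicator C x \<partial>\<mu>0)
      + 2 * \<delta> * (\<integral>x. laplace_density (y - x) * indicator ({y - \<delta>..y + \<delta>} \<inter> C) x \<partial>\<mu>0)"
    (is "\<bar>?I - ?m\<bar> \<le> 3 * \<delta>\<^sup>2 * ?I + 2 * \<delta> * ?J")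
proof -
  have iI: "integrable \<mu>0 (\<lambda>x. laplace_density (y - x) * indicator C x)" by (rule integrable_laplace_indicator) simp
  have iJ: "integrable \<mu>0 (\<lambda>x. laplace_density (y - x) * indicator ({y - \<delta>..y + \<delta>} \<inter> C) x)"
    by (rule integrable_laplace_indicator) simp
  have iC: "integrable \<mu>0 (\<lambda>x. indicator C x :: real)" by (intro integrable_\<mu>0_bounded[where B=1]) (auto simp: indicator_def)
  have iB: "integrable \<mu>0 (\<lambda>x. (x - b) * indicator C x)"
    using Cl b by (intro integrable_\<mu>0_bounded[where B=\<delta>]) (auto simp: indicator_def abs_le_iff)
  have I0: "0 \<le> ?I" and J0: "0 \<le> ?J" by (intro Bochner_Integration.integral_nonneg; simp)+
  have tl: "\<bar>x - b\<bar> \<le> \<delta>" if "x \<in> C" for x using that Cl b by (auto simp: abs_le_iff)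
  show ?thesis
  \<comment> \<open>If \<open>y\<close> is inside the cell, all of the cell is within
    \<open>\<delta>\<close> of \<open>y\<close>, so the whole first order error is covered by the
    second integral.\<close>
  proof (cases "l < y \<and> y < l + \<delta>")
    case True
    have eq: "?I - ?m = (\<integral>x. laplace_density (y - x) * indicator C x - laplace_density (y - b) * indicator C x \<partial>\<mu>0)"
      using iI iC by simp
    have "\<bar>?I - ?m\<bar> \<le> (\<integral>x. 2 * \<delta> * (laplace_density (y - x) * indicator ({y - \<delta>..y + \<delta>} \<inter> C) x) \<partial>\<mu>0)"
      unfolding eq
    proof (rule order_trans[OF integral_abs_bound], rule integral_mono')
      fix x
      show "\<bar>laplace_density (y - x) * indicator C x - laplace_density (y - b) * indicator C x\<bar>
        \<le> 2 * \<delta> * (laplace_density (y - x) * indicator ({y - \<delta>..y + \<delta>} \<inter> C) x)"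
      proof (cases "x \<in> C")
        case xC: True
        have "x \<in> {y - \<delta>..y + \<delta>}" using True Cl xC by auto
        moreover have "\<bar>laplace_density (y - b) - laplace_density (y - x)\<bar> \<le> 2 * \<delta> * laplace_density (y - x)"
        proof -
          have "\<bar>laplace_density (y - b) - laplace_density (y - x)\<bar> \<le> (exp \<bar>(y - b) - (y - x)\<bar> - 1) * laplace_density (y - x)"
            by (rule laplace_density_diff)
          also have "\<dots> \<le> 2 * \<delta> * laplace_density (y - x)"
            using tl[OF xC] \<delta> by (intro mult_right_mono order_trans[OF exp_minus_one_le_double]) auto
          finally show ?thesis .
        qed
        ultimately show ?thesis using xC by (simp add: abs_minus_commute)
      qed simp
    qed (use iJ \<delta> in auto)
    also have "\<dots> = 2 * \<delta> * ?J" by simp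
    finally show ?thesis using I0 by (smt (verit) mult_nonneg_nonneg zero_le_power2)
  next
    case False
    \<comment> \<open>The slope of the exponent on the cell, fixed by the side on which
      \<open>y\<close> lies. The linear term of the expansion at \<open>b\<close> integrates to 0
      because \<open>b\<close> is the barycentre.\<close>
    define s :: real where "s = (if l + \<delta> \<le> y then 1 else - 1)"
    have s: "\<bar>s\<bar> = 1" by (simp add: s_def)
    have lap: "laplace_density (y - x) = laplace_density (y - b) * exp (s * (x - b))" if "x \<in> C" for x
    proof -
      have x: "l \<le> x" "x \<le> l + \<delta>" using that Cl by auto
      have "- \<bar>y - x\<bar> = - \<bar>y - b\<bar> + s * (x - b)"
        using False x b by (auto simp: s_def abs_real_def)
      then show ?thesis unfolding laplace_density_def by (simp only: exp_add times_divide_eq_left)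
    qed
    have eq: "?I - ?m = (\<integral>x. laplace_density (y - x) * indicator C x - (laplace_density (y - b) * indicator C x
        + s * laplace_density (y - b) * ((x - b) * indicator C x)) \<partial>\<mu>0)"
      using iI iC iB bary by simp
    have "\<bar>?I - ?m\<bar> \<le> (\<integral>x. 3 * \<delta>\<^sup>2 * (laplace_density (y - x) * indicator C x) \<partial>\<mu>0)"
      unfolding eq
    proof (rule order_trans[OF integral_abs_bound], rule integral_mono')
      fix x
      show "\<bar>laplace_density (y - x) * indicator C x - (laplace_density (y - b) * indicator C x
        + s * laplace_density (y - b) * ((x - b) * indicator C x))\<bar> \<le> 3 * \<delta>\<^sup>2 * (laplace_density (y - x) * indicator C x)"
      proof (cases "x \<in> C")
        case xC: True
        define t where "t = s * (x - b)"
        have t: "\<bar>t\<bar> \<le> \<delta>" using tl[OF xC] s by (simp add: t_def abs_mult)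
        have "\<bar>exp t - 1 - t\<bar> \<le> t\<^sup>2"
          using exp_le_quadratic[of t] exp_ge_add_one_self[of t] t \<delta> zero_le_power2[of t] by linarith
        also have "t\<^sup>2 \<le> \<delta>\<^sup>2" using power_mono[OF t, of 2] by simp
        finally have e: "\<bar>exp t - 1 - t\<bar> \<le> \<delta>\<^sup>2" .
        have "laplace_density (y - b) \<le> exp \<bar>(y - b) - (y - x)\<bar> * laplace_density (y - x)" by (rule laplace_density_shift)
        also have "\<dots> \<le> 3 * laplace_density (y - x)"
        proof (intro mult_right_mono)
          have "exp \<bar>(y - b) - (y - x)\<bar> \<le> exp 1" using tl[OF xC] \<delta> by simp
          then show "exp \<bar>(y - b) - (y - x)\<bar> \<le> 3" using exp_le by linarith
        qed simp
        finally have "\<bar>exp t - 1 - t\<bar> * laplace_density (y - b) \<le> \<delta>\<^sup>2 * (3 * laplace_density (y - x))"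
          using e by (intro mult_mono) auto
        moreover have "laplace_density (y - x) - (laplace_density (y - b) + s * laplace_density (y - b) * (x - b))
          = (exp t - 1 - t) * laplace_density (y - b)"
          using lap[OF xC] by (simp add: t_def algebra_simps)
        ultimately show ?thesis using xC by (simp add: abs_mult)
      qed simp
    qed (use iI in auto)
    also have "\<dots> = 3 * \<delta>\<^sup>2 * ?I" by simp
    finally show ?thesis using J0 \<delta> by (smt (verit) mult_nonneg_nonneg)
  qed
qed

text \<open>The first moment about \<open>c\<close> is affine in \<open>c\<close>, nonnegative at
  the left end and nonpositive at the right end. On a cell of mass 0 it is constant, hence 0, and
  the left end serves.\<close>

lemma barycentre_exists:
  assumes C[measurable]: "C \<in> sets borel" and Cl: "C \<subseteq> {l..l + \<delta>}" and \<delta>: "0 < \<delta>"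
  obtains b where "l \<le> b" "b \<le> l + \<delta>" "(\<integral>x. (x - b) * indicator C x \<partial>\<mu>0) = 0"
proof -
  have i: "integrable \<mu>0 (\<lambda>x. (x - c) * indicator C x)" for c
    using Cl \<delta> by (intro integrable_\<mu>0_bounded[where B="\<bar>l - c\<bar> + \<delta>"]) (auto simp: indicator_def abs_real_def)
  have iC: "integrable \<mu>0 (\<lambda>x. indicator C x :: real)" by (intro integrable_\<mu>0_bounded[where B=1]) (auto simp: indicator_def)
  let ?F = "\<lambda>c. (\<integral>x. (x - c) * indicator C x \<partial>\<mu>0)"
  have F: "?F c = ?F 0 - c * measure \<mu>0 C" for c
  proof -
    have "?F c = (\<integral>x. (x - 0) * indicator C x - c * indicator C x \<partial>\<mu>0)" by (simp add: algebra_simps)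
    also have "\<dots> = ?F 0 - c * measure \<mu>0 C" using i[of 0] iC by (subst Bochner_Integration.integral_diff) auto
    finally show ?thesis .
  qed
  have 1: "0 \<le> ?F l" using Cl by (intro Bochner_Integration.integral_nonneg) (auto simp: indicator_def)
  have 2: "?F (l + \<delta>) \<le> 0"
  proof -
    have "0 \<le> (\<integral>x. - ((x - (l + \<delta>)) * indicator C x) \<partial>\<mu>0)"
      using Cl by (intro Bochner_Integration.integral_nonneg) (auto simp: indicator_def)
    then show ?thesis by simp
  qed
  show thesis
  proof (cases "measure \<mu>0 C = 0")
    case True
    then show ?thesis using 1 2 F[of l] F[of "l + \<delta>"] \<delta> by (intro that[of l]) auto
  next
    case False
    then have m: "0 < measure \<mu>0 C" by (simp add: less_le)
    define b where "b = ?F 0 / measure \<mu>0 C"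
    have "?F b = 0" using m F[of b] by (simp add: b_def)
    moreover have "l \<le> b" using 1 m F[of l] by (simp add: b_def field_simps)
    moreover have "b \<le> l + \<delta>" using 2 m F[of "l + \<delta>"] by (simp add: b_def field_simps)
    ultimately show ?thesis using that by blast
  qed
qed

text \<open>Dominates every coefficient of \<open>approximation_error\<close>. With
  \<open>c = M / C0\<close> these are \<open>8 * c + 16 * M\<close> for smoothing,
  \<open>6 * c + 4 * M\<close> and \<open>4 * c\<close> for discretisation and the tail, and 1 for
  perturbing the atoms, all multiplied by \<open>exp_abs_moment\<close>.\<close>

definition approx_const :: real where
  "approx_const = exp_abs_moment * (18 * M / C0 + 20 * M + 1)"

lemma approx_const_pos: "0 < approx_const"
  unfolding approx_const_def using exp_abs_moment_ge M C0 by (intro mult_pos_pos add_nonneg_pos) auto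

text \<open>The cell errors are summed. By disjointness the kink terms combine into the mass of one
  interval of radius \<open>\<delta>\<close> around \<open>y\<close>, so the first order error is
  charged once and not once per cell. Points outside the cells contribute a tail.\<close>

lemma discretisation_error:
  fixes C U :: "nat \<Rightarrow> real set" and l b :: "nat \<Rightarrow> real"
  assumes C: "\<And>j. j < k \<Longrightarrow> C j \<in> sets borel" "\<And>j. j < k \<Longrightarrow> C j \<subseteq> {l j..l j + \<delta>}"
    and b: "\<And>j. j < k \<Longrightarrow> l j \<le> b j" "\<And>j. j < k \<Longrightarrow> b j \<le> l j + \<delta>"
      "\<And>j. j < k \<Longrightarrow> (\<integral>x. (x - b j) * indicator (C j) x \<partial>\<mu>0) = 0"
    and disj: "disjoint_family_on C {..<k}" and cover: "{x. \<bar>x\<bar> < L} \<subseteq> (\<Union>j<k. C j)"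
    and \<delta>: "0 < \<delta>" "\<delta> \<le> 1"
  shows "\<bar>obs_density \<mu>0 y - (\<Sum>j<k. measure \<mu>0 (C j) * laplace_density (y - b j))\<bar>
    \<le> ((6 * M / C0 + 4 * M) * \<delta>\<^sup>2 + 4 * M / C0 * exp (- C0 * L / 2)) * laplace_density y"
proof -
  let ?UC = "\<Union>j<k. C j"
  have UC[measurable]: "?UC \<in> sets borel" using C(1) by (intro sets.finite_UN) auto
  let ?I = "\<lambda>A. (\<integral>x. laplace_density (y - x) * indicator A x \<partial>\<mu>0)"
  have sumI: "(\<Sum>j<k. ?I (A \<inter> C j)) = ?I (A \<inter> ?UC)" if A[measurable]: "A \<in> sets borel" for A
  proof -
    have "(\<Sum>j<k. ?I (A \<inter> C j)) = (\<integral>x. (\<Sum>j<k. laplace_density (y - x) * indicator (A \<inter> C j) x) \<partial>\<mu>0)"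
      using C(1) by (intro Bochner_Integration.integral_sum[symmetric] integrable_laplace_indicator) auto
    also have "\<dots> = ?I (A \<inter> ?UC)"
    proof (intro Bochner_Integration.integral_cong refl)
      fix x
      have "(\<Sum>j<k. indicator (C j) x) = (indicator ?UC x :: real)"
        by (rule indicator_UN_disjoint[OF _ disj, symmetric]) simp
      then show "(\<Sum>j<k. laplace_density (y - x) * indicator (A \<inter> C j) x) = laplace_density (y - x) * indicator (A \<inter> ?UC) x"
        unfolding indicator_inter_arith by (simp flip: sum_distrib_left)
    qed
    finally show ?thesis .
  qed
  have sumC: "(\<Sum>j<k. ?I (C j)) = ?I ?UC" using sumI[of UNIV] by simp
  have mono: "?I A \<le> ?I B" if "A \<subseteq> B" "A \<in> sets borel" "B \<in> sets borel" for A B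
    using that by (intro integral_mono integrable_laplace_indicator) (auto simp: indicator_def)
  have pI: "obs_density \<mu>0 y = ?I UNIV" by (simp add: conv_density_def)
  have split: "?I UNIV = ?I ?UC + ?I (- ?UC)"
  proof -
    have "?I ?UC + ?I (- ?UC) = (\<integral>x. laplace_density (y - x) * indicator ?UC x + laplace_density (y - x) * indicator (- ?UC) x \<partial>\<mu>0)"
      by (intro Bochner_Integration.integral_add[symmetric] integrable_laplace_indicator UC borel_comp)
    also have "\<dots> = ?I UNIV"
      by (intro Bochner_Integration.integral_cong refl) (simp add: indicator_def)
    finally show ?thesis by simp
  qed
  have "\<bar>?I UNIV - (\<Sum>j<k. measure \<mu>0 (C j) * laplace_density (y - b j))\<bar>
    = \<bar>(\<Sum>j<k. ?I (C j) - measure \<mu>0 (C j) * laplace_density (y - b j)) + ?I (- ?UC)\<bar>"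
    unfolding split sum_subtractf sumC by simp
  also have "\<dots> \<le> (\<Sum>j<k. \<bar>?I (C j) - measure \<mu>0 (C j) * laplace_density (y - b j)\<bar>) + \<bar>?I (- ?UC)\<bar>"
    by (intro order_trans[OF abs_triangle_ineq] add_right_mono sum_abs)
  also have "\<bar>?I (- ?UC)\<bar> = ?I (- ?UC)" by (intro abs_of_nonneg Bochner_Integration.integral_nonneg) simp
  also have "(\<Sum>j<k. \<bar>?I (C j) - measure \<mu>0 (C j) * laplace_density (y - b j)\<bar>)
    \<le> (\<Sum>j<k. 3 * \<delta>\<^sup>2 * ?I (C j) + 2 * \<delta> * ?I ({y - \<delta>..y + \<delta>} \<inter> C j))"
    using C b \<delta> by (intro sum_mono cell_error) auto
  also have "\<dots> = 3 * \<delta>\<^sup>2 * ?I ?UC + 2 * \<delta> * ?I ({y - \<delta>..y + \<delta>} \<inter> ?UC)"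
    by (simp add: sum.distrib sumC sumI flip: sum_distrib_left)
  also have "\<dots> \<le> 3 * \<delta>\<^sup>2 * (2 * M / C0 * laplace_density y) + 2 * \<delta> * (laplace_density y * (M * (2 * \<delta>)))"
  proof (intro add_mono mult_left_mono)
    have "?I ?UC \<le> ?I UNIV" by (rule mono) auto
    then show "?I ?UC \<le> 2 * M / C0 * laplace_density y" using obs_density_\<mu>0_le[of y] pI by simp
    have "?I ({y - \<delta>..y + \<delta>} \<inter> ?UC) \<le> ?I {y - \<delta>..y + \<delta>}" by (rule mono) auto
    also have "\<dots> \<le> laplace_density y * (M * (2 * \<delta>))" using \<delta> by (intro local_mass_le) auto
    finally show "?I ({y - \<delta>..y + \<delta>} \<inter> ?UC) \<le> laplace_density y * (M * (2 * \<delta>))" .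
  qed (use \<delta> in auto)
  also have "?I (- ?UC) \<le> laplace_density y * (4 * M / C0 * exp (- C0 * L / 2))"
  proof -
    have "?I (- ?UC) \<le> ?I {x. L \<le> \<bar>x\<bar>}" using cover by (intro mono borel_comp UC) (auto simp: not_less[symmetric])
    then show ?thesis using tail_mass_le[of y L] by simp
  qed
  finally show ?thesis unfolding pI by (simp add: algebra_simps power2_eq_square)
qed


text \<open>Three comparisons in turn: the truth with its Gaussian smoothing, this with the smoothed
  atoms, these with the part of \<open>\<mu>\<close> on the sets \<open>U j\<close> close to the
  atoms. Only the last costs \<open>exp L\<close>, because kernels centred up to \<open>L\<close>
  away are compared with the kernel at \<open>y\<close>; this is affordable when
  \<open>\<tau>\<close> and \<open>\<eta>\<close> are small powers.\<close>

lemma approximation_error: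
  fixes C U :: "nat \<Rightarrow> real set" and l b :: "nat \<Rightarrow> real"
  assumes C: "\<And>j. j < k \<Longrightarrow> C j \<in> sets borel" "\<And>j. j < k \<Longrightarrow> C j \<subseteq> {l j..l j + \<delta>}"
    and b: "\<And>j. j < k \<Longrightarrow> l j \<le> b j" "\<And>j. j < k \<Longrightarrow> b j \<le> l j + \<delta>"
      "\<And>j. j < k \<Longrightarrow> (\<integral>x. (x - b j) * indicator (C j) x \<partial>\<mu>0) = 0" "\<And>j. j < k \<Longrightarrow> \<bar>b j\<bar> \<le> L"
    and disj: "disjoint_family_on C {..<k}" and cover: "{x. \<bar>x\<bar> < L} \<subseteq> (\<Union>j<k. C j)"
    and \<delta>: "0 < \<delta>" "\<delta> \<le> 1" and \<sigma>: "0 < \<sigma>" "\<sigma> \<le> 1 / 2" and \<eta>: "0 \<le> \<eta>" "\<eta> \<le> 1"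
    and U: "\<And>j. j < k \<Longrightarrow> U j \<in> sets borel" "\<And>j. j < k \<Longrightarrow> U j \<subseteq> C j" "\<And>j. j < k \<Longrightarrow> U j \<subseteq> {b j - \<eta>..b j + \<eta>}"
    and \<mu>: "\<mu> \<in> space (prob_algebra borel)" and \<tau>: "\<And>j. j < k \<Longrightarrow> \<bar>measure \<mu> (U j) - measure \<mu>0 (C j)\<bar> \<le> \<tau>"
  shows "\<bar>obs_density \<mu>0 y - (\<integral>h. smooth_laplace \<sigma> (y - h) * indicator (\<Union>j<k. U j) h \<partial>\<mu>)\<bar>
    \<le> approx_const * (\<sigma>\<^sup>2 + \<delta>\<^sup>2 + exp (- C0 * L / 2) + (real k * \<tau> + 2 * \<eta>) * exp L) * laplace_density y"
proof -
  interpret mu: prob_space \<mu> using prob_algebra_borelD[OF \<mu>] by simp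
  note [measurable_cong] = prob_algebra_borelD(2)[OF \<mu>]
  interpret N: prob_space std_normal by (rule prob_space_std_normal)
  note [measurable] = obs_density_measurable[OF \<mu>0]
  let ?m = "\<lambda>j. measure \<mu>0 (C j)" and ?K = exp_abs_moment and ?G = "smooth_laplace \<sigma>" and ?p = "obs_density \<mu>0"
  have K: "1 \<le> ?K" by (rule exp_abs_moment_ge)
  define \<kappa> where "\<kappa> = (6 * M / C0 + 4 * M) * \<delta>\<^sup>2 + 4 * M / C0 * exp (- C0 * L / 2)"
  have disc: "\<bar>?p v - (\<Sum>j<k. ?m j * laplace_density (v - b j))\<bar> \<le> \<kappa> * laplace_density v" for v
    unfolding \<kappa>_def by (rule discretisation_error[OF C b(1-3) disj cover \<delta>])
  have ip: "integrable std_normal (\<lambda>z. ?p (y - \<sigma> * z))"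
    using obs_density_le[OF \<mu>0] by (auto intro!: N.integrable_const_bound[where B="1/2"])
  have isum: "integrable std_normal (\<lambda>z. \<Sum>j<k. ?m j * laplace_density (y - \<sigma> * z - b j))"
    using integrable_smooth_laplace[of "y - b _" \<sigma>]
    by (intro Bochner_Integration.integrable_sum integrable_mult_right) (simp add: diff_diff_eq add.commute)
  have sG: "(\<integral>z. (\<Sum>j<k. ?m j * laplace_density (y - \<sigma> * z - b j)) \<partial>std_normal) = (\<Sum>j<k. ?m j * ?G (y - b j))"
  proof -
    have "(\<integral>z. (\<Sum>j<k. ?m j * laplace_density (y - \<sigma> * z - b j)) \<partial>std_normal)
      = (\<Sum>j<k. (\<integral>z. ?m j * laplace_density (y - b j - \<sigma> * z) \<partial>std_normal))"
      using integrable_smooth_laplace[of "y - b _" \<sigma>]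
      by (subst Bochner_Integration.integral_sum[symmetric])
         (auto intro!: integrable_mult_right Bochner_Integration.integral_cong sum.cong simp: diff_diff_eq add.commute)
    then show ?thesis by (simp add: smooth_laplace_def)
  qed
  have 3: "\<bar>(\<integral>z. ?p (y - \<sigma> * z) \<partial>std_normal) - (\<Sum>j<k. ?m j * ?G (y - b j))\<bar> \<le> \<kappa> * (?K * laplace_density y)"
  proof -
    have \<kappa>0: "0 \<le> \<kappa>" unfolding \<kappa>_def using M C0 by (intro add_nonneg_nonneg mult_nonneg_nonneg) auto
    have eq: "(\<integral>z. ?p (y - \<sigma> * z) \<partial>std_normal) - (\<Sum>j<k. ?m j * ?G (y - b j))
      = (\<integral>z. ?p (y - \<sigma> * z) - (\<Sum>j<k. ?m j * laplace_density (y - \<sigma> * z - b j)) \<partial>std_normal)"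
      unfolding sG[symmetric] by (intro Bochner_Integration.integral_diff[symmetric] ip isum)
    \<comment> \<open>The discretisation error is relative to the kernel at every point, so
      averaging it over the Gaussian shift costs only \<open>exp_abs_moment\<close>.\<close>
    have "\<bar>(\<integral>z. ?p (y - \<sigma> * z) \<partial>std_normal) - (\<Sum>j<k. ?m j * ?G (y - b j))\<bar> \<le> (\<integral>z. \<kappa> * laplace_density (y - \<sigma> * z) \<partial>std_normal)"
      unfolding eq
    proof (rule order_trans[OF integral_abs_bound], rule integral_mono')
      show "integrable std_normal (\<lambda>z. \<kappa> * laplace_density (y - \<sigma> * z))"
        by (intro integrable_mult_right integrable_smooth_laplace)
    qed (use disc \<kappa>0 in simp_all)
    also have "\<dots> = \<kappa> * ?G y" by (simp add: smooth_laplace_def)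
    also have "\<dots> \<le> \<kappa> * (?K * laplace_density y)"
      using \<sigma> \<kappa>0 by (intro mult_left_mono smooth_laplace_le_laplace) auto
    finally show ?thesis .
  qed
  have Gle: "?G u \<le> 1" for u using smooth_laplace_le[of \<sigma> u] by simp
  have iU: "integrable \<mu> (\<lambda>h. ?G (y - h) * indicator A h)" if "A \<in> sets borel" for A
    using that by (intro mu.integrable_const_bound[where B=1])
      (auto simp: indicator_def Gle)
  have disjU: "disjoint_family_on U {..<k}"
    using disj U(2) unfolding disjoint_family_on_def by (metis Int_mono disjoint_iff lessThan_iff subset_eq)
  have sumU: "(\<Sum>j<k. (\<integral>h. ?G (y - h) * indicator (U j) h \<partial>\<mu>)) = (\<integral>h. ?G (y - h) * indicator (\<Union>j<k. U j) h \<partial>\<mu>)"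
  proof -
    have "(\<Sum>j<k. (\<integral>h. ?G (y - h) * indicator (U j) h \<partial>\<mu>)) = (\<integral>h. (\<Sum>j<k. ?G (y - h) * indicator (U j) h) \<partial>\<mu>)"
      using U(1) by (intro Bochner_Integration.integral_sum[symmetric] iU) auto
    also have "\<dots> = (\<integral>h. ?G (y - h) * indicator (\<Union>j<k. U j) h \<partial>\<mu>)"
    proof (intro Bochner_Integration.integral_cong refl)
      fix h
      have "(\<Sum>j<k. indicator (U j) h) = (indicator (\<Union>j<k. U j) h :: real)"
        by (rule indicator_UN_disjoint[OF _ disjU, symmetric]) simp
      then show "(\<Sum>j<k. ?G (y - h) * indicator (U j) h) = ?G (y - h) * indicator (\<Union>j<k. U j) h"
        by (simp flip: sum_distrib_left)
    qed
    finally show ?thesis .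
  qed
  have mU: "(\<Sum>j<k. measure \<mu> (U j)) \<le> 1"
  proof -
    have "(\<Sum>j<k. measure \<mu> (U j)) = measure \<mu> (\<Union>j<k. U j)"
      using U(1) disjU by (intro mu.finite_measure_finite_Union[symmetric]) (auto simp: prob_algebra_borelD[OF \<mu>])
    then show ?thesis by simp
  qed
  have e\<eta>: "exp \<eta> - 1 \<le> 2 * \<eta>" using \<eta> by (rule exp_minus_one_le_double)
  have cell: "\<bar>?m j * ?G (y - b j) - (\<integral>h. ?G (y - h) * indicator (U j) h \<partial>\<mu>)\<bar>
    \<le> (\<tau> + 2 * \<eta> * measure \<mu> (U j)) * (?K * exp L * laplace_density y)" if j: "j < k" for j
  proof -
    have Uj[measurable]: "U j \<in> sets borel" using U(1) j by simp
    have G0: "?G (y - b j) \<le> ?K * exp L * laplace_density y"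
    proof -
      have "laplace_density (y - b j) \<le> exp \<bar>(y - b j) - y\<bar> * laplace_density y" by (rule laplace_density_shift)
      also have "\<dots> \<le> exp L * laplace_density y" using b(4)[OF j] by (intro mult_right_mono) auto
      finally have "?K * laplace_density (y - b j) \<le> ?K * (exp L * laplace_density y)"
        using K by (intro mult_left_mono) auto
      then show ?thesis using smooth_laplace_le_laplace[of \<sigma> "y - b j"] \<sigma> by (simp add: mult.assoc)
    qed
    have "?m j * ?G (y - b j) - (\<integral>h. ?G (y - h) * indicator (U j) h \<partial>\<mu>)
      = (?m j - measure \<mu> (U j)) * ?G (y - b j) + (\<integral>h. (?G (y - b j) - ?G (y - h)) * indicator (U j) h \<partial>\<mu>)"
    proof -
      have "(\<integral>h. (?G (y - b j) - ?G (y - h)) * indicator (U j) h \<partial>\<mu>)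
        = (\<integral>h. ?G (y - b j) * indicator (U j) h - ?G (y - h) * indicator (U j) h \<partial>\<mu>)"
        by (simp add: left_diff_distrib)
      also have "\<dots> = ?G (y - b j) * measure \<mu> (U j) - (\<integral>h. ?G (y - h) * indicator (U j) h \<partial>\<mu>)"
        using iU[OF Uj] by (subst Bochner_Integration.integral_diff)
          (auto intro!: integrable_mult_right mu.integrable_const_bound[where B=1] simp: prob_algebra_borelD[OF \<mu>])
      finally show ?thesis by (simp add: algebra_simps)
    qed
    moreover have "\<bar>(?m j - measure \<mu> (U j)) * ?G (y - b j)\<bar> \<le> \<tau> * (?K * exp L * laplace_density y)"
      unfolding abs_mult using \<tau>[OF j] G0 by (intro mult_mono) (auto simp: abs_minus_commute)
    moreover have "\<bar>\<integral>h. (?G (y - b j) - ?G (y - h)) * indicator (U j) h \<partial>\<mu>\<bar> \<le> 2 * \<eta> * measure \<mu> (U j) * (?K * exp L * laplace_density y)"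
    proof -
      have "\<bar>\<integral>h. (?G (y - b j) - ?G (y - h)) * indicator (U j) h \<partial>\<mu>\<bar>
        \<le> (\<integral>h. (2 * \<eta> * (?K * exp L * laplace_density y)) * indicator (U j) h \<partial>\<mu>)"
      proof (rule order_trans[OF integral_abs_bound], rule integral_mono')
        show "integrable \<mu> (\<lambda>h. (2 * \<eta> * (?K * exp L * laplace_density y)) * indicator (U j) h)"
          by (intro integrable_mult_right mu.integrable_const_bound[where B=1]) (auto simp: prob_algebra_borelD[OF \<mu>])
        fix h
        show "\<bar>(?G (y - b j) - ?G (y - h)) * indicator (U j) h\<bar> \<le> (2 * \<eta> * (?K * exp L * laplace_density y)) * indicator (U j) h"
        proof (cases "h \<in> U j")
          case True
          then have "\<bar>(y - h) - (y - b j)\<bar> \<le> \<eta>" using U(3)[OF j] by (auto simp: abs_le_iff)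
          then have "exp \<bar>(y - h) - (y - b j)\<bar> - 1 \<le> 2 * \<eta>" using e\<eta> by (smt (verit) exp_le_cancel_iff)
          then have "\<bar>?G (y - h) - ?G (y - b j)\<bar> \<le> 2 * \<eta> * ?G (y - b j)"
            by (intro order_trans[OF smooth_laplace_diff] mult_right_mono) auto
          also have "\<dots> \<le> 2 * \<eta> * (?K * exp L * laplace_density y)" using \<eta> by (intro mult_left_mono G0) auto
          finally show ?thesis using True by (simp add: abs_minus_commute)
        qed simp
        show "0 \<le> (2 * \<eta> * (?K * exp L * laplace_density y)) * indicator (U j) h"
          using \<eta> K by (intro mult_nonneg_nonneg) auto
      qed
      also have "\<dots> = 2 * \<eta> * measure \<mu> (U j) * (?K * exp L * laplace_density y)"
        by (simp add: prob_algebra_borelD[OF \<mu>])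
      finally show ?thesis .
    qed
    ultimately show ?thesis by (simp only: distrib_right)
  qed
  have 4: "\<bar>(\<Sum>j<k. ?m j * ?G (y - b j)) - (\<integral>h. ?G (y - h) * indicator (\<Union>j<k. U j) h \<partial>\<mu>)\<bar>
    \<le> (real k * \<tau> + 2 * \<eta>) * (?K * exp L * laplace_density y)"
  proof -
    have "\<bar>(\<Sum>j<k. ?m j * ?G (y - b j)) - (\<integral>h. ?G (y - h) * indicator (\<Union>j<k. U j) h \<partial>\<mu>)\<bar>
      \<le> (\<Sum>j<k. \<bar>?m j * ?G (y - b j) - (\<integral>h. ?G (y - h) * indicator (U j) h \<partial>\<mu>)\<bar>)"
      unfolding sumU[symmetric] sum_subtractf[symmetric] by (rule sum_abs)
    also have "\<dots> \<le> (\<Sum>j<k. (\<tau> + 2 * \<eta> * measure \<mu> (U j)) * (?K * exp L * laplace_density y))"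
      by (intro sum_mono cell) simp
    also have "\<dots> = (real k * \<tau> + 2 * \<eta> * (\<Sum>j<k. measure \<mu> (U j))) * (?K * exp L * laplace_density y)"
      by (simp add: sum.distrib sum_distrib_left flip: sum_distrib_right)
    also have "\<dots> \<le> (real k * \<tau> + 2 * \<eta> * 1) * (?K * exp L * laplace_density y)"
      using mU \<eta> K by (intro mult_right_mono add_left_mono mult_left_mono mult_nonneg_nonneg) auto
    finally show ?thesis by simp
  qed
  define a1 a2 a3 a4 where "a1 = \<sigma>\<^sup>2" and "a2 = \<delta>\<^sup>2" and "a3 = exp (- C0 * L / 2)" and "a4 = (real k * \<tau> + 2 * \<eta>) * exp L"
  have a4: "0 \<le> a4"
  proof (cases "k = 0")
    case False
    then have "0 \<le> \<tau>" using \<tau>[of 0] by linarith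
    then show ?thesis using \<eta> by (simp add: a4_def)
  qed (use \<eta> in \<open>simp add: a4_def\<close>)
  have a: "0 \<le> a1" "0 \<le> a2" "0 \<le> a3" by (simp_all add: a1_def a2_def a3_def)
  define c where "c = M / C0"
  have c: "0 \<le> c" using M C0 by (simp add: c_def)
  define B where "B = 18 * c + 20 * M + 1"
  let ?l = "laplace_density y"
  have "\<bar>?p y - (\<integral>h. ?G (y - h) * indicator (\<Union>j<k. U j) h \<partial>\<mu>)\<bar>
    \<le> (8 * M / C0 + 16 * M) * ?K * \<sigma>\<^sup>2 * ?l + \<kappa> * (?K * ?l) + (real k * \<tau> + 2 * \<eta>) * (?K * exp L * ?l)"
    using smoothing_bias[of \<sigma> y] \<sigma> 3 4 by linarith
  also have "\<dots> = ?K * ?l * ((8 * c + 16 * M) * a1 + ((6 * c + 4 * M) * a2 + 4 * c * a3) + 1 * a4)"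
    by (simp add: \<kappa>_def a1_def a2_def a3_def a4_def c_def algebra_simps)
  also have "\<dots> \<le> ?K * ?l * (B * a1 + (B * a2 + B * a3) + B * a4)"
  proof (rule mult_left_mono)
    have "8 * c + 16 * M \<le> B" "6 * c + 4 * M \<le> B" "4 * c \<le> B" "1 \<le> B" using c M by (simp_all add: B_def)
    then show "(8 * c + 16 * M) * a1 + ((6 * c + 4 * M) * a2 + 4 * c * a3) + 1 * a4 \<le> B * a1 + (B * a2 + B * a3) + B * a4"
      using a a4 by (intro add_mono mult_right_mono)
  qed (use K in auto)
  also have "\<dots> = approx_const * (a1 + a2 + a3 + a4) * ?l"
  proof -
    have "approx_const = ?K * B" by (simp add: approx_const_def c_def B_def)
    then show ?thesis by (simp add: algebra_simps)
  qed
  finally show ?thesis by (simp add: a1_def a2_def a3_def a4_def)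
qed

text \<open>The part \<open>r\<close> of the model density coming from mass outside \<open>A\<close>
  need not be small relative to the truth. It is at most the model density \<open>q\<close>,
  however, so \<open>r\<^sup>2 / q \<le> r\<close> and it contributes only its total mass. The part
  from \<open>A\<close> is controlled relative to the kernel, and
  \<open>\<kappa> \<le> lower_const / 2\<close> keeps \<open>q\<close> above half of the lower bound
  for the truth.\<close>

lemma chi_square_le:
  assumes \<mu>: "\<mu> \<in> space (prob_algebra borel)" and \<sigma>: "0 < \<sigma>" and A[measurable]: "A \<in> sets borel"
    and \<kappa>: "0 \<le> \<kappa>" "\<kappa> \<le> lower_const / 2"
    and err: "\<And>y. \<bar>obs_density \<mu>0 y - (\<integral>h. smooth_laplace \<sigma> (y - h) * indicator A h \<partial>\<mu>)\<bar> \<le> \<kappa> * laplace_density y"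
  shows "chi_square \<mu>0 (normal_mixture \<mu> \<sigma>) \<le> ennreal (4 * \<kappa>\<^sup>2 / lower_const + 2 * measure \<mu> (- A))"
proof -
  interpret mu: prob_space \<mu> using prob_algebra_borelD[OF \<mu>] by simp
  interpret pair_sigma_finite lborel \<mu> by unfold_locales
  note [measurable_cong] = prob_algebra_borelD(2)[OF \<mu>]
  let ?p = "obs_density \<mu>0" and ?q = "obs_density (normal_mixture \<mu> \<sigma>)"
  note PA = normal_mixture_prob_algebra[OF \<mu> \<sigma>]
  note [measurable] = obs_density_measurable[OF \<mu>0] obs_density_measurable[OF PA]
  have Gle: "smooth_laplace \<sigma> u \<le> 1" for u using smooth_laplace_le[of \<sigma> u] by simp
  have i: "integrable \<mu> (\<lambda>h. smooth_laplace \<sigma> (y - h) * indicator B h)" if "B \<in> sets borel" for B y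
    using that by (intro mu.integrable_const_bound[where B=1])
      (auto simp: indicator_def Gle)
  define r where "r y = (\<integral>h. smooth_laplace \<sigma> (y - h) * indicator (- A) h \<partial>\<mu>)" for y
  have r0: "0 \<le> r y" for y unfolding r_def by (intro Bochner_Integration.integral_nonneg) auto
  have q: "?q y = (\<integral>h. smooth_laplace \<sigma> (y - h) * indicator A h \<partial>\<mu>) + r y" for y
  proof -
    have "?q y = (\<integral>h. smooth_laplace \<sigma> (y - h) \<partial>\<mu>)"
      using obs_density_normal_mixture[OF \<mu> \<sigma>, of y] by (simp only: conv_density_def[of "smooth_laplace \<sigma>"])
    also have "\<dots> = (\<integral>h. smooth_laplace \<sigma> (y - h) * indicator A h + smooth_laplace \<sigma> (y - h) * indicator (- A) h \<partial>\<mu>)"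
      by (intro Bochner_Integration.integral_cong) (auto simp: indicator_def)
    also have "\<dots> = (\<integral>h. smooth_laplace \<sigma> (y - h) * indicator A h \<partial>\<mu>) + r y"
      unfolding r_def by (intro Bochner_Integration.integral_add i A borel_comp)
    finally show ?thesis .
  qed
  have er: "ennreal (r y) = (\<integral>\<^sup>+h. ennreal (smooth_laplace \<sigma> (y - h)) * indicator (- A) h \<partial>\<mu>)" for y
  proof -
    have "ennreal (r y) = (\<integral>\<^sup>+h. ennreal (smooth_laplace \<sigma> (y - h) * indicator (- A) h) \<partial>\<mu>)"
      unfolding r_def by (intro nn_integral_eq_integral[symmetric] i borel_comp A) simp
    also have "\<dots> = (\<integral>\<^sup>+h. ennreal (smooth_laplace \<sigma> (y - h)) * indicator (- A) h \<partial>\<mu>)"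
      by (intro nn_integral_cong) (simp add: indicator_def)
    finally show ?thesis .
  qed
  have rm[measurable]: "(\<lambda>y. ennreal (r y)) \<in> borel_measurable lborel"
    unfolding er by measurable
  have "(\<integral>\<^sup>+y. ennreal (r y) \<partial>lborel) = (\<integral>\<^sup>+h. \<integral>\<^sup>+y. ennreal (smooth_laplace \<sigma> (y - h)) * indicator (- A) h \<partial>lborel \<partial>\<mu>)"
    unfolding er by (rule Fubini'[symmetric]) measurable
  also have "\<dots> = (\<integral>\<^sup>+h. indicator (- A) h \<partial>\<mu>)"
  proof (intro nn_integral_cong)
    fix h :: real
    show "(\<integral>\<^sup>+y. ennreal (smooth_laplace \<sigma> (y - h)) * indicator (- A) h \<partial>lborel) = indicator (- A) h"
      using nn_integral_shift[of "\<lambda>y. ennreal (smooth_laplace \<sigma> y)" h]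
      by (simp add: nn_integral_multc nn_integral_smooth_laplace)
  qed
  also have "\<dots> = ennreal (measure \<mu> (- A))"
    using A by (simp add: mu.emeasure_eq_measure prob_algebra_borelD[OF \<mu>])
  finally have rint: "(\<integral>\<^sup>+y. ennreal (r y) \<partial>lborel) = ennreal (measure \<mu> (- A))" .
  have pw: "(?p y - ?q y)\<^sup>2 / ?q y \<le> 4 * \<kappa>\<^sup>2 / lower_const * laplace_density y + 2 * r y" for y
  proof -
    let ?l = "laplace_density y" and ?e = "?p y - (?q y - r y)"
    have e: "\<bar>?e\<bar> \<le> \<kappa> * ?l" using err[of y] q[of y] by simp
    have q0: "0 < ?q y" by (rule obs_density_pos[OF PA])
    have "\<kappa> * ?l \<le> lower_const / 2 * ?l" using \<kappa> by (intro mult_right_mono) auto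
    then have ql: "lower_const * ?l / 2 \<le> ?q y" using e r0[of y] obs_density_\<mu>0_ge[of y] by linarith
    have qr: "r y \<le> ?q y" using e obs_density_\<mu>0_ge[of y] \<open>\<kappa> * ?l \<le> lower_const / 2 * ?l\<close> lower_const_pos
      mult_pos_pos[OF lower_const_pos laplace_density_pos[of y]] by linarith
    have "(?p y - ?q y)\<^sup>2 = (?e - r y)\<^sup>2" by simp
    also have "\<dots> \<le> 2 * ?e\<^sup>2 + 2 * (r y)\<^sup>2"
      using zero_le_power2[of "?e + r y"] by (simp add: power2_eq_square algebra_simps)
    finally have "(?p y - ?q y)\<^sup>2 / ?q y \<le> (2 * ?e\<^sup>2 + 2 * (r y)\<^sup>2) / ?q y" using q0 by (intro divide_right_mono) auto
    also have "\<dots> = 2 * ?e\<^sup>2 / ?q y + 2 * (r y)\<^sup>2 / ?q y" by (simp add: add_divide_distrib)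
    also have "\<dots> \<le> 2 * (\<kappa> * ?l)\<^sup>2 / (lower_const * ?l / 2) + 2 * r y"
    proof (intro add_mono frac_le)
      show "2 * ?e\<^sup>2 \<le> 2 * (\<kappa> * ?l)\<^sup>2" using e \<kappa> by (simp add: abs_le_square_iff[symmetric] abs_mult)
      show "2 * (r y)\<^sup>2 / ?q y \<le> 2 * r y"
        using q0 mult_left_mono[OF qr r0[of y]] by (simp add: field_simps power2_eq_square)
    qed (use ql lower_const_pos in auto)
    also have "2 * (\<kappa> * ?l)\<^sup>2 / (lower_const * ?l / 2) = 4 * \<kappa>\<^sup>2 / lower_const * ?l"
      using lower_const_pos laplace_density_pos[of y] by (simp add: power2_eq_square field_simps)
    finally show ?thesis .
  qed
  have "chi_square \<mu>0 (normal_mixture \<mu> \<sigma>) \<le> (\<integral>\<^sup>+y. ennreal (4 * \<kappa>\<^sup>2 / lower_const) * ennreal (laplace_density y) + 2 * ennreal (r y) \<partial>lborel)"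
    unfolding chi_square_def
  proof (intro nn_integral_mono)
    fix y
    have "ennreal ((?p y - ?q y)\<^sup>2 / ?q y) \<le> ennreal (4 * \<kappa>\<^sup>2 / lower_const * laplace_density y + 2 * r y)"
      by (intro ennreal_leI pw)
    also have "\<dots> = ennreal (4 * \<kappa>\<^sup>2 / lower_const) * ennreal (laplace_density y) + 2 * ennreal (r y)"
    proof -
      have "ennreal (4 * \<kappa>\<^sup>2 / lower_const * laplace_density y) = ennreal (4 * \<kappa>\<^sup>2 / lower_const) * ennreal (laplace_density y)"
        using lower_const_pos by (intro ennreal_mult) auto
      moreover have "ennreal (2 * r y) = 2 * ennreal (r y)" using r0[of y] by (simp add: ennreal_mult')
      ultimately show ?thesis using lower_const_pos r0[of y] by (subst ennreal_plus) auto
    qed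
    finally show "ennreal ((?p y - ?q y)\<^sup>2 / ?q y) \<le> \<dots>" .
  qed
  also have "\<dots> = ennreal (4 * \<kappa>\<^sup>2 / lower_const) + 2 * ennreal (measure \<mu> (- A))"
    by (simp add: nn_integral_add nn_integral_cmult nn_integral_laplace_density rint)
  also have "\<dots> = ennreal (4 * \<kappa>\<^sup>2 / lower_const + 2 * measure \<mu> (- A))"
    using lower_const_pos by (subst ennreal_plus) (auto simp: ennreal_mult')
  finally show ?thesis .
qed

end

section \<open>The mixture prior as an image of the product of the Dirichlet and bandwidth
  laws\<close>

lemma mixture_map_measurable:
  assumes DH: "sets DH = sets (prob_algebra borel)" and S: "sets S = sets (restrict_space borel {0<..})"
  shows "(\<lambda>(\<mu>, \<sigma>). normal_mixture \<mu> \<sigma>) \<in> DH \<Otimes>\<^sub>M S \<rightarrow>\<^sub>M prob_algebra borel"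
  using normal_mixture_measurable[OF S] DH by (simp cong: measurable_cong_sets sets_pair_measure_cong)

lemma mixture_prior:
  assumes DH: "prob_space DH" "sets DH = sets (prob_algebra borel)"
    and S: "prob_space S" "sets S = sets (restrict_space borel {0<..})"
  shows "prob_space (mixture_prior DH S)" "sets (mixture_prior DH S) = sets (prob_algebra borel)"
proof -
  interpret DH: prob_space DH by (rule DH)
  interpret S: prob_space S by (rule S)
  interpret P: pair_prob_space DH S ..
  show "prob_space (mixture_prior DH S)"
    unfolding mixture_prior_def by (intro P.prob_space_distr mixture_map_measurable DH S)
  show "sets (mixture_prior DH S) = sets (prob_algebra borel)" by (simp add: mixture_prior_def)
qed

lemma mixture_prior_ge:
  assumes DH: "prob_space DH" "sets DH = sets (prob_algebra borel)"
    and S: "prob_space S" "sets S = sets (restrict_space borel {0<..})"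
    and E: "E \<in> sets DH" and I: "I \<in> sets S" and G: "G \<in> sets (prob_algebra borel)"
    and sub: "\<And>\<mu> \<sigma>. \<mu> \<in> E \<Longrightarrow> \<sigma> \<in> I \<Longrightarrow> normal_mixture \<mu> \<sigma> \<in> G"
  shows "measure DH E * measure S I \<le> measure (mixture_prior DH S) G"
proof -
  interpret DH: prob_space DH by (rule DH)
  interpret S: prob_space S by (rule S)
  interpret P: pair_prob_space DH S ..
  note m = mixture_map_measurable[OF DH(2) S(2)]
  have "measure DH E * measure S I = P.prob (E \<times> I)"
    using E I by (simp add: measure_def S.emeasure_pair_measure_Times enn2real_mult)
  also have "\<dots> \<le> P.prob ((\<lambda>(\<mu>, \<sigma>). normal_mixture \<mu> \<sigma>) -` G \<inter> space (DH \<Otimes>\<^sub>M S))"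
    using sub E[THEN sets.sets_into_space] I[THEN sets.sets_into_space]
    by (intro P.finite_measure_mono measurable_sets[OF m G]) (auto simp: space_pair_measure)
  also have "\<dots> = measure (mixture_prior DH S) G"
    unfolding mixture_prior_def by (rule measure_distr[OF m G, symmetric])
  finally show ?thesis .
qed

lemma mixture_prior_le:
  assumes DH: "prob_space DH" "sets DH = sets (prob_algebra borel)"
    and S: "prob_space S" "sets S = sets (restrict_space borel {0<..})"
    and E: "E \<in> sets DH" and I: "I \<in> sets S" and G: "G \<in> sets (prob_algebra borel)"
    and sub: "\<And>\<mu> \<sigma>. \<mu> \<in> space DH - E \<Longrightarrow> \<sigma> \<in> space S - I \<Longrightarrow> normal_mixture \<mu> \<sigma> \<notin> G"
  shows "measure (mixture_prior DH S) G \<le> measure DH E + measure S I"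
proof -
  interpret DH: prob_space DH by (rule DH)
  interpret S: prob_space S by (rule S)
  interpret P: pair_prob_space DH S ..
  note m = mixture_map_measurable[OF DH(2) S(2)]
  have "measure (mixture_prior DH S) G = P.prob ((\<lambda>(\<mu>, \<sigma>). normal_mixture \<mu> \<sigma>) -` G \<inter> space (DH \<Otimes>\<^sub>M S))"
    unfolding mixture_prior_def by (rule measure_distr[OF m G])
  also have "\<dots> \<le> P.prob ((E \<times> space S) \<union> (space DH \<times> I))"
    using sub E I by (intro P.finite_measure_mono) (auto simp: space_pair_measure)
  also have "\<dots> \<le> P.prob (E \<times> space S) + P.prob (space DH \<times> I)"
    using E I by (intro measure_Un_le) auto
  also have "P.prob (E \<times> space S) = measure DH E"
    using E by (simp add: measure_def S.emeasure_pair_measure_Times S.emeasure_space_1)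
  also have "P.prob (space DH \<times> I) = measure S I"
    using I by (simp add: measure_def S.emeasure_pair_measure_Times DH.emeasure_space_1)
  finally show ?thesis .
qed

lemma dirichlet_process_cells:
  assumes D: "dirichlet_process H D" and k: "0 < k"
    and A: "\<And>i. i < k \<Longrightarrow> A i \<in> sets borel" "disjoint_family_on A {..<k}" "(\<Union>i<k. A i) = UNIV"
    and F: "F \<in> sets (PiM {..<k} (\<lambda>_. borel))"
  shows "{\<mu>\<in>space (prob_algebra borel). (\<lambda>i\<in>{..<k}. measure \<mu> (A i)) \<in> F} \<in> sets D"
    "measure D {\<mu>\<in>space (prob_algebra borel). (\<lambda>i\<in>{..<k}. measure \<mu> (A i)) \<in> F} = measure (dirichlet_law k (\<lambda>i. measure H (A i))) F"
proof -
  have D': "prob_space D" "sets D = sets (prob_algebra borel)"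
    "distr D (PiM {..<k} (\<lambda>i. borel)) (\<lambda>\<mu>. \<lambda>i\<in>{..<k}. measure \<mu> (A i)) = dirichlet_law k (\<lambda>i. measure H (A i))"
    using D k A unfolding dirichlet_process_def by auto
  have sp: "space D = space (prob_algebra borel)" by (rule sets_eq_imp_space_eq[OF D'(2)])
  have m: "(\<lambda>\<mu>. \<lambda>i\<in>{..<k}. measure \<mu> (A i)) \<in> D \<rightarrow>\<^sub>M PiM {..<k} (\<lambda>i. borel)"
    unfolding measurable_cong_sets[OF D'(2) refl] using A(1)
    by (intro measurable_restrict measurable_measure_prob_algebra) auto
  have eq: "{\<mu>\<in>space (prob_algebra borel). (\<lambda>i\<in>{..<k}. measure \<mu> (A i)) \<in> F} = (\<lambda>\<mu>. \<lambda>i\<in>{..<k}. measure \<mu> (A i)) -` F \<inter> space D"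
    by (auto simp: sp)
  show "{\<mu>\<in>space (prob_algebra borel). (\<lambda>i\<in>{..<k}. measure \<mu> (A i)) \<in> F} \<in> sets D"
    unfolding eq by (rule measurable_sets[OF m F])
  show "measure D {\<mu>\<in>space (prob_algebra borel). (\<lambda>i\<in>{..<k}. measure \<mu> (A i)) \<in> F} = measure (dirichlet_law k (\<lambda>i. measure H (A i))) F"
    unfolding eq D'(3)[symmetric] by (rule measure_distr[OF m F, symmetric])
qed

lemma interval_cells:
  fixes a \<delta> :: real
  assumes \<delta>: "0 < \<delta>"
  defines "C \<equiv> \<lambda>j. {a + real j * \<delta>..<a + real j * \<delta> + \<delta>}"
  shows "disjoint_family_on C {..<k}" "(\<Union>j<k. C j) = {a..<a + real k * \<delta>}"
proof -
  show "disjoint_family_on C {..<k}"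
  proof (unfold disjoint_family_on_def, intro ballI impI)
    fix i j assume ij: "i \<in> {..<k}" "j \<in> {..<k}" "i \<noteq> j"
    have "C i \<inter> C j = {}" if "i < j" for i j
    proof -
      have "real i * \<delta> + \<delta> = real (Suc i) * \<delta>" by (simp add: algebra_simps)
      also have "\<dots> \<le> real j * \<delta>" using that \<delta> by (intro mult_right_mono) auto
      finally show ?thesis by (auto simp: C_def)
    qed
    then show "C i \<inter> C j = {}" using ij(3) by (metis Int_commute nat_neq_iff)
  qed
  show "(\<Union>j<k. C j) = {a..<a + real k * \<delta>}"
  proof (induction k)
    case (Suc k)
    have "(\<Union>j<Suc k. C j) = (\<Union>j<k. C j) \<union> C k" by (auto simp: lessThan_Suc)
    also have "\<dots> = {a..<a + real (Suc k) * \<delta>}"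
    proof -
      have "{a..<a + real k * \<delta>} \<union> {a + real k * \<delta>..<a + real k * \<delta> + \<delta>} = {a..<a + real k * \<delta> + \<delta>}"
        using \<delta> by (intro ivl_disj_un_two(3)) auto
      then show ?thesis unfolding Suc by (simp add: C_def algebra_simps)
    qed
    finally show ?case .
  qed simp
qed

lemma density_measure_ge:
  fixes h :: "real \<Rightarrow> real"
  assumes H: "finite_measure H" "H = density lborel (\<lambda>u. ennreal (h u))" and h: "h \<in> borel_measurable borel"
    and A: "A \<in> sets borel" and I: "{c..<c + w} \<subseteq> A" and w: "0 \<le> w" and c: "0 \<le> m" "\<And>u. u \<in> {c..<c + w} \<Longrightarrow> m \<le> h u"
  shows "m * w \<le> measure H A"
proof -
  interpret finite_measure H by (rule H)
  have "ennreal (m * w) = (\<integral>\<^sup>+u. ennreal m * indicator {c..<c + w} u \<partial>lborel)"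
    using w c(1) by (simp add: nn_integral_cmult ennreal_mult')
  also have "\<dots> \<le> (\<integral>\<^sup>+u. ennreal (h u) * indicator A u \<partial>lborel)"
    using c(2) I by (intro nn_integral_mono) (auto simp: indicator_def intro!: ennreal_leI)
  also have "\<dots> = emeasure H A" using h A by (simp add: H(2) emeasure_density)
  finally show ?thesis by (simp add: emeasure_eq_measure)
qed

context laplace_truth
begin

text \<open>The partition has \<open>k + 1\<close> cells: in each interval \<open>C j\<close> the
  part \<open>U j\<close> within \<open>\<eta>\<close> of the barycentre, and one cell
  \<open>V\<close> for everything else. Requiring that \<open>U j\<close> receive nearly the true
  mass of \<open>C j\<close>, and \<open>V\<close> that of the exterior, is a small-ball event for
  the Dirichlet law. On it the divergence is at most \<open>r\<close> for every bandwidth between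
  \<open>\<sigma>n\<close> and \<open>2 * \<sigma>n\<close>.\<close>

lemma prior_mass_ge:
  fixes k :: nat and L \<delta> \<eta> t \<sigma>n \<kappa> r hl A c :: real
  assumes D: "dirichlet_process H D"
    and H: "finite_measure H" "H = density lborel (\<lambda>u. ennreal (h u))" and h: "h \<in> borel_measurable borel"
    and hl: "0 < hl" "\<And>u. \<bar>u\<bar> \<le> L + 1 \<Longrightarrow> hl \<le> h u" and A: "A = measure H UNIV"
    and c: "0 < c" "\<And>k a p \<tau>. 0 < k \<Longrightarrow> (\<And>i. 0 \<le> a i) \<Longrightarrow> (\<And>i. i < k \<Longrightarrow> 0 < a i \<and> a i \<le> A) \<Longrightarrow> (\<And>i. i < k \<Longrightarrow> 0 \<le> p i) \<Longrightarrow>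
       (\<Sum>i<k. p i) = 1 \<Longrightarrow> 0 < \<tau> \<Longrightarrow> \<tau> \<le> 1 \<Longrightarrow>
       (\<Prod>i<k. c * a i * \<tau> powr (A + 1))
         \<le> measure (dirichlet_law k a) {x\<in>space (PiM {..<k} (\<lambda>_. borel)). \<forall>i<k. \<bar>x i - p i\<bar> \<le> (real k + 1) * \<tau>}"
    and S: "prob_space S" "sets S = sets (restrict_space borel {0<..})"
    and L: "0 < L" and \<delta>: "0 < \<delta>" "\<delta> \<le> 1" "real k * \<delta> = 2 * L" and \<eta>: "0 < \<eta>" "\<eta> \<le> \<delta> / 2"
    and t: "0 < t" "t \<le> 1" and \<sigma>n: "0 < \<sigma>n" "\<sigma>n \<le> 1 / 4"
    and \<kappa>: "approx_const * ((2 * \<sigma>n)\<^sup>2 + \<delta>\<^sup>2 + exp (- C0 * L / 2) + (real k * ((real k + 2) * t) + 2 * \<eta>) * exp L) \<le> \<kappa>" "\<kappa> \<le> lower_const / 2"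
    and r: "4 * \<kappa>\<^sup>2 / lower_const + 2 * (4 * M / C0 * exp (- C0 * L / 2) + (real k + 2) * t) \<le> r"
  shows "(c * (hl * \<eta>) * t powr (A + 1)) ^ (k + 1) * measure S {\<sigma>n..2 * \<sigma>n}
    \<le> measure (mixture_prior D S) {\<mu> \<in> space (prob_algebra borel). chi_square \<mu>0 \<mu> \<le> ennreal r}"
proof -
  interpret H: finite_measure H by (rule H)
  have D': "prob_space D" "sets D = sets (prob_algebra borel)" using D by (auto simp: dirichlet_process_def)
  have \<eta>1: "\<eta> \<le> 1" using \<eta> \<delta> by linarith
  define l where "l j = - L + real j * \<delta>" for j :: nat
  define C where "C j = {l j..<l j + \<delta>}" for j
  have disj: "disjoint_family_on C {..<k}" and UC: "(\<Union>j<k. C j) = {- L..<L}"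
    using interval_cells[OF \<delta>(1), of "- L" k] \<delta>(3) by (simp_all add: C_def[abs_def] l_def[abs_def])
  have "\<forall>j. \<exists>b. l j \<le> b \<and> b \<le> l j + \<delta> \<and> (\<integral>x. (x - b) * indicator (C j) x \<partial>\<mu>0) = 0"
    using barycentre_exists[of "C _" "l _" \<delta>] \<delta>(1) by (metis C_def atLeastLessThan_borel atLeastLessThan_subseteq_atLeastAtMost_iff order_refl)
  then obtain b where b: "\<And>j. l j \<le> b j" "\<And>j. b j \<le> l j + \<delta>" "\<And>j. (\<integral>x. (x - b j) * indicator (C j) x \<partial>\<mu>0) = 0"
    by metis
  have bL: "\<bar>b j\<bar> \<le> L" "- L \<le> l j" "l j + \<delta> \<le> L" if "j < k" for j
  proof -
    have "real j * \<delta> + \<delta> = real (Suc j) * \<delta>" by (simp add: algebra_simps)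
    also have "\<dots> \<le> real k * \<delta>" using that \<delta> by (intro mult_right_mono) auto
    finally have 1: "l j + \<delta> \<le> L" using \<delta>(3) by (simp add: l_def)
    have 2: "- L \<le> l j" using \<delta> by (simp add: l_def)
    show "\<bar>b j\<bar> \<le> L" "- L \<le> l j" "l j + \<delta> \<le> L" using 1 2 b(1,2)[of j] by auto
  qed
  define U where "U j = C j \<inter> {b j - \<eta>..b j + \<eta>}" for j
  define V where "V = - (\<Union>j<k. U j)"
  have Ub: "U j \<in> sets borel" for j by (simp add: U_def C_def)
  have Vb: "V \<in> sets borel" unfolding V_def using Ub by (intro borel_comp sets.finite_UN) auto
  define B where "B i = (if i < k then U i else V)" for i
  have disjU: "disjoint_family_on U {..<k}"
    using disj unfolding disjoint_family_on_def U_def by blast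
  have Bd: "disjoint_family_on B {..<Suc k}"
  proof (unfold disjoint_family_on_def, intro ballI impI)
    fix i j assume "i \<in> {..<Suc k}" "j \<in> {..<Suc k}" "i \<noteq> j"
    then show "B i \<inter> B j = {}"
      using disjU by (auto simp: B_def V_def disjoint_family_on_def)
  qed
  have BU: "(\<Union>i<Suc k. B i) = UNIV" by (auto simp: B_def V_def lessThan_Suc)
  have Bb: "B i \<in> sets borel" for i using Ub Vb by (simp add: B_def)
  define p where "p i = measure \<mu>0 (if i < k then C i else - {- L..<L})" for i
  have p1: "(\<Sum>i<Suc k. p i) = 1"
  proof -
    have "(\<Sum>i<k. p i) = (\<Sum>i<k. measure \<mu>0 (C i))" by (simp add: p_def)
    also have "\<dots> = measure \<mu>0 {- L..<L}"
      unfolding UC[symmetric] by (intro \<mu>0.finite_measure_finite_Union[OF _ _ disj, symmetric]) (auto simp: C_def)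
    finally have "(\<Sum>i<Suc k. p i) = measure \<mu>0 {- L..<L} + measure \<mu>0 (- {- L..<L})" by (simp add: p_def)
    also have "\<dots> = measure \<mu>0 ({- L..<L} \<union> - {- L..<L})"
      by (rule \<mu>0.finite_measure_Union[symmetric]) auto
    also have "\<dots> = 1" using \<mu>0.prob_space by (simp add: \<mu>0_def)
    finally show ?thesis .
  qed
  have Hge: "hl * \<eta> \<le> measure H (B i)" for i
  proof (cases "i < k")
    case True
    \<comment> \<open>The half of the window around the barycentre that stays in the interval; by
      \<open>\<eta> \<le> \<delta> / 2\<close> one of the two sides fits.\<close>
    define s where "s = (if b i + \<eta> \<le> l i + \<delta> then b i else b i - \<eta>)"
    have "{s..<s + \<eta>} \<subseteq> U i" using b(1,2)[of i] \<eta> by (auto simp: s_def U_def C_def)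
    moreover have "hl \<le> h u" if "u \<in> {s..<s + \<eta>}" for u
      using that bL[OF True] \<eta> \<eta>1 by (intro hl(2)) (auto simp: s_def abs_le_iff split: if_splits)
    ultimately have "hl * \<eta> \<le> measure H (U i)"
      using hl(1) \<eta> by (intro density_measure_ge[OF H h Ub, of s]) auto
    then show ?thesis using True by (simp add: B_def)
  next
    case False
    have "(\<Union>j<k. U j) \<subseteq> {- L..<L}" unfolding UC[symmetric] by (auto simp: U_def)
    then have "{L..<L + 1} \<subseteq> V" by (auto simp: V_def)
    then have "hl * 1 \<le> measure H V"
      using hl L by (intro density_measure_ge[OF H h Vb, of L]) auto
    moreover have "hl * \<eta> \<le> hl * 1" using hl \<eta>1 by (intro mult_left_mono) auto
    ultimately show ?thesis using False by (simp add: B_def)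
  qed
  define \<tau> where "\<tau> = (real (Suc k) + 1) * t"
  define F where "F = {x\<in>space (PiM {..<Suc k} (\<lambda>_. borel)). \<forall>i<Suc k. \<bar>x i - p i\<bar> \<le> \<tau>}"
  have "F = {x\<in>space (PiM {..<Suc k} (\<lambda>_. borel)). \<forall>i\<in>{..<Suc k}. \<bar>x i - p i\<bar> \<le> \<tau>}" by (auto simp: F_def)
  also have "\<dots> \<in> sets (PiM {..<Suc k} (\<lambda>_. borel))" by measurable
  finally have F: "F \<in> sets (PiM {..<Suc k} (\<lambda>_. borel))" .
  define E where "E = {\<mu>\<in>space (prob_algebra borel). (\<lambda>i\<in>{..<Suc k}. measure \<mu> (B i)) \<in> F}"
  have E: "E \<in> sets D" "measure D E = measure (dirichlet_law (Suc k) (\<lambda>i. measure H (B i))) F"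
    unfolding E_def by (rule dirichlet_process_cells[OF D _ Bb Bd BU F]; simp)+
  have "(c * (hl * \<eta>) * t powr (A + 1)) ^ (k + 1) = (\<Prod>i<Suc k. c * (hl * \<eta>) * t powr (A + 1))" by simp
  also have "\<dots> \<le> (\<Prod>i<Suc k. c * measure H (B i) * t powr (A + 1))"
    using c(1) hl(1) \<eta>(1) Hge by (intro prod_mono conjI mult_right_mono mult_left_mono mult_nonneg_nonneg) auto
  also have "\<dots> \<le> measure D E"
  proof -
    have "0 < measure H (B i)" for i using Hge[of i] hl(1) \<eta>(1) by (meson less_le_trans mult_pos_pos)
    moreover have "measure H (B i) \<le> A" for i
      unfolding A using Bb[of i] by (intro H.finite_measure_mono) (auto simp: H(2))
    ultimately show ?thesis
      unfolding E(2) F_def \<tau>_def using t by (intro c(2) p1) (auto simp: p_def)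
  qed
  finally have 1: "(c * (hl * \<eta>) * t powr (A + 1)) ^ (k + 1) \<le> measure D E" .
  have \<kappa>0: "0 \<le> \<kappa>"
    using approx_const_pos t \<eta> by (intro order_trans[OF _ \<kappa>(1)] mult_nonneg_nonneg add_nonneg_nonneg) auto
  have sub: "chi_square \<mu>0 (normal_mixture \<mu> \<sigma>) \<le> ennreal r" if \<mu>: "\<mu> \<in> E" and \<sigma>: "\<sigma> \<in> {\<sigma>n..2 * \<sigma>n}" for \<mu> \<sigma>
  proof -
    have \<mu>PA: "\<mu> \<in> space (prob_algebra borel)" using \<mu> by (simp add: E_def)
    have cells: "\<bar>measure \<mu> (B i) - p i\<bar> \<le> \<tau>" if "i < Suc k" for i
      using \<mu> that by (auto simp: E_def F_def)
    have \<sigma>0: "0 < \<sigma>" "\<sigma> \<le> 1 / 2" using \<sigma> \<sigma>n by auto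
    have "\<bar>obs_density \<mu>0 y - (\<integral>h. smooth_laplace \<sigma> (y - h) * indicator (\<Union>j<k. U j) h \<partial>\<mu>)\<bar> \<le> \<kappa> * laplace_density y" for y
    proof -
      have "\<bar>obs_density \<mu>0 y - (\<integral>h. smooth_laplace \<sigma> (y - h) * indicator (\<Union>j<k. U j) h \<partial>\<mu>)\<bar>
        \<le> approx_const * (\<sigma>\<^sup>2 + \<delta>\<^sup>2 + exp (- C0 * L / 2) + (real k * \<tau> + 2 * \<eta>) * exp L) * laplace_density y"
      proof (rule approximation_error[where C=C and l=l and b=b])
        show "\<bar>measure \<mu> (U j) - measure \<mu>0 (C j)\<bar> \<le> \<tau>" if "j < k" for j
          using cells[of j] that by (simp add: B_def p_def)
      qed (use b bL disj UC \<delta> \<sigma>0 \<eta> \<eta>1 Ub \<mu>PA in \<open>auto simp: C_def U_def\<close>)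
      also have "\<dots> \<le> \<kappa> * laplace_density y"
      proof (intro mult_right_mono order_trans[OF mult_left_mono \<kappa>(1)])
        have "\<sigma>\<^sup>2 \<le> (2 * \<sigma>n)\<^sup>2" using \<sigma> \<sigma>0 by (intro power_mono) auto
        then show "\<sigma>\<^sup>2 + \<delta>\<^sup>2 + exp (- C0 * L / 2) + (real k * \<tau> + 2 * \<eta>) * exp L
          \<le> (2 * \<sigma>n)\<^sup>2 + \<delta>\<^sup>2 + exp (- C0 * L / 2) + (real k * ((real k + 2) * t) + 2 * \<eta>) * exp L"
          by (simp add: \<tau>_def algebra_simps)
      qed (use approx_const_pos in auto)
      finally show ?thesis .
    qed
    then have "chi_square \<mu>0 (normal_mixture \<mu> \<sigma>) \<le> ennreal (4 * \<kappa>\<^sup>2 / lower_const + 2 * measure \<mu> (- (\<Union>j<k. U j)))"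
      using Ub by (intro chi_square_le \<mu>PA \<sigma>0 \<kappa>0 \<kappa>(2) sets.finite_UN) auto
    also have "\<dots> \<le> ennreal r"
    proof (intro ennreal_leI order_trans[OF _ r] add_left_mono mult_left_mono)
      have "p k \<le> measure \<mu>0 {x. L \<le> \<bar>x\<bar>}"
        unfolding p_def using L by (auto intro!: \<mu>0.finite_measure_mono)
      also have "\<dots> \<le> 4 * M / C0 * exp (- C0 * L / 2)" by (rule tail_prob_le)
      finally have "p k \<le> 4 * M / C0 * exp (- C0 * L / 2)" .
      then show "measure \<mu> (- (\<Union>j<k. U j)) \<le> 4 * M / C0 * exp (- C0 * L / 2) + (real k + 2) * t"
        using cells[of k] by (simp add: B_def V_def \<tau>_def algebra_simps)
    qed simp
    finally show ?thesis .
  qed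
  have G: "{\<mu> \<in> space (prob_algebra borel). chi_square \<mu>0 \<mu> \<le> ennreal r} \<in> sets (prob_algebra borel)"
    using chi_square_measurable[OF \<mu>0] by measurable
  have I: "{\<sigma>n..2 * \<sigma>n} \<in> sets S" using \<sigma>n by (auto simp: S(2) sets_restrict_space_iff)
  have "measure D E * measure S {\<sigma>n..2 * \<sigma>n}
    \<le> measure (mixture_prior D S) {\<mu> \<in> space (prob_algebra borel). chi_square \<mu>0 \<mu> \<le> ennreal r}"
    using sub \<sigma>n by (intro mixture_prior_ge D' S E I G) (auto simp: E_def intro!: normal_mixture_prob_algebra)
  then show ?thesis using 1 by (meson measure_nonneg mult_right_mono order_trans)
qed

end

section \<open>Entropy of the sieve\<close>

lemma L1_diff_triangle:
  assumes \<mu>: "\<mu> \<in> space (prob_algebra borel)" "\<nu> \<in> space (prob_algebra borel)" and g: "g \<in> borel_measurable borel"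
  shows "L1_diff \<mu> (obs_density \<nu>) \<le> L1_diff \<mu> g + L1_diff \<nu> g"
proof -
  note [measurable] = obs_density_measurable[OF \<mu>(1)] obs_density_measurable[OF \<mu>(2)] g
  have "L1_diff \<mu> (obs_density \<nu>) \<le> (\<integral>\<^sup>+y. ennreal \<bar>obs_density \<mu> y - g y\<bar> + ennreal \<bar>obs_density \<nu> y - g y\<bar> \<partial>lborel)"
    unfolding L1_diff_def by (intro nn_integral_mono) (auto simp flip: ennreal_plus intro!: ennreal_leI)
  also have "\<dots> = L1_diff \<mu> g + L1_diff \<nu> g"
    unfolding L1_diff_def by (intro nn_integral_add) auto
  finally show ?thesis .
qed

text \<open>Two members of one ball are within \<open>\<epsilon>\<^sup>2 / 2\<close> in L1. Hence
  they are closer than \<open>\<epsilon>\<close> in the Hellinger distance, whose square is at most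
  the L1 distance, and closer than \<open>\<epsilon>\<close> in L1 since
  \<open>\<epsilon> \<le> 1\<close>. An \<open>\<epsilon>\<close>-separated set therefore maps
  injectively to the centres.\<close>

lemma packing_number_L1_net_sieve:
  assumes C: "finite C" "C \<subseteq> borel_measurable borel" and \<epsilon>: "0 < \<epsilon>" "\<epsilon> \<le> 1" and d: "d \<in> {hellinger_dist, L1_dist}"
  shows "packing_number \<epsilon> (obs_law ` L1_net_sieve C (\<epsilon>\<^sup>2 / 4)) d \<le> enat (card C)"
  unfolding packing_number_def
proof (rule SUP_least)
  fix S assume "S \<in> {S. S \<subseteq> obs_law ` L1_net_sieve C (\<epsilon>\<^sup>2 / 4) \<and> finite S \<and> pairwise (\<lambda>x y. \<epsilon> \<le> d x y) S}"
  then have S: "S \<subseteq> obs_law ` L1_net_sieve C (\<epsilon>\<^sup>2 / 4)" "finite S" "pairwise (\<lambda>x y. \<epsilon> \<le> d x y) S" by auto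
  have "\<forall>Q\<in>S. \<exists>g. g \<in> C \<and> (\<exists>\<mu>\<in>space (prob_algebra borel). Q = obs_law \<mu> \<and> L1_diff \<mu> g \<le> ennreal (\<epsilon>\<^sup>2 / 4))"
    using S(1) unfolding L1_net_sieve_def by blast
  from bchoice[OF this] obtain c where c: "\<And>Q. Q \<in> S \<Longrightarrow> c Q \<in> C"
    "\<And>Q. Q \<in> S \<Longrightarrow> \<exists>\<mu>\<in>space (prob_algebra borel). Q = obs_law \<mu> \<and> L1_diff \<mu> (c Q) \<le> ennreal (\<epsilon>\<^sup>2 / 4)" by blast
  have "inj_on c S"
  proof (rule inj_onI, rule ccontr)
    fix Q R assume QR: "Q \<in> S" "R \<in> S" "c Q = c R" "Q \<noteq> R"
    obtain \<mu> where \<mu>: "\<mu> \<in> space (prob_algebra borel)" "Q = obs_law \<mu>" "L1_diff \<mu> (c Q) \<le> ennreal (\<epsilon>\<^sup>2 / 4)" using c(2)[OF QR(1)] by blast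
    obtain \<nu> where \<nu>: "\<nu> \<in> space (prob_algebra borel)" "R = obs_law \<nu>" "L1_diff \<nu> (c Q) \<le> ennreal (\<epsilon>\<^sup>2 / 4)" using c(2)[OF QR(2)] QR(3) by auto
    have "L1_diff \<mu> (obs_density \<nu>) \<le> L1_diff \<mu> (c Q) + L1_diff \<nu> (c Q)"
      using c(1)[OF QR(1)] C(2) by (intro L1_diff_triangle \<mu> \<nu>) auto
    also have "\<dots> \<le> ennreal (\<epsilon>\<^sup>2 / 4) + ennreal (\<epsilon>\<^sup>2 / 4)" by (intro add_mono \<mu> \<nu>)
    also have "\<dots> = ennreal (\<epsilon>\<^sup>2 / 2)" by (simp flip: ennreal_plus)
    finally have L: "L1_diff \<mu> (obs_density \<nu>) \<le> ennreal (\<epsilon>\<^sup>2 / 2)" .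
    have dQR: "\<epsilon> \<le> d Q R" using S(3) QR by (auto simp: pairwise_def)
    have e2: "\<epsilon>\<^sup>2 / 2 < \<epsilon>\<^sup>2" using \<epsilon> by simp
    from d show False
    proof safe
      assume "d = hellinger_dist"
      then have "\<epsilon>\<^sup>2 \<le> (hellinger_dist Q R)\<^sup>2" using dQR \<epsilon> by (intro power_mono) auto
      moreover have "ennreal ((hellinger_dist Q R)\<^sup>2) \<le> ennreal (\<epsilon>\<^sup>2 / 2)"
        using order_trans[OF hellinger_dist_obs_law[OF \<mu>(1) \<nu>(1)] L] \<mu>(2) \<nu>(2) by (simp only:)
      then have "(hellinger_dist Q R)\<^sup>2 \<le> \<epsilon>\<^sup>2 / 2" by (simp add: ennreal_le_iff)
      ultimately show False using e2 by linarith
    next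
      assume "d = L1_dist"
      have "\<epsilon>\<^sup>2 \<le> \<epsilon>" using \<epsilon> mult_left_mono[of \<epsilon> 1 \<epsilon>] by (simp add: power2_eq_square)
      then have "\<epsilon>\<^sup>2 \<le> L1_dist Q R" using dQR \<open>d = L1_dist\<close> by simp
      moreover have "ennreal (L1_dist Q R) \<le> ennreal (\<epsilon>\<^sup>2 / 2)"
        using L1_dist_obs_law[OF \<mu>(1) \<nu>(1)] L \<mu>(2) \<nu>(2) by (simp only:)
      then have "L1_dist Q R \<le> \<epsilon>\<^sup>2 / 2" by (simp add: ennreal_le_iff)
      ultimately show False using e2 by linarith
    qed
  qed
  then have "card S \<le> card C" using c(1) C(1) by (intro card_inj_on_le[of c]) auto
  then show "enat (card S) \<le> enat (card C)" by simp
qed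

definition mixture_net :: "nat \<Rightarrow> real \<Rightarrow> nat \<Rightarrow> (nat \<Rightarrow> real) \<Rightarrow> nat \<Rightarrow> nat \<Rightarrow> (real \<Rightarrow> real) set" where
  "mixture_net S r K x m N =
    (\<lambda>p y. \<Sum>i<N. real (snd (snd p i)) / real m * smooth_laplace (real (fst p) * r) (y - x (fst (snd p i))))
      ` ({..S} \<times> PiE {..<N} (\<lambda>_. {..<K} \<times> {..m}))"

lemma mixture_net:
  shows finite_mixture_net: "finite (mixture_net S r K x m N)"
    and card_mixture_net: "card (mixture_net S r K x m N) \<le> (S + 1) * (K * (m + 1)) ^ N"
    and mixture_net_measurable: "mixture_net S r K x m N \<subseteq> borel_measurable borel"
proof -
  let ?D = "{..S} \<times> PiE {..<N} (\<lambda>_. {..<K} \<times> {..m})"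
  have f: "finite ?D" by (intro finite_cartesian_product finite_PiE) auto
  then show "finite (mixture_net S r K x m N)" unfolding mixture_net_def by (rule finite_imageI)
  have "card (mixture_net S r K x m N) \<le> card ?D" unfolding mixture_net_def by (rule card_image_le[OF f])
  also have "card ?D = (S + 1) * (K * (m + 1)) ^ N" by (simp add: card_cartesian_product card_PiE)
  finally show "card (mixture_net S r K x m N) \<le> (S + 1) * (K * (m + 1)) ^ N" .
  show "mixture_net S r K x m N \<subseteq> borel_measurable borel"
  proof
    fix g assume "g \<in> mixture_net S r K x m N"
    then obtain p where g: "g = (\<lambda>y. \<Sum>i<N. real (snd (snd p i)) / real m * smooth_laplace (real (fst p) * r) (y - x (fst (snd p i))))"
      unfolding mixture_net_def by (elim imageE) (rule that)
    show "g \<in> borel_measurable borel" unfolding g by measurable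
  qed
qed

text \<open>The terms of the error are, in order: rounding the bandwidth to the grid, discarding the
  mass outside the cells of \<open>J\<close>, moving the mass of a cell to \<open>x j\<close>, and
  rounding at most \<open>N\<close> weights. Each is an L1 error of kernels of total mass 1, hence
  uniform in the bandwidth.\<close>

lemma mixture_net_approximates:
  fixes \<mu> :: "real measure" and I :: "nat \<Rightarrow> real set"
  assumes \<mu>: "\<mu> \<in> space (prob_algebra borel)" and \<sigma>: "0 < \<sigma>" "\<sigma> \<le> real S * r" and r: "0 < r" "r \<le> 1"
    and I: "\<And>j. j < K \<Longrightarrow> I j \<in> sets borel" "\<And>j. j < K \<Longrightarrow> I j \<subseteq> {x j..x j + w}" "disjoint_family_on I {..<K}"
    and w: "0 \<le> w" "w \<le> 1" and J: "J \<subseteq> {..<K}" "card J \<le> N" and K: "0 < K" and m: "0 < m"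
    and out: "measure \<mu> (- (\<Union>j\<in>J. I j)) \<le> e"
  shows "\<exists>g\<in>mixture_net S r K x m N. L1_diff (normal_mixture \<mu> \<sigma>) g \<le> ennreal (exp_abs_moment * r + e + 2 * w + real N / real m)"
proof -
  interpret mu: prob_space \<mu> using prob_algebra_borelD[OF \<mu>] by simp
  interpret pair_sigma_finite lborel \<mu> by unfold_locales
  note [measurable_cong] = prob_algebra_borelD(2)[OF \<mu>]
  have e0: "0 \<le> e" using out measure_nonneg[of \<mu>] order_trans by blast
  \<comment> \<open>Rounding down may give 0, where the kernel is the Laplace density
    itself.\<close>
  define s where "s = nat \<lfloor>\<sigma> / r\<rfloor>"
  have s1: "real s * r \<le> \<sigma>" "\<sigma> < real s * r + r"
  proof -
    have "real s = real_of_int \<lfloor>\<sigma> / r\<rfloor>" using \<sigma> r by (simp add: s_def)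
    then have "real s \<le> \<sigma> / r" "\<sigma> / r < real s + 1" by linarith+
    then show "real s * r \<le> \<sigma>" "\<sigma> < real s * r + r" using r by (simp_all add: field_simps)
  qed
  have sS: "s \<le> S"
  proof -
    have "real s * r \<le> real S * r" using s1 \<sigma> by linarith
    then show ?thesis using r by simp
  qed
  let ?G = "smooth_laplace \<sigma>" and ?H = "smooth_laplace (real s * r)"
  have finJ: "finite J" using J finite_subset by blast
  obtain q where q: "bij_betw q {..<card J} J"
    using ex_bij_betw_nat_finite[OF finJ] by (auto simp: atLeast0LessThan)
  define v where "v j = nat \<lfloor>real m * measure \<mu> (I j)\<rfloor>" for j
  have v: "real (v j) / real m \<le> measure \<mu> (I j)" "measure \<mu> (I j) \<le> real (v j) / real m + 1 / real m" "v j \<le> m" for j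
  proof -
    have 0: "0 \<le> real m * measure \<mu> (I j)" by simp
    have "real (v j) = real_of_int \<lfloor>real m * measure \<mu> (I j)\<rfloor>" by (simp add: v_def)
    then have 1: "real (v j) \<le> real m * measure \<mu> (I j)" "real m * measure \<mu> (I j) \<le> real (v j) + 1" by linarith+
    then show "real (v j) / real m \<le> measure \<mu> (I j)" "measure \<mu> (I j) \<le> real (v j) / real m + 1 / real m"
      using m by (simp_all add: field_simps)
    have "real m * measure \<mu> (I j) \<le> real m * 1" by (intro mult_left_mono mu.prob_le_1) auto
    then show "v j \<le> m" using 1 by linarith
  qed
  \<comment> \<open>Slots beyond \<open>card J\<close> are padded with weight 0 and cell 0, a legal
    index by \<open>0 < K\<close>.\<close>
  define f where "f = (\<lambda>i\<in>{..<N}. if i < card J then (q i, v (q i)) else (0, 0))"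
  have qJ: "q i \<in> J" if "i < card J" for i using q that by (auto simp: bij_betw_def)
  have qK: "q i < K" if "i < card J" for i using qJ[OF that] J(1) by auto
  have f: "f \<in> PiE {..<N} (\<lambda>_. {..<K} \<times> {..m})"
    using qK v(3) K by (auto simp: f_def)
  define g where "g y = (\<Sum>i<N. real (snd (f i)) / real m * ?H (y - x (fst (f i))))" for y
  have gC: "g \<in> mixture_net S r K x m N"
    unfolding mixture_net_def g_def[abs_def] using f sS by (intro image_eqI[where x="(s, f)"]) auto
  have gJ: "g y = (\<Sum>j\<in>J. real (v j) / real m * ?H (y - x j))" for y
  proof -
    have "g y = (\<Sum>i<card J. real (snd (f i)) / real m * ?H (y - x (fst (f i))))"
      unfolding g_def using J(2) by (intro sum.mono_neutral_right) (auto simp: f_def)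
    also have "\<dots> = (\<Sum>i<card J. real (v (q i)) / real m * ?H (y - x (q i)))"
      using J(2) by (intro sum.cong) (auto simp: f_def)
    also have "\<dots> = (\<Sum>j\<in>J. real (v j) / real m * ?H (y - x j))"
      by (rule sum.reindex_bij_betw[OF q])
    finally show ?thesis .
  qed
  define A where "A = (\<Union>j\<in>J. I j)"
  have IJ: "I j \<in> sets borel" "I j \<subseteq> {x j..x j + w}" if "j \<in> J" for j using I J that by auto
  have A[measurable]: "A \<in> sets borel" unfolding A_def using finJ IJ by (intro sets.finite_UN) auto
  have disjJ: "disjoint_family_on I J" using I(3) J(1) by (rule disjoint_family_on_mono[rotated])
  have iG: "integrable \<mu> (\<lambda>h. smooth_laplace c (y - h) * indicator B h)" if "B \<in> sets borel" for c y B
  proof -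
    have "smooth_laplace c u \<le> 1" for u using smooth_laplace_le[of c u] by simp
    then show ?thesis using that by (intro mu.integrable_const_bound[where B=1]) (auto simp: indicator_def)
  qed
  have iG1: "integrable \<mu> (\<lambda>h. smooth_laplace c (y - h))" for c y using iG[of UNIV] by simp
  have q_eq: "obs_density (normal_mixture \<mu> \<sigma>) y = (\<integral>h. ?G (y - h) \<partial>\<mu>)" for y
    using obs_density_normal_mixture[OF \<mu> \<sigma>(1), of y] by (simp only: conv_density_def[of ?G])
  let ?T1 = "\<lambda>y. (\<integral>h. \<bar>?G (y - h) - ?H (y - h)\<bar> \<partial>\<mu>)" and ?T2 = "\<lambda>y. (\<integral>h. ?H (y - h) * indicator (- A) h \<partial>\<mu>)"
    and ?T3 = "\<lambda>y. (\<Sum>j\<in>J. (2 * w * measure \<mu> (I j) + 1 / real m) * ?H (y - x j))"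
  have iT1: "integrable \<mu> (\<lambda>h. \<bar>?G (y - h) - ?H (y - h)\<bar>)" for y
    by (intro integrable_abs Bochner_Integration.integrable_diff iG1)
  have cell: "\<bar>(\<integral>h. ?H (y - h) * indicator (I j) h \<partial>\<mu>) - real (v j) / real m * ?H (y - x j)\<bar>
    \<le> (2 * w * measure \<mu> (I j) + 1 / real m) * ?H (y - x j)" if j: "j \<in> J" for j y
  proof -
    note IJ(1)[OF j, measurable]
    have ic: "integrable \<mu> (\<lambda>h. ?H (y - x j) * indicator (I j) h)"
      by (intro integrable_mult_right mu.integrable_const_bound[where B=1]) auto
    have "\<bar>(\<integral>h. ?H (y - h) * indicator (I j) h \<partial>\<mu>) - measure \<mu> (I j) * ?H (y - x j)\<bar>
      = \<bar>\<integral>h. ?H (y - h) * indicator (I j) h - ?H (y - x j) * indicator (I j) h \<partial>\<mu>\<bar>"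
      using iG[OF IJ(1)[OF j]] ic by (subst Bochner_Integration.integral_diff) (auto simp: prob_algebra_borelD[OF \<mu>] mult.commute)
    also have "\<dots> \<le> (\<integral>h. 2 * w * (?H (y - x j) * indicator (I j) h) \<partial>\<mu>)"
    proof (rule order_trans[OF integral_abs_bound], rule integral_mono')
      show "integrable \<mu> (\<lambda>h. 2 * w * (?H (y - x j) * indicator (I j) h))" by (intro integrable_mult_right ic)
      fix h
      show "\<bar>?H (y - h) * indicator (I j) h - ?H (y - x j) * indicator (I j) h\<bar> \<le> 2 * w * (?H (y - x j) * indicator (I j) h)"
      proof (cases "h \<in> I j")
        case True
        then have "\<bar>(y - h) - (y - x j)\<bar> \<le> w" using IJ(2)[OF j] by auto
        then have "exp \<bar>(y - h) - (y - x j)\<bar> - 1 \<le> 2 * w"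
          using exp_minus_one_le_double[OF w] exp_le_cancel_iff[of "\<bar>(y - h) - (y - x j)\<bar>" w] by linarith
        then have "\<bar>?H (y - h) - ?H (y - x j)\<bar> \<le> 2 * w * ?H (y - x j)"
          by (intro order_trans[OF smooth_laplace_diff] mult_right_mono) auto
        then show ?thesis using True by simp
      qed simp
      show "0 \<le> 2 * w * (?H (y - x j) * indicator (I j) h)" using w by (intro mult_nonneg_nonneg) auto
    qed
    also have "\<dots> = 2 * w * measure \<mu> (I j) * ?H (y - x j)" by (simp add: prob_algebra_borelD[OF \<mu>])
    finally have 1: "\<bar>(\<integral>h. ?H (y - h) * indicator (I j) h \<partial>\<mu>) - measure \<mu> (I j) * ?H (y - x j)\<bar> \<le> 2 * w * measure \<mu> (I j) * ?H (y - x j)" .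
    have "\<bar>measure \<mu> (I j) * ?H (y - x j) - real (v j) / real m * ?H (y - x j)\<bar> \<le> 1 / real m * ?H (y - x j)"
      unfolding left_diff_distrib[symmetric] abs_mult using v[of j] by (intro mult_mono) (auto simp: abs_le_iff)
    with 1 show ?thesis unfolding distrib_right by linarith
  qed
  have pw: "\<bar>obs_density (normal_mixture \<mu> \<sigma>) y - g y\<bar> \<le> ?T1 y + ?T2 y + ?T3 y" for y
  proof -
    have s1: "(\<integral>h. ?H (y - h) \<partial>\<mu>) = ?T2 y + (\<Sum>j\<in>J. (\<integral>h. ?H (y - h) * indicator (I j) h \<partial>\<mu>))"
    proof -
      have "(\<integral>h. ?H (y - h) \<partial>\<mu>) = (\<integral>h. ?H (y - h) * indicator (- A) h + ?H (y - h) * indicator A h \<partial>\<mu>)"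
        by (intro Bochner_Integration.integral_cong) (auto simp: indicator_def)
      also have "\<dots> = ?T2 y + (\<integral>h. ?H (y - h) * indicator A h \<partial>\<mu>)"
        by (intro Bochner_Integration.integral_add iG A borel_comp)
      also have "(\<integral>h. ?H (y - h) * indicator A h \<partial>\<mu>) = (\<integral>h. (\<Sum>j\<in>J. ?H (y - h) * indicator (I j) h) \<partial>\<mu>)"
      proof (intro Bochner_Integration.integral_cong refl)
        fix h
        have "(indicator A h :: real) = (\<Sum>j\<in>J. indicator (I j) h)"
          unfolding A_def by (rule indicator_UN_disjoint[OF finJ disjJ])
        then show "?H (y - h) * indicator A h = (\<Sum>j\<in>J. ?H (y - h) * indicator (I j) h)"
          by (simp add: sum_distrib_left)
      qed
      also have "\<dots> = (\<Sum>j\<in>J. (\<integral>h. ?H (y - h) * indicator (I j) h \<partial>\<mu>))"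
        by (intro Bochner_Integration.integral_sum iG IJ)
      finally show ?thesis .
    qed
    have "\<bar>(\<integral>h. ?G (y - h) \<partial>\<mu>) - (\<integral>h. ?H (y - h) \<partial>\<mu>)\<bar> \<le> ?T1 y"
      by (subst Bochner_Integration.integral_diff[symmetric]) (auto intro!: iG1 integral_abs_bound)
    moreover have "\<bar>(\<Sum>j\<in>J. (\<integral>h. ?H (y - h) * indicator (I j) h \<partial>\<mu>)) - g y\<bar> \<le> ?T3 y"
      unfolding gJ sum_subtractf[symmetric] by (intro order_trans[OF sum_abs] sum_mono cell)
    moreover have "0 \<le> ?T2 y" by (intro Bochner_Integration.integral_nonneg) auto
    ultimately show ?thesis unfolding q_eq using s1 by linarith
  qed
  have T1: "ennreal (?T1 y) = (\<integral>\<^sup>+h. ennreal \<bar>?G (y - h) - ?H (y - h)\<bar> \<partial>\<mu>)" for y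
    by (intro nn_integral_eq_integral[symmetric] iT1) simp
  have T2: "ennreal (?T2 y) = (\<integral>\<^sup>+h. ennreal (?H (y - h)) * indicator (- A) h \<partial>\<mu>)" for y
  proof -
    have "ennreal (?T2 y) = (\<integral>\<^sup>+h. ennreal (?H (y - h) * indicator (- A) h) \<partial>\<mu>)"
      by (intro nn_integral_eq_integral[symmetric] iG borel_comp A) simp
    also have "\<dots> = (\<integral>\<^sup>+h. ennreal (?H (y - h)) * indicator (- A) h \<partial>\<mu>)"
      by (intro nn_integral_cong) (simp add: indicator_def)
    finally show ?thesis .
  qed
  have [measurable]: "(\<lambda>y. ennreal (?T1 y)) \<in> borel_measurable lborel" unfolding T1 by measurable
  have [measurable]: "(\<lambda>y. ennreal (?T2 y)) \<in> borel_measurable lborel" unfolding T2 by measurable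
  have [measurable]: "(\<lambda>y. ennreal (?T3 y)) \<in> borel_measurable lborel" by measurable
  have iT1': "(\<integral>\<^sup>+y. ennreal (?T1 y) \<partial>lborel) \<le> ennreal (exp_abs_moment * r)"
  proof -
    have "(\<integral>\<^sup>+y. ennreal (?T1 y) \<partial>lborel) = (\<integral>\<^sup>+h. \<integral>\<^sup>+y. ennreal \<bar>?G (y - h) - ?H (y - h)\<bar> \<partial>lborel \<partial>\<mu>)"
      unfolding T1 by (rule Fubini'[symmetric]) measurable
    also have "\<dots> \<le> (\<integral>\<^sup>+h. ennreal (exp_abs_moment * r) \<partial>\<mu>)"
    proof (intro nn_integral_mono)
      fix h
      have ab: "\<bar>\<sigma> - real s * r\<bar> \<le> r" using s1 by auto
      have "(\<integral>\<^sup>+y. ennreal \<bar>?G (y - h) - ?H (y - h)\<bar> \<partial>lborel) = (\<integral>\<^sup>+y. ennreal \<bar>?G y - ?H y\<bar> \<partial>lborel)"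
        by (rule nn_integral_shift[of "\<lambda>y. ennreal \<bar>?G y - ?H y\<bar>"]) measurable
      also have "\<dots> \<le> ennreal (exp_abs_moment * \<bar>\<sigma> - real s * r\<bar>)"
        using ab r by (intro smooth_laplace_bandwidth) auto
      also have "\<dots> \<le> ennreal (exp_abs_moment * r)"
        using ab exp_abs_moment_ge by (intro ennreal_leI mult_left_mono) auto
      finally show "(\<integral>\<^sup>+y. ennreal \<bar>?G (y - h) - ?H (y - h)\<bar> \<partial>lborel) \<le> ennreal (exp_abs_moment * r)" .
    qed
    also have "\<dots> = ennreal (exp_abs_moment * r)" by (simp add: mu.emeasure_space_1)
    finally show ?thesis .
  qed
  have iH: "(\<integral>\<^sup>+y. ennreal (?H (y - h)) \<partial>lborel) = 1" for h
    using nn_integral_shift[of "\<lambda>y. ennreal (?H y)" h] by (simp add: nn_integral_smooth_laplace)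
  have iT2': "(\<integral>\<^sup>+y. ennreal (?T2 y) \<partial>lborel) \<le> ennreal e"
  proof -
    have "(\<integral>\<^sup>+y. ennreal (?T2 y) \<partial>lborel) = (\<integral>\<^sup>+h. \<integral>\<^sup>+y. ennreal (?H (y - h)) * indicator (- A) h \<partial>lborel \<partial>\<mu>)"
      unfolding T2 by (rule Fubini'[symmetric]) measurable
    also have "\<dots> = (\<integral>\<^sup>+h. indicator (- A) h \<partial>\<mu>)"
      by (intro nn_integral_cong) (simp add: nn_integral_multc iH)
    also have "\<dots> = ennreal (measure \<mu> (- A))" using A by (simp add: mu.emeasure_eq_measure prob_algebra_borelD[OF \<mu>])
    also have "\<dots> \<le> ennreal e" using out by (intro ennreal_leI) (simp add: A_def)
    finally show ?thesis .
  qed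
  have iT3': "(\<integral>\<^sup>+y. ennreal (?T3 y) \<partial>lborel) \<le> ennreal (2 * w + real N / real m)"
  proof -
    have "(\<integral>\<^sup>+y. ennreal (?T3 y) \<partial>lborel) = (\<integral>\<^sup>+y. (\<Sum>j\<in>J. ennreal (2 * w * measure \<mu> (I j) + 1 / real m) * ennreal (?H (y - x j))) \<partial>lborel)"
      using w by (intro nn_integral_cong) (simp add: sum_ennreal[symmetric] ennreal_mult')
    also have "\<dots> = (\<Sum>j\<in>J. ennreal (2 * w * measure \<mu> (I j) + 1 / real m))"
      by (subst nn_integral_sum) (auto simp: nn_integral_cmult iH)
    also have "\<dots> = ennreal (\<Sum>j\<in>J. 2 * w * measure \<mu> (I j) + 1 / real m)"
      using w by (intro sum_ennreal) auto
    also have "\<dots> \<le> ennreal (2 * w + real N / real m)"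
    proof (intro ennreal_leI)
      have "(\<Sum>j\<in>J. measure \<mu> (I j)) = measure \<mu> (\<Union>j\<in>J. I j)"
        using IJ(1) finJ disjJ by (intro mu.finite_measure_finite_Union[symmetric]) (auto simp: prob_algebra_borelD[OF \<mu>])
      then have "(\<Sum>j\<in>J. measure \<mu> (I j)) \<le> 1" by simp
      then have "2 * w * (\<Sum>j\<in>J. measure \<mu> (I j)) \<le> 2 * w * 1" using w by (intro mult_left_mono) auto
      moreover have "real (card J) / real m \<le> real N / real m" using J(2) m by (intro divide_right_mono) auto
      ultimately show "(\<Sum>j\<in>J. 2 * w * measure \<mu> (I j) + 1 / real m) \<le> 2 * w + real N / real m"
        by (simp add: sum.distrib flip: sum_distrib_left)
    qed
    finally show ?thesis .
  qed
  have "L1_diff (normal_mixture \<mu> \<sigma>) g \<le> (\<integral>\<^sup>+y. ennreal (?T1 y) + ennreal (?T2 y) + ennreal (?T3 y) \<partial>lborel)"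
    unfolding L1_diff_def
  proof (intro nn_integral_mono)
    fix y
    have "0 \<le> ?T1 y" "0 \<le> ?T2 y" "0 \<le> ?T3 y"
      using w by (auto intro!: Bochner_Integration.integral_nonneg sum_nonneg)
    then have "ennreal (?T1 y) + ennreal (?T2 y) + ennreal (?T3 y) = ennreal (?T1 y + ?T2 y + ?T3 y)"
      by (simp only: ennreal_plus add_nonneg_nonneg)
    then show "ennreal \<bar>obs_density (normal_mixture \<mu> \<sigma>) y - g y\<bar> \<le> ennreal (?T1 y) + ennreal (?T2 y) + ennreal (?T3 y)"
      using pw[of y] by (simp only: ennreal_leI)
  qed
  also have "\<dots> = (\<integral>\<^sup>+y. ennreal (?T1 y) \<partial>lborel) + (\<integral>\<^sup>+y. ennreal (?T2 y) \<partial>lborel) + (\<integral>\<^sup>+y. ennreal (?T3 y) \<partial>lborel)"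
    by (subst nn_integral_add, measurable, subst nn_integral_add, measurable)
  also have "\<dots> \<le> ennreal (exp_abs_moment * r) + ennreal e + ennreal (2 * w + real N / real m)"
    by (intro add_mono iT1' iT2' iT3')
  also have "\<dots> = ennreal (exp_abs_moment * r + e + 2 * w + real N / real m)"
    using e0 w r exp_abs_moment_ge by (simp flip: ennreal_plus add: add.assoc)
  finally show ?thesis using gC by blast
qed

text \<open>If the exterior has mass at most \<open>t\<close> and at most \<open>N\<close> cells
  have more than \<open>t\<close>, keeping only those cells discards at most
  \<open>(K + 1) * t\<close>, so the mixture is near the net unless its bandwidth exceeds the grid.
  The bound adds the Dirichlet probability of the opposite event to the tail of the bandwidth
  law.\<close>

lemma sieve_mass_le:
  fixes K N m Sg :: nat and a w t s0 l r A C \<beta> \<rho> :: real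
  assumes D: "dirichlet_process H D" and H: "finite_measure H" "sets H = sets borel" and A: "A = measure H UNIV"
    and S: "prob_space S" "sets S = sets (restrict_space borel {0<..})"
    and w: "0 < w" "w \<le> 1" "real K * w = 2 * a" and a: "0 < a"
    and cells: "\<And>j. j < K \<Longrightarrow> measure H {- a + real j * w..<- a + real j * w + w} \<le> 1" and out: "measure H (- {- a..<a}) \<le> 1"
    and C: "\<And>K N a A t s0 l. (\<And>i. 0 \<le> a i) \<Longrightarrow> (\<And>i. i \<le> K \<Longrightarrow> a i \<le> 1) \<Longrightarrow> (\<Sum>i\<le>K. a i) = A \<Longrightarrow>
       0 < s0 \<Longrightarrow> exp 1 * (1 + 1 / s0) powr (- A) \<le> 1 / 2 \<Longrightarrow> 0 < t \<Longrightarrow> 1 \<le> l \<Longrightarrow>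
       measure (dirichlet_law (Suc K) a) {x\<in>space (PiM {..<Suc K} (\<lambda>_. borel)). t < x K \<or> N < card {j\<in>{..<K}. t < x j}}
         \<le> 2 * (a K * C * (t * s0) powr (- \<beta>) + l powr (- real N) * exp (l * A * C * (t * s0) powr (- \<beta>)))"
    and s0: "0 < s0" "exp 1 * (1 + 1 / s0) powr (- A) \<le> 1 / 2" and t: "0 < t" and l: "1 \<le> l"
    and r: "0 < r" "r \<le> 1" and m: "0 < m"
    and \<rho>: "exp_abs_moment * r + (real K + 1) * t + 2 * w + real N / real m \<le> \<rho>"
  shows "measure (mixture_prior D S) (space (prob_algebra borel) - L1_net_sieve (mixture_net Sg r K (\<lambda>j. - a + real j * w) m N) \<rho>)
    \<le> 2 * (measure H (- {- a..<a}) * C * (t * s0) powr (- \<beta>) + l powr (- real N) * exp (l * A * C * (t * s0) powr (- \<beta>)))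
      + measure S {real Sg * r<..}"
proof -
  interpret H: finite_measure H by (rule H)
  have D': "prob_space D" "sets D = sets (prob_algebra borel)" using D by (auto simp: dirichlet_process_def)
  have spD: "space D = space (prob_algebra borel)" using D'(2) by (rule sets_eq_imp_space_eq)
  have spS: "space S = {0<..}" using sets_eq_imp_space_eq[OF S(2)] by (simp add: space_restrict_space)
  have K: "0 < K" using w a by (cases "K = 0") auto
  let ?x = "\<lambda>j. - a + real j * w"
  define I where "I j = {?x j..<?x j + w}" for j
  have disj: "disjoint_family_on I {..<K}" and UI: "(\<Union>j<K. I j) = {- a..<a}"
    using interval_cells[OF w(1), of "- a" K] w(3) by (simp_all add: I_def[abs_def])
  define B where "B i = (if i < K then I i else - {- a..<a})" for i
  have Bb: "B i \<in> sets borel" for i by (simp add: B_def I_def)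
  have IU: "I i \<subseteq> {- a..<a}" if "i < K" for i using that unfolding UI[symmetric] by blast
  have IU': "I i \<inter> - {- a..<a} = {}" "- {- a..<a} \<inter> I i = {}" if "i < K" for i using IU[OF that] by blast+
  have Bd: "disjoint_family_on B {..<Suc K}"
  proof (unfold disjoint_family_on_def, intro ballI impI)
    fix i j assume ij: "i \<in> {..<Suc K}" "j \<in> {..<Suc K}" "i \<noteq> j"
    show "B i \<inter> B j = {}"
    proof (cases "i < K \<and> j < K")
      case True
      then show ?thesis using disj ij(3) by (simp add: B_def disjoint_family_on_def)
    next
      case False
      then have "i < K \<and> j = K \<or> i = K \<and> j < K" using ij by auto
      then show ?thesis using IU' by (elim disjE conjE) (simp_all only: B_def if_True if_False less_irrefl)
    qed
  qed
  have BU: "(\<Union>i<Suc K. B i) = UNIV"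
  proof -
    have "(\<Union>i<Suc K. B i) = (\<Union>i<K. I i) \<union> - {- a..<a}" by (auto simp: B_def lessThan_Suc)
    then show ?thesis unfolding UI by simp
  qed
  define F where "F = {x\<in>space (PiM {..<Suc K} (\<lambda>_. borel :: real measure)). t < x K \<or> N < card {j\<in>{..<K}. t < x j}}"
  have F: "F \<in> sets (PiM {..<Suc K} (\<lambda>_. borel))" unfolding F_def by (rule many_cells_measurable)
  define E where "E = {\<mu>\<in>space (prob_algebra borel). (\<lambda>i\<in>{..<Suc K}. measure \<mu> (B i)) \<in> F}"
  have E: "E \<in> sets D" "measure D E = measure (dirichlet_law (Suc K) (\<lambda>i. measure H (B i))) F"
    unfolding E_def by (rule dirichlet_process_cells[OF D _ Bb Bd BU F]; simp)+
  have "measure D E \<le> 2 * (measure H (B K) * C * (t * s0) powr (- \<beta>) + l powr (- real N) * exp (l * A * C * (t * s0) powr (- \<beta>)))"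
    unfolding E(2) F_def
  proof (rule C)
    show "measure H (B i) \<le> 1" if "i \<le> K" for i using cells[of i] out by (simp add: B_def I_def)
    have "(\<Sum>i\<le>K. measure H (B i)) = measure H (\<Union>i<Suc K. B i)"
      unfolding lessThan_Suc_atMost[symmetric] using Bb by (intro H.finite_measure_finite_Union[OF _ _ Bd, symmetric]) (auto simp: H)
    then show "(\<Sum>i\<le>K. measure H (B i)) = A" unfolding BU A .
  qed (use s0 t l in auto)
  then have DE: "measure D E \<le> 2 * (measure H (- {- a..<a}) * C * (t * s0) powr (- \<beta>) + l powr (- real N) * exp (l * A * C * (t * s0) powr (- \<beta>)))"
    by (simp add: B_def)
  let ?C = "mixture_net Sg r K ?x m N"
  have sub: "normal_mixture \<mu> \<sigma> \<in> L1_net_sieve ?C \<rho>" if \<mu>: "\<mu> \<in> space D - E" and \<sigma>: "\<sigma> \<in> space S - {real Sg * r<..}" for \<mu> \<sigma>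
  proof -
    have \<mu>': "\<mu> \<in> space (prob_algebra borel)" using \<mu> by (simp add: spD)
    interpret mu: prob_space \<mu> using prob_algebra_borelD[OF \<mu>'] by simp
    have \<sigma>': "0 < \<sigma>" "\<sigma> \<le> real Sg * r" using \<sigma> by (auto simp: spS)
    define J where "J = {j\<in>{..<K}. t < measure \<mu> (I j)}"
    have "(\<lambda>i\<in>{..<Suc K}. measure \<mu> (B i)) \<notin> F" using \<mu> \<mu>' by (simp add: E_def)
    then have nF: "measure \<mu> (B K) \<le> t" "card {j\<in>{..<K}. t < (\<lambda>i\<in>{..<Suc K}. measure \<mu> (B i)) j} \<le> N"
      by (auto simp: F_def space_PiM not_less)
    have "{j\<in>{..<K}. t < (\<lambda>i\<in>{..<Suc K}. measure \<mu> (B i)) j} = J" by (auto simp: J_def B_def)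
    then have J: "J \<subseteq> {..<K}" "card J \<le> N" using nF(2) by (auto simp: J_def)
    have sb: "sets \<mu> = sets borel" by (rule prob_algebra_borelD[OF \<mu>'])
    have Ib: "I j \<in> sets borel" for j by (simp add: I_def)
    have "- (\<Union>j\<in>J. I j) \<subseteq> B K \<union> (\<Union>j\<in>{..<K} - J. I j)"
    proof -
      have "UNIV = (\<Union>j<K. I j) \<union> B K" unfolding UI by (auto simp: B_def)
      then show ?thesis by blast
    qed
    then have "measure \<mu> (- (\<Union>j\<in>J. I j)) \<le> measure \<mu> (B K \<union> (\<Union>j\<in>{..<K} - J. I j))"
      using Ib Bb by (intro mu.finite_measure_mono) (auto simp: sb)
    also have "\<dots> \<le> measure \<mu> (B K) + measure \<mu> (\<Union>j\<in>{..<K} - J. I j)"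
      using Ib Bb by (intro measure_Un_le) (auto simp: sb)
    also have "measure \<mu> (\<Union>j\<in>{..<K} - J. I j) \<le> (\<Sum>j\<in>{..<K} - J. measure \<mu> (I j))"
      using Ib by (intro mu.finite_measure_subadditive_finite) (auto simp: sb)
    also have "\<dots> \<le> (\<Sum>j\<in>{..<K} - J. t)" by (intro sum_mono) (auto simp: J_def)
    also have "\<dots> \<le> real K * t"
    proof -
      have "card ({..<K} - J) \<le> card {..<K}" by (intro card_mono) auto
      then have "real (card ({..<K} - J)) * t \<le> real K * t" using t by (intro mult_right_mono) auto
      then show ?thesis by simp
    qed
    finally have out': "measure \<mu> (- (\<Union>j\<in>J. I j)) \<le> (real K + 1) * t" using nF(1) by (simp add: algebra_simps)
    have "\<exists>g\<in>?C. L1_diff (normal_mixture \<mu> \<sigma>) g \<le> ennreal (exp_abs_moment * r + (real K + 1) * t + 2 * w + real N / real m)"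
      using w by (intro mixture_net_approximates[OF \<mu>' \<sigma>' r _ _ disj _ _ J K m out']) (auto simp: I_def)
    then show ?thesis
      using normal_mixture_prob_algebra[OF \<mu>' \<sigma>'(1)] \<rho> unfolding L1_net_sieve_def
      by (auto intro: order_trans[OF _ ennreal_leI])
  qed
  have "measure (mixture_prior D S) (space (prob_algebra borel) - L1_net_sieve ?C \<rho>) \<le> measure D E + measure S {real Sg * r<..}"
  proof (rule mixture_prior_le[OF D' S E(1)])
    show "{real Sg * r<..} \<in> sets S" using r by (auto simp: S(2) sets_restrict_space_iff intro: le_less_trans[of 0 "real Sg * r"])
    show "space (prob_algebra borel) - L1_net_sieve ?C \<rho> \<in> sets (prob_algebra borel)"
      by (intro sets.compl_sets L1_net_sieve_measurable finite_mixture_net mixture_net_measurable)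
  qed (use sub in auto)
  with DE show ?thesis by linarith
qed

section \<open>Rates\<close>

definition rate :: "real \<Rightarrow> nat \<Rightarrow> real" where
  "rate \<phi> n = real n powr (- 2 / 5) * ln (real n) powr \<phi>"

text \<open>The quantity available in exponents, \<open>n\<close> times the squared rate, in a
  closed form that can be compared asymptotically with powers and logarithms.\<close>

definition budget :: "real \<Rightarrow> nat \<Rightarrow> real" where
  "budget \<phi> n = real n powr (1 / 5) * ln (real n) powr (2 * \<phi>)"

lemma rate_pos: "2 \<le> n \<Longrightarrow> 0 < rate \<phi> n"
  by (simp add: rate_def)

lemma rate_square:
  assumes "2 \<le> n"
  shows "(rate \<phi> n)\<^sup>2 = real n powr (- 4 / 5) * ln (real n) powr (2 * \<phi>)"
  unfolding rate_def power_mult_distrib using assms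
  by (simp add: power2_eq_square flip: powr_add)

lemma budget_eq:
  assumes "2 \<le> n"
  shows "real n * (rate \<phi> n)\<^sup>2 = budget \<phi> n"
proof -
  have "real n * real n powr (- 4 / 5) = real n powr (1 + (- 4 / 5))"
    using assms unfolding powr_add by simp
  then show ?thesis unfolding rate_square[OF assms] budget_def by (simp add: mult.assoc[symmetric])
qed

section \<open>The base measure and the bandwidth law\<close>

lemma bandwidth_mass_ge:
  fixes \<pi> :: "real \<Rightarrow> real"
  assumes S: "prob_space S" "S = density (restrict_space lborel {0<..}) (\<lambda>\<sigma>. ennreal (\<pi> \<sigma>))"
    and \<pi>: "continuous_on {0<..} \<pi>" and v: "0 < v" and m: "0 \<le> m" "\<And>\<sigma>. v \<le> \<sigma> \<Longrightarrow> \<sigma> \<le> 2 * v \<Longrightarrow> m \<le> \<pi> \<sigma>"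
  shows "m * v \<le> measure S {v..2 * v}"
proof -
  interpret prob_space S by (rule S)
  have "\<pi> \<in> borel_measurable (restrict_space borel {0<..})"
    using \<pi> by (rule borel_measurable_continuous_on_restrict)
  then have pm: "\<pi> \<in> borel_measurable (restrict_space lborel {0<..})"
    by (simp cong: measurable_cong_sets sets_restrict_space_cong)
  have I: "{v..2 * v} \<in> sets (restrict_space lborel {0<..})"
    using v by (auto simp: sets_restrict_space_iff)
  have "ennreal (m * v) = (\<integral>\<^sup>+\<sigma>. ennreal m * indicator {v..2 * v} \<sigma> \<partial>lborel)"
    using v m(1) by (simp add: nn_integral_cmult ennreal_mult')
  also have "\<dots> = (\<integral>\<^sup>+\<sigma>. ennreal m * indicator {v..2 * v} \<sigma> * indicator {0<..} \<sigma> \<partial>lborel)"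
    using v by (intro nn_integral_cong) (auto simp: indicator_def)
  also have "\<dots> = (\<integral>\<^sup>+\<sigma>. ennreal m * indicator {v..2 * v} \<sigma> \<partial>restrict_space lborel {0<..})"
    by (subst nn_integral_restrict_space) auto
  also have "\<dots> \<le> (\<integral>\<^sup>+\<sigma>. ennreal (\<pi> \<sigma>) * indicator {v..2 * v} \<sigma> \<partial>restrict_space lborel {0<..})"
    using m(2) by (intro nn_integral_mono) (auto simp: indicator_def intro!: ennreal_leI)
  also have "\<dots> = emeasure S {v..2 * v}" unfolding S(2) using pm I by (subst emeasure_density) auto
  finally show ?thesis by (simp add: emeasure_eq_measure)
qed

lemma density_measure_le:
  fixes h :: "real \<Rightarrow> real"
  assumes H: "finite_measure H" "H = density lborel (\<lambda>u. ennreal (h u))" and h: "h \<in> borel_measurable borel"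
    and w: "0 \<le> w" and c: "0 \<le> m" "\<And>u. h u \<le> m"
  shows "measure H {c..<c + w} \<le> m * w"
proof -
  interpret finite_measure H by (rule H)
  have "emeasure H {c..<c + w} = (\<integral>\<^sup>+u. ennreal (h u) * indicator {c..<c + w} u \<partial>lborel)"
    using h by (simp add: H(2) emeasure_density)
  also have "\<dots> \<le> (\<integral>\<^sup>+u. ennreal m * indicator {c..<c + w} u \<partial>lborel)"
    using c(2) by (intro nn_integral_mono mult_right_mono ennreal_leI) auto
  also have "\<dots> = ennreal (m * w)"
    using w c(1) by (simp add: nn_integral_cmult ennreal_mult')
  finally show ?thesis using w c(1) by (simp add: emeasure_eq_measure)
qed

lemma base_measure_pos:
  fixes h :: "real \<Rightarrow> real"
  assumes H: "finite_measure H" "H = density lborel (\<lambda>u. ennreal (h u))" and h: "h \<in> borel_measurable borel"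
    and b: "0 < b0" "0 < c0" "0 < \<iota>" and lo: "\<And>u. c0 * exp (- b0 * \<bar>u\<bar> powr \<iota>) \<le> h u"
  shows "0 < measure H UNIV"
proof -
  have "c0 * exp (- b0 * \<bar>u\<bar> powr \<iota>) \<ge> c0 * exp (- b0)" if "u \<in> {0..<0 + 1}" for u
  proof -
    have "\<bar>u\<bar> powr \<iota> \<le> 1 powr \<iota>" using that b by (intro powr_mono2) auto
    then have "b0 * \<bar>u\<bar> powr \<iota> \<le> b0 * 1" using b by (intro mult_left_mono) auto
    then show ?thesis using b by simp
  qed
  then have "c0 * exp (- b0) * 1 \<le> measure H UNIV"
    using b by (intro density_measure_ge[OF H h, of _ 0]) (auto intro: order_trans[OF _ lo])
  moreover have "0 < c0 * exp (- b0) * 1" using b by simp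
  ultimately show ?thesis by linarith
qed

text \<open>
  The lower bound on the base density makes \<open>exp (- b0 |u| powr \<iota>)\<close> integrable; rescaling \<open>u\<close> then
  makes every \<open>exp (- b |u| powr \<iota>)\<close> integrable.
\<close>

lemma base_measure_tail:
  fixes h :: "real \<Rightarrow> real"
  assumes H: "finite_measure H" "H = density lborel (\<lambda>u. ennreal (h u))" and h: "h \<in> borel_measurable borel"
    and b: "0 < b0" "0 < b0'" "0 < c0" "0 < c0'" "0 < \<iota>"
    and lo: "\<And>u. c0 * exp (- b0 * \<bar>u\<bar> powr \<iota>) \<le> h u" and hi: "\<And>u. h u \<le> c0' * exp (- b0' * \<bar>u\<bar> powr \<iota>)"
  obtains C where "0 < C" "\<And>a. 0 < a \<Longrightarrow> measure H (- {- a..<a}) \<le> C * exp (- (b0' / 2) * a powr \<iota>)"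
proof -
  interpret H: finite_measure H by (rule H)
  let ?e = "\<lambda>b u. exp (- b * \<bar>u\<bar> powr \<iota>)"
  have "ennreal c0 * (\<integral>\<^sup>+u. ennreal (?e b0 u) \<partial>lborel) = (\<integral>\<^sup>+u. ennreal (c0 * ?e b0 u) \<partial>lborel)"
    using b by (simp add: nn_integral_cmult[symmetric] ennreal_mult')
  also have "\<dots> \<le> (\<integral>\<^sup>+u. ennreal (h u) \<partial>lborel)" by (intro nn_integral_mono ennreal_leI lo)
  also have "\<dots> = emeasure H (space H)" using h by (simp add: H(2) emeasure_density)
  also have "\<dots> < \<infinity>" by (simp add: H.emeasure_eq_measure)
  finally have f0: "(\<integral>\<^sup>+u. ennreal (?e b0 u) \<partial>lborel) < \<infinity>"
    using b by (auto simp: ennreal_mult_less_top)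
  \<comment> \<open>Chosen so that
    \<open>b0 * |g * u| powr \<iota> = (b0' / 2) * |u| powr \<iota>\<close>.\<close>
  define g where "g = (b0' / 2 / b0) powr (1 / \<iota>)"
  have g: "0 < g" using b by (simp add: g_def)
  have gi: "g powr \<iota> = b0' / 2 / b0" using b by (simp add: g_def powr_powr)
  have "(\<integral>\<^sup>+u. ennreal (?e b0 u) \<partial>lborel) = ennreal g * (\<integral>\<^sup>+u. ennreal (?e (b0' / 2) u) \<partial>lborel)"
  proof -
    have "(\<integral>\<^sup>+u. ennreal (?e b0 u) \<partial>lborel) = ennreal g * (\<integral>\<^sup>+u. ennreal (?e b0 (g * u)) \<partial>lborel)"
      using g by (subst nn_integral_real_affine[where c=g and t=0]) auto
    moreover have "?e b0 (g * u) = ?e (b0' / 2) u" for u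
      using g b gi by (simp add: abs_mult powr_mult)
    ultimately show ?thesis by (simp only:)
  qed
  then have f1: "(\<integral>\<^sup>+u. ennreal (?e (b0' / 2) u) \<partial>lborel) < \<infinity>"
    using f0 g by (auto simp: ennreal_mult_less_top)
  then obtain I where I: "0 \<le> I" "(\<integral>\<^sup>+u. ennreal (?e (b0' / 2) u) \<partial>lborel) = ennreal I"
    by (cases "\<integral>\<^sup>+u. ennreal (?e (b0' / 2) u) \<partial>lborel") auto
  show thesis
  proof
    show "0 < c0' * (I + 1)" using b I by simp
    fix a :: real assume a: "0 < a"
    have "emeasure H (- {- a..<a}) = (\<integral>\<^sup>+u. ennreal (h u) * indicator (- {- a..<a}) u \<partial>lborel)"
      using h by (simp add: H(2) emeasure_density)
    also have "\<dots> \<le> (\<integral>\<^sup>+u. ennreal (c0' * exp (- (b0' / 2) * a powr \<iota>)) * ennreal (?e (b0' / 2) u) \<partial>lborel)"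
    proof (intro nn_integral_mono)
      fix u :: real
      show "ennreal (h u) * indicator (- {- a..<a}) u \<le> ennreal (c0' * exp (- (b0' / 2) * a powr \<iota>)) * ennreal (?e (b0' / 2) u)"
      proof (cases "u \<in> - {- a..<a}")
        case True
        then have "a \<le> \<bar>u\<bar>" by auto
        then have "a powr \<iota> \<le> \<bar>u\<bar> powr \<iota>" using a b by (intro powr_mono2) auto
        then have "b0' * a powr \<iota> \<le> b0' * \<bar>u\<bar> powr \<iota>" using b by (intro mult_left_mono) auto
        \<comment> \<open>One half of the exponent yields the decay in \<open>a\<close>, the other
          half is kept for integrability.\<close>
        then have "?e b0' u \<le> exp (- (b0' / 2) * a powr \<iota>) * ?e (b0' / 2) u"
          by (simp flip: exp_add)
        then have "c0' * ?e b0' u \<le> c0' * (exp (- (b0' / 2) * a powr \<iota>) * ?e (b0' / 2) u)"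
          using b by (intro mult_left_mono) auto
        then have "h u \<le> c0' * exp (- (b0' / 2) * a powr \<iota>) * ?e (b0' / 2) u"
          using hi[of u] unfolding mult.assoc by linarith
        then have "ennreal (h u) \<le> ennreal (c0' * exp (- (b0' / 2) * a powr \<iota>) * ?e (b0' / 2) u)" by (rule ennreal_leI)
        also have "\<dots> = ennreal (c0' * exp (- (b0' / 2) * a powr \<iota>)) * ennreal (?e (b0' / 2) u)"
          using b by (intro ennreal_mult) auto
        finally show ?thesis using True by simp
      qed simp
    qed
    also have "\<dots> = ennreal (c0' * exp (- (b0' / 2) * a powr \<iota>)) * ennreal I"
      unfolding I(2)[symmetric] by (intro nn_integral_cmult) measurable
    also have "\<dots> = ennreal (c0' * exp (- (b0' / 2) * a powr \<iota>) * I)"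
      using b I by (intro ennreal_mult[symmetric]) auto
    finally have "measure H (- {- a..<a}) \<le> c0' * exp (- (b0' / 2) * a powr \<iota>) * I"
      using b I by (simp add: H.emeasure_eq_measure)
    also have "\<dots> \<le> c0' * exp (- (b0' / 2) * a powr \<iota>) * (I + 1)" using b by (intro mult_left_mono) auto
    finally show "measure H (- {- a..<a}) \<le> c0' * (I + 1) * exp (- (b0' / 2) * a powr \<iota>)" by (simp add: mult_ac)
  qed
qed

section \<open>Prior mass of chi-square neighbourhoods\<close>

text \<open>The first factor bounds the number of cells, the second minus the logarithm of the
  contribution of one cell, and the remaining terms come from the bandwidth. With
  \<open>n powr (1 / 5)\<close> on both sides, the logarithm has power at most \<open>s + 1\<close>
  on the left and \<open>2 * (s + 2)\<close> on the right.\<close>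

lemma eventually_log_budget:
  assumes "1 < s" "0 < p" "0 < q" "0 < d"
  shows "eventually (\<lambda>n. (p * ln (real n) * real n powr (1 / 5) + 2) * (q * ln (real n) powr s + q1 * ln (real n) + q0)
      + q2 + ln (real n) + d * real n powr (1 / 5) * ln (real n) powr s \<le> budget (s + 2) n) sequentially"
  unfolding budget_def using assms by real_asymp

lemma eventually_power_small:
  "0 < k \<Longrightarrow> 0 < c \<Longrightarrow> eventually (\<lambda>n. k * real n powr (- 2 / 5) \<le> c) sequentially"
  by real_asymp

lemma eventually_chi_square_budget:
  "0 < c \<Longrightarrow> 0 < s \<Longrightarrow> 0 < k \<Longrightarrow> 0 < d \<Longrightarrow> eventually (\<lambda>n. 4 * (k * real n powr (- 2 / 5))\<^sup>2 / c + 2 * (d * (1 / real n) + (real n + 2) * real n powr (- 4))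
      \<le> real n powr (- 4 / 5) * ln (real n) powr (2 * s)) sequentially"
  by real_asymp

context laplace_truth
begin

text \<open>\<open>L\<close> is a multiple of \<open>ln n\<close> that makes the tail
  \<open>1 / n\<close>; there are of order \<open>n powr (1 / 5) * ln n\<close> cells, of length at
  most \<open>n powr (- 1 / 5)\<close>, and the bandwidth has this order too. The mass tolerance and
  the radius of the windows are the same power \<open>t\<close> of \<open>n\<close>. Each cell then
  costs a power of \<open>ln n\<close> in the exponent, and the bandwidth
  \<open>n powr (1 / 5)\<close> up to logarithms.\<close>

lemma prior_mass_eventually:
  fixes h \<pi> :: "real \<Rightarrow> real" and S H :: "real measure"
  assumes D: "dirichlet_process H D"
    and H: "finite_measure H" "H = density lborel (\<lambda>u. ennreal (h u))" and h: "h \<in> borel_measurable borel"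
    and b: "0 < b0" "0 < c0" "0 < \<iota>" and lo: "\<And>u. c0 * exp (- b0 * \<bar>u\<bar> powr \<iota>) \<le> h u"
    and S: "prob_space S" "S = density (restrict_space lborel {0<..}) (\<lambda>\<sigma>. ennreal (\<pi> \<sigma>))"
    and \<pi>: "continuous_on {0<..} \<pi>" and D1: "0 < D1" and s1: "0 \<le> s1" and t1: "0 \<le> t1"
    and Cs: "0 < Cs" "\<forall>\<^sub>F \<sigma> in at_right 0. \<sigma> powr (- s1) * exp (- D1 * inverse \<sigma> * \<bar>ln \<sigma>\<bar> powr t1) \<le> Cs * \<pi> \<sigma>"
  shows "eventually (\<lambda>n. exp (- budget (3 + \<iota> + t1) n)
    \<le> measure (mixture_prior D S) {\<mu> \<in> space (prob_algebra borel). chi_square \<mu>0 \<mu> \<le> ennreal ((rate (3 + \<iota> + t1) n)\<^sup>2)}) sequentially"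
proof -
  define A where "A = measure H UNIV"
  have A: "0 < A" unfolding A_def by (rule base_measure_pos[OF H h b lo])
  obtain c where c: "0 < c" "\<And>k a p \<tau>. 0 < k \<Longrightarrow> (\<And>i. 0 \<le> a i) \<Longrightarrow> (\<And>i. i < k \<Longrightarrow> 0 < a i \<and> a i \<le> A) \<Longrightarrow> (\<And>i. i < k \<Longrightarrow> 0 \<le> p i) \<Longrightarrow>
       (\<Sum>i<k. p i) = 1 \<Longrightarrow> 0 < \<tau> \<Longrightarrow> \<tau> \<le> 1 \<Longrightarrow>
       (\<Prod>i<k. c * a i * \<tau> powr (A + 1))
         \<le> measure (dirichlet_law k a) {x\<in>space (PiM {..<k} (\<lambda>_. borel)). \<forall>i<k. \<bar>x i - p i\<bar> \<le> (real k + 1) * \<tau>}"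
    by (rule dirichlet_law_small_ball[OF A]) blast
  have Ss: "sets S = sets (restrict_space borel {0<..})" by (simp add: S(2) cong: sets_restrict_space_cong)
  obtain \<sigma>1 where \<sigma>1: "0 < \<sigma>1" "\<And>\<sigma>. 0 < \<sigma> \<Longrightarrow> \<sigma> < \<sigma>1 \<Longrightarrow> \<sigma> powr (- s1) * exp (- D1 * inverse \<sigma> * \<bar>ln \<sigma>\<bar> powr t1) \<le> Cs * \<pi> \<sigma>"
    using Cs(2) unfolding eventually_at_right_field by auto
  define s where "s = 1 + \<iota> + t1"
  have s: "1 < s" "\<iota> \<le> s" "t1 \<le> s" "s + 2 = 3 + \<iota> + t1" using b t1 by (auto simp: s_def)
  define p where "p = 4 / C0"
  \<comment> \<open>\<open>exp L\<close> is \<open>n powr (2 / C0)\<close>, so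
    \<open>t = n powr (- Bx)\<close> leaves \<open>t * exp L = n powr (- 4)\<close>, which survives
    a factor quadratic in the number of cells.\<close>
  define Bx where "Bx = 2 / C0 + 4"
  have Bx: "0 < Bx" "2 / C0 - Bx = - 4" using C0 by (auto simp: Bx_def add_pos_pos)
  define q where "q = b0 * (2 / C0 + 1) powr \<iota>"
  have "0 < 2 / C0 + 1" using C0 by (simp add: add_pos_pos)
  then have q: "0 < q" "0 < p" using b C0 by (auto simp: q_def p_def)
  \<comment> \<open>Seven units of \<open>n powr (- 2 / 5)\<close>: four from
    \<open>(2 * \<sigma>n)\<^sup>2\<close> and one from each of the other three error terms.\<close>
  define \<kappa>c where "\<kappa>c = approx_const * 7"
  have \<kappa>c: "0 < \<kappa>c" using approx_const_pos by (simp add: \<kappa>c_def)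
  have "eventually (\<lambda>n. (2::nat) \<le> n) sequentially" by (rule eventually_ge_at_top)
  moreover have "eventually (\<lambda>n. 1 \<le> ln (real n)) sequentially" by real_asymp
  moreover have "eventually (\<lambda>n. p * ln (real n) * real n powr (1 / 5) + 2 \<le> real n) sequentially" by real_asymp
  moreover have "eventually (\<lambda>n. real n powr (- Bx) \<le> ln (real n) * (2 / C0) / real n) sequentially"
  proof -
    have "0 < C0" "1 < Bx" using C0 by (auto simp: Bx_def add_pos_pos intro: less_le_trans[of 1 4])
    then show ?thesis by real_asymp
  qed
  moreover have "eventually (\<lambda>n. real n powr (- Bx) \<le> 1) sequentially" using Bx by real_asymp
  moreover have "eventually (\<lambda>n. real n powr (- 1 / 5) \<le> 1 / 4) sequentially" by real_asymp
  moreover have "eventually (\<lambda>n. 2 * real n powr (- 1 / 5) < \<sigma>1) sequentially" using \<sigma>1(1) by real_asymp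
  moreover have "eventually (\<lambda>n. (real n * (real n + 2) + 2) * real n powr (- 4) \<le> real n powr (- 2 / 5)) sequentially" by real_asymp
  moreover have "eventually (\<lambda>n. 1 / real n \<le> real n powr (- 2 / 5)) sequentially" by real_asymp
  moreover have "eventually (\<lambda>n. \<kappa>c * real n powr (- 2 / 5) \<le> lower_const / 2) sequentially"
    using lower_const_pos by (intro eventually_power_small \<kappa>c) simp
  moreover have "eventually (\<lambda>n. 4 * (\<kappa>c * real n powr (- 2 / 5))\<^sup>2 / lower_const + 2 * (4 * M / C0 * (1 / real n) + (real n + 2) * real n powr (- 4))
      \<le> real n powr (- 4 / 5) * ln (real n) powr (2 * (s + 2))) sequentially"
    using lower_const_pos s(1) M C0 \<kappa>c by (intro eventually_chi_square_budget) auto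
  moreover have "eventually (\<lambda>n. (p * ln (real n) * real n powr (1 / 5) + 2) * (q * ln (real n) powr s + (Bx * (A + 2)) * ln (real n) + (\<bar>ln c\<bar> + \<bar>ln c0\<bar>))
      + \<bar>ln Cs\<bar> + ln (real n) + D1 * real n powr (1 / 5) * ln (real n) powr s \<le> budget (s + 2) n) sequentially"
    by (intro eventually_log_budget s q D1)
  ultimately show ?thesis
  proof eventually_elim
    case (elim n)
    note n2 = elim(1) and \<Lambda>1 = elim(2) and kn = elim(3) and \<eta>\<delta> = elim(4) and t1' = elim(5) and \<sigma>4 = elim(6)
      and \<sigma>1' = elim(7) and e8 = elim(8) and e9 = elim(9) and e10 = elim(10) and e11 = elim(11) and e12 = elim(12)
    define x where "x = real n"
    define \<Lambda> where "\<Lambda> = ln x"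
    have x: "2 \<le> x" "0 < x" using n2 by (auto simp: x_def)
    note fold = x_def[symmetric] \<Lambda>_def[symmetric]
    define L where "L = 2 / C0 * \<Lambda>"
    have L: "0 < L" using C0 \<Lambda>1 by (simp add: L_def \<Lambda>_def x_def)
    have eL: "exp (- C0 * L / 2) = 1 / x" using C0 x by (simp add: L_def \<Lambda>_def exp_minus field_simps)
    have eL2: "exp L = x powr (2 / C0)" using x by (simp add: L_def \<Lambda>_def powr_def)
    \<comment> \<open>Rounded up so that \<open>\<delta> = 2 * L / k\<close> does not exceed
      \<open>n powr (- 1 / 5)\<close>.\<close>
    define k where "k = nat \<lceil>2 * L * x powr (1 / 5)\<rceil>"
    have k0: "0 < 2 * L * x powr (1 / 5)" using L x by simp
    then have kk: "2 * L * x powr (1 / 5) \<le> real k" "real k \<le> 2 * L * x powr (1 / 5) + 1"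
      unfolding k_def by linarith+
    have kpos: "0 < real k" using kk k0 by linarith
    have k1: "real k + 1 \<le> p * \<Lambda> * x powr (1 / 5) + 2" using kk(2) by (simp add: p_def L_def)
    have kx: "real k \<le> x" using k1 kn by (simp add: fold)
    define \<delta> where "\<delta> = 2 * L / real k"
    have \<delta>: "0 < \<delta>" "real k * \<delta> = 2 * L" "\<delta> \<le> x powr (- 1 / 5)"
    proof -
      show "0 < \<delta>" "real k * \<delta> = 2 * L" using L kpos by (auto simp: \<delta>_def)
      have "\<delta> \<le> 2 * L / (2 * L * x powr (1 / 5))" unfolding \<delta>_def using kk k0 L kpos by (intro divide_left_mono) auto
      also have "\<dots> = x powr (- 1 / 5)" using L x by (simp add: powr_minus field_simps)
      finally show "\<delta> \<le> x powr (- 1 / 5)" .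
    qed
    define \<sigma>n where "\<sigma>n = x powr (- 1 / 5)"
    have \<sigma>n: "0 < \<sigma>n" "\<sigma>n \<le> 1 / 4" using x \<sigma>4 by (auto simp: \<sigma>n_def x_def)
    define t where "t = x powr (- Bx)"
    have t: "0 < t" "t \<le> 1" using x t1' by (auto simp: t_def x_def)
    have \<eta>: "t \<le> \<delta> / 2"
    proof -
      have "t \<le> L / x" using \<eta>\<delta> by (simp add: t_def L_def \<Lambda>_def x_def mult.commute)
      also have "\<dots> \<le> L / real k" using kx kpos L x by (intro divide_left_mono) auto
      finally show ?thesis by (simp add: \<delta>_def)
    qed
    have tL: "t * exp L = x powr (- 4)" unfolding t_def eL2 using Bx(2) by (simp add: add.commute flip: powr_add)
    have tx: "t \<le> x powr (- 4)"
      unfolding t_def using x C0 by (intro powr_mono) (auto simp: Bx_def)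
    have two: "x powr (- 1 / 5) * x powr (- 1 / 5) = x powr (- 2 / 5)" by (simp flip: powr_add)
    have kap: "approx_const * ((2 * \<sigma>n)\<^sup>2 + \<delta>\<^sup>2 + exp (- C0 * L / 2) + (real k * ((real k + 2) * t) + 2 * t) * exp L) \<le> \<kappa>c * x powr (- 2 / 5)"
    proof -
      have "(2 * \<sigma>n)\<^sup>2 = 4 * x powr (- 2 / 5)" using two by (simp add: \<sigma>n_def power2_eq_square)
      moreover have "\<delta>\<^sup>2 \<le> x powr (- 2 / 5)"
        using power_mono[OF \<delta>(3), of 2] \<delta>(1) two by (simp add: power2_eq_square)
      moreover have "exp (- C0 * L / 2) \<le> x powr (- 2 / 5)" using e9 unfolding eL by (simp add: x_def)
      moreover have "(real k * ((real k + 2) * t) + 2 * t) * exp L \<le> x powr (- 2 / 5)"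
      proof -
        have "(real k * ((real k + 2) * t) + 2 * t) * exp L = (real k * (real k + 2) + 2) * (t * exp L)" by (simp add: algebra_simps)
        also have "\<dots> \<le> (x * (x + 2) + 2) * x powr (- 4)"
          unfolding tL using kx kpos x by (intro mult_right_mono add_right_mono mult_mono) auto
        also have "\<dots> \<le> x powr (- 2 / 5)" using e8 by (simp add: x_def)
        finally show ?thesis .
      qed
      ultimately have "(2 * \<sigma>n)\<^sup>2 + \<delta>\<^sup>2 + exp (- C0 * L / 2) + (real k * ((real k + 2) * t) + 2 * t) * exp L \<le> 7 * x powr (- 2 / 5)" by linarith
      then have "approx_const * ((2 * \<sigma>n)\<^sup>2 + \<delta>\<^sup>2 + exp (- C0 * L / 2) + (real k * ((real k + 2) * t) + 2 * t) * exp L)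
        \<le> approx_const * (7 * x powr (- 2 / 5))" using approx_const_pos by (intro mult_left_mono) auto
      then show ?thesis by (simp add: \<kappa>c_def)
    qed
    have rr: "4 * (\<kappa>c * x powr (- 2 / 5))\<^sup>2 / lower_const + 2 * (4 * M / C0 * exp (- C0 * L / 2) + (real k + 2) * t) \<le> (rate (3 + \<iota> + t1) n)\<^sup>2"
    proof -
      have "(real k + 2) * t \<le> (x + 2) * x powr (- 4)" using kx tx t x by (intro mult_mono) auto
      then show ?thesis using e11 unfolding rate_square[OF n2] s(4)[symmetric] eL x_def
        by (intro order_trans[OF _ e11] add_left_mono mult_left_mono) auto
    qed
    define hl where "hl = c0 * exp (- b0 * (L + 1) powr \<iota>)"
    have hl: "0 < hl" using b by (simp add: hl_def)
    have hlh: "hl \<le> h u" if "\<bar>u\<bar> \<le> L + 1" for u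
    proof -
      have "\<bar>u\<bar> powr \<iota> \<le> (L + 1) powr \<iota>" using that b by (intro powr_mono2) auto
      then have "b0 * \<bar>u\<bar> powr \<iota> \<le> b0 * (L + 1) powr \<iota>" using b by (intro mult_left_mono) auto
      then have "hl \<le> c0 * exp (- b0 * \<bar>u\<bar> powr \<iota>)" unfolding hl_def using b by (intro mult_left_mono) auto
      then show ?thesis using lo[of u] by linarith
    qed
    have \<delta>1: "\<delta> \<le> 1" using \<delta>(3) \<sigma>4 by (simp add: x_def)
    have main: "(c * (hl * t) * t powr (A + 1)) ^ (k + 1) * measure S {\<sigma>n..2 * \<sigma>n}
      \<le> measure (mixture_prior D S) {\<mu> \<in> space (prob_algebra borel). chi_square \<mu>0 \<mu> \<le> ennreal ((rate (3 + \<iota> + t1) n)\<^sup>2)}"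
      using e10
      by (intro prior_mass_ge[OF D H h hl hlh A_def c S(1) Ss L \<delta>(1) \<delta>1 \<delta>(2) t(1) \<eta> t \<sigma>n kap _ rr]) (auto simp: x_def)
    \<comment> \<open>On this interval \<open>1 / \<sigma>\<close> is at most
      \<open>n powr (1 / 5)\<close>, \<open>|ln \<sigma>|\<close> is at most \<open>ln n\<close>,
      and \<open>\<sigma> powr (- s1)\<close> is at least 1.\<close>
    have Sm: "exp (- (\<bar>ln Cs\<bar> + \<Lambda> + D1 * x powr (1 / 5) * \<Lambda> powr s)) \<le> measure S {\<sigma>n..2 * \<sigma>n}"
    proof -
      define m where "m = exp (- (D1 * x powr (1 / 5) * \<Lambda> powr s)) / Cs"
      have "m * \<sigma>n \<le> measure S {\<sigma>n..2 * \<sigma>n}"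
      proof (rule bandwidth_mass_ge[OF S \<pi> \<sigma>n(1)])
        show "0 \<le> m" using Cs by (simp add: m_def)
        fix \<sigma> assume \<sigma>: "\<sigma>n \<le> \<sigma>" "\<sigma> \<le> 2 * \<sigma>n"
        have "2 * \<sigma>n < \<sigma>1" using \<sigma>1' by (simp add: \<sigma>n_def x_def)
        then have \<sigma>0: "0 < \<sigma>" "\<sigma> \<le> 1" "\<sigma> < \<sigma>1" using \<sigma> \<sigma>n by linarith+
        have i: "inverse \<sigma> \<le> x powr (1 / 5)"
        proof -
          have "inverse \<sigma> \<le> inverse \<sigma>n" using \<sigma> \<sigma>n by (intro le_imp_inverse_le) auto
          also have "inverse \<sigma>n = x powr (1 / 5)" using x by (simp add: \<sigma>n_def powr_minus)
          finally show ?thesis .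
        qed
        have l: "\<bar>ln \<sigma>\<bar> \<le> \<Lambda>"
        proof -
          have "\<bar>ln \<sigma>\<bar> = - ln \<sigma>" using \<sigma>0 by simp
          also have "\<dots> \<le> - ln \<sigma>n" using \<sigma> \<sigma>n by simp
          also have "\<dots> = \<Lambda> / 5" using x by (simp add: \<sigma>n_def \<Lambda>_def ln_powr)
          also have "\<dots> \<le> \<Lambda>" using \<Lambda>1 by (simp add: \<Lambda>_def x_def)
          finally show ?thesis .
        qed
        have "\<bar>ln \<sigma>\<bar> powr t1 \<le> \<Lambda> powr t1" using l t1 by (intro powr_mono2) auto
        also have "\<dots> \<le> \<Lambda> powr s" using \<Lambda>1 s by (intro powr_mono) (auto simp: \<Lambda>_def x_def)
        finally have "D1 * inverse \<sigma> * \<bar>ln \<sigma>\<bar> powr t1 \<le> D1 * x powr (1 / 5) * \<Lambda> powr s"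
          using i D1 \<sigma>0 by (intro mult_mono mult_left_mono) auto
        then have "exp (- (D1 * x powr (1 / 5) * \<Lambda> powr s)) \<le> exp (- D1 * inverse \<sigma> * \<bar>ln \<sigma>\<bar> powr t1)" by simp
        also have "\<dots> \<le> \<sigma> powr (- s1) * exp (- D1 * inverse \<sigma> * \<bar>ln \<sigma>\<bar> powr t1)"
        proof -
          have "1 \<le> \<sigma> powr (- s1)" using \<sigma>0 s1 powr_mono2'[of "- s1" \<sigma> 1] by simp
          then show ?thesis by (simp add: mult_le_cancel_right1)
        qed
        also have "\<dots> \<le> Cs * \<pi> \<sigma>" by (rule \<sigma>1(2)[OF \<sigma>0(1,3)])
        finally show "m \<le> \<pi> \<sigma>" using Cs by (simp add: m_def field_simps)
      qed
      moreover have "exp (- (\<bar>ln Cs\<bar> + \<Lambda> + D1 * x powr (1 / 5) * \<Lambda> powr s)) \<le> m * \<sigma>n"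
      proof -
        have "m = exp (- (D1 * x powr (1 / 5) * \<Lambda> powr s) - ln Cs)" using Cs by (simp add: m_def exp_diff)
        moreover have "\<sigma>n = exp (- (\<Lambda> / 5))" using x by (simp add: \<sigma>n_def powr_def \<Lambda>_def)
        ultimately have "m * \<sigma>n = exp (- (D1 * x powr (1 / 5) * \<Lambda> powr s) - ln Cs - \<Lambda> / 5)" by (simp flip: exp_add)
        then show ?thesis using \<Lambda>1 by (simp add: \<Lambda>_def x_def)
      qed
      ultimately show ?thesis by linarith
    qed
    have Dm: "exp (- ((p * \<Lambda> * x powr (1 / 5) + 2) * (q * \<Lambda> powr s + (Bx * (A + 2)) * \<Lambda> + (\<bar>ln c\<bar> + \<bar>ln c0\<bar>))))
      \<le> (c * (hl * t) * t powr (A + 1)) ^ (k + 1)"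
    proof -
      let ?Q = "q * \<Lambda> powr s + (Bx * (A + 2)) * \<Lambda> + (\<bar>ln c\<bar> + \<bar>ln c0\<bar>)"
      have \<Lambda>0: "1 \<le> \<Lambda>" using \<Lambda>1 by (simp add: \<Lambda>_def x_def)
      have Q0: "0 \<le> ?Q" using q Bx A \<Lambda>0 by (intro add_nonneg_nonneg mult_nonneg_nonneg) auto
      have tE: "t = exp (- Bx * \<Lambda>)" using x by (simp add: t_def powr_def \<Lambda>_def)
      have vE: "t powr (A + 1) = exp ((A + 1) * (- Bx * \<Lambda>))" unfolding tE by (simp add: powr_def)
      have "c * (hl * t) * t powr (A + 1)
        = exp (ln c) * (exp (ln c0) * exp (- b0 * (L + 1) powr \<iota>) * exp (- Bx * \<Lambda>)) * exp ((A + 1) * (- Bx * \<Lambda>))"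
        unfolding vE using c(1) b(2) tE by (simp add: hl_def)
      also have "\<dots> = exp (ln c + ln c0 - b0 * (L + 1) powr \<iota> - Bx * \<Lambda> + (A + 1) * (- Bx * \<Lambda>))"
        unfolding mult_exp_exp by (simp add: algebra_simps)
      also have "\<dots> \<ge> exp (- ?Q)"
      proof -
        have "L + 1 \<le> (2 / C0 + 1) * \<Lambda>" using \<Lambda>0 by (simp add: L_def algebra_simps)
        then have "(L + 1) powr \<iota> \<le> ((2 / C0 + 1) * \<Lambda>) powr \<iota>" using L b by (intro powr_mono2) auto
        also have "\<dots> = (2 / C0 + 1) powr \<iota> * \<Lambda> powr \<iota>" by (rule powr_mult)
        also have "\<dots> \<le> (2 / C0 + 1) powr \<iota> * \<Lambda> powr s" using \<Lambda>0 s by (intro mult_left_mono powr_mono) auto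
        finally have "b0 * (L + 1) powr \<iota> \<le> q * \<Lambda> powr s" using b by (simp add: q_def mult.assoc)
        then show ?thesis by (simp add: algebra_simps)
      qed
      finally have base: "exp (- ?Q) \<le> c * (hl * t) * t powr (A + 1)" .
      have "exp (- ((p * \<Lambda> * x powr (1 / 5) + 2) * ?Q)) \<le> exp (- ((real k + 1) * ?Q))"
        using k1 Q0 by (simp add: mult_right_mono)
      also have "\<dots> = exp (- ?Q) ^ (k + 1)" 
      proof -
        have "- ((real k + 1) * ?Q) = real (k + 1) * (- ?Q)" unfolding mult_minus_right by (simp add: add.commute)
        then show ?thesis by (simp only: exp_of_nat_mult)
      qed
      also have "\<dots> \<le> (c * (hl * t) * t powr (A + 1)) ^ (k + 1)" by (intro power_mono base) auto
      finally show ?thesis .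
    qed
    have "exp (- budget (s + 2) n) \<le> exp (- ((p * \<Lambda> * x powr (1 / 5) + 2) * (q * \<Lambda> powr s + (Bx * (A + 2)) * \<Lambda> + (\<bar>ln c\<bar> + \<bar>ln c0\<bar>))))
        * exp (- (\<bar>ln Cs\<bar> + \<Lambda> + D1 * x powr (1 / 5) * \<Lambda> powr s))"
      using e12 unfolding mult_exp_exp exp_le_cancel_iff by (simp add: \<Lambda>_def x_def)
    also have "\<dots> \<le> (c * (hl * t) * t powr (A + 1)) ^ (k + 1) * measure S {\<sigma>n..2 * \<sigma>n}"
      using c(1) hl t by (intro mult_mono Dm Sm zero_le_power mult_nonneg_nonneg) auto
    finally show ?case using main s(4) by simp
  qed
qed

end

section \<open>Sieve mass and entropy\<close>

lemma eventually_exp_small: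
  "0 < \<phi> \<Longrightarrow> 0 < b \<Longrightarrow> 0 < c \<Longrightarrow> eventually (\<lambda>n. c * real n powr (1 / 20) * exp (- b * real n) \<le> exp (- 5 * budget \<phi> n) / 8) sequentially"
  unfolding budget_def by real_asymp

lemma eventually_budget_large:
  "0 < \<phi> \<Longrightarrow> 0 < c \<Longrightarrow> eventually (\<lambda>n. c * real n powr (1 / 10) + 2 \<le> budget \<phi> n) sequentially"
  "0 < \<phi> \<Longrightarrow> eventually (\<lambda>n. ln (real n) \<le> budget \<phi> n) sequentially"
  unfolding budget_def by real_asymp+

lemma eventually_rate_large:
  "0 < \<phi> \<Longrightarrow> 0 < c \<Longrightarrow> eventually (\<lambda>n. c / real n \<le> real n powr (- 4 / 5) * ln (real n) powr (2 * \<phi>) / 4) sequentially"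
  by real_asymp

lemma eventually_cells_le:
  "1 < \<phi> \<Longrightarrow> eventually (\<lambda>n. 200 * (real n powr (1 / 5) * ln (real n) powr (2 * \<phi> - 1)) + 1 \<le> real n) sequentially"
  by real_asymp

text \<open>All sizes are powers of \<open>n\<close>: the half-length \<open>n ^ q\<close> with
  \<open>q * \<iota> \<ge> 1\<close> and the largest bandwidth \<open>n ^ q'\<close> with
  \<open>q' * v \<ge> 1\<close> make both tails exponentially small in \<open>n\<close>; cells and
  bandwidth steps have length \<open>1 / n\<close>, weights are multiples of
  \<open>1 / n\<^sup>2\<close>. Polynomial sizes enter the entropy through \<open>N * ln n\<close>,
  so \<open>N\<close> is taken of order \<open>budget \<phi> n / ln n\<close>.\<close>

lemma sieve_eventually:
  fixes h \<pi> :: "real \<Rightarrow> real" and S H :: "real measure"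
  assumes D: "dirichlet_process H D"
    and H: "finite_measure H" "H = density lborel (\<lambda>u. ennreal (h u))" and h: "h \<in> borel_measurable borel"
    and b: "0 < b0" "0 < b0'" "0 < c0" "0 < c0'" "0 < \<iota>"
    and lo: "\<And>u. c0 * exp (- b0 * \<bar>u\<bar> powr \<iota>) \<le> h u" and hi: "\<And>u. h u \<le> c0' * exp (- b0' * \<bar>u\<bar> powr \<iota>)"
    and S: "prob_space S" "sets S = sets (restrict_space borel {0<..})"
    and D3: "0 < D3" "0 < v" and Ct: "0 < Ct" "\<forall>\<^sub>F s in at_top. measure S {s<..} \<le> Ct * exp (- D3 * s powr v)"
    and \<phi>: "1 < \<phi>"
  obtains c1 where "0 < c1" "eventually (\<lambda>n. \<exists>C. finite C \<and> C \<subseteq> borel_measurable borel \<and> real (card C) \<le> exp (c1 * budget \<phi> n) \<and>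
      measure (mixture_prior D S) (space (prob_algebra borel) - L1_net_sieve C ((rate \<phi> n)\<^sup>2 / 4)) \<le> exp (- 5 * budget \<phi> n)) sequentially"
proof -
  define A where "A = measure H UNIV"
  have hc: "h u \<le> c0'" for u
  proof -
    have "c0' * exp (- b0' * \<bar>u\<bar> powr \<iota>) \<le> c0' * 1" using b by (intro mult_left_mono) auto
    then show ?thesis using hi[of u] by linarith
  qed
  have A: "0 < A" unfolding A_def by (rule base_measure_pos[OF H h b(1,3,5) lo])
  \<comment> \<open>Solves \<open>exp 1 * (1 + 1 / s0) powr (- A) = 1 / 2\<close>, the condition for
    passing to gamma variables of total at least \<open>s0\<close>.\<close>
  define s0 where "s0 = 1 / ((2 * exp 1) powr (1 / A) - 1)"
  have s0: "0 < s0" "exp 1 * (1 + 1 / s0) powr (- A) \<le> 1 / 2"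
  proof -
    have "1 < 2 * exp (1::real)" using exp_ge_add_one_self[of "1::real"] by linarith
    then have "1 < (2 * exp (1::real)) powr (1 / A)" using A powr_less_mono[of 0 "1 / A" "2 * exp 1"] by simp
    then show "0 < s0" by (simp add: s0_def)
    have "1 + 1 / s0 = (2 * exp 1) powr (1 / A)" by (simp add: s0_def)
    then have "(1 + 1 / s0) powr (- A) = (2 * exp 1) powr (- 1)" using A by (simp add: powr_powr)
    also have "\<dots> = 1 / (2 * exp (1::real))" by (simp add: powr_minus_divide)
    finally show "exp 1 * (1 + 1 / s0) powr (- A) \<le> 1 / 2" by simp
  qed
  obtain Co where Co: "0 < Co" "\<And>a. 0 < a \<Longrightarrow> measure H (- {- a..<a}) \<le> Co * exp (- (b0' / 2) * a powr \<iota>)"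
    using base_measure_tail[OF H h b lo hi] by blast
  define q where "q = nat \<lceil>1 / \<iota>\<rceil>"
  have q: "1 \<le> real q * \<iota>"
  proof -
    have "1 / \<iota> \<le> real q" unfolding q_def using b by linarith
    then show ?thesis using b by (simp add: field_simps)
  qed
  define q' where "q' = nat \<lceil>1 / v\<rceil>"
  have q': "1 \<le> real q' * v" "1 \<le> q'"
  proof -
    have 1: "1 / v \<le> real q'" unfolding q'_def using D3 by linarith
    then show "1 \<le> real q' * v" using D3 by (simp add: field_simps)
    have "0 < real q'" using 1 D3 by (intro less_le_trans[OF _ 1]) simp
    then show "1 \<le> q'" by simp
  qed
  obtain st where st: "\<And>s. st \<le> s \<Longrightarrow> measure S {s<..} \<le> Ct * exp (- D3 * s powr v)"
    using Ct(2) unfolding eventually_at_top_linorder by blast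
  \<comment> \<open>As \<open>t * s0\<close> will be at least \<open>n powr (- (q + 4))\<close>,
    this keeps \<open>(t * s0) powr (- \<beta>)\<close> below \<open>n powr (1 / 20)\<close>,
    negligible against the \<open>n powr (1 / 5)\<close> of the budget.\<close>
  define \<beta> :: real where "\<beta> = 1 / (20 * (real q + 4))"
  have \<beta>: "0 < \<beta>" "(real q + 4) * \<beta> = 1 / 20" by (auto simp: \<beta>_def add_pos_pos field_simps)
  obtain Cb where Cb: "0 < Cb"
    "\<And>K N a A t s0 l. (\<And>i. 0 \<le> a i) \<Longrightarrow> (\<And>i. i \<le> K \<Longrightarrow> a i \<le> 1) \<Longrightarrow> (\<Sum>i\<le>K. a i) = A \<Longrightarrow>
       0 < s0 \<Longrightarrow> exp 1 * (1 + 1 / s0) powr (- A) \<le> 1 / 2 \<Longrightarrow> 0 < t \<Longrightarrow> 1 \<le> l \<Longrightarrow>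
       measure (dirichlet_law (Suc K) a) {x\<in>space (PiM {..<Suc K} (\<lambda>_. borel)). t < x K \<or> N < card {j\<in>{..<K}. t < x j}}
         \<le> 2 * (a K * Cb * (t * s0) powr (- \<beta>) + l powr (- real N) * exp (l * A * Cb * (t * s0) powr (- \<beta>)))"
    by (rule dirichlet_law_many_cells[OF \<beta>(1)]) blast
  \<comment> \<open>The bandwidth grid has at most \<open>n ^ (q' + 2)\<close> points and each slot
    at most \<open>n ^ (q + 5)\<close> values; \<open>N * ln n\<close> is at most 201 times the
    budget, the last unit coming from rounding \<open>N\<close> up.\<close>
  define c1 where "c1 = real (q' + 2) + real (q + 5) * 201"
  have c1: "0 < c1" by (simp add: c1_def add_pos_pos)
  have \<phi>0: "0 < \<phi>" using \<phi> by simp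
  have K1: "0 < exp_abs_moment + 4" using exp_abs_moment_ge by linarith
  have "eventually (\<lambda>n. \<exists>C. finite C \<and> C \<subseteq> borel_measurable borel \<and> real (card C) \<le> exp (c1 * budget \<phi> n) \<and>
      measure (mixture_prior D S) (space (prob_algebra borel) - L1_net_sieve C ((rate \<phi> n)\<^sup>2 / 4)) \<le> exp (- 5 * budget \<phi> n)) sequentially"
  proof -
    have "eventually (\<lambda>n. (4::nat) \<le> n) sequentially" by (rule eventually_ge_at_top)
    moreover have "eventually (\<lambda>n. 1 \<le> ln (real n)) sequentially" by real_asymp
    moreover have "eventually (\<lambda>n. c0' \<le> real n) sequentially" by real_asymp
    moreover have "eventually (\<lambda>n. st \<le> real n) sequentially" by real_asymp
    moreover have "eventually (\<lambda>n. 3 \<le> s0 * (real n)\<^sup>2) sequentially" using s0(1) by real_asymp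
    moreover have "eventually (\<lambda>n. Co * exp (- (b0' / 2) * real n) \<le> 1) sequentially" using b(2) by real_asymp
    moreover have "eventually (\<lambda>n. (exp_abs_moment + 4) / real n \<le> real n powr (- 4 / 5) * ln (real n) powr (2 * \<phi>) / 4) sequentially"
      by (rule eventually_rate_large[OF \<phi>0 K1])
    moreover have "eventually (\<lambda>n. Co * Cb * real n powr (1 / 20) * exp (- (b0' / 2) * real n) \<le> exp (- 5 * budget \<phi> n) / 8) sequentially"
      using Co(1) Cb(1) b(2) by (intro eventually_exp_small \<phi>0) auto
    moreover have "eventually (\<lambda>n. Ct * real n powr (1 / 20) * exp (- D3 * real n) \<le> exp (- 5 * budget \<phi> n) / 8) sequentially"
      using Ct(1) D3(1) by (intro eventually_exp_small \<phi>0) auto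
    moreover have "eventually (\<lambda>n. A * Cb * real n powr (1 / 10) + 2 \<le> budget \<phi> n) sequentially"
      using A Cb(1) by (intro eventually_budget_large(1) \<phi>0) auto
    moreover have "eventually (\<lambda>n. ln (real n) \<le> budget \<phi> n) sequentially" by (rule eventually_budget_large(2)[OF \<phi>0])
    moreover have "eventually (\<lambda>n. 200 * (real n powr (1 / 5) * ln (real n) powr (2 * \<phi> - 1)) + 1 \<le> real n) sequentially"
      by (rule eventually_cells_le[OF \<phi>])
    ultimately show ?thesis
    proof eventually_elim
      case (elim n)
      note n4 = elim(1) and \<Lambda>1' = elim(2) and c0x = elim(3) and stx = elim(4) and s0x = elim(5) and Cox = elim(6)
        and rx = elim(7) and e8 = elim(8) and e9 = elim(9) and e10 = elim(10) and e11 = elim(11) and Nx = elim(12)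
      define x where "x = real n"
      define \<Lambda> where "\<Lambda> = ln x"
      define E where "E = budget \<phi> n"
      have x: "4 \<le> x" "0 < x" "1 \<le> x" using n4 by (auto simp: x_def)
      have n2: "2 \<le> n" using n4 by simp
      have \<Lambda>1: "1 \<le> \<Lambda>" using \<Lambda>1' by (simp add: \<Lambda>_def x_def)
      have xe: "x = exp \<Lambda>" using x by (simp add: \<Lambda>_def)
      have E: "E = x powr (1 / 5) * \<Lambda> powr (2 * \<phi>)" by (simp add: E_def budget_def x_def \<Lambda>_def)
      have E1: "\<Lambda> \<le> E" "1 \<le> E" using e11 \<Lambda>1 by (simp_all add: \<Lambda>_def x_def E_def)
      define a where "a = x ^ q"
      have a: "0 < a" using x by (simp add: a_def)
      define K where "K = 2 * n ^ (q + 1)"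
      have Kx: "real K = 2 * x ^ (q + 1)" by (simp add: K_def x_def)
      define w where "w = 1 / x"
      have w: "0 < w" "w \<le> 1" "real K * w = 2 * a" using x by (auto simp: w_def Kx a_def)
      \<comment> \<open>Makes the mass that may be lost on light cells and the exterior,
        \<open>(K + 1) * t\<close>, exactly \<open>1 / n\<close>.\<close>
      define t where "t = 1 / (x * (real K + 1))"
      have K0: "0 \<le> real K" by simp
      have t: "0 < t" "(real K + 1) * t = 1 / x" using x K0 by (auto simp: t_def add_nonneg_pos)
      define m where "m = n ^ 2"
      have m: "0 < m" "real m = x\<^sup>2" using n4 by (auto simp: m_def x_def)
      define Sg where "Sg = n ^ (q' + 1)"
      have Sgw: "real Sg * w = x ^ q'" using x by (simp add: Sg_def w_def x_def[symmetric])
      \<comment> \<open>With base \<open>l = n powr (1 / 20)\<close> the number 200 makes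
        \<open>l powr (- real N)\<close> at most \<open>exp (- 10 * E)\<close>, enough to absorb the
        moment factor \<open>exp (E - 2)\<close> and still give
        \<open>exp (- 5 * E - 2)\<close>.\<close>
      define N0 where "N0 = 200 * (x powr (1 / 5) * \<Lambda> powr (2 * \<phi> - 1))"
      have N00: "0 \<le> N0" by (simp add: N0_def)
      have N0\<Lambda>: "N0 * \<Lambda> = 200 * E"
      proof -
        have "\<Lambda> powr (2 * \<phi> - 1) * \<Lambda> = \<Lambda> powr (2 * \<phi>)" using \<Lambda>1 by (simp add: powr_diff)
        then show ?thesis by (simp add: N0_def E)
      qed
      define N where "N = nat \<lceil>N0\<rceil>"
      have N: "N0 \<le> real N" "real N \<le> N0 + 1" unfolding N_def using N00 by linarith+
      have Nlx: "real N \<le> x" using N(2) Nx by (simp add: N0_def x_def \<Lambda>_def)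
      define l where "l = x powr (1 / 20)"
      have l: "1 \<le> l" unfolding l_def using x by (intro ge_one_powr_ge_zero) auto
      have cells: "measure H {- a + real j * w..<- a + real j * w + w} \<le> 1" for j
      proof -
        have "measure H {- a + real j * w..<- a + real j * w + w} \<le> c0' * w"
          using w b hc by (intro density_measure_le[OF H h]) auto
        also have "\<dots> \<le> 1" using c0x x by (simp add: w_def x_def)
        finally show ?thesis .
      qed
      have out: "measure H (- {- a..<a}) \<le> Co * exp (- (b0' / 2) * x)"
      proof -
        have "x powr 1 \<le> x powr (real q * \<iota>)" using q x by (intro powr_mono) auto
        also have "\<dots> = a powr \<iota>" using x by (simp add: a_def powr_powr flip: powr_realpow)
        finally have "x \<le> a powr \<iota>" using x by simp
        then have "Co * exp (- (b0' / 2) * a powr \<iota>) \<le> Co * exp (- (b0' / 2) * x)"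
          using b Co(1) by (intro mult_left_mono) auto
        then show ?thesis using Co(2)[OF a] by linarith
      qed
      have out1: "measure H (- {- a..<a}) \<le> 1" using out Cox by (simp add: x_def)
      have ts: "(t * s0) powr (- \<beta>) \<le> x powr (1 / 20)"
      proof -
        have xK: "x * (real K + 1) \<le> 3 * x ^ (q + 2)"
        proof -
          have "1 \<le> x ^ (q + 1)" using x by (intro one_le_power) auto
          then have "real K + 1 \<le> 3 * x ^ (q + 1)" by (simp add: Kx)
          then have "x * (real K + 1) \<le> x * (3 * x ^ (q + 1))" using x by (intro mult_left_mono) auto
          then show ?thesis by simp
        qed
        have "inverse (x ^ (q + 4)) \<le> t * s0"
        proof -
          have "x * (real K + 1) \<le> s0 * x\<^sup>2 * x ^ (q + 2)"
          proof -
            have "3 * x ^ (q + 2) \<le> s0 * x\<^sup>2 * x ^ (q + 2)" using s0x x by (intro mult_right_mono) (auto simp: x_def)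
            then show ?thesis using xK by linarith
          qed
          also have "s0 * x\<^sup>2 * x ^ (q + 2) = s0 * x ^ (q + 4)" by (simp add: power_add power2_eq_square power4_eq_xxxx)
          finally have "x * (real K + 1) \<le> s0 * x ^ (q + 4)" .
          moreover have "0 < x * (real K + 1)" using x K0 by (intro mult_pos_pos add_nonneg_pos) auto
          ultimately show ?thesis using x by (simp add: t_def field_simps del: of_nat_add)
        qed
        moreover have "inverse (x ^ (q + 4)) = x powr (- (real q + 4))"
        proof -
          have "x powr (real q + 4) = x ^ (q + 4)" using powr_realpow[of x "q + 4"] x by simp
          then show ?thesis by (simp only: powr_minus)
        qed
        ultimately have "(t * s0) powr (- \<beta>) \<le> (x powr (- (real q + 4))) powr (- \<beta>)"
          using x \<beta>(1) by (intro powr_mono2') auto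
        also have "\<dots> = x powr (1 / 20)" unfolding powr_powr minus_mult_minus \<beta>(2) ..
        finally show ?thesis .
      qed
      define C where "C = mixture_net Sg w K (\<lambda>j. - a + real j * w) m N"
      have \<rho>: "exp_abs_moment * w + (real K + 1) * t + 2 * w + real N / real m \<le> (rate \<phi> n)\<^sup>2 / 4"
      proof -
        have "real N / real m \<le> x / x\<^sup>2" unfolding m(2) using Nlx x by (intro divide_right_mono) auto
        also have "\<dots> = 1 / x" by (simp add: power2_eq_square)
        finally have "exp_abs_moment * w + (real K + 1) * t + 2 * w + real N / real m \<le> (exp_abs_moment + 4) / x"
          unfolding t(2) by (simp add: w_def add_divide_distrib)
        then show ?thesis using rx unfolding rate_square[OF n2] x_def by linarith
      qed
      have mass: "measure (mixture_prior D S) (space (prob_algebra borel) - L1_net_sieve C ((rate \<phi> n)\<^sup>2 / 4))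
        \<le> 2 * (measure H (- {- a..<a}) * Cb * (t * s0) powr (- \<beta>) + l powr (- real N) * exp (l * A * Cb * (t * s0) powr (- \<beta>)))
          + measure S {real Sg * w<..}"
        unfolding C_def using H(2) cells
        by (intro sieve_mass_le[OF D H(1) _ A_def S w a _ out1 Cb(2) s0 t(1) l w(1,2) m(1) \<rho>]) auto
      have p1: "measure H (- {- a..<a}) * Cb * (t * s0) powr (- \<beta>) \<le> exp (- 5 * E) / 8"
      proof -
        have "measure H (- {- a..<a}) * Cb * (t * s0) powr (- \<beta>) \<le> (Co * exp (- (b0' / 2) * x)) * Cb * x powr (1 / 20)"
          using out ts Cb(1) Co(1) by (intro mult_mono mult_right_mono mult_nonneg_nonneg) auto
        also have "\<dots> = Co * Cb * x powr (1 / 20) * exp (- (b0' / 2) * x)" by simp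
        also have "\<dots> \<le> exp (- 5 * E) / 8" using e8 by (simp add: x_def E_def)
        finally show ?thesis .
      qed
      have p2: "l powr (- real N) * exp (l * A * Cb * (t * s0) powr (- \<beta>)) \<le> exp (- 5 * E) / 4"
      proof -
        have "l powr (- real N) = exp (- (real N * \<Lambda> / 20))" using x by (simp add: l_def powr_powr) (simp add: powr_def \<Lambda>_def)
        moreover have "200 * E \<le> real N * \<Lambda>" unfolding N0\<Lambda>[symmetric] using N(1) \<Lambda>1 by (intro mult_right_mono) auto
        ultimately have lN: "l powr (- real N) \<le> exp (- 10 * E)" by simp
        have "l * A * Cb * (t * s0) powr (- \<beta>) \<le> l * A * Cb * x powr (1 / 20)"
          using ts l A Cb(1) by (intro mult_left_mono) auto
        also have "\<dots> = A * Cb * x powr (1 / 10)"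
        proof -
          have "x powr (1 / 20) * x powr (1 / 20) = x powr (1 / 10)" by (simp flip: powr_add)
          then show ?thesis by (simp add: l_def mult_ac)
        qed
        also have "\<dots> \<le> E - 2" using e10 by (simp add: x_def E_def)
        finally have "exp (l * A * Cb * (t * s0) powr (- \<beta>)) \<le> exp (E - 2)" by simp
        with lN have "l powr (- real N) * exp (l * A * Cb * (t * s0) powr (- \<beta>)) \<le> exp (- 10 * E) * exp (E - 2)"
          by (intro mult_mono) auto
        also have "\<dots> \<le> exp (- 5 * E - 2)" using E1 by (simp flip: exp_add)
        also have "\<dots> \<le> exp (- 5 * E) / 4"
        proof -
          have "2 * 2 \<le> exp 1 * exp (1::real)" using exp_ge_add_one_self[of "1::real"] by (intro mult_mono) auto
          then have "4 \<le> exp (2::real)" by (simp flip: exp_add)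
          then show ?thesis unfolding exp_diff by (intro divide_left_mono) auto
        qed
        finally show ?thesis .
      qed
      have p3: "measure S {real Sg * w<..} \<le> exp (- 5 * E) / 8"
      proof -
        have xq: "x \<le> x ^ q'" using q'(2) x power_increasing[of 1 q' x] by simp
        have "measure S {x ^ q'<..} \<le> Ct * exp (- D3 * (x ^ q') powr v)"
          using order_trans[OF _ xq, of st] stx unfolding x_def[symmetric] by (intro st)
        also have "\<dots> \<le> Ct * (1 * exp (- D3 * x))"
        proof -
          have "x powr 1 \<le> x powr (real q' * v)" using q' x by (intro powr_mono) auto
          also have "\<dots> = (x ^ q') powr v" using x by (simp add: powr_powr flip: powr_realpow)
          finally have "x \<le> (x ^ q') powr v" using x by simp
          then show ?thesis using D3 Ct(1) by (intro mult_left_mono) auto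
        qed
        also have "\<dots> \<le> Ct * (x powr (1 / 20) * exp (- D3 * x))"
          using l Ct(1) by (intro mult_left_mono mult_right_mono) (auto simp: l_def)
        also have "\<dots> \<le> exp (- 5 * E) / 8" using e9 by (simp add: x_def E_def mult.assoc)
        finally show ?thesis unfolding Sgw .
      qed
      have sieve: "measure (mixture_prior D S) (space (prob_algebra borel) - L1_net_sieve C ((rate \<phi> n)\<^sup>2 / 4)) \<le> exp (- 5 * E)"
      proof -
        note mass
        also have "2 * (measure H (- {- a..<a}) * Cb * (t * s0) powr (- \<beta>) + l powr (- real N) * exp (l * A * Cb * (t * s0) powr (- \<beta>)))
            + measure S {real Sg * w<..} \<le> 2 * (exp (- 5 * E) / 8 + exp (- 5 * E) / 4) + exp (- 5 * E) / 8"
          by (intro add_mono mult_left_mono p1 p2 p3) auto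
        also have "\<dots> \<le> exp (- 5 * E)" by simp
        finally show ?thesis .
      qed
      have card: "real (card C) \<le> exp (c1 * E)"
      proof -
        have "real (card C) \<le> real ((Sg + 1) * (K * (m + 1)) ^ N)"
          unfolding C_def of_nat_le_iff by (rule card_mixture_net)
        also have "\<dots> = (real Sg + 1) * (real K * (real m + 1)) ^ N"
          by (simp only: of_nat_mult of_nat_add of_nat_power of_nat_1)
        also have "\<dots> \<le> x ^ (q' + 2) * (x ^ (q + 5)) ^ N"
        proof (intro mult_mono power_mono)
          have "1 \<le> x ^ (q' + 1)" using x by (intro one_le_power) auto
          then have "real Sg + 1 \<le> 2 * x ^ (q' + 1)" by (simp add: Sg_def x_def)
          also have "\<dots> \<le> x * x ^ (q' + 1)" using x by (intro mult_right_mono) auto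
          finally show "real Sg + 1 \<le> x ^ (q' + 2)" by simp
          have "1 \<le> x\<^sup>2" using x by (intro one_le_power) auto
          then have "real K * (real m + 1) \<le> (2 * x ^ (q + 1)) * (2 * x\<^sup>2)"
            unfolding Kx m(2) using x by (intro mult_left_mono) auto
          also have "\<dots> = 4 * x ^ (q + 3)" by (simp add: power_add power2_eq_square power3_eq_cube)
          also have "\<dots> \<le> x\<^sup>2 * x ^ (q + 3)"
          proof (intro mult_right_mono)
            have "4 * 1 \<le> x * x" using x by (intro mult_mono) auto
            then show "4 \<le> x\<^sup>2" by (simp add: power2_eq_square)
          qed (use x in auto)
          also have "\<dots> = x ^ (q + 5)" by (simp add: add.commute flip: power_add)
          finally show "real K * (real m + 1) \<le> x ^ (q + 5)" .
        qed (use x K0 in auto)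
        also have "\<dots> = exp (real (q' + 2) * \<Lambda> + real (q + 5) * (real N * \<Lambda>))"
        proof -
          have pw: "x ^ j = exp (real j * \<Lambda>)" for j unfolding xe by (rule exp_of_nat_mult[symmetric])
          have "(x ^ (q + 5)) ^ N = exp (real N * (real (q + 5) * \<Lambda>))" unfolding pw[of "q + 5"] by (rule exp_of_nat_mult[symmetric])
          also have "real N * (real (q + 5) * \<Lambda>) = real (q + 5) * (real N * \<Lambda>)" by (rule mult.left_commute)
          finally show ?thesis unfolding pw[of "q' + 2"] by (simp only: exp_add)
        qed
        also have "\<dots> \<le> exp (c1 * E)"
        proof -
          have "real N * \<Lambda> \<le> (N0 + 1) * \<Lambda>" using N(2) \<Lambda>1 by (intro mult_right_mono) auto
          then have "real N * \<Lambda> \<le> 201 * E" using N0\<Lambda> E1 by (simp add: distrib_right)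
          then have "real (q + 5) * (real N * \<Lambda>) \<le> real (q + 5) * (201 * E)" by (intro mult_left_mono) auto
          moreover have "real (q' + 2) * \<Lambda> \<le> real (q' + 2) * E" using E1 by (intro mult_left_mono) auto
          ultimately show ?thesis
            unfolding c1_def distrib_right mult.assoc exp_le_cancel_iff by (intro add_mono)
        qed
        finally show ?thesis .
      qed
      show ?case
        using sieve card finite_mixture_net mixture_net_measurable unfolding E_def
        by (intro exI[of _ C]) (auto simp: C_def)
    qed
  qed
  then show thesis using that c1 by blast
qed

section \<open>Assembling the constants for all sample sizes\<close>

lemma rate_tendsto_0: "0 < \<phi> \<Longrightarrow> rate \<phi> \<longlonglongrightarrow> 0"
  unfolding rate_def[abs_def] by real_asymp

lemma budget_at_top: "0 < \<phi> \<Longrightarrow> filterlim (budget \<phi>) at_top sequentially"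
  unfolding budget_def[abs_def] by real_asymp

lemma ln_enat_le:
  assumes "N \<le> enat k" "real k \<le> exp c"
  shows "ln_enat N \<le> ereal c"
proof -
  obtain j where j: "N = enat j" "j \<le> k" using assms(1) by (cases N) auto
  show ?thesis
  proof (cases "j = 0")
    case False
    have "ln (real j) \<le> ln (exp c)" using j(2) assms(2) False by (intro ln_mono) auto
    then show ?thesis using False j(1) by (simp add: ln_enat_def)
  qed (simp add: ln_enat_def j(1))
qed

theorem theorem4p2:
  fixes f0X h0 \<pi>\<sigma> :: "real \<Rightarrow> real"
    and H0 \<Pi>\<sigma> :: "real measure"
    and DH :: "real measure measure"
    and C0 b0 b0' c0 c0' \<iota> D1 D2 D3 s1 s2 t1 t2 w :: real
  defines "\<mu>0X \<equiv> density lborel (\<lambda>x. ennreal (f0X x))"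
  defines "f0Y \<equiv> conv_density laplace_density \<mu>0X"
  defines "P0Y \<equiv> density lborel (\<lambda>y. ennreal (f0Y y))"
  defines "prior \<equiv> mixture_prior DH \<Pi>\<sigma>"
  assumes f0X: "f0X \<in> borel_measurable borel" "\<And>x. 0 \<le> f0X x" "prob_space \<mu>0X"
    and f0X_tail: "0 < C0" "\<exists>C>0. \<forall>x. f0X x \<le> C * exp (- (1 + C0) * \<bar>x\<bar>)"
    and H0: "finite_measure H0" "H0 = density lborel (\<lambda>u. ennreal (h0 u))"
    and h0: "continuous_on UNIV h0" "\<And>u. 0 < h0 u"
    and h0_bounds: "0 < b0" "0 < b0'" "0 < c0" "0 < c0'" "0 < \<iota>"
      "\<And>u. c0 * exp (- b0 * \<bar>u\<bar> powr \<iota>) \<le> h0 u"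
      "\<And>u. h0 u \<le> c0' * exp (- b0' * \<bar>u\<bar> powr \<iota>)"
    and DH: "dirichlet_process H0 DH"
    and Pi_sigma: "prob_space \<Pi>\<sigma>"
      "\<Pi>\<sigma> = density (restrict_space lborel {0<..}) (\<lambda>\<sigma>. ennreal (\<pi>\<sigma> \<sigma>))"
      "continuous_on {0<..} \<pi>\<sigma>" "\<And>\<sigma>. 0 < \<sigma> \<Longrightarrow> 0 \<le> \<pi>\<sigma> \<sigma>"
    and pi_sigma_near_0: "0 < D1" "0 < D2" "0 \<le> s1" "0 \<le> s2" "0 \<le> t1" "0 \<le> t2"
      "\<exists>C>0. \<forall>\<^sub>F \<sigma> in at_right 0.
         \<sigma> powr (- s1) * exp (- D1 * inverse \<sigma> * \<bar>ln \<sigma>\<bar> powr t1) \<le> C * \<pi>\<sigma> \<sigma>"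
      "\<exists>C>0. \<forall>\<^sub>F \<sigma> in at_right 0.
         \<pi>\<sigma> \<sigma> \<le> C * (\<sigma> powr (- s2) * exp (- D2 * inverse \<sigma> * \<bar>ln \<sigma>\<bar> powr t2))"
    and Pi_sigma_tail: "0 < D3" "0 < w"
      "\<exists>C>0. \<forall>\<^sub>F s in at_top. measure \<Pi>\<sigma> {s<..} \<le> C * exp (- D3 * s powr w)"
  shows "\<exists>\<phi>>0. let \<epsilon> = (\<lambda>n::nat. real n powr (- 2 / 5) * ln (real n) powr \<phi>) in
    (\<exists>c1>0. \<exists>c2>0. \<exists>c3>0. \<exists>c4>0. \<exists>\<P> :: nat \<Rightarrow> real measure set. \<forall>n\<ge>2.
       \<P> n \<in> sets (prob_algebra borel) \<and>
       (\<forall>d\<in>{hellinger_dist, L1_dist}.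
          ln_enat (packing_number (\<epsilon> n) (obs_law ` \<P> n) d) \<le> ereal (c1 * real n * (\<epsilon> n)\<^sup>2)) \<and>
       measure prior (space prior - \<P> n) \<le> c3 * exp (- (c2 + 4) * real n * (\<epsilon> n)\<^sup>2) \<and>
       measure prior {\<mu>X \<in> space prior. obs_law \<mu>X \<in> KL_nbhd P0Y ((\<epsilon> n)\<^sup>2)}
         \<ge> c4 * exp (- c2 * real n * (\<epsilon> n)\<^sup>2)) \<and>
    (\<exists>D>0. \<forall>\<eta>>0.
       (\<lambda>n. measure (\<Pi>\<^sub>M i\<in>{..<n}. P0Y)
              {y \<in> space (\<Pi>\<^sub>M i\<in>{..<n}. P0Y).
                 \<eta> < measure (posterior prior n y)
                       {\<mu>X \<in> space prior. D * \<epsilon> n < (\<integral>x. \<bar>obs_density \<mu>X x - f0Y x\<bar> \<partial>lborel)}})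
         \<longlonglongrightarrow> 0)"
proof -
  obtain M where M: "0 < M" "\<And>x. f0X x \<le> M * exp (- (1 + C0) * \<bar>x\<bar>)" using f0X_tail(2) by blast
  interpret T: laplace_truth f0X M C0
    by (intro laplace_truth.intro f0X(1,2) f0X(3)[unfolded \<mu>0X_def] f0X_tail(1) M)
  have \<mu>0X: "\<mu>0X = T.\<mu>0" by (simp add: \<mu>0X_def T.\<mu>0_def)
  note \<mu>0 = T.\<mu>0
  have P0Y: "P0Y = obs_law T.\<mu>0" by (simp add: P0Y_def f0Y_def \<mu>0X obs_law_def)
  have f0Y: "f0Y = obs_density T.\<mu>0" by (simp add: f0Y_def \<mu>0X)
  have hm: "h0 \<in> borel_measurable borel" using h0(1) by (rule borel_measurable_continuous_onI)
  have S: "sets \<Pi>\<sigma> = sets (restrict_space borel {0<..})" by (simp add: Pi_sigma(2) cong: sets_restrict_space_cong)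
  have D': "prob_space DH" "sets DH = sets (prob_algebra borel)" using DH by (auto simp: dirichlet_process_def)
  note prior = mixture_prior[OF D' Pi_sigma(1) S, folded prior_def]
  interpret prior: prob_space prior by (rule prior)
  have sp: "space prior = space (prob_algebra borel)" using prior(2) by (rule sets_eq_imp_space_eq)
  obtain Cs where Cs: "0 < Cs" "\<forall>\<^sub>F \<sigma> in at_right 0. \<sigma> powr (- s1) * exp (- D1 * inverse \<sigma> * \<bar>ln \<sigma>\<bar> powr t1) \<le> Cs * \<pi>\<sigma> \<sigma>"
    using pi_sigma_near_0(7) by blast
  obtain Ct where Ct: "0 < Ct" "\<forall>\<^sub>F s in at_top. measure \<Pi>\<sigma> {s<..} \<le> Ct * exp (- D3 * s powr w)"
    using Pi_sigma_tail(3) by blast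
  define \<phi> where "\<phi> = 3 + \<iota> + t1"
  have \<phi>: "0 < \<phi>" "1 < \<phi>" using h0_bounds pi_sigma_near_0 by (auto simp: \<phi>_def)
  define chi where "chi r = {\<mu> \<in> space (prob_algebra borel). chi_square T.\<mu>0 \<mu> \<le> ennreal r}" for r
  have chi_sets: "chi r \<in> sets (prob_algebra borel)" for r
    unfolding chi_def using chi_square_measurable[OF \<mu>0] by measurable
  have mass: "eventually (\<lambda>n. exp (- budget \<phi> n) \<le> measure prior (chi ((rate \<phi> n)\<^sup>2))) sequentially"
    unfolding \<phi>_def chi_def prior_def
    by (rule T.prior_mass_eventually[OF DH H0 hm h0_bounds(1,3,5,6) Pi_sigma(1-3) pi_sigma_near_0(1,3,5) Cs])
  obtain c1 where c1: "0 < c1" and sieve: "eventually (\<lambda>n. \<exists>C. finite C \<and> C \<subseteq> borel_measurable borel \<and> real (card C) \<le> exp (c1 * budget \<phi> n) \<and>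
      measure prior (space (prob_algebra borel) - L1_net_sieve C ((rate \<phi> n)\<^sup>2 / 4)) \<le> exp (- 5 * budget \<phi> n)) sequentially"
    unfolding prior_def
    by (rule sieve_eventually[OF DH H0 hm h0_bounds Pi_sigma(1) S Pi_sigma_tail(1,2) Ct \<phi>(2)])
  \<comment> \<open>The smallest value with \<open>256 * (c1 + 5) \<le> D\<^sup>2\<close>, the
    separation that lets the tests beat the entropy of the sieve.\<close>
  define D where "D = 16 * sqrt (c1 + 5)"
  have D: "1 \<le> D" "256 * (c1 + 5) \<le> D\<^sup>2"
  proof -
    have "1 \<le> sqrt (c1 + 5)" using c1 by (intro real_le_rsqrt) simp
    then show "1 \<le> D" unfolding D_def by linarith
    show "256 * (c1 + 5) \<le> D\<^sup>2" using c1 by (simp add: D_def power_mult_distrib)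
  qed
  have small: "eventually (\<lambda>n. rate \<phi> n < \<delta>) sequentially" if "0 < \<delta>" for \<delta>
    using order_tendstoD(2)[OF rate_tendsto_0[OF \<phi>(1)] that] .
  have D0: "0 < D" using D(1) by simp
  have "eventually (\<lambda>n. exp (- budget \<phi> n) \<le> measure prior (chi ((rate \<phi> n)\<^sup>2)) \<and> rate \<phi> n \<le> 1 \<and> D * rate \<phi> n \<le> 16 \<and> 2 \<le> n \<and>
      (\<exists>C. finite C \<and> C \<subseteq> borel_measurable borel \<and> real (card C) \<le> exp (c1 * budget \<phi> n) \<and>
        measure prior (space (prob_algebra borel) - L1_net_sieve C ((rate \<phi> n)\<^sup>2 / 4)) \<le> exp (- 5 * budget \<phi> n))) sequentially"
  proof -
    have s1: "eventually (\<lambda>n. rate \<phi> n < 1) sequentially" and s2: "eventually (\<lambda>n. rate \<phi> n < 16 / D) sequentially"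
      using D0 by (auto intro!: small)
    show ?thesis
      using mass sieve s1 s2 eventually_ge_at_top[of "2::nat"]
    proof eventually_elim
      case (elim n)
      have "D * rate \<phi> n \<le> 16" using elim(4) D0 by (simp add: field_simps)
      then show ?case using elim by (intro conjI) simp_all
    qed
  qed
  then obtain n0 where n0: "\<And>n. n0 \<le> n \<Longrightarrow> exp (- budget \<phi> n) \<le> measure prior (chi ((rate \<phi> n)\<^sup>2)) \<and> rate \<phi> n \<le> 1 \<and> D * rate \<phi> n \<le> 16 \<and> 2 \<le> n \<and>
      (\<exists>C. finite C \<and> C \<subseteq> borel_measurable borel \<and> real (card C) \<le> exp (c1 * budget \<phi> n) \<and>
        measure prior (space (prob_algebra borel) - L1_net_sieve C ((rate \<phi> n)\<^sup>2 / 4)) \<le> exp (- 5 * budget \<phi> n))"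
    unfolding eventually_sequentially by blast
  have "\<forall>n. \<exists>C. n0 \<le> n \<longrightarrow> finite C \<and> C \<subseteq> borel_measurable borel \<and> real (card C) \<le> exp (c1 * budget \<phi> n) \<and>
        measure prior (space (prob_algebra borel) - L1_net_sieve C ((rate \<phi> n)\<^sup>2 / 4)) \<le> exp (- 5 * budget \<phi> n)"
    using n0 by blast
  from choice[OF this] obtain C where C: "\<And>n. n0 \<le> n \<Longrightarrow> finite (C n)" "\<And>n. n0 \<le> n \<Longrightarrow> C n \<subseteq> borel_measurable borel"
      "\<And>n. n0 \<le> n \<Longrightarrow> real (card (C n)) \<le> exp (c1 * budget \<phi> n)"
      "\<And>n. n0 \<le> n \<Longrightarrow> measure prior (space (prob_algebra borel) - L1_net_sieve (C n) ((rate \<phi> n)\<^sup>2 / 4)) \<le> exp (- 5 * budget \<phi> n)"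
    by blast
  \<comment> \<open>The estimates are available from \<open>n0\<close> on. Below it the sieve is
    empty, with logarithmic packing number minus infinity, and its complement is left to the
    constant \<open>c3\<close>.\<close>
  define \<P> where "\<P> n = (if n0 \<le> n then L1_net_sieve (C n) ((rate \<phi> n)\<^sup>2 / 4) else {})" for n
  define KL where "KL n = {\<mu>X \<in> space prior. obs_law \<mu>X \<in> KL_nbhd P0Y ((rate \<phi> n)\<^sup>2)}" for n
  have KL_sets: "KL n \<in> sets prior" for n
    using KL_nbhd_obs_law_measurable[OF \<mu>0, of "(rate \<phi> n)\<^sup>2"] by (simp add: KL_def sp P0Y prior(2))
  have chi_KL: "chi r \<subseteq> KL n" if "0 \<le> r" "r \<le> (rate \<phi> n)\<^sup>2" for r n
  proof
    fix \<mu> assume "\<mu> \<in> chi r"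
    then have \<mu>: "\<mu> \<in> space (prob_algebra borel)" "chi_square T.\<mu>0 \<mu> \<le> ennreal r" by (auto simp: chi_def)
    have "chi_square T.\<mu>0 \<mu> \<le> ennreal ((rate \<phi> n)\<^sup>2)" by (rule order_trans[OF \<mu>(2) ennreal_leI[OF that(2)]])
    then show "\<mu> \<in> KL n" using chi_square_KL_nbhd[OF \<mu>0 \<mu>(1)] \<mu>(1) by (simp add: KL_def sp P0Y)
  qed
  have KL_large: "exp (- budget \<phi> n) \<le> measure prior (KL n)" if "n0 \<le> n" for n
    using n0[OF that] prior.finite_measure_mono[OF chi_KL[of "(rate \<phi> n)\<^sup>2" n] KL_sets] by simp
  \<comment> \<open>Below \<open>n0\<close> only positivity is claimed: the smaller neighbourhood
    belonging to some later sample size \<open>m\<close> already has positive mass and is contained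
    in this one.\<close>
  have KL_pos: "0 < measure prior (KL n)" if n: "2 \<le> n" for n
  proof -
    obtain N where N: "\<And>m. N \<le> m \<Longrightarrow> rate \<phi> m < rate \<phi> n"
      using small[OF rate_pos[OF n]] unfolding eventually_sequentially by blast
    define m where "m = max N n0"
    have "(rate \<phi> m)\<^sup>2 \<le> (rate \<phi> n)\<^sup>2"
      using N[of m] n0[of m] rate_pos[of m \<phi>] by (intro power_mono) (auto simp: m_def less_imp_le)
    then have "measure prior (chi ((rate \<phi> m)\<^sup>2)) \<le> measure prior (KL n)"
      by (intro prior.finite_measure_mono chi_KL KL_sets) auto
    moreover have "exp (- budget \<phi> m) \<le> measure prior (chi ((rate \<phi> m)\<^sup>2))" using n0[of m] by (simp add: m_def)
    moreover have "0 < exp (- budget \<phi> m)" by simp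
    ultimately show ?thesis by linarith
  qed
  have budget0: "0 \<le> budget \<phi> n" for n by (simp add: budget_def)
  \<comment> \<open>Absorbs the finitely many early sample sizes; the inserted 1 covers an empty
    range and makes \<open>c4 \<le> 1\<close>.\<close>
  define c4 where "c4 = Min (insert 1 ((\<lambda>n. measure prior (KL n)) ` {2..<n0}))"
  have c4: "0 < c4" unfolding c4_def using KL_pos by (subst Min_gr_iff) auto
  have c4': "c4 \<le> 1" unfolding c4_def by (rule Min_le) auto
  have c4'': "c4 \<le> measure prior (KL n)" if "2 \<le> n" "n < n0" for n
    unfolding c4_def using that by (intro Min_le) auto
  \<comment> \<open>Large enough that the bound for the complement of the sieve is at least 1 for
    every \<open>n < n0\<close>.\<close>
  define c3 where "c3 = 1 + (\<Sum>n<n0. exp (5 * budget \<phi> n))"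
  have c3: "1 \<le> c3" by (simp add: c3_def sum_nonneg)
  \<comment> \<open>The constant \<open>c2\<close> is 1, so \<open>c2 + 4\<close> is the factor 5
    that the sieve provides.\<close>
  have first: "\<P> n \<in> sets (prob_algebra borel) \<and>
       (\<forall>d\<in>{hellinger_dist, L1_dist}. ln_enat (packing_number (rate \<phi> n) (obs_law ` \<P> n) d) \<le> ereal (c1 * real n * (rate \<phi> n)\<^sup>2)) \<and>
       measure prior (space prior - \<P> n) \<le> c3 * exp (- (1 + 4) * real n * (rate \<phi> n)\<^sup>2) \<and>
       measure prior (KL n) \<ge> c4 * exp (- 1 * real n * (rate \<phi> n)\<^sup>2)" if n: "2 \<le> n" for n
  proof -
    have b: "c1 * real n * (rate \<phi> n)\<^sup>2 = c1 * budget \<phi> n" "- (1 + 4) * real n * (rate \<phi> n)\<^sup>2 = - 5 * budget \<phi> n"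
      "- 1 * real n * (rate \<phi> n)\<^sup>2 = - budget \<phi> n"
      unfolding budget_eq[OF n, symmetric] by simp_all
    show ?thesis unfolding b
    proof (intro conjI ballI)
      show "\<P> n \<in> sets (prob_algebra borel)"
        unfolding \<P>_def using C by (auto intro!: L1_net_sieve_measurable)
    next
      fix d :: "real measure \<Rightarrow> real measure \<Rightarrow> real" assume d: "d \<in> {hellinger_dist, L1_dist}"
      show "ln_enat (packing_number (rate \<phi> n) (obs_law ` \<P> n) d) \<le> ereal (c1 * budget \<phi> n)"
      proof (cases "n0 \<le> n")
        case True
        have "packing_number (rate \<phi> n) (obs_law ` \<P> n) d \<le> enat (card (C n))"
          unfolding \<P>_def using True n0[OF True] d
          by (simp only: if_True) (intro packing_number_L1_net_sieve C rate_pos n; simp)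
        then show ?thesis using C(3)[OF True] by (rule ln_enat_le)
      next
        case False
        have "packing_number (rate \<phi> n) (obs_law ` \<P> n) d \<le> enat 0"
          unfolding packing_number_def using False by (intro SUP_least) (auto simp: \<P>_def zero_enat_def)
        then show ?thesis by (rule ln_enat_le) simp
      qed
    next
      show "measure prior (space prior - \<P> n) \<le> c3 * exp (- 5 * budget \<phi> n)"
      proof (cases "n0 \<le> n")
        case True
        then have "measure prior (space prior - \<P> n) \<le> 1 * exp (- 5 * budget \<phi> n)" using C(4) by (simp add: \<P>_def sp)
        also have "\<dots> \<le> c3 * exp (- 5 * budget \<phi> n)" using c3 by (intro mult_right_mono) auto
        finally show ?thesis .
      next
        case False
        then have "exp (5 * budget \<phi> n) \<le> (\<Sum>n<n0. exp (5 * budget \<phi> n))"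
          by (intro member_le_sum[where f="\<lambda>n. exp (5 * budget \<phi> n)"]) auto
        then have "exp (5 * budget \<phi> n) \<le> c3" by (simp add: c3_def)
        then have "exp (5 * budget \<phi> n) * exp (- 5 * budget \<phi> n) \<le> c3 * exp (- 5 * budget \<phi> n)" by (intro mult_right_mono) auto
        moreover have "exp (5 * budget \<phi> n) * exp (- 5 * budget \<phi> n) = 1" by (simp flip: exp_add)
        ultimately show ?thesis using prior.prob_le_1[of "space prior - \<P> n"] by linarith
      qed
    next
      show "c4 * exp (- budget \<phi> n) \<le> measure prior (KL n)"
      proof (cases "n0 \<le> n")
        case True
        have "c4 * exp (- budget \<phi> n) \<le> 1 * exp (- budget \<phi> n)" using c4' by (intro mult_right_mono) auto
        then show ?thesis using KL_large[OF True] by linarith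
      next
        case False
        have "c4 * exp (- budget \<phi> n) \<le> c4 * 1" using c4 budget0 by (intro mult_left_mono) auto
        then show ?thesis using c4''[OF n] False by linarith
      qed
    qed
  qed
  have second: "(\<lambda>n. measure (sample_law n T.\<mu>0) {y \<in> space (sample_law n T.\<mu>0). \<eta> < measure (posterior prior n y)
        {\<mu>X \<in> space prior. D * rate \<phi> n < (\<integral>x. \<bar>obs_density \<mu>X x - obs_density T.\<mu>0 x\<bar> \<partial>lborel)}}) \<longlonglongrightarrow> 0"
    (is "?f \<longlonglongrightarrow> 0") if \<eta>: "0 < \<eta>" for \<eta>
  proof (rule tendsto_sandwich)
    show "eventually (\<lambda>n. 0 \<le> ?f n) sequentially" by simp
    show "eventually (\<lambda>n. ?f n \<le> 2 * exp (- budget \<phi> n) + 2 / \<eta> * exp (- 2 * budget \<phi> n)) sequentially"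
      using eventually_ge_at_top[of n0]
    proof eventually_elim
      case (elim n)
      note nn = n0[OF elim]
      have n2: "2 \<le> n" using nn by simp
      show ?case
      proof (rule posterior_mass_bound[OF \<mu>0 prior rate_pos[OF n2] _ D(1) _ D(2) less_imp_le[OF c1] budget_eq[OF n2, symmetric], where G="chi ((rate \<phi> n)\<^sup>2)" and C="C n"])
        show "chi ((rate \<phi> n)\<^sup>2) \<in> sets prior" by (simp add: prior(2) chi_sets)
        show "chi_square T.\<mu>0 \<mu> \<le> ennreal ((rate \<phi> n)\<^sup>2)" if "\<mu> \<in> chi ((rate \<phi> n)\<^sup>2)" for \<mu>
          using that by (simp add: chi_def)
        show "measure prior (space prior - L1_net_sieve (C n) ((rate \<phi> n)\<^sup>2 / 4)) \<le> exp (- 5 * budget \<phi> n)"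
          using C(4)[OF elim] by (simp add: sp)
      qed (use nn C[OF elim] \<eta> in auto)
    qed
    have e: "filterlim (\<lambda>n. - budget \<phi> n) at_bot sequentially"
      using budget_at_top[OF \<phi>(1)] by (simp add: filterlim_uminus_at_bot)
    have 1: "(\<lambda>n. exp (- budget \<phi> n)) \<longlonglongrightarrow> 0" by (rule filterlim_compose[OF exp_at_bot e])
    have "exp (- 2 * budget \<phi> n) = exp (- budget \<phi> n) * exp (- budget \<phi> n)" for n by (simp flip: exp_add)
    then have 2: "(\<lambda>n. exp (- 2 * budget \<phi> n)) \<longlonglongrightarrow> 0" using tendsto_mult[OF 1 1] by simp
    show "(\<lambda>n. 2 * exp (- budget \<phi> n) + 2 / \<eta> * exp (- 2 * budget \<phi> n)) \<longlonglongrightarrow> 0"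
      using tendsto_add[OF tendsto_mult[OF tendsto_const[of 2] 1] tendsto_mult[OF tendsto_const[of "2 / \<eta>"] 2]] by simp
  qed simp
  show ?thesis
    unfolding Let_def rate_def[symmetric]
  proof (rule exI[of _ \<phi>], intro conjI \<phi>(1))
    show "\<exists>c1>0. \<exists>c2>0. \<exists>c3>0. \<exists>c4>0. \<exists>\<P> :: nat \<Rightarrow> real measure set. \<forall>n\<ge>2.
       \<P> n \<in> sets (prob_algebra borel) \<and>
       (\<forall>d\<in>{hellinger_dist, L1_dist}.
          ln_enat (packing_number (rate \<phi> n) (obs_law ` \<P> n) d) \<le> ereal (c1 * real n * (rate \<phi> n)\<^sup>2)) \<and>
       measure prior (space prior - \<P> n) \<le> c3 * exp (- (c2 + 4) * real n * (rate \<phi> n)\<^sup>2) \<and>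
       measure prior {\<mu>X \<in> space prior. obs_law \<mu>X \<in> KL_nbhd P0Y ((rate \<phi> n)\<^sup>2)}
         \<ge> c4 * exp (- c2 * real n * (rate \<phi> n)\<^sup>2)"
      using c1 c3 c4 first unfolding KL_def
      by (intro exI[of _ c1] exI[of _ "1::real"] exI[of _ c3] exI[of _ c4] exI[of _ \<P>] conjI allI impI) auto
    show "\<exists>D>0. \<forall>\<eta>>0.
       (\<lambda>n. measure (\<Pi>\<^sub>M i\<in>{..<n}. P0Y)
              {y \<in> space (\<Pi>\<^sub>M i\<in>{..<n}. P0Y).
                 \<eta> < measure (posterior prior n y)
                       {\<mu>X \<in> space prior. D * rate \<phi> n < (\<integral>x. \<bar>obs_density \<mu>X x - f0Y x\<bar> \<partial>lborel)}})
         \<longlonglongrightarrow> 0"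
      using D0 second unfolding P0Y f0Y by blast
  qed
qed

end
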